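(* Let $(R,\mathfrak m)$ be a Noetherian local ring, $I$ an $\mathfrak m$-primary ideal, and $M$ a finitely generated $R$-module with $\dim M=1$. Then: (a) $\ell\bigl(M/\widetilde{I^{n+1}M}\bigr)=e^I_0(M)(n+1)-e^I_1(M)-\ell\bigl(H^0_{\mathfrak m}(M)\bigr)$ for all $n\gg 0$; (b) $\widetilde{G}_I(M)$ is a finitely generated $G_I(R)$-module of dimension $1$; (c) $\widetilde{G}_I(M)$ is a Cohen-Macaulay $G_I(R)$-module.
   Context: $\ell(-)$ denotes length. $H^0_{\mathfrak m}(M)=\{m\in M : \mathfrak m^nm=0 \text{ for some } n\geq 1\}$. For a submodule $A$ of $M$ and an ideal $L$ of $R$, $(A:_M L)=\{m\in M : Lm\subseteq A\}$. For $n\geq 1$, $\widetilde{I^nM}=\bigcup_{k\geq 1}(I^{n+k}M:_M I^k)$ (an ascending union of submodules of $M$), and $\widetilde{I^0M}=M$. $G_I(R)=\bigoplus_{n\geq 0}I^n/I^{n+1}$ is the associated graded ring, and $\widetilde{G}_I(M)=\bigoplus_{n\geq 0}\widetilde{I^nM}/\widetilde{I^{n+1}M}$, which is a graded $G_I(R)$-module because $I^n\,\widetilde{I^mM}\subseteq\widetilde{I^{n+m}M}$. The Hilbert coefficients $e^I_0(M),e^I_1(M)$ of the one-dimensional module $M$ are the integers with $\ell(M/I^{n+1}M)=e^I_0(M)(n+1)-e^I_1(M)$ for all $n\gg 0$. *)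

theory Defs
  imports "HOL-Algebra.Module" "HOL-Algebra.Ring_Divisibility" "HOL-Algebra.Ideal_Product" "HOL-Library.Extended_Nat"
begin

section \<open>Ideals and local rings\<close>

abbreviation ideal_pow :: "('a, 'c) ring_scheme \<Rightarrow> 'a set \<Rightarrow> nat \<Rightarrow> 'a set"
  where "ideal_pow R I n \<equiv> I [^]\<^bsub>ideals_set R\<^esub> n"

definition radical :: "('a, 'c) ring_scheme \<Rightarrow> 'a set \<Rightarrow> 'a set"
  where "radical R I = {a \<in> carrier R. \<exists>n::nat. a [^]\<^bsub>R\<^esub> n \<in> I}"

definition primary_ideal :: "'a set \<Rightarrow> ('a, 'c) ring_scheme \<Rightarrow> bool"
  where "primary_ideal Q R \<longleftrightarrow> ideal Q R \<and> carrier R \<noteq> Q \<and>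
    (\<forall>a\<in>carrier R. \<forall>b\<in>carrier R. a \<otimes>\<^bsub>R\<^esub> b \<in> Q \<longrightarrow> a \<in> Q \<or> b \<in> radical R Q)"

definition primary_to :: "('a, 'c) ring_scheme \<Rightarrow> 'a set \<Rightarrow> 'a set \<Rightarrow> bool"
  where "primary_to R P Q \<longleftrightarrow> primary_ideal Q R \<and> radical R Q = P"

definition noetherian_local_ring :: "('a, 'c) ring_scheme \<Rightarrow> 'a set \<Rightarrow> bool"
  where "noetherian_local_ring R \<mm> \<longleftrightarrow> cring R \<and> noetherian_ring R \<and>
    maximalideal \<mm> R \<and> (\<forall>J. maximalideal J R \<longrightarrow> J = \<mm>)"

text \<open>The supremum of the empty set is 0 in \<^typ>\<open>enat\<close>, so the zero ring (and below the zero
  module) gets dimension 0 rather than a negative value.\<close>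

definition krull_dim :: "('a, 'c) ring_scheme \<Rightarrow> enat"
  where "krull_dim R = Sup {enat n | n. \<exists>P :: nat \<Rightarrow> 'a set.
    (\<forall>i\<le>n. primeideal (P i) R) \<and> (\<forall>i<n. P i \<subset> P (Suc i))}"


section \<open>Modules\<close>

text \<open>In the module records below only \<open>carrier\<close>, \<open>zero\<close>, \<open>add\<close> and \<open>smult\<close> matter; the fields
  \<open>mult\<close> and \<open>one\<close>, inherited from the record of rings, are left unspecified unless the module is a ring.\<close>

definition submodule_gen ::
    "('a, 'c) ring_scheme \<Rightarrow> ('a, 'b, 'd) module_scheme \<Rightarrow> 'b set \<Rightarrow> 'b set"
  where "submodule_gen R M S = \<Inter>{H. submodule H R M \<and> S \<subseteq> H}"

definition fin_gen_module :: "('a, 'c) ring_scheme \<Rightarrow> ('a, 'b, 'd) module_scheme \<Rightarrow> bool"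
  where "fin_gen_module R M \<longleftrightarrow> module R M \<and>
    (\<exists>S. finite S \<and> S \<subseteq> carrier M \<and> submodule_gen R M S = carrier M)"

definition ideal_smult ::
    "('a, 'c) ring_scheme \<Rightarrow> 'a set \<Rightarrow> ('a, 'b, 'd) module_scheme \<Rightarrow> 'b set"
  where "ideal_smult R J M = submodule_gen R M {a \<odot>\<^bsub>M\<^esub> x | a x. a \<in> J \<and> x \<in> carrier M}"

definition quot_module :: "('a, 'b, 'd) module_scheme \<Rightarrow> 'b set \<Rightarrow> ('a, 'b set) module"
  where "quot_module M N =
    \<lparr> carrier = a_rcosets\<^bsub>M\<^esub> N, monoid.mult = undefined, one = undefined,
      zero = N, add = set_add M,
      smult = (\<lambda>a C. \<Union>x\<in>C. N +>\<^bsub>M\<^esub> (a \<odot>\<^bsub>M\<^esub> x)) \<rparr>"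

definition self_module :: "('a, 'c) ring_scheme \<Rightarrow> ('a, 'a) module"
  where "self_module R =
    \<lparr> carrier = carrier R, monoid.mult = monoid.mult R, one = one R,
      zero = zero R, add = add R, smult = monoid.mult R \<rparr>"

definition annihilator :: "('a, 'c) ring_scheme \<Rightarrow> ('a, 'b, 'd) module_scheme \<Rightarrow> 'a set"
  where "annihilator R M = {a \<in> carrier R. \<forall>x\<in>carrier M. a \<odot>\<^bsub>M\<^esub> x = \<zero>\<^bsub>M\<^esub>}"

definition module_dim :: "('a, 'c) ring_scheme \<Rightarrow> ('a, 'b, 'd) module_scheme \<Rightarrow> enat"
  where "module_dim R M = krull_dim (R Quot annihilator R M)"

definition module_length :: "('a, 'c) ring_scheme \<Rightarrow> ('a, 'b, 'd) module_scheme \<Rightarrow> enat"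
  where "module_length R M = Sup {enat n | n. \<exists>N :: nat \<Rightarrow> 'b set.
    N 0 = {\<zero>\<^bsub>M\<^esub>} \<and> N n = carrier M \<and>
    (\<forall>i\<le>n. submodule (N i) R M) \<and> (\<forall>i<n. N i \<subset> N (Suc i))}"

definition module_colon ::
    "('a, 'b, 'd) module_scheme \<Rightarrow> 'b set \<Rightarrow> 'a set \<Rightarrow> 'b set"
  where "module_colon M A L = {x \<in> carrier M. \<forall>a\<in>L. a \<odot>\<^bsub>M\<^esub> x \<in> A}"

definition local_cohomology_0 ::
    "('a, 'c) ring_scheme \<Rightarrow> 'a set \<Rightarrow> ('a, 'b, 'd) module_scheme \<Rightarrow> 'b set"
  where "local_cohomology_0 R J M =
    {x \<in> carrier M. \<exists>n\<ge>1. \<forall>a\<in>ideal_pow R J n. a \<odot>\<^bsub>M\<^esub> x = \<zero>\<^bsub>M\<^esub>}"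


section \<open>Localization, depth and the Cohen-Macaulay property\<close>

text \<open>\<open>loc_frac R S M x s\<close> is the fraction \<open>x/s\<close>, the class of all pairs \<open>(y, t)\<close> with \<open>u(tx) = u(sy)\<close>
  for some \<open>u\<close> in the multiplicative set \<open>S\<close>.\<close>

definition loc_frac ::
    "('a, 'c) ring_scheme \<Rightarrow> 'a set \<Rightarrow> ('a, 'b, 'd) module_scheme \<Rightarrow> 'b \<Rightarrow> 'a \<Rightarrow> ('b \<times> 'a) set"
  where "loc_frac R S M x s = {(y, t). y \<in> carrier M \<and> t \<in> S \<and>
    (\<exists>u\<in>S. u \<odot>\<^bsub>M\<^esub> (t \<odot>\<^bsub>M\<^esub> x) = u \<odot>\<^bsub>M\<^esub> (s \<odot>\<^bsub>M\<^esub> y))}"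

definition loc_module ::
    "('a, 'c) ring_scheme \<Rightarrow> 'a set \<Rightarrow> ('a, 'b, 'd) module_scheme
      \<Rightarrow> (('a \<times> 'a) set, ('b \<times> 'a) set) module"
  where "loc_module R S M =
    \<lparr> carrier = {loc_frac R S M x s | x s. x \<in> carrier M \<and> s \<in> S},
      monoid.mult = undefined, one = undefined,
      zero = loc_frac R S M \<zero>\<^bsub>M\<^esub> \<one>\<^bsub>R\<^esub>,
      add = (\<lambda>C D. \<Union>(x, s)\<in>C. \<Union>(y, t)\<in>D.
        loc_frac R S M ((t \<odot>\<^bsub>M\<^esub> x) \<oplus>\<^bsub>M\<^esub> (s \<odot>\<^bsub>M\<^esub> y)) (s \<otimes>\<^bsub>R\<^esub> t)),
      smult = (\<lambda>A C. \<Union>(a, s)\<in>A. \<Union>(x, t)\<in>C.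
        loc_frac R S M (a \<odot>\<^bsub>M\<^esub> x) (s \<otimes>\<^bsub>R\<^esub> t)) \<rparr>"

definition loc_ring :: "('a, 'c) ring_scheme \<Rightarrow> 'a set \<Rightarrow> ('a \<times> 'a) set ring"
  where "loc_ring R S = (let L = loc_module R S (self_module R) in
    \<lparr> carrier = carrier L, monoid.mult = smult L,
      one = loc_frac R S (self_module R) \<one>\<^bsub>R\<^esub> \<one>\<^bsub>R\<^esub>,
      zero = zero L, add = add L \<rparr>)"

definition nonzerodivisor_on :: "('a, 'b, 'd) module_scheme \<Rightarrow> 'a \<Rightarrow> bool"
  where "nonzerodivisor_on M a \<longleftrightarrow> (\<forall>x\<in>carrier M. a \<odot>\<^bsub>M\<^esub> x = \<zero>\<^bsub>M\<^esub> \<longrightarrow> x = \<zero>\<^bsub>M\<^esub>)"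

definition regular_sequence ::
    "('a, 'c) ring_scheme \<Rightarrow> ('a, 'b, 'd) module_scheme \<Rightarrow> 'a list \<Rightarrow> bool"
  where "regular_sequence R M as \<longleftrightarrow>
    (let Q = (\<lambda>i. quot_module M (ideal_smult R (Idl\<^bsub>R\<^esub> (set (take i as))) M)) in
      set as \<subseteq> carrier R \<and>
      (\<forall>i<length as. nonzerodivisor_on (Q i) (as ! i)) \<and>
      carrier (Q (length as)) \<noteq> {\<zero>\<^bsub>Q (length as)\<^esub>})"

definition module_depth ::
    "('a, 'c) ring_scheme \<Rightarrow> 'a set \<Rightarrow> ('a, 'b, 'd) module_scheme \<Rightarrow> enat"
  where "module_depth R J M =
    Sup {enat (length as) | as. set as \<subseteq> J \<and> regular_sequence R M as}"

definition cohen_macaulay_local ::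
    "('a, 'c) ring_scheme \<Rightarrow> 'a set \<Rightarrow> ('a, 'b, 'd) module_scheme \<Rightarrow> bool"
  where "cohen_macaulay_local R \<mm> M \<longleftrightarrow> noetherian_local_ring R \<mm> \<and> fin_gen_module R M \<and>
    module_depth R \<mm> M = module_dim R M"

text \<open>Over a Noetherian ring that need not be local, the condition is imposed on the localizations
  at the maximal ideals in the support.\<close>

definition cohen_macaulay_module ::
    "('a, 'c) ring_scheme \<Rightarrow> ('a, 'b, 'd) module_scheme \<Rightarrow> bool"
  where "cohen_macaulay_module R M \<longleftrightarrow> cring R \<and> noetherian_ring R \<and> fin_gen_module R M \<and>
    (\<forall>P. maximalideal P R \<longrightarrow>
      (let S = carrier R - P; R\<^sub>P = loc_ring R S; M\<^sub>P = loc_module R S M in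
        carrier M\<^sub>P \<noteq> {\<zero>\<^bsub>M\<^sub>P\<^esub>} \<longrightarrow> (\<exists>\<mm>. cohen_macaulay_local R\<^sub>P \<mm> M\<^sub>P)))"


section \<open>Associated graded objects\<close>

text \<open>Elements of a direct sum of the quotients \<open>F n / F (n + 1)\<close> are sequences of cosets, almost all
  of them zero.\<close>

definition gr_piece ::
    "('a, 'b, 'd) module_scheme \<Rightarrow> (nat \<Rightarrow> 'b set) \<Rightarrow> nat \<Rightarrow> ('a, 'b set) module"
  where "gr_piece M F n = quot_module (M\<lparr>carrier := F n\<rparr>) (F (Suc n))"

definition gr_carrier ::
    "('a, 'b, 'd) module_scheme \<Rightarrow> (nat \<Rightarrow> 'b set) \<Rightarrow> (nat \<Rightarrow> 'b set) set"
  where "gr_carrier M F = {f. (\<forall>n. f n \<in> carrier (gr_piece M F n)) \<and>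
    finite {n. f n \<noteq> \<zero>\<^bsub>gr_piece M F n\<^esub>}}"

definition assoc_graded_ring :: "('a, 'c) ring_scheme \<Rightarrow> 'a set \<Rightarrow> (nat \<Rightarrow> 'a set) ring"
  where "assoc_graded_ring R I = (let F = ideal_pow R I; Q = gr_piece (self_module R) F in
    \<lparr> carrier = gr_carrier (self_module R) F,
      monoid.mult = (\<lambda>f g n. \<Oplus>\<^bsub>Q n\<^esub>i\<in>{..n}. rcoset_mult R (F (Suc n)) (f i) (g (n - i))),
      one = (\<lambda>n. F (Suc n) +>\<^bsub>R\<^esub> (if n = 0 then \<one>\<^bsub>R\<^esub> else \<zero>\<^bsub>R\<^esub>)),
      zero = (\<lambda>n. \<zero>\<^bsub>Q n\<^esub>),
      add = (\<lambda>f g n. f n \<oplus>\<^bsub>Q n\<^esub> g n) \<rparr>)"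

text \<open>The graded module of a filtration \<open>F\<close> with \<open>I\<^sup>i F j \<subseteq> F (i + j)\<close>, over the associated graded
  ring of \<open>I\<close>. The inner union is the analogue of \<^const>\<open>rcoset_mult\<close>: the coset of \<open>F (n + 1)\<close>
  that contains all products of representatives.\<close>

definition assoc_graded_module ::
    "('a, 'b, 'd) module_scheme \<Rightarrow> (nat \<Rightarrow> 'b set) \<Rightarrow> (nat \<Rightarrow> 'a set, nat \<Rightarrow> 'b set) module"
  where "assoc_graded_module M F = (let Q = gr_piece M F in
    \<lparr> carrier = gr_carrier M F, monoid.mult = undefined, one = undefined,
      zero = (\<lambda>n. \<zero>\<^bsub>Q n\<^esub>),
      add = (\<lambda>f g n. f n \<oplus>\<^bsub>Q n\<^esub> g n),
      smult = (\<lambda>f g n. \<Oplus>\<^bsub>Q n\<^esub>i\<in>{..n}.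
        \<Union>a\<in>f i. \<Union>x\<in>g (n - i). F (Suc n) +>\<^bsub>M\<^esub> (a \<odot>\<^bsub>M\<^esub> x)) \<rparr>)"


section \<open>Ratliff-Rush filtration and Hilbert coefficients\<close>

definition ratliff_rush ::
    "('a, 'c) ring_scheme \<Rightarrow> 'a set \<Rightarrow> ('a, 'b, 'd) module_scheme \<Rightarrow> nat \<Rightarrow> 'b set"
  where "ratliff_rush R I M n = (if n = 0 then carrier M else
    \<Union>k\<in>{1..}. module_colon M (ideal_smult R (ideal_pow R I (n + k)) M) (ideal_pow R I k))"

definition ratliff_rush_graded ::
    "('a, 'c) ring_scheme \<Rightarrow> 'a set \<Rightarrow> ('a, 'b, 'd) module_scheme
      \<Rightarrow> (nat \<Rightarrow> 'a set, nat \<Rightarrow> 'b set) module"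
  where "ratliff_rush_graded R I M = assoc_graded_module M (ratliff_rush R I M)"

definition has_hilbert_coeffs ::
    "('a, 'c) ring_scheme \<Rightarrow> 'a set \<Rightarrow> ('a, 'b, 'd) module_scheme \<Rightarrow> int \<Rightarrow> int \<Rightarrow> bool"
  where "has_hilbert_coeffs R I M e0 e1 \<longleftrightarrow> (\<forall>\<^sub>F n in sequentially.
    (let l = module_length R (quot_module M (ideal_smult R (ideal_pow R I (n + 1)) M)) in
      l \<noteq> \<infinity> \<and> int (the_enat l) = e0 * (int n + 1) - e1))"

text \<open>Meaningful for modules of dimension one, where the Hilbert polynomial has degree one.\<close>

definition hilbert_e0 ::
    "('a, 'c) ring_scheme \<Rightarrow> 'a set \<Rightarrow> ('a, 'b, 'd) module_scheme \<Rightarrow> int"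
  where "hilbert_e0 R I M = (THE e0. \<exists>e1. has_hilbert_coeffs R I M e0 e1)"

definition hilbert_e1 ::
    "('a, 'c) ring_scheme \<Rightarrow> 'a set \<Rightarrow> ('a, 'b, 'd) module_scheme \<Rightarrow> int"
  where "hilbert_e1 R I M = (THE e1. \<exists>e0. has_hilbert_coeffs R I M e0 e1)"

end

theory Submission imports Defs begin

text \<open>
  Let \<open>H\<close> be the submodule \<open>H\<^sup>0\<^sub>\<mm>(M)\<close> of \<open>\<mm>\<close>-torsion. The whole argument rests on one identity,
  \<open>ratliff_rush_eq_Fil\<close>: for all large \<open>n\<close> the Ratliff-Rush submodule of \<open>I\<^sup>n M\<close> is \<open>I\<^sup>n M + H\<close>. One inclusion holds
  because a power of \<open>I\<close> kills \<open>H\<close>. For the other, choose \<open>x \<in> I\<close> regular on \<open>M / H\<close>; since \<open>M\<close> has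
  dimension one, \<open>x\<close> is a parameter, and \<open>I\<^sup>N M \<subseteq> x I\<^sup>n M\<close> whenever \<open>N\<close> is large compared with \<open>n\<close>
  (\<open>pow_mult_into_x0\<close>). An element \<open>v\<close> with \<open>I v \<subseteq> I\<^sup>N\<^sup>+\<^sup>1 M + H\<close> therefore lies fairly deep in
  the filtration, and it lies in \<open>I\<^sup>N M + H\<close>, because in high degrees the graded module of the
  filtration \<open>I\<^sup>n M + H\<close> has no element killed by \<open>I / I\<^sup>2\<close>: such elements form a finitely generated module
  on which \<open>I / I\<^sup>2\<close> acts as zero, and so they live in finitely many degrees (\<open>Fil_socle_vanishes\<close>,
  \<open>Fil_colon\<close>).

  For part (a) it remains to compare \<open>M / I\<^sup>n M\<close> with \<open>M / (I\<^sup>n M + H)\<close>. Their lengths differ by the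
  length of \<open>H / (H \<inter> I\<^sup>n M)\<close>, and \<open>H \<inter> I\<^sup>n M = 0\<close> for large \<open>n\<close>. That these lengths are linear functions of
  \<open>n\<close> in the end is Hilbert's theorem for a graded module whose Hilbert function
  stays below some bound infinitely often (\<open>hilbert_function_eventually_constant\<close>), and the bound comes from \<open>x\<^sup>n M \<subseteq> I\<^sup>n M\<close>.

  For parts (b) and (c) let \<open>G\<close> be the graded module of the Ratliff-Rush filtration over the graded ring \<open>A\<close>.
  Three properties are enough, by \<open>cohen_macaulay_dim_one\<close>. First, \<open>A\<close> and \<open>G\<close> are
  Noetherian, by a graded form of Hilbert's basis theorem: beyond some degree the filtration is
  \<open>I\<^sup>n M + H\<close>, so that each graded piece is \<open>I / I\<^sup>2\<close> times the preceding one. Secondly, the lengths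
  of the quotients of \<open>M\<close> by the filtration grow at most linearly, and this forbids chains of three primes over the annihilator of \<open>G\<close>
  (\<open>Gr_no_long_prime_chain\<close>). Thirdly, every maximal ideal of \<open>A\<close>, homogeneous or not, contains an
  element that is regular on \<open>G\<close> (\<open>Gr_regular_in_maximal\<close>). A maximal ideal of zero divisors would kill
  some nonzero \<open>v\<close>. If it contains all forms of degree one, it cannot, since by construction
  the Ratliff-Rush filtration has no socle in any degree (\<open>RR_socle\<close>); otherwise \<open>v\<close> is a multiple of a form of
  degree one, and \<open>v = 0\<close> by comparing components of lowest degree. Localized at a maximal
  ideal in its support, \<open>G\<close> thus has dimension exactly one; its depth is at least one by Nakayama's
  lemma, and at most one because a regular element is a parameter.

  Lengths and chain conditions are read off from the lattice of submodules of \<open>M\<close>; in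
  particular, graded submodules are handled as sequences of submodules of \<open>M\<close>, and quotients are
  formed only where the statement mentions them.
\<close>

section \<open>Ascending chain conditions\<close>

text \<open>The order is arbitrary so that the condition applies both to submodules and to sequences of
  submodules.\<close>
definition asc_chain_cond :: "('x::order \<Rightarrow> bool) \<Rightarrow> bool" where
  "asc_chain_cond P \<longleftrightarrow>
    (\<forall>f::nat \<Rightarrow> 'x. (\<forall>n. P (f n)) \<and> mono f \<longrightarrow> (\<exists>k. \<forall>n\<ge>k. f n = f k))"

lemma asc_chain_condD:
  assumes "asc_chain_cond P" "\<And>n. P (f n)" "\<And>n. f n \<le> f (Suc n)"
  obtains k where "\<And>n. n \<ge> k \<Longrightarrow> f n = f (k::nat)"
proof -
  have "mono f" by (rule mono_iff_le_Suc[THEN iffD2]) (use assms(3) in blast)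
  then show ?thesis using assms that unfolding asc_chain_cond_def by blast
qed

lemma asc_chain_cond_mono:
  "asc_chain_cond Q \<Longrightarrow> (\<And>x. P x \<Longrightarrow> Q x) \<Longrightarrow> asc_chain_cond P"
  unfolding asc_chain_cond_def by blast

text \<open>Along a chain each of the finitely many monotone invariants \<open>g j\<close> becomes stationary. Typical
  invariants are the intersection and the sum with a fixed submodule, or the entries of a sequence.\<close>
lemma asc_chain_cond_transfer_finite:
  fixes g :: "'j \<Rightarrow> 'x::order \<Rightarrow> 'y::order"
  assumes acc: "\<And>j. j \<in> J \<Longrightarrow> asc_chain_cond (Q j)" and J: "finite J"
    and PQ: "\<And>j x. j \<in> J \<Longrightarrow> P x \<Longrightarrow> Q j (g j x)"
    and mon: "\<And>j x y. j \<in> J \<Longrightarrow> P x \<Longrightarrow> P y \<Longrightarrow> x \<le> y \<Longrightarrow> g j x \<le> g j y"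
    and inj: "\<And>x y. P x \<Longrightarrow> P y \<Longrightarrow> x \<le> y \<Longrightarrow> (\<And>j. j \<in> J \<Longrightarrow> g j x = g j y) \<Longrightarrow> x = y"
  shows "asc_chain_cond P"
  unfolding asc_chain_cond_def
proof (intro allI impI, elim conjE)
  fix f :: "nat \<Rightarrow> 'x" assume Pf: "\<forall>n. P (f n)" and mf: "mono f"
  have "\<exists>k. \<forall>n\<ge>k. g j (f n) = g j (f k)" if j: "j \<in> J" for j
  proof -
    have "\<And>n. Q j (g j (f n))" using PQ j Pf by blast
    moreover have "\<And>n. g j (f n) \<le> g j (f (Suc n))"
      using mon j Pf mf by (meson le_Suc_eq monoD order_refl)
    ultimately show ?thesis using asc_chain_condD[OF acc[OF j], of "\<lambda>n. g j (f n)"] by metis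
  qed
  then obtain k where k: "\<And>j n. j \<in> J \<Longrightarrow> n \<ge> k j \<Longrightarrow> g j (f n) = g j (f (k j))" by metis
  define K where "K = Max (insert 0 (k ` J))"
  have K: "k j \<le> K" if "j \<in> J" for j unfolding K_def using J that by (intro Max_ge) auto
  have "f n = f K" if "n \<ge> K" for n
  proof -
    have "f K \<le> f n" using mf that by (rule monoD)
    moreover have "g j (f K) = g j (f n)" if "j \<in> J" for j
      using k[OF that K[OF that]] k[OF that, of n] K[OF that] \<open>n \<ge> K\<close> by simp
    ultimately show ?thesis using inj[of "f K" "f n"] Pf by metis
  qed
  then show "\<exists>k. \<forall>n\<ge>k. f n = f k" by blast
qed

lemma asc_chain_cond_transfer:
  fixes g :: "'x::order \<Rightarrow> 'y::order"
  assumes "asc_chain_cond Q" "\<And>x. P x \<Longrightarrow> Q (g x)"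
    "\<And>x y. P x \<Longrightarrow> P y \<Longrightarrow> x \<le> y \<Longrightarrow> g x \<le> g y"
    "\<And>x y. P x \<Longrightarrow> P y \<Longrightarrow> x \<le> y \<Longrightarrow> g x = g y \<Longrightarrow> x = y"
  shows "asc_chain_cond P"
  by (rule asc_chain_cond_transfer_finite[of "{()}" "\<lambda>_. Q" P "\<lambda>_. g"]) (use assms in auto)

text \<open>For a family \<open>g 0 \<le> g 1 \<le> \<dots>\<close> of monotone maps, a chain \<open>f\<close> produces a double array
  \<open>g i (f k)\<close> that ascends in both indices. Its diagonal stabilizes, say at \<open>d\<close>; beyond
  \<open>d\<close> in both indices the array is constant, so that only the finitely many maps \<open>g i\<close> with
  \<open>i \<le> d\<close> are still needed to tell members of the chain apart.\<close>
lemma asc_chain_cond_transfer_double: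
  fixes g :: "nat \<Rightarrow> 'x::order \<Rightarrow> 'y::order"
  assumes acc: "asc_chain_cond Q"
    and PQ: "\<And>i x. P x \<Longrightarrow> Q (g i x)"
    and mon: "\<And>i x y. P x \<Longrightarrow> P y \<Longrightarrow> x \<le> y \<Longrightarrow> g i x \<le> g i y"
    and asc: "\<And>i x. P x \<Longrightarrow> g i x \<le> g (Suc i) x"
    and inj: "\<And>x y. P x \<Longrightarrow> P y \<Longrightarrow> x \<le> y \<Longrightarrow> (\<And>i. g i x = g i y) \<Longrightarrow> x = y"
  shows "asc_chain_cond P"
  unfolding asc_chain_cond_def
proof (intro allI impI, elim conjE)
  fix f :: "nat \<Rightarrow> 'x" assume Pf: "\<forall>n. P (f n)" and mf: "mono f"
  have asc': "g i x \<le> g j x" if "P x" "i \<le> j" for i j x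
    using that(2) by (induct rule: dec_induct) (use asc that(1) order_trans in blast)+
  have le: "g i (f k) \<le> g j (f l)" if "i \<le> j" "k \<le> l" for i j k l
    using asc'[of "f k" i j] mon[of "f k" "f l" j] that Pf monoD[OF mf, of k l] by (meson order_trans)
  obtain d where d: "\<And>n. n \<ge> d \<Longrightarrow> g n (f n) = g d (f d)"
    by (rule asc_chain_condD[OF acc, of "\<lambda>n. g n (f n)"]) (use PQ Pf le in auto)
  have far: "g i (f k) = g d (f d)" if "i \<ge> d" "k \<ge> d" for i k
    using le[of d i d k] le[of i "max i k" k "max i k"] d[of "max i k"] that by simp
  have "\<exists>k. \<forall>n\<ge>k. g i (f n) = g i (f k)" for i
    using asc_chain_condD[OF acc, of "\<lambda>n. g i (f n)"] PQ Pf le by (metis le_Suc_eq order_refl)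
  then obtain k where k: "\<And>i n. n \<ge> k i \<Longrightarrow> g i (f n) = g i (f (k i))" by metis
  define K where "K = Max (insert d (k ` {..d}))"
  have K: "k i \<le> K" if "i \<le> d" for i unfolding K_def using that by (intro Max_ge) auto
  have Kd: "d \<le> K" unfolding K_def by (intro Max_ge) auto
  have "f n = f K" if n: "n \<ge> K" for n
  proof -
    have "g i (f K) = g i (f n)" for i
      using k[of i K] k[of i n] K[of i] far[of i K] far[of i n] Kd n
      by (cases "i \<le> d") auto
    then show ?thesis using inj[of "f K" "f n"] Pf monoD[OF mf n] by metis
  qed
  then show "\<exists>k. \<forall>n\<ge>k. f n = f k" by blast
qed

lemma asc_chain_cond_maximal:
  assumes acc: "asc_chain_cond P" and x: "S x" and SP: "\<And>y. S y \<Longrightarrow> P y"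
  obtains m where "S m" "x \<le> m" "\<And>y. S y \<Longrightarrow> m \<le> y \<Longrightarrow> y = m"
proof (rule ccontr)
  assume "\<not> thesis"
  then have ex: "\<And>m. S m \<Longrightarrow> x \<le> m \<Longrightarrow> \<exists>y. S y \<and> m < y" using that by (metis order_le_less)
  define nxt where "nxt m = (SOME y. S y \<and> m < y)" for m
  have nxt: "S (nxt m) \<and> m < nxt m" if "S m" "x \<le> m" for m
    unfolding nxt_def using someI_ex[OF ex[OF that]] .
  define f where "f n = (nxt ^^ n) x" for n
  have f: "S (f n) \<and> x \<le> f n" for n
  proof (induct n)
    case (Suc n) then show ?case using nxt[of "f n"] unfolding f_def by (auto intro: order_trans less_imp_le)
  qed (simp add: f_def x)
  have lt: "f n < f (Suc n)" for n using nxt[of "f n"] f[of n] by (simp add: f_def)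
  obtain k where "\<And>n. n \<ge> k \<Longrightarrow> f n = f k"
    by (rule asc_chain_condD[OF acc, of f]) (use f SP lt in \<open>auto simp: less_imp_le\<close>)
  then show False using lt[of k] by (metis le_SucI less_irrefl order_refl)
qed


section \<open>Submodules\<close>

text \<open>Linearity is asked for on \<open>V\<close> only, since a map that sends an element to its class in one
  piece of a graded module makes sense only on a member of the filtration.\<close>
definition linear_on ::
    "('a, 'c) ring_scheme \<Rightarrow> ('a, 'b, 'd) module_scheme \<Rightarrow> ('a, 'e, 'f) module_scheme
      \<Rightarrow> 'b set \<Rightarrow> ('b \<Rightarrow> 'e) \<Rightarrow> bool" where
  "linear_on R M N V \<phi> \<longleftrightarrow> (\<forall>x\<in>V. \<phi> x \<in> carrier N) \<and>
    (\<forall>x\<in>V. \<forall>y\<in>V. \<phi> (x \<oplus>\<^bsub>M\<^esub> y) = \<phi> x \<oplus>\<^bsub>N\<^esub> \<phi> y) \<and>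
    (\<forall>a\<in>carrier R. \<forall>x\<in>V. \<phi> (a \<odot>\<^bsub>M\<^esub> x) = a \<odot>\<^bsub>N\<^esub> \<phi> x)"

definition noeth_module :: "('a, 'c) ring_scheme \<Rightarrow> ('a, 'b, 'd) module_scheme \<Rightarrow> bool" where
  "noeth_module R M \<longleftrightarrow> asc_chain_cond (\<lambda>U. submodule U R M)"

lemma mem_set_add: "z \<in> U <+>\<^bsub>M\<^esub> V \<longleftrightarrow> (\<exists>u\<in>U. \<exists>v\<in>V. z = u \<oplus>\<^bsub>M\<^esub> v)"
  by (auto simp: set_add_def')

lemma submoduleD:
  assumes "submodule U R M"
  shows submodule_in_carrier: "x \<in> U \<Longrightarrow> x \<in> carrier M"
    and submodule_zero: "\<zero>\<^bsub>M\<^esub> \<in> U"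
    and submodule_add: "x \<in> U \<Longrightarrow> y \<in> U \<Longrightarrow> x \<oplus>\<^bsub>M\<^esub> y \<in> U"
    and submodule_neg: "x \<in> U \<Longrightarrow> \<ominus>\<^bsub>M\<^esub> x \<in> U"
    and submodule_smult: "a \<in> carrier R \<Longrightarrow> x \<in> U \<Longrightarrow> a \<odot>\<^bsub>M\<^esub> x \<in> U"
  using submodule.axioms(1)[OF assms] submodule.smult_closed[OF assms]
  by (auto simp: subgroup_def a_inv_def)

context module
begin

lemma a_diff_cancel: "\<lbrakk>x \<in> carrier M; y \<in> carrier M\<rbrakk> \<Longrightarrow> (x \<oplus>\<^bsub>M\<^esub> y) \<ominus>\<^bsub>M\<^esub> y = x"
  by (simp add: a_minus_def M.a_assoc M.r_neg)

lemma submodule_minus: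
  "submodule U R M \<Longrightarrow> x \<in> U \<Longrightarrow> y \<in> U \<Longrightarrow> x \<ominus>\<^bsub>M\<^esub> y \<in> U"
  unfolding a_minus_def by (intro submodule_add submodule_neg)

lemma submodule_add_cancel:
  assumes "submodule U R M" "x \<oplus>\<^bsub>M\<^esub> y \<in> U" "y \<in> U" "x \<in> carrier M"
  shows "x \<in> U"
  using submodule_minus[OF assms(1,2,3)] a_diff_cancel[of x y] assms submodule_in_carrier by metis

lemma submodule_sum:
  assumes U: "submodule U R M" and V: "submodule V R M"
  shows "submodule (U <+>\<^bsub>M\<^esub> V) R M"
proof (rule submoduleI)
  show "U <+>\<^bsub>M\<^esub> V \<subseteq> carrier M"
    using submodule_in_carrier[OF U] submodule_in_carrier[OF V] by (auto simp: mem_set_add)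
  show "\<zero>\<^bsub>M\<^esub> \<in> U <+>\<^bsub>M\<^esub> V"
    unfolding mem_set_add using submodule_zero[OF U] submodule_zero[OF V] M.r_zero M.zero_closed by metis
next
  fix a assume "a \<in> U <+>\<^bsub>M\<^esub> V"
  then obtain u v where "u \<in> U" "v \<in> V" "a = u \<oplus>\<^bsub>M\<^esub> v" unfolding mem_set_add by blast
  then show "\<ominus>\<^bsub>M\<^esub> a \<in> U <+>\<^bsub>M\<^esub> V" unfolding mem_set_add
    using submodule_neg[OF U] submodule_neg[OF V] M.minus_add submodule_in_carrier[OF U] submodule_in_carrier[OF V]
    by metis
next
  fix a b assume "a \<in> U <+>\<^bsub>M\<^esub> V" "b \<in> U <+>\<^bsub>M\<^esub> V"
  then obtain u v u' v' where h: "u \<in> U" "v \<in> V" "a = u \<oplus>\<^bsub>M\<^esub> v" "u' \<in> U" "v' \<in> V" "b = u' \<oplus>\<^bsub>M\<^esub> v'"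
    unfolding mem_set_add by blast
  then have "a \<oplus>\<^bsub>M\<^esub> b = (u \<oplus>\<^bsub>M\<^esub> u') \<oplus>\<^bsub>M\<^esub> (v \<oplus>\<^bsub>M\<^esub> v')"
    using submodule_in_carrier[OF U] submodule_in_carrier[OF V] by (simp add: M.a_ac)
  then show "a \<oplus>\<^bsub>M\<^esub> b \<in> U <+>\<^bsub>M\<^esub> V" unfolding mem_set_add
    using submodule_add[OF U] submodule_add[OF V] h by blast
next
  fix a x assume a: "a \<in> carrier R" and "x \<in> U <+>\<^bsub>M\<^esub> V"
  then obtain u v where h: "u \<in> U" "v \<in> V" "x = u \<oplus>\<^bsub>M\<^esub> v" unfolding mem_set_add by blast
  then have "a \<odot>\<^bsub>M\<^esub> x = a \<odot>\<^bsub>M\<^esub> u \<oplus>\<^bsub>M\<^esub> a \<odot>\<^bsub>M\<^esub> v"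
    using a submodule_in_carrier[OF U] submodule_in_carrier[OF V] smult_r_distr by blast
  then show "a \<odot>\<^bsub>M\<^esub> x \<in> U <+>\<^bsub>M\<^esub> V" unfolding mem_set_add
    using submodule_smult[OF U a] submodule_smult[OF V a] h by blast
qed

lemma sum_upper:
  assumes "submodule U R M" "submodule V R M"
  shows "U \<subseteq> U <+>\<^bsub>M\<^esub> V" "V \<subseteq> U <+>\<^bsub>M\<^esub> V"
proof -
  show "U \<subseteq> U <+>\<^bsub>M\<^esub> V"
    using assms submodule_zero M.r_zero submodule_in_carrier unfolding subset_iff mem_set_add by metis
  show "V \<subseteq> U <+>\<^bsub>M\<^esub> V"
    using assms submodule_zero M.l_zero submodule_in_carrier unfolding subset_iff mem_set_add by metis
qed

lemma sum_least:
  assumes "submodule W R M" "U \<subseteq> W" "V \<subseteq> W"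
  shows "U <+>\<^bsub>M\<^esub> V \<subseteq> W"
  using assms by (auto simp: mem_set_add subset_iff intro: submodule_add)

lemma submodule_Int: "submodule U R M \<Longrightarrow> submodule V R M \<Longrightarrow> submodule (U \<inter> V) R M"
  by (rule submoduleI) (auto simp: submoduleD)

lemma submodule_Inter:
  assumes "\<And>U. U \<in> S \<Longrightarrow> submodule U R M" "S \<noteq> {}"
  shows "submodule (\<Inter>S) R M"
proof (rule submoduleI)
  obtain U where "U \<in> S" using assms(2) by blast
  then show "\<Inter>S \<subseteq> carrier M" using submodule_in_carrier[OF assms(1)] by (meson Inter_lower subset_iff)
  show "\<zero>\<^bsub>M\<^esub> \<in> \<Inter>S" by (rule InterI) (rule submodule_zero[OF assms(1)])
  show "\<ominus>\<^bsub>M\<^esub> a \<in> \<Inter>S" if "a \<in> \<Inter>S" for a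
    by (rule InterI) (rule submodule_neg[OF assms(1)], use that in auto)
  show "a \<oplus>\<^bsub>M\<^esub> b \<in> \<Inter>S" if "a \<in> \<Inter>S" "b \<in> \<Inter>S" for a b
    by (rule InterI) (rule submodule_add[OF assms(1)], use that in auto)
  show "a \<odot>\<^bsub>M\<^esub> x \<in> \<Inter>S" if "a \<in> carrier R" "x \<in> \<Inter>S" for a x
    by (rule InterI) (rule submodule_smult[OF assms(1)], use that in auto)
qed

lemma submodule_gen_submodule: "S \<subseteq> carrier M \<Longrightarrow> submodule (submodule_gen R M S) R M"
  unfolding submodule_gen_def
  by (rule submodule_Inter) (use carrier_is_submodule in auto)

lemma submodule_gen_least: "submodule W R M \<Longrightarrow> S \<subseteq> W \<Longrightarrow> submodule_gen R M S \<subseteq> W"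
  unfolding submodule_gen_def by blast

lemma submodule_gen_upper: "S \<subseteq> submodule_gen R M S"
  unfolding submodule_gen_def by blast

lemma zero_submodule: "submodule {\<zero>\<^bsub>M\<^esub>} R M"
  by (rule submoduleI) (use M.minus_equality in auto)

lemma submodule_Union_chain:
  assumes "\<And>n. submodule (f n) R M" "\<And>n. f n \<subseteq> f (Suc n)"
  shows "submodule (\<Union>n. f (n::nat)) R M"
proof (rule submoduleI)
  have mono: "f i \<subseteq> f j" if "i \<le> j" for i j
    using that by (induct rule: dec_induct) (use assms(2) in blast)+
  fix a b assume "a \<in> (\<Union>n. f n)" "b \<in> (\<Union>n. f n)"
  then obtain i j where "a \<in> f i" "b \<in> f j" by blast
  then have "a \<in> f (max i j)" "b \<in> f (max i j)" using mono[of i "max i j"] mono[of j "max i j"] by auto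
  then show "a \<oplus>\<^bsub>M\<^esub> b \<in> (\<Union>n. f n)" using submodule_add[OF assms(1)] by blast
next
  show "(\<Union>n. f n) \<subseteq> carrier M" by (rule UN_least) (rule subsetI, rule submodule_in_carrier[OF assms(1)])
  show "\<zero>\<^bsub>M\<^esub> \<in> (\<Union>n. f n)" using submodule_zero[OF assms(1)] by blast
  show "\<ominus>\<^bsub>M\<^esub> a \<in> (\<Union>n. f n)" if "a \<in> (\<Union>n. f n)" for a
    using that by (auto intro: submodule_neg assms(1))
  show "a \<odot>\<^bsub>M\<^esub> x \<in> (\<Union>n. f n)" if "a \<in> carrier R" "x \<in> (\<Union>n. f n)" for a x
    using that by (auto intro: submodule_smult assms(1))
qed

lemma linear_on_neg:
  assumes N: "module R N" and V: "submodule V R M" and lin: "linear_on R M N V \<phi>" and x: "x \<in> V"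
  shows "\<phi> (\<ominus>\<^bsub>M\<^esub> x) = \<ominus>\<^bsub>N\<^esub> \<phi> x" and "\<phi> \<zero>\<^bsub>M\<^esub> = \<zero>\<^bsub>N\<^esub>"
proof -
  interpret N: module R N by fact
  have c: "x \<in> carrier M" using V x by (rule submodule_in_carrier)
  have px: "\<phi> x \<in> carrier N" using lin x by (simp add: linear_on_def)
  have "\<phi> ((\<ominus> \<one>) \<odot>\<^bsub>M\<^esub> x) = (\<ominus> \<one>) \<odot>\<^bsub>N\<^esub> \<phi> x" "\<phi> (\<zero> \<odot>\<^bsub>M\<^esub> x) = \<zero> \<odot>\<^bsub>N\<^esub> \<phi> x"
    using lin x by (simp_all add: linear_on_def)
  then show "\<phi> (\<ominus>\<^bsub>M\<^esub> x) = \<ominus>\<^bsub>N\<^esub> \<phi> x" "\<phi> \<zero>\<^bsub>M\<^esub> = \<zero>\<^bsub>N\<^esub>"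
    using c px by (simp_all add: smult_l_minus N.smult_l_minus)
qed

lemma submodule_preimage:
  assumes N: "module R N" and V: "submodule V R M" and lin: "linear_on R M N V \<phi>"
    and B: "submodule B R N"
  shows "submodule {v \<in> V. \<phi> v \<in> B} R M"
proof (rule submoduleI)
  show "\<zero>\<^bsub>M\<^esub> \<in> {v \<in> V. \<phi> v \<in> B}"
    using submodule_zero[OF V] submodule_zero[OF B] linear_on_neg(2)[OF N V lin] by auto
  fix a assume "a \<in> {v \<in> V. \<phi> v \<in> B}"
  then show "\<ominus>\<^bsub>M\<^esub> a \<in> {v \<in> V. \<phi> v \<in> B}"
    using submodule_neg[OF V] submodule_neg[OF B] linear_on_neg(1)[OF N V lin] by auto
qed (use lin V B in \<open>auto simp: linear_on_def submoduleD\<close>)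

lemma submodule_image:
  assumes N: "module R N" and V: "submodule V R M" and lin: "linear_on R M N V \<phi>"
  shows "submodule (\<phi> ` V) R N"
proof (rule module.submoduleI[OF N])
  show "\<phi> ` V \<subseteq> carrier N" using lin by (auto simp: linear_on_def)
  show "\<zero>\<^bsub>N\<^esub> \<in> \<phi> ` V" using linear_on_neg(2)[OF N V lin] submodule_zero[OF V] by (metis imageI)
  show "\<ominus>\<^bsub>N\<^esub> a \<in> \<phi> ` V" if "a \<in> \<phi> ` V" for a
    using that linear_on_neg(1)[OF N V lin] submodule_neg[OF V] by (metis (no_types, lifting) imageE imageI)
  show "a \<oplus>\<^bsub>N\<^esub> b \<in> \<phi> ` V" if ab: "a \<in> \<phi> ` V" "b \<in> \<phi> ` V" for a b
  proof -
    from ab obtain u v where "u \<in> V" "v \<in> V" "a = \<phi> u" "b = \<phi> v" by blast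
    then have "a \<oplus>\<^bsub>N\<^esub> b = \<phi> (u \<oplus>\<^bsub>M\<^esub> v)" "u \<oplus>\<^bsub>M\<^esub> v \<in> V"
      using lin submodule_add[OF V] by (auto simp: linear_on_def)
    then show ?thesis by blast
  qed
  show "a \<odot>\<^bsub>N\<^esub> x \<in> \<phi> ` V" if ax: "a \<in> carrier R" "x \<in> \<phi> ` V" for a x
  proof -
    from ax obtain u where "u \<in> V" "x = \<phi> u" by blast
    then have "a \<odot>\<^bsub>N\<^esub> x = \<phi> (a \<odot>\<^bsub>M\<^esub> u)" "a \<odot>\<^bsub>M\<^esub> u \<in> V"
      using ax lin submodule_smult[OF V] by (auto simp: linear_on_def)
    then show ?thesis by blast
  qed
qed

lemma linear_on_smult:
  assumes "a \<in> carrier R" "V \<subseteq> carrier M"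
  shows "linear_on R M M V (\<lambda>x. a \<odot>\<^bsub>M\<^esub> x)"
  unfolding linear_on_def
proof (intro conjI ballI)
  fix b x assume "b \<in> carrier R" "x \<in> V"
  then have x: "x \<in> carrier M" "b \<in> carrier R" using assms by auto
  show "a \<odot>\<^bsub>M\<^esub> (b \<odot>\<^bsub>M\<^esub> x) = b \<odot>\<^bsub>M\<^esub> (a \<odot>\<^bsub>M\<^esub> x)"
    using x assms by (metis R.m_comm smult_assoc1)
qed (use assms in \<open>auto simp: smult_r_distr subset_iff\<close>)

lemma smult_comm:
  "\<lbrakk>a \<in> carrier R; b \<in> carrier R; x \<in> carrier M\<rbrakk> \<Longrightarrow> a \<odot>\<^bsub>M\<^esub> (b \<odot>\<^bsub>M\<^esub> x) = b \<odot>\<^bsub>M\<^esub> (a \<odot>\<^bsub>M\<^esub> x)"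
  by (metis R.m_comm smult_assoc1)

lemma submodule_smult_image:
  "a \<in> carrier R \<Longrightarrow> submodule V R M \<Longrightarrow> submodule ((\<lambda>x. a \<odot>\<^bsub>M\<^esub> x) ` V) R M"
  by (intro submodule_image module_axioms linear_on_smult) (auto simp: submoduleD)

lemma submodule_smult_preimage:
  assumes "a \<in> carrier R" "submodule V R M" "submodule B R M"
  shows "submodule {v \<in> V. a \<odot>\<^bsub>M\<^esub> v \<in> B} R M"
  by (rule submodule_preimage[OF module_axioms assms(2) linear_on_smult assms(3)])
     (use assms in \<open>auto simp: submoduleD\<close>)

lemma submodule_cyclic:
  assumes v: "v \<in> carrier M" shows "submodule {a \<odot>\<^bsub>M\<^esub> v | a. a \<in> carrier R} R M"
proof (rule submoduleI)
  show "{a \<odot>\<^bsub>M\<^esub> v | a. a \<in> carrier R} \<subseteq> carrier M" using v by auto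
  have "\<zero>\<^bsub>M\<^esub> = \<zero> \<odot>\<^bsub>M\<^esub> v" using v by simp
  then show "\<zero>\<^bsub>M\<^esub> \<in> {a \<odot>\<^bsub>M\<^esub> v | a. a \<in> carrier R}" using R.zero_closed by blast
next
  fix x assume "x \<in> {a \<odot>\<^bsub>M\<^esub> v | a. a \<in> carrier R}"
  then obtain a where a: "a \<in> carrier R" "x = a \<odot>\<^bsub>M\<^esub> v" by blast
  have "\<ominus>\<^bsub>M\<^esub> x = (\<ominus> a) \<odot>\<^bsub>M\<^esub> v" using a v by (simp add: smult_l_minus)
  then show "\<ominus>\<^bsub>M\<^esub> x \<in> {a \<odot>\<^bsub>M\<^esub> v | a. a \<in> carrier R}" using a(1) R.a_inv_closed by blast
  fix y assume "y \<in> {a \<odot>\<^bsub>M\<^esub> v | a. a \<in> carrier R}"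
  then obtain b where b: "b \<in> carrier R" "y = b \<odot>\<^bsub>M\<^esub> v" by blast
  have "x \<oplus>\<^bsub>M\<^esub> y = (a \<oplus> b) \<odot>\<^bsub>M\<^esub> v" using a b v by (simp add: smult_l_distr)
  then show "x \<oplus>\<^bsub>M\<^esub> y \<in> {a \<odot>\<^bsub>M\<^esub> v | a. a \<in> carrier R}" using a(1) b(1) R.a_closed by blast
next
  fix b x assume b: "b \<in> carrier R" and "x \<in> {a \<odot>\<^bsub>M\<^esub> v | a. a \<in> carrier R}"
  then obtain a where a: "a \<in> carrier R" "x = a \<odot>\<^bsub>M\<^esub> v" by blast
  have "b \<odot>\<^bsub>M\<^esub> x = (b \<otimes> a) \<odot>\<^bsub>M\<^esub> v" using a b v by (simp add: smult_assoc1)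
  then show "b \<odot>\<^bsub>M\<^esub> x \<in> {a \<odot>\<^bsub>M\<^esub> v | a. a \<in> carrier R}" using a(1) b(1) R.m_closed by blast
qed

lemma cyclic_self: "v \<in> carrier M \<Longrightarrow> v \<in> {a \<odot>\<^bsub>M\<^esub> v | a. a \<in> carrier R}"
  using smult_one R.one_closed by (metis (mono_tags, lifting) mem_Collect_eq)

end


section \<open>Relative length\<close>

inductive submodule_chain ::
    "('a, 'c) ring_scheme \<Rightarrow> ('a, 'b, 'd) module_scheme \<Rightarrow> 'b set \<Rightarrow> 'b set \<Rightarrow> nat \<Rightarrow> bool"
  for R M U where
  refl: "submodule U R M \<Longrightarrow> submodule_chain R M U U 0"
| step: "submodule_chain R M U V n \<Longrightarrow> submodule W R M \<Longrightarrow> V \<subset> W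
    \<Longrightarrow> submodule_chain R M U W (Suc n)"

text \<open>The length of \<open>V / U\<close>, read off from the interval between \<open>U\<close> and \<open>V\<close> in the lattice of
  submodules, so that no quotient module has to be formed.\<close>
definition rel_length ::
    "('a, 'c) ring_scheme \<Rightarrow> ('a, 'b, 'd) module_scheme \<Rightarrow> 'b set \<Rightarrow> 'b set \<Rightarrow> enat" where
  "rel_length R M U V = Sup {enat n | n. submodule_chain R M U V n}"

lemma submodule_chain_submodules:
  assumes "submodule_chain R M U V n"
  shows "submodule U R M" "submodule V R M" "U \<subseteq> V"
  using assms by induct auto

lemma submodule_chain_trans:
  assumes "submodule_chain R M V W n" "submodule_chain R M U V m"
  shows "submodule_chain R M U W (m + n)"
  using assms by induct (auto intro: submodule_chain.intros)

lemma submodule_chain_map: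
  assumes "submodule_chain R M U V n"
    and "\<And>W. submodule W R M \<Longrightarrow> U \<subseteq> W \<Longrightarrow> W \<subseteq> V \<Longrightarrow> submodule (f W) R' M'"
    and "\<And>W W'. submodule W R M \<Longrightarrow> submodule W' R M \<Longrightarrow> U \<subseteq> W \<Longrightarrow> W \<subset> W' \<Longrightarrow> W' \<subseteq> V \<Longrightarrow> f W \<subset> f W'"
  shows "submodule_chain R' M' (f U) (f V) n"
  using assms
proof induct
  case refl then show ?case by (auto intro: submodule_chain.refl)
next
  case (step V n W)
  have "submodule_chain R' M' (f U) (f V) n" by (rule step.hyps(2)) (use step.prems step.hyps(4) in auto)
  moreover have "submodule (f W) R' M'"
    using step.prems(1)[of W] step.hyps submodule_chain_submodules[OF step.hyps(1)] by auto
  moreover have "f V \<subset> f W"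
    using step.prems(2)[of V W] step.hyps submodule_chain_submodules[OF step.hyps(1)] by auto
  ultimately show ?case by (rule submodule_chain.step)
qed

lemma rel_length_le_map:
  assumes "\<And>W. submodule W R M \<Longrightarrow> U \<subseteq> W \<Longrightarrow> W \<subseteq> V \<Longrightarrow> submodule (f W) R' M'"
    and "\<And>W W'. submodule W R M \<Longrightarrow> submodule W' R M \<Longrightarrow> U \<subseteq> W \<Longrightarrow> W \<subset> W' \<Longrightarrow> W' \<subseteq> V \<Longrightarrow> f W \<subset> f W'"
  shows "rel_length R M U V \<le> rel_length R' M' (f U) (f V)"
  unfolding rel_length_def
proof (intro Sup_subset_mono subsetI)
  fix l assume "l \<in> {enat n | n. submodule_chain R M U V n}"
  then obtain n where n: "l = enat n" "submodule_chain R M U V n" by blast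
  have "submodule_chain R' M' (f U) (f V) n" by (rule submodule_chain_map[OF n(2)]) (use assms in auto)
  then show "l \<in> {enat n | n. submodule_chain R' M' (f U) (f V) n}" using n(1) by blast
qed

lemma rel_length_refl: "rel_length R M U U = 0"
proof -
  have "n = 0" if "submodule_chain R M U U n" for n
    using that by (cases rule: submodule_chain.cases) (auto dest: submodule_chain_submodules(3))
  then have "enat n \<le> 0" if "submodule_chain R M U U n" for n using that by (auto simp: zero_enat_def)
  then have "rel_length R M U U \<le> 0" unfolding rel_length_def by (intro Sup_least) auto
  then show ?thesis by simp
qed

lemma chain_le_rel_length: "submodule_chain R M U V n \<Longrightarrow> enat n \<le> rel_length R M U V"
  unfolding rel_length_def by (intro Sup_upper) blast

lemma rel_length_leI: "(\<And>n. submodule_chain R M U V n \<Longrightarrow> enat n \<le> l) \<Longrightarrow> rel_length R M U V \<le> l"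
  unfolding rel_length_def by (intro Sup_least) blast

lemma rel_length_attained:
  assumes "submodule U R M" "submodule V R M" "U \<subseteq> V" "rel_length R M U V \<noteq> \<infinity>"
  obtains n where "submodule_chain R M U V n" "rel_length R M U V = enat n"
proof -
  let ?S = "{enat n | n. submodule_chain R M U V n}"
  have "submodule_chain R M U V (if U = V then 0 else Suc 0)"
    using assms submodule_chain.refl[of U R M] submodule_chain.step[of R M U U 0 V] by auto
  then have ne: "?S \<noteq> {}" by blast
  then have fin: "finite ?S" using assms(4) by (auto simp: rel_length_def Sup_enat_def split: if_splits)
  then have "rel_length R M U V = Max ?S" using ne fin unfolding rel_length_def Sup_enat_def by (simp only: if_False if_True)
  moreover have "Max ?S \<in> ?S" using Max_in[OF fin ne] .
  ultimately show ?thesis using that by auto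
qed

context module
begin

lemma modular_law:
  assumes "submodule W R M" "submodule W' R M" "submodule V R M" "W \<subseteq> W'"
    and "W \<inter> V = W' \<inter> V" "W <+>\<^bsub>M\<^esub> V = W' <+>\<^bsub>M\<^esub> V"
  shows "W = W'"
proof
  show "W' \<subseteq> W"
  proof
    fix x assume x: "x \<in> W'"
    then have "x \<in> W <+>\<^bsub>M\<^esub> V" using sum_upper(1)[OF assms(2,3)] assms(6) by blast
    then obtain w v where wv: "w \<in> W" "v \<in> V" "x = w \<oplus>\<^bsub>M\<^esub> v" by (auto simp: mem_set_add)
    have wc: "w \<in> carrier M" "v \<in> carrier M" using wv submodule_in_carrier[OF assms(2), of w] submodule_in_carrier[OF assms(3), of v] assms(4) by auto
    have "v \<oplus>\<^bsub>M\<^esub> w \<in> W'" using x wv(3) wc by (simp add: M.a_comm)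
    then have "v \<in> W'" using submodule_add_cancel[OF assms(2), of v w] wv(1) assms(4) wc by blast
    then have "v \<in> W" using assms(5) wv(2) by blast
    then show "x \<in> W" using wv submodule_add[OF assms(1)] by blast
  qed
qed (fact assms(4))

text \<open>Intersecting a chain with \<open>V\<close> and adding \<open>V\<close> to it yields two chains, and by the modular law
  every step of the given chain survives in at least one of them. Additivity of length and the
  second isomorphism theorem for lengths both come from this count.\<close>
lemma submodule_chain_split:
  assumes "submodule_chain R M U W n" and V: "submodule V R M"
  shows "\<exists>a b. n \<le> a + b \<and> submodule_chain R M (U \<inter> V) (W \<inter> V) a
    \<and> submodule_chain R M (U <+>\<^bsub>M\<^esub> V) (W <+>\<^bsub>M\<^esub> V) b"
  using assms(1)
proof induct
  case refl
  then show ?case using V by (intro exI[of _ 0]) (auto intro!: submodule_chain.refl submodule_Int submodule_sum)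
next
  case (step W n W')
  then obtain a b where ab: "n \<le> a + b" "submodule_chain R M (U \<inter> V) (W \<inter> V) a"
      "submodule_chain R M (U <+>\<^bsub>M\<^esub> V) (W <+>\<^bsub>M\<^esub> V) b" by blast
  have W: "submodule W R M" using submodule_chain_submodules[OF step.hyps(1)] by blast
  note W' = step.hyps(3)
  have i: "submodule (W' \<inter> V) R M" "W \<inter> V \<subseteq> W' \<inter> V"
    and s: "submodule (W' <+>\<^bsub>M\<^esub> V) R M"
    using submodule_Int W' V submodule_sum step.hyps(4) by auto
  have s2: "W <+>\<^bsub>M\<^esub> V \<subseteq> W' <+>\<^bsub>M\<^esub> V"
    using step.hyps(4) by (fastforce simp: mem_set_add)
  consider "W \<inter> V \<subset> W' \<inter> V" | "W <+>\<^bsub>M\<^esub> V \<subset> W' <+>\<^bsub>M\<^esub> V"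
    using modular_law[OF W W' V] i(2) s2 step.hyps(4) by blast
  then show ?case
  proof cases
    case 1
    have "submodule_chain R M (U \<inter> V) (W' \<inter> V) (Suc a)" using submodule_chain.step[OF ab(2) i(1) 1] .
    moreover have "\<exists>b'\<ge>b. submodule_chain R M (U <+>\<^bsub>M\<^esub> V) (W' <+>\<^bsub>M\<^esub> V) b'"
      using submodule_chain.step[OF ab(3) s] ab(3) s2
      by (metis le_SucI order_refl psubsetI)
    ultimately show ?thesis using ab(1) by (metis Suc_le_mono add_Suc add_le_mono le_refl order_trans)
  next
    case 2
    have "submodule_chain R M (U <+>\<^bsub>M\<^esub> V) (W' <+>\<^bsub>M\<^esub> V) (Suc b)" using submodule_chain.step[OF ab(3) s 2] .
    moreover have "\<exists>a'\<ge>a. submodule_chain R M (U \<inter> V) (W' \<inter> V) a'"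
      using submodule_chain.step[OF ab(2) i(1)] ab(2) i(2)
      by (metis le_SucI order_refl psubsetI)
    ultimately show ?thesis using ab(1) by (metis Suc_le_mono add_Suc_right add_le_mono le_refl order_trans)
  qed
qed

lemma rel_length_add:
  assumes U: "submodule U R M" and V: "submodule V R M" and W: "submodule W R M"
    and UV: "U \<subseteq> V" and VW: "V \<subseteq> W"
  shows "rel_length R M U W = rel_length R M U V + rel_length R M V W"
proof (rule antisym)
  have eq: "U \<inter> V = U" "W \<inter> V = V" "U <+>\<^bsub>M\<^esub> V = V" "W <+>\<^bsub>M\<^esub> V = W"
    using UV VW sum_upper[OF U V] sum_upper[OF W V] sum_least[OF V, of U V] sum_least[OF W, of W V] by blast+
  show "rel_length R M U W \<le> rel_length R M U V + rel_length R M V W"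
  proof (rule rel_length_leI)
    fix n assume "submodule_chain R M U W n"
    from submodule_chain_split[OF this V] obtain a b where "n \<le> a + b"
      "submodule_chain R M U V a" "submodule_chain R M V W b" unfolding eq by blast
    then have "enat n \<le> enat a + enat b" "enat a \<le> rel_length R M U V" "enat b \<le> rel_length R M V W"
      by (auto intro: chain_le_rel_length)
    then show "enat n \<le> rel_length R M U V + rel_length R M V W"
      by (meson add_mono order_trans)
  qed
  show "rel_length R M U V + rel_length R M V W \<le> rel_length R M U W"
  proof (cases "rel_length R M U W = \<infinity>")
    case False
    obtain k where k: "submodule_chain R M U V k"
      using U V UV submodule_chain.refl[of U R M] submodule_chain.step[of R M U U 0 V] by (cases "U = V") auto
    obtain l where l: "submodule_chain R M V W l"
      using W V VW submodule_chain.refl[of V R M] submodule_chain.step[of R M V V 0 W] by (cases "V = W") auto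
    have "rel_length R M U V \<le> rel_length R M U W"
    proof (rule rel_length_leI)
      fix n assume "submodule_chain R M U V n"
      from chain_le_rel_length[OF submodule_chain_trans[OF l this]]
      show "enat n \<le> rel_length R M U W" by (metis enat_ord_simps(1) le_add1 order_trans)
    qed
    moreover have "rel_length R M V W \<le> rel_length R M U W"
    proof (rule rel_length_leI)
      fix n assume "submodule_chain R M V W n"
      from chain_le_rel_length[OF submodule_chain_trans[OF this k]]
      show "enat n \<le> rel_length R M U W" by (metis enat_ord_simps(1) le_add2 order_trans)
    qed
    ultimately have "rel_length R M U V \<noteq> \<infinity>" "rel_length R M V W \<noteq> \<infinity>" using False by (metis enat_ord_simps(5))+
    then obtain a b where a: "submodule_chain R M U V a" "rel_length R M U V = enat a"
      and b: "submodule_chain R M V W b" "rel_length R M V W = enat b"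
      using rel_length_attained[OF U V UV] rel_length_attained[OF V W VW] by metis
    show ?thesis using chain_le_rel_length[OF submodule_chain_trans[OF b(1) a(1)]] a b by simp
  qed simp
qed

lemma rel_length_mono:
  assumes "submodule U R M" "submodule U' R M" "submodule V' R M" "submodule V R M"
    "U \<subseteq> U'" "U' \<subseteq> V'" "V' \<subseteq> V"
  shows "rel_length R M U' V' \<le> rel_length R M U V"
proof -
  have "rel_length R M U V = rel_length R M U U' + (rel_length R M U' V' + rel_length R M V' V)"
    using rel_length_add[of U U' V] rel_length_add[of U' V' V] assms by auto
  then show ?thesis by (metis add.left_commute le_iff_add)
qed

text \<open>The isomorphism \<open>B / (A \<inter> B) \<cong> (A + B) / A\<close>: splitting a chain by \<open>A\<close> or by \<open>B\<close> leaves a chain on one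
  side only, because the other interval is trivial.\<close>
lemma rel_length_Int_sum:
  assumes A: "submodule A R M" and B: "submodule B R M"
  shows "rel_length R M (A \<inter> B) B = rel_length R M A (A <+>\<^bsub>M\<^esub> B)"
proof -
  have S: "submodule (A <+>\<^bsub>M\<^esub> B) R M" "A \<subseteq> A <+>\<^bsub>M\<^esub> B" "B \<subseteq> A <+>\<^bsub>M\<^esub> B"
    using submodule_sum A B sum_upper[OF A B] by auto
  have I: "submodule (A \<inter> B) R M" by (rule submodule_Int[OF A B])
  have e1: "(A <+>\<^bsub>M\<^esub> B) <+>\<^bsub>M\<^esub> B = A <+>\<^bsub>M\<^esub> B" "A \<inter> B <+>\<^bsub>M\<^esub> A = A"
    using sum_upper[OF S(1) B] sum_least[OF S(1) _ S(3)] sum_upper[OF I A] sum_least[OF A, of "A \<inter> B" A] by blast+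
  have e2: "B <+>\<^bsub>M\<^esub> A = A <+>\<^bsub>M\<^esub> B"
    using sum_upper[OF A B] sum_upper[OF B A] sum_least[OF S(1), of B A]
      sum_least[OF submodule_sum[OF B A], of A B] by blast
  have triv: "b = 0" if "submodule_chain R M X X b" for X b
    using chain_le_rel_length[OF that] by (simp add: rel_length_refl zero_enat_def)
  show ?thesis
  proof (rule antisym; rule rel_length_leI)
    fix n assume "submodule_chain R M (A \<inter> B) B n"
    from submodule_chain_split[OF this A] obtain a b where "n \<le> a + b"
      "submodule_chain R M (A \<inter> B \<inter> A) (B \<inter> A) a" "submodule_chain R M A (A <+>\<^bsub>M\<^esub> B) b"
      unfolding e1 e2 by blast
    moreover have "A \<inter> B \<inter> A = B \<inter> A" by blast
    ultimately show "enat n \<le> rel_length R M A (A <+>\<^bsub>M\<^esub> B)"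
      using triv[of "B \<inter> A" a] chain_le_rel_length[of R M A _ b] by (auto simp flip: enat_ord_simps(1) intro: order_trans)
  next
    fix n assume "submodule_chain R M A (A <+>\<^bsub>M\<^esub> B) n"
    from submodule_chain_split[OF this B] obtain a b where "n \<le> a + b"
      "submodule_chain R M (A \<inter> B) ((A <+>\<^bsub>M\<^esub> B) \<inter> B) a" "submodule_chain R M (A <+>\<^bsub>M\<^esub> B) (A <+>\<^bsub>M\<^esub> B) b"
      unfolding e1 by blast
    moreover have "(A <+>\<^bsub>M\<^esub> B) \<inter> B = B" using S(3) by blast
    ultimately show "enat n \<le> rel_length R M (A \<inter> B) B"
      using triv[of "A <+>\<^bsub>M\<^esub> B" b] chain_le_rel_length[of R M "A \<inter> B" B a] by (auto simp flip: enat_ord_simps(1) intro: order_trans)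
  qed
qed

text \<open>A linear map \<open>\<phi>\<close> identifies the submodules between the preimage of \<open>B\<close> and \<open>V\<close> with those
  between \<open>B\<close> and \<open>B + \<phi> V\<close>.\<close>
lemma rel_length_linear:
  assumes N: "module R N" and V: "submodule V R M" and lin: "linear_on R M N V \<phi>"
    and B: "submodule B R N"
  shows "rel_length R M {v \<in> V. \<phi> v \<in> B} V = rel_length R N B (B <+>\<^bsub>N\<^esub> \<phi> ` V)"
proof (rule antisym)
  interpret N: module R N by fact
  let ?K = "{v \<in> V. \<phi> v \<in> B}"
  have lin': "linear_on R M N W \<phi>" if "W \<subseteq> V" for W using lin that unfolding linear_on_def by blast
  have im: "submodule (\<phi> ` W) R N" if "submodule W R M" "W \<subseteq> V" for W
    by (rule submodule_image[OF N that(1) lin'[OF that(2)]])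
  have add: "\<phi> (x \<oplus>\<^bsub>M\<^esub> y) = \<phi> x \<oplus>\<^bsub>N\<^esub> \<phi> y" "\<phi> x \<in> carrier N" if "x \<in> V" "y \<in> V" for x y
    using lin that by (auto simp: linear_on_def)
  have diff: "\<phi> (x \<ominus>\<^bsub>M\<^esub> y) = \<phi> x \<ominus>\<^bsub>N\<^esub> \<phi> y" if "x \<in> V" "y \<in> V" for x y
    using linear_on_neg(1)[OF N V lin that(2)] add(1)[OF that(1) submodule_neg[OF V that(2)]]
    by (simp add: a_minus_def)
  have B0: "B <+>\<^bsub>N\<^esub> \<phi> ` ?K = B"
    using N.sum_upper(1)[OF B im[OF submodule_preimage[OF N V lin B]]] N.sum_least[OF B, of B "\<phi> ` ?K"] by blast
  have "rel_length R M ?K V \<le> rel_length R N (B <+>\<^bsub>N\<^esub> \<phi> ` ?K) (B <+>\<^bsub>N\<^esub> \<phi> ` V)"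
  proof (rule rel_length_le_map)
    fix W assume "submodule W R M" "?K \<subseteq> W" "W \<subseteq> V"
    then show "submodule (B <+>\<^bsub>N\<^esub> \<phi> ` W) R N" using N.submodule_sum[OF B im] by blast
  next
    fix W W' assume W: "submodule W R M" and W': "submodule W' R M" and K: "?K \<subseteq> W" and s: "W \<subset> W'" and le: "W' \<subseteq> V"
    from s obtain w where w: "w \<in> W'" "w \<notin> W" by blast
    have wV: "w \<in> V" using w le by blast
    have "\<phi> w \<notin> B <+>\<^bsub>N\<^esub> \<phi> ` W"
    proof
      assume "\<phi> w \<in> B <+>\<^bsub>N\<^esub> \<phi> ` W"
      then obtain b u where bu: "b \<in> B" "u \<in> W" "\<phi> w = b \<oplus>\<^bsub>N\<^esub> \<phi> u" by (auto simp: mem_set_add)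
      have uV: "u \<in> V" using bu s le by blast
      have bc: "b \<in> carrier N" using submodule_in_carrier[OF B bu(1)] .
      have "\<phi> (w \<ominus>\<^bsub>M\<^esub> u) = b" using diff[OF wV uV] bu(3) N.a_diff_cancel[OF bc] add(2)[OF uV uV] by simp
      moreover have "w \<ominus>\<^bsub>M\<^esub> u \<in> V" using submodule_minus[OF V wV uV] .
      ultimately have "w \<ominus>\<^bsub>M\<^esub> u \<in> W" using K bu(1) by blast
      then have "(w \<ominus>\<^bsub>M\<^esub> u) \<oplus>\<^bsub>M\<^esub> u \<in> W" using bu(2) submodule_add[OF W] by blast
      moreover have "(w \<ominus>\<^bsub>M\<^esub> u) \<oplus>\<^bsub>M\<^esub> u = w"
        using submodule_in_carrier[OF V] wV uV by (simp add: a_minus_def M.a_assoc M.l_neg)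
      ultimately show False using w(2) by simp
    qed
    moreover have "\<phi> w \<in> B <+>\<^bsub>N\<^esub> \<phi> ` W'"
      using N.sum_upper(2)[OF B im[OF W' le]] w(1) by blast
    moreover have "B <+>\<^bsub>N\<^esub> \<phi> ` W \<subseteq> B <+>\<^bsub>N\<^esub> \<phi> ` W'" using s by (fastforce simp: mem_set_add)
    ultimately show "B <+>\<^bsub>N\<^esub> \<phi> ` W \<subset> B <+>\<^bsub>N\<^esub> \<phi> ` W'" by blast
  qed
  then show "rel_length R M ?K V \<le> rel_length R N B (B <+>\<^bsub>N\<^esub> \<phi> ` V)" unfolding B0 .
  have top: "{v \<in> V. \<phi> v \<in> B <+>\<^bsub>N\<^esub> \<phi> ` V} = V"
    using N.sum_upper(2)[OF B im[OF V]] by blast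
  have "rel_length R N B (B <+>\<^bsub>N\<^esub> \<phi> ` V) \<le> rel_length R M {v \<in> V. \<phi> v \<in> B} {v \<in> V. \<phi> v \<in> B <+>\<^bsub>N\<^esub> \<phi> ` V}"
  proof (rule rel_length_le_map)
    fix W assume "submodule W R N"
    then show "submodule {v \<in> V. \<phi> v \<in> W} R M" by (rule submodule_preimage[OF N V lin])
  next
    fix W W' assume W: "submodule W R N" and W': "submodule W' R N" and BW: "B \<subseteq> W"
      and s: "W \<subset> W'" and le: "W' \<subseteq> B <+>\<^bsub>N\<^esub> \<phi> ` V"
    from s obtain w where w: "w \<in> W'" "w \<notin> W" by blast
    then obtain b v where bv: "b \<in> B" "v \<in> V" "w = b \<oplus>\<^bsub>N\<^esub> \<phi> v" using le by (auto simp: mem_set_add subset_iff)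
    have c: "b \<in> carrier N" "\<phi> v \<in> carrier N" using submodule_in_carrier[OF B bv(1)] add(2)[OF bv(2) bv(2)] by auto
    have "\<phi> v \<notin> W" using w(2) bv BW submodule_add[OF W] by blast
    moreover have "\<phi> v \<in> W'"
      using N.submodule_add_cancel[OF W', of "\<phi> v" b] w(1) bv BW s c by (auto simp: N.a_comm)
    ultimately show "{v \<in> V. \<phi> v \<in> W} \<subset> {v \<in> V. \<phi> v \<in> W'}" using bv(2) s by blast
  qed
  then show "rel_length R N B (B <+>\<^bsub>N\<^esub> \<phi> ` V) \<le> rel_length R M ?K V" unfolding top .
qed

end


section \<open>Families of submodules and the Hilbert basis theorem\<close>

text \<open>A graded submodule of \<open>\<Oplus> V n / D n\<close> over \<open>R[x t | x \<in> X]\<close> is recorded as the sequence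
  of its homogeneous parts, pulled back to \<open>M\<close>: a sequence of submodules between \<open>D\<close> and \<open>V\<close> such
  that multiplication by each \<open>x \<in> X\<close> raises the index by one. The Rees module and the associated
  graded module of a filtration are thereby treated inside \<open>M\<close>.\<close>
definition shift_closed ::
    "('a, 'b, 'd) module_scheme \<Rightarrow> 'a set \<Rightarrow> (nat \<Rightarrow> 'b set) \<Rightarrow> bool" where
  "shift_closed M X U \<longleftrightarrow> (\<forall>x\<in>X. \<forall>n. \<forall>u\<in>U n. x \<odot>\<^bsub>M\<^esub> u \<in> U (Suc n))"

definition graded_family ::
    "('a, 'c) ring_scheme \<Rightarrow> ('a, 'b, 'd) module_scheme \<Rightarrow> 'a set \<Rightarrow> (nat \<Rightarrow> 'b set)
      \<Rightarrow> (nat \<Rightarrow> 'b set) \<Rightarrow> (nat \<Rightarrow> 'b set) \<Rightarrow> bool" where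
  "graded_family R M X D V U \<longleftrightarrow>
    (\<forall>n. submodule (U n) R M \<and> D n \<subseteq> U n \<and> U n \<subseteq> V n) \<and> shift_closed M X U"

lemma shift_closedD: "shift_closed M X U \<Longrightarrow> x \<in> X \<Longrightarrow> u \<in> U n \<Longrightarrow> x \<odot>\<^bsub>M\<^esub> u \<in> U (Suc n)"
  unfolding shift_closed_def by blast

context module
begin

text \<open>The sums \<open>d + \<Sum>\<^sub>j x\<^sup>j e\<^sub>j\<close> of degree \<open>n\<close>, taken over \<open>j < i\<close>, with \<open>d \<in> D n\<close> and \<open>e\<^sub>j \<in> E (n - j)\<close>:
  what a graded module \<open>E\<close> generates under the new operator \<open>x\<close> in \<open>x\<close>-degree less than \<open>i\<close>.\<close>
primrec poly_part :: "'a \<Rightarrow> (nat \<Rightarrow> 'c set) \<Rightarrow> (nat \<Rightarrow> 'c set) \<Rightarrow> nat \<Rightarrow> nat \<Rightarrow> 'c set" where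
  "poly_part x D E 0 n = D n"
| "poly_part x D E (Suc i) n = (if i \<le> n
    then poly_part x D E i n <+>\<^bsub>M\<^esub> (\<lambda>e. (x [^] i) \<odot>\<^bsub>M\<^esub> e) ` E (n - i)
    else poly_part x D E i n)"

context
  fixes X :: "'a set" and x :: 'a and D E :: "nat \<Rightarrow> 'c set"
  assumes X: "X \<subseteq> carrier R" and x: "x \<in> carrier R"
    and D: "\<And>n. submodule (D n) R M" and E: "\<And>n. submodule (E n) R M"
    and DE: "\<And>n. D n \<subseteq> E n"
    and DX: "shift_closed M (insert x X) D" and EX: "shift_closed M X E"
begin

lemma poly_part_submodule: "submodule (poly_part x D E i n) R M"
proof (induct i)
  case (Suc i)
  have "submodule ((\<lambda>e. (x [^] i) \<odot>\<^bsub>M\<^esub> e) ` E (n - i)) R M" by (intro submodule_smult_image E) (use x in auto)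
  then show ?case using Suc by (auto intro: submodule_sum)
qed (simp add: D)

lemma poly_part_pow_image: "submodule ((\<lambda>e. (x [^] (i::nat)) \<odot>\<^bsub>M\<^esub> e) ` E n) R M"
  by (intro submodule_smult_image E) (use x in auto)

lemma poly_part_Suc_upper: "poly_part x D E i n \<subseteq> poly_part x D E (Suc i) n"
  using sum_upper(1)[OF poly_part_submodule[of i n] poly_part_pow_image[of i "n - i"]] by simp

lemma poly_part_mono: "i \<le> j \<Longrightarrow> poly_part x D E i n \<subseteq> poly_part x D E j n"
  by (induct rule: dec_induct) (use poly_part_Suc_upper in blast)+

lemma poly_part_monom:
  assumes "e \<in> E n" shows "(x [^] i) \<odot>\<^bsub>M\<^esub> e \<in> poly_part x D E (Suc i) (n + i)"
proof -
  have "(\<lambda>e. (x [^] i) \<odot>\<^bsub>M\<^esub> e) ` E n \<subseteq> poly_part x D E (Suc i) (n + i)"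
    using sum_upper(2)[OF poly_part_submodule[of i "n + i"] poly_part_pow_image[of i n]] by simp
  then show ?thesis using assms by blast
qed

lemma poly_part_cases:
  assumes "v \<in> poly_part x D E (Suc i) n"
  obtains "v \<in> poly_part x D E i n"
    | w e where "i \<le> n" "w \<in> poly_part x D E i n" "e \<in> E (n - i)" "v = w \<oplus>\<^bsub>M\<^esub> (x [^] i) \<odot>\<^bsub>M\<^esub> e"
  using assms by (auto simp: mem_set_add split: if_splits)

lemma pow_Suc_smult: "e \<in> carrier M \<Longrightarrow> x \<odot>\<^bsub>M\<^esub> ((x [^] i) \<odot>\<^bsub>M\<^esub> e) = (x [^] Suc i) \<odot>\<^bsub>M\<^esub> e"
  using x smult_assoc1[of x "x [^] i" e] R.m_comm[of x "x [^] i"] by simp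

lemma poly_part_shift_x:
  "v \<in> poly_part x D E i n \<Longrightarrow> x \<odot>\<^bsub>M\<^esub> v \<in> poly_part x D E (Suc i) (Suc n)"
proof (induct i arbitrary: v)
  case 0
  then have "x \<odot>\<^bsub>M\<^esub> v \<in> D (Suc n)" using shift_closedD[OF DX, of x v n] by simp
  then show ?case using poly_part_Suc_upper[of 0 "Suc n"] by auto
next
  case (Suc i)
  from Suc.prems show ?case
  proof (cases rule: poly_part_cases)
    case 1 then show ?thesis using Suc.hyps poly_part_Suc_upper by blast
  next
    case (2 w e)
    have c: "w \<in> carrier M" "e \<in> carrier M"
      using submodule_in_carrier[OF poly_part_submodule 2(2)] submodule_in_carrier[OF E 2(3)] by auto
    have "x \<odot>\<^bsub>M\<^esub> v = x \<odot>\<^bsub>M\<^esub> w \<oplus>\<^bsub>M\<^esub> (x [^] Suc i) \<odot>\<^bsub>M\<^esub> e"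
      using 2(4) c x pow_Suc_smult[OF c(2), of i] by (simp add: smult_r_distr)
    moreover have "(x [^] Suc i) \<odot>\<^bsub>M\<^esub> e \<in> poly_part x D E (Suc (Suc i)) (Suc n)"
      using poly_part_monom[OF 2(3), of "Suc i"] 2(1) by simp
    moreover have "x \<odot>\<^bsub>M\<^esub> w \<in> poly_part x D E (Suc (Suc i)) (Suc n)"
      using Suc.hyps[OF 2(2)] poly_part_Suc_upper by blast
    ultimately show ?thesis using submodule_add[OF poly_part_submodule] by metis
  qed
qed

lemma poly_part_shift:
  assumes y: "y \<in> X"
  shows "v \<in> poly_part x D E i n \<Longrightarrow> y \<odot>\<^bsub>M\<^esub> v \<in> poly_part x D E i (Suc n)"
proof (induct i arbitrary: v)
  case 0
  then show ?case using shift_closedD[OF DX, of y v n] y by simp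
next
  case (Suc i)
  have yc: "y \<in> carrier R" using y X by blast
  from Suc.prems show ?case
  proof (cases rule: poly_part_cases)
    case 1 then show ?thesis using Suc.hyps poly_part_Suc_upper by blast
  next
    case (2 w e)
    have c: "w \<in> carrier M" "e \<in> carrier M"
      using submodule_in_carrier[OF poly_part_submodule 2(2)] submodule_in_carrier[OF E 2(3)] by auto
    have "y \<odot>\<^bsub>M\<^esub> v = y \<odot>\<^bsub>M\<^esub> w \<oplus>\<^bsub>M\<^esub> (x [^] i) \<odot>\<^bsub>M\<^esub> (y \<odot>\<^bsub>M\<^esub> e)"
      using 2(4) c x yc smult_comm[of y "x [^] i" e] by (simp add: smult_r_distr)
    moreover have "(x [^] i) \<odot>\<^bsub>M\<^esub> (y \<odot>\<^bsub>M\<^esub> e) \<in> poly_part x D E (Suc i) (Suc n)"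
      using poly_part_monom[OF shift_closedD[OF EX y 2(3)], of i] 2(1) by simp
    moreover have "y \<odot>\<^bsub>M\<^esub> w \<in> poly_part x D E (Suc i) (Suc n)"
      using Suc.hyps[OF 2(2)] poly_part_Suc_upper by blast
    ultimately show ?thesis using submodule_add[OF poly_part_submodule] by metis
  qed
qed

text \<open>The coefficients of \<open>x\<^sup>i\<close> in those elements of \<open>U\<close> whose \<open>x\<close>-degree is at most \<open>i\<close>.\<close>
definition lead_part :: "(nat \<Rightarrow> 'c set) \<Rightarrow> nat \<Rightarrow> nat \<Rightarrow> 'c set" where
  "lead_part U i n =
    {e \<in> E n. \<exists>w\<in>poly_part x D E i (n + i). w \<oplus>\<^bsub>M\<^esub> (x [^] i) \<odot>\<^bsub>M\<^esub> e \<in> U (n + i)}"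

abbreviation "poly_family \<equiv> \<lambda>n. poly_part x D E (Suc n) n"

lemma lead_part_family:
  assumes U: "graded_family R M (insert x X) D poly_family U"
  shows "graded_family R M X D E (lead_part U i)"
  unfolding graded_family_def
proof (intro conjI allI)
  have Usub: "submodule (U n) R M" "D n \<subseteq> U n" for n using U by (auto simp: graded_family_def)
  have Ush: "shift_closed M (insert x X) U" using U by (auto simp: graded_family_def)
  have pc: "x [^] i \<in> carrier R" using x by simp
  note P = poly_part_submodule[of i]
  fix n
  note Ec = submodule_in_carrier[OF E[of n]] and Pc = submodule_in_carrier[OF P[of "n + i"]]
  show "submodule (lead_part U i n) R M"
  proof (rule submoduleI)
    show "lead_part U i n \<subseteq> carrier M" using Ec unfolding lead_part_def by blast
    have "\<zero>\<^bsub>M\<^esub> \<oplus>\<^bsub>M\<^esub> (x [^] i) \<odot>\<^bsub>M\<^esub> \<zero>\<^bsub>M\<^esub> \<in> U (n + i)" using submodule_zero[OF Usub(1)] pc by simp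
    then show "\<zero>\<^bsub>M\<^esub> \<in> lead_part U i n"
      unfolding lead_part_def using submodule_zero[OF E] submodule_zero[OF P] by blast
  next
    fix a assume "a \<in> lead_part U i n"
    then obtain w where a: "a \<in> E n" and w: "w \<in> poly_part x D E i (n + i)"
      "w \<oplus>\<^bsub>M\<^esub> (x [^] i) \<odot>\<^bsub>M\<^esub> a \<in> U (n + i)" unfolding lead_part_def by blast
    have "\<ominus>\<^bsub>M\<^esub> (w \<oplus>\<^bsub>M\<^esub> (x [^] i) \<odot>\<^bsub>M\<^esub> a) = (\<ominus>\<^bsub>M\<^esub> w) \<oplus>\<^bsub>M\<^esub> (x [^] i) \<odot>\<^bsub>M\<^esub> (\<ominus>\<^bsub>M\<^esub> a)"
      using Ec[OF a] Pc[OF w(1)] pc by (simp add: M.minus_add smult_r_minus)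
    then have "(\<ominus>\<^bsub>M\<^esub> w) \<oplus>\<^bsub>M\<^esub> (x [^] i) \<odot>\<^bsub>M\<^esub> (\<ominus>\<^bsub>M\<^esub> a) \<in> U (n + i)"
      using submodule_neg[OF Usub(1) w(2)] by simp
    then show "\<ominus>\<^bsub>M\<^esub> a \<in> lead_part U i n"
      unfolding lead_part_def using submodule_neg[OF E a] submodule_neg[OF P w(1)] by blast
    fix b assume "b \<in> lead_part U i n"
    then obtain w' where b: "b \<in> E n" and w': "w' \<in> poly_part x D E i (n + i)"
      "w' \<oplus>\<^bsub>M\<^esub> (x [^] i) \<odot>\<^bsub>M\<^esub> b \<in> U (n + i)" unfolding lead_part_def by blast
    have "(w \<oplus>\<^bsub>M\<^esub> (x [^] i) \<odot>\<^bsub>M\<^esub> a) \<oplus>\<^bsub>M\<^esub> (w' \<oplus>\<^bsub>M\<^esub> (x [^] i) \<odot>\<^bsub>M\<^esub> b)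
        = (w \<oplus>\<^bsub>M\<^esub> w') \<oplus>\<^bsub>M\<^esub> (x [^] i) \<odot>\<^bsub>M\<^esub> (a \<oplus>\<^bsub>M\<^esub> b)"
      using Ec[OF a] Pc[OF w(1)] Ec[OF b] Pc[OF w'(1)] pc by (simp add: M.a_ac smult_r_distr)
    then have "(w \<oplus>\<^bsub>M\<^esub> w') \<oplus>\<^bsub>M\<^esub> (x [^] i) \<odot>\<^bsub>M\<^esub> (a \<oplus>\<^bsub>M\<^esub> b) \<in> U (n + i)"
      using submodule_add[OF Usub(1) w(2) w'(2)] by simp
    then show "a \<oplus>\<^bsub>M\<^esub> b \<in> lead_part U i n"
      unfolding lead_part_def using submodule_add[OF E a b] submodule_add[OF P w(1) w'(1)] by blast
  next
    fix r a assume r: "r \<in> carrier R" and "a \<in> lead_part U i n"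
    then obtain w where a: "a \<in> E n" and w: "w \<in> poly_part x D E i (n + i)"
      "w \<oplus>\<^bsub>M\<^esub> (x [^] i) \<odot>\<^bsub>M\<^esub> a \<in> U (n + i)" unfolding lead_part_def by blast
    have "r \<odot>\<^bsub>M\<^esub> (w \<oplus>\<^bsub>M\<^esub> (x [^] i) \<odot>\<^bsub>M\<^esub> a) = r \<odot>\<^bsub>M\<^esub> w \<oplus>\<^bsub>M\<^esub> (x [^] i) \<odot>\<^bsub>M\<^esub> (r \<odot>\<^bsub>M\<^esub> a)"
      using Ec[OF a] Pc[OF w(1)] pc r smult_comm[of r "x [^] i" a] by (simp add: smult_r_distr)
    then have "r \<odot>\<^bsub>M\<^esub> w \<oplus>\<^bsub>M\<^esub> (x [^] i) \<odot>\<^bsub>M\<^esub> (r \<odot>\<^bsub>M\<^esub> a) \<in> U (n + i)"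
      using submodule_smult[OF Usub(1) r w(2)] by simp
    then show "r \<odot>\<^bsub>M\<^esub> a \<in> lead_part U i n"
      unfolding lead_part_def using submodule_smult[OF E r a] submodule_smult[OF P r w(1)] by blast
  qed
  show "lead_part U i n \<subseteq> E n" unfolding lead_part_def by blast
  show "D n \<subseteq> lead_part U i n"
  proof
    fix d assume d: "d \<in> D n"
    have "(x [^] j) \<odot>\<^bsub>M\<^esub> d \<in> D (n + j)" for j
    proof (induct j)
      case (Suc j)
      then show ?case using shift_closedD[OF DX _ Suc, of x] pow_Suc_smult[OF submodule_in_carrier[OF D d]] by simp
    qed (use d submodule_in_carrier[OF D d] in simp)
    then have "\<zero>\<^bsub>M\<^esub> \<oplus>\<^bsub>M\<^esub> (x [^] i) \<odot>\<^bsub>M\<^esub> d \<in> U (n + i)"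
      using Usub(2)[of "n + i"] submodule_in_carrier[OF D d] pc by auto
    then show "d \<in> lead_part U i n" unfolding lead_part_def using d DE submodule_zero[OF P] by blast
  qed
next
  have Ush: "shift_closed M (insert x X) U" using U by (auto simp: graded_family_def)
  have pc: "x [^] i \<in> carrier R" using x by simp
  show "shift_closed M X (lead_part U i)" unfolding shift_closed_def
  proof (intro ballI allI)
    fix y n a assume y: "y \<in> X" and "a \<in> lead_part U i n"
    then obtain w where a: "a \<in> E n" and w: "w \<in> poly_part x D E i (n + i)"
      "w \<oplus>\<^bsub>M\<^esub> (x [^] i) \<odot>\<^bsub>M\<^esub> a \<in> U (n + i)" unfolding lead_part_def by blast
    have yc: "y \<in> carrier R" using y X by blast
    have "y \<odot>\<^bsub>M\<^esub> (w \<oplus>\<^bsub>M\<^esub> (x [^] i) \<odot>\<^bsub>M\<^esub> a) = y \<odot>\<^bsub>M\<^esub> w \<oplus>\<^bsub>M\<^esub> (x [^] i) \<odot>\<^bsub>M\<^esub> (y \<odot>\<^bsub>M\<^esub> a)"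
      using submodule_in_carrier[OF E a] submodule_in_carrier[OF poly_part_submodule w(1)] pc yc
        smult_comm[of y "x [^] i" a] by (simp add: smult_r_distr)
    then have "y \<odot>\<^bsub>M\<^esub> w \<oplus>\<^bsub>M\<^esub> (x [^] i) \<odot>\<^bsub>M\<^esub> (y \<odot>\<^bsub>M\<^esub> a) \<in> U (Suc n + i)"
      using shift_closedD[OF Ush _ w(2), of y] y by simp
    then show "y \<odot>\<^bsub>M\<^esub> a \<in> lead_part U i (Suc n)"
      unfolding lead_part_def using shift_closedD[OF EX y a] poly_part_shift[OF y w(1)] by auto
  qed
qed

lemma lead_part_ascending:
  assumes U: "graded_family R M (insert x X) D poly_family U"
  shows "lead_part U i n \<subseteq> lead_part U (Suc i) n"
proof
  have Ush: "shift_closed M (insert x X) U" using U by (auto simp: graded_family_def)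
  fix a assume "a \<in> lead_part U i n"
  then obtain w where a: "a \<in> E n" and w: "w \<in> poly_part x D E i (n + i)"
    "w \<oplus>\<^bsub>M\<^esub> (x [^] i) \<odot>\<^bsub>M\<^esub> a \<in> U (n + i)" unfolding lead_part_def by blast
  have "x \<odot>\<^bsub>M\<^esub> (w \<oplus>\<^bsub>M\<^esub> (x [^] i) \<odot>\<^bsub>M\<^esub> a) = x \<odot>\<^bsub>M\<^esub> w \<oplus>\<^bsub>M\<^esub> (x [^] Suc i) \<odot>\<^bsub>M\<^esub> a"
    using submodule_in_carrier[OF E a] submodule_in_carrier[OF poly_part_submodule w(1)] x
      pow_Suc_smult[of a i] by (simp add: smult_r_distr)
  then have "x \<odot>\<^bsub>M\<^esub> w \<oplus>\<^bsub>M\<^esub> (x [^] Suc i) \<odot>\<^bsub>M\<^esub> a \<in> U (n + Suc i)"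
    using shift_closedD[OF Ush _ w(2), of x] by simp
  then show "a \<in> lead_part U (Suc i) n"
    unfolding lead_part_def using a poly_part_shift_x[OF w(1)] by auto
qed

text \<open>The induction step of Hilbert's basis theorem, in graded form: a graded submodule \<open>U\<close> of the
  family of all sums \<open>\<Sum>\<^sub>j x\<^sup>j e\<^sub>j\<close> is compared with its parts \<open>lead_part U i\<close> of
  leading coefficients of \<open>x\<^sup>i\<close>. If \<open>U \<le> U'\<close> have the same leading coefficients in every
  \<open>x\<close>-degree, an element of \<open>U'\<close> can be reduced to lower and lower \<open>x\<close>-degree by subtracting elements
  of \<open>U\<close>, hence belongs to \<open>U\<close>.\<close>
lemma hilbert_basis_step:
  assumes acc: "asc_chain_cond (graded_family R M X D E)"
  shows "asc_chain_cond (graded_family R M (insert x X) D poly_family)"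
proof (rule asc_chain_cond_transfer_double[OF acc, of _ "\<lambda>i U. lead_part U i"])
  show "graded_family R M X D E (lead_part U i)"
    if "graded_family R M (insert x X) D poly_family U" for U i
    using lead_part_family[OF that] .
  show "lead_part U i \<le> lead_part U (Suc i)"
    if "graded_family R M (insert x X) D poly_family U" for U i
    using lead_part_ascending[OF that] by (simp add: le_fun_def)
  show "lead_part U i \<le> lead_part U' i" if "U \<le> U'" for U U' i
    using that unfolding lead_part_def le_fun_def by blast
  fix U U'
  assume U: "graded_family R M (insert x X) D poly_family U"
    and U': "graded_family R M (insert x X) D poly_family U'"
    and le: "U \<le> U'" and eq: "\<And>i. lead_part U i = lead_part U' i"
  have Us: "submodule (U n) R M" "D n \<subseteq> U n" and Us': "submodule (U' n) R M" "U' n \<subseteq> poly_part x D E (Suc n) n"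
    and le': "U n \<subseteq> U' n" for n
    using U U' le by (auto simp: graded_family_def le_fun_def)
  have "v \<in> U n" if "v \<in> U' n" "v \<in> poly_part x D E i n" for v i n
    using that
  proof (induct i arbitrary: v)
    case 0 then show ?case using Us(2) by auto
  next
    case (Suc i)
    from Suc.prems(2) show ?case
    proof (cases rule: poly_part_cases)
      case 1 then show ?thesis using Suc by blast
    next
      case (2 w e)
      have "e \<in> lead_part U' i (n - i)" unfolding lead_part_def
        using 2 Suc.prems(1) by auto
      then have "e \<in> lead_part U i (n - i)" using eq by simp
      then obtain w' where w': "w' \<in> poly_part x D E i n" "w' \<oplus>\<^bsub>M\<^esub> (x [^] i) \<odot>\<^bsub>M\<^esub> e \<in> U n"
        unfolding lead_part_def using 2(1) by auto
      have c: "w \<in> carrier M" "w' \<in> carrier M" "(x [^] i) \<odot>\<^bsub>M\<^esub> e \<in> carrier M"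
        using submodule_in_carrier[OF poly_part_submodule 2(2)] submodule_in_carrier[OF poly_part_submodule w'(1)]
          submodule_in_carrier[OF E 2(3)] x by auto
      have d: "v \<ominus>\<^bsub>M\<^esub> (w' \<oplus>\<^bsub>M\<^esub> (x [^] i) \<odot>\<^bsub>M\<^esub> e) = w \<ominus>\<^bsub>M\<^esub> w'"
      proof -
        have "v \<ominus>\<^bsub>M\<^esub> (w' \<oplus>\<^bsub>M\<^esub> (x [^] i) \<odot>\<^bsub>M\<^esub> e) = (w \<oplus>\<^bsub>M\<^esub> \<ominus>\<^bsub>M\<^esub> w') \<oplus>\<^bsub>M\<^esub> ((x [^] i) \<odot>\<^bsub>M\<^esub> e \<oplus>\<^bsub>M\<^esub> \<ominus>\<^bsub>M\<^esub> ((x [^] i) \<odot>\<^bsub>M\<^esub> e))"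
          unfolding 2(4) a_minus_def using c by (simp add: M.minus_add M.a_ac)
        then show ?thesis using c by (simp add: M.r_neg a_minus_def)
      qed
      have "v \<ominus>\<^bsub>M\<^esub> (w' \<oplus>\<^bsub>M\<^esub> (x [^] i) \<odot>\<^bsub>M\<^esub> e) \<in> U n"
      proof (rule Suc.hyps)
        show "v \<ominus>\<^bsub>M\<^esub> (w' \<oplus>\<^bsub>M\<^esub> (x [^] i) \<odot>\<^bsub>M\<^esub> e) \<in> U' n"
          using submodule_minus[OF Us'(1) Suc.prems(1)] w'(2) le' by blast
        show "v \<ominus>\<^bsub>M\<^esub> (w' \<oplus>\<^bsub>M\<^esub> (x [^] i) \<odot>\<^bsub>M\<^esub> e) \<in> poly_part x D E i n"
          unfolding d by (rule submodule_minus[OF poly_part_submodule 2(2) w'(1)])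
      qed
      then show ?thesis
        using submodule_add_cancel[OF Us(1), of v "\<ominus>\<^bsub>M\<^esub> (w' \<oplus>\<^bsub>M\<^esub> (x [^] i) \<odot>\<^bsub>M\<^esub> e)"]
          submodule_neg[OF Us(1) w'(2)] submodule_in_carrier[OF Us'(1) Suc.prems(1)] by (simp add: a_minus_def)
    qed
  qed
  then have "U' n \<subseteq> U n" for n using Us'(2) by blast
  then show "U = U'" using le' by (intro ext) blast
qed

end

text \<open>A family that is \<open>V\<close> up to index \<open>N\<close> and \<open>D\<close> afterwards has only finitely many nontrivial entries, hence is
  Noetherian over no operators at all; the operators in \<open>X\<close> are then adjoined one by one.\<close>
lemma hilbert_basis_exists:
  assumes "finite X" "X \<subseteq> carrier R" and noeth: "noeth_module R M"
    and D: "\<And>n. submodule (D n) R M" and DX: "shift_closed M X D"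
    and V: "\<And>n. submodule (V n) R M" and DV: "\<And>n. D n \<subseteq> V n"
  shows "\<exists>E. (\<forall>n. submodule (E n) R M \<and> D n \<subseteq> E n \<and> (n \<le> N \<longrightarrow> V n \<subseteq> E n)) \<and>
    shift_closed M X E \<and> asc_chain_cond (graded_family R M X D E)"
  using assms(1,2) DX
proof (induct X)
  case empty
  let ?E = "\<lambda>n. if n \<le> N then V n else D n"
  have "asc_chain_cond (graded_family R M {} D ?E)"
  proof (rule asc_chain_cond_transfer_finite[where J="{..N}" and Q="\<lambda>_ U. submodule U R M" and g="\<lambda>j U. U j"])
    show "asc_chain_cond (\<lambda>U. submodule U R M)" using noeth by (simp add: noeth_module_def)
    fix U U' assume U: "graded_family R M {} D ?E U" "graded_family R M {} D ?E U'" and eq: "\<And>j. j \<in> {..N} \<Longrightarrow> U j = U' j"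
    have "U n = U' n" for n
    proof (cases "n \<le> N")
      case False
      then have "U n = D n" "U' n = D n" using U False by (auto simp: graded_family_def split: if_splits)
      then show ?thesis by simp
    qed (use eq in auto)
    then show "U = U'" by blast
  qed (auto simp: graded_family_def le_fun_def)
  then show ?case by (intro exI[of _ ?E]) (use D V DV in \<open>auto simp: shift_closed_def\<close>)
next
  case (insert x X)
  then have x: "x \<in> carrier R" "X \<subseteq> carrier R" by auto
  have "shift_closed M X D" using insert.prems(2) by (auto simp: shift_closed_def)
  with insert.hyps(3) x(2) obtain E where
    E: "\<And>n. submodule (E n) R M" "\<And>n. D n \<subseteq> E n" "\<And>n. n \<le> N \<Longrightarrow> V n \<subseteq> E n" "shift_closed M X E"
    and acc: "asc_chain_cond (graded_family R M X D E)" by blast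
  note facts = x(2) x(1) D E(1) E(2) insert.prems(2) E(4)
  let ?W = "\<lambda>n. poly_part x D E (Suc n) n"
  have EW: "E n \<subseteq> ?W n" for n
  proof
    fix e assume "e \<in> E n"
    then have "(x [^] (0::nat)) \<odot>\<^bsub>M\<^esub> e \<in> poly_part x D E (Suc 0) n"
      using poly_part_monom[OF facts, of e n 0] by simp
    then have "e \<in> poly_part x D E (Suc 0) n" using submodule_in_carrier[OF E(1) \<open>e \<in> E n\<close>] by simp
    then show "e \<in> ?W n" using poly_part_mono[OF facts, of "Suc 0" "Suc n" n] by auto
  qed
  have "shift_closed M (insert x X) ?W"
    unfolding shift_closed_def
  proof (intro ballI allI)
    fix y n u assume y: "y \<in> insert x X" and u: "u \<in> ?W n"
    show "y \<odot>\<^bsub>M\<^esub> u \<in> ?W (Suc n)"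
    proof (cases "y = x")
      case True then show ?thesis using poly_part_shift_x[OF facts u] by simp
    next
      case False
      then show ?thesis using poly_part_shift[OF facts _ u, of y] y poly_part_Suc_upper[OF facts, of "Suc n" "Suc n"] by blast
    qed
  qed
  moreover have "asc_chain_cond (graded_family R M (insert x X) D ?W)"
    by (rule hilbert_basis_step[OF facts acc])
  moreover have "submodule (?W n) R M \<and> D n \<subseteq> ?W n \<and> (n \<le> N \<longrightarrow> V n \<subseteq> ?W n)" for n
    using poly_part_submodule[OF facts] EW E(2,3) by (meson order_trans)
  ultimately show ?case by (intro exI[of _ ?W]) blast
qed

text \<open>If, from some index on, \<open>V (n + 1)\<close> is generated by the products of elements of \<open>X\<close> and \<open>V n\<close>
  together with \<open>D (n + 1)\<close>, then \<open>\<Oplus> V n / D n\<close> is finitely generated over \<open>R[x t | x \<in> X]\<close>, and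
  the basis theorem applies.\<close>
theorem graded_family_noetherian:
  assumes "finite X" "X \<subseteq> carrier R" and noeth: "noeth_module R M"
    and D: "\<And>n. submodule (D n) R M" and DX: "shift_closed M X D"
    and V: "\<And>n. submodule (V n) R M" and DV: "\<And>n. D n \<subseteq> V n"
    and gen: "\<And>n W. N \<le> n \<Longrightarrow> submodule W R M \<Longrightarrow> D (Suc n) \<subseteq> W \<Longrightarrow>
      (\<And>x v. x \<in> X \<Longrightarrow> v \<in> V n \<Longrightarrow> x \<odot>\<^bsub>M\<^esub> v \<in> W) \<Longrightarrow> V (Suc n) \<subseteq> W"
  shows "asc_chain_cond (graded_family R M X D V)"
proof -
  obtain E where E: "\<And>n. submodule (E n) R M" "\<And>n. D n \<subseteq> E n" "\<And>n. n \<le> N \<Longrightarrow> V n \<subseteq> E n" "shift_closed M X E"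
    and acc: "asc_chain_cond (graded_family R M X D E)"
    using hilbert_basis_exists[OF assms(1-7), of N] by blast
  have "V n \<subseteq> E n" for n
  proof (induct n)
    case (Suc n)
    show ?case
    proof (cases "Suc n \<le> N")
      case False
      then show ?thesis using gen[of n "E (Suc n)"] E(1,2) shift_closedD[OF E(4)] Suc by (meson not_less_eq_eq subsetD)
    qed (use E(3) in auto)
  qed (use E(3) in auto)
  then show ?thesis
    by (intro asc_chain_cond_mono[OF acc]) (unfold graded_family_def, meson order_trans)
qed

end


section \<open>Hilbert functions\<close>

lemma enat_le_finite: "(a::enat) \<le> b \<Longrightarrow> b \<noteq> \<infinity> \<Longrightarrow> a \<noteq> \<infinity>"
  by (cases a; cases b) auto

text \<open>If \<open>w\<close> gained more than \<open>C c\<close> on every interval of length \<open>c\<close> from \<open>m\<close> on, it would outgrow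
  \<open>C (n + K)\<close>.\<close>
lemma linear_growth_gap:
  fixes w :: "nat \<Rightarrow> nat"
  assumes "\<And>n. w n \<le> C * (n + K)"
  shows "\<exists>n\<ge>m. w (n + c) \<le> w n + C * c"
proof (rule ccontr)
  assume "\<not> ?thesis"
  then have big: "w (n + c) \<ge> Suc (w n + C * c)" if "n \<ge> m" for n using that by (meson not_less_eq_eq)
  have grow: "w (m + j * c) \<ge> j * Suc (C * c)" for j
  proof (induct j)
    case (Suc j)
    then show ?case using big[of "m + j * c"] by (simp add: algebra_simps)
  qed simp
  from grow[of "Suc (C * (m + K))"] assms[of "m + Suc (C * (m + K)) * c"] show False by (simp add: algebra_simps)
qed

text \<open>The increments are all \<open>c - k\<close>. Were this positive, \<open>h\<close> would tend to infinity; were it negative,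
  \<open>h\<close> would become negative.\<close>
lemma eventually_constant_increments:
  fixes h :: "nat \<Rightarrow> nat"
  assumes inc: "\<And>n. n \<ge> N \<Longrightarrow> h (Suc n) + k = h n + c"
    and bdd: "\<And>m. \<exists>n\<ge>m. h n \<le> C"
  shows "\<forall>n\<ge>N. h n = h N"
proof -
  have lin: "h (N + j) + j * k = h N + j * c" for j
  proof (induct j)
    case (Suc j) then show ?case using inc[of "N + j"] by simp
  qed simp
  have "\<not> k < c"
  proof
    assume "k < c"
    obtain n where n: "n \<ge> N + Suc C" "h n \<le> C" using bdd by blast
    then obtain j where j: "n = N + j" "j \<ge> Suc C" by (metis add_le_cancel_left le_Suc_ex le_add1 order_trans)
    have "j * k + j \<le> j * c" using \<open>k < c\<close> by (metis Suc_leI add.commute mult_Suc_right mult_le_mono2)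
    then show False using lin[of j] n j by simp
  qed
  moreover have "\<not> c < k"
  proof
    assume "c < k"
    let ?j = "Suc (h N)"
    have "?j * c + ?j \<le> ?j * k" using \<open>c < k\<close> by (metis Suc_leI add.commute mult_Suc_right mult_le_mono2)
    then show False using lin[of ?j] by simp
  qed
  ultimately have "c = k" by simp
  then have "h (N + j) = h N" for j using lin[of j] by simp
  then show ?thesis by (metis le_Suc_ex)
qed

context module
begin

text \<open>By induction on the set \<open>X\<close> of degree-one operators. For \<open>x \<in> X\<close> let \<open>K\<close> and \<open>C\<close> be the kernel
  and the cokernel of multiplication by \<open>x\<close> on \<open>\<Oplus> V n / U n\<close>; both are killed by \<open>x\<close>, so
  they are Noetherian over the remaining operators. The exact sequence
  \<open>0 \<rightarrow> K n \<rightarrow> V n / U n \<rightarrow> V (n + 1) / U (n + 1) \<rightarrow> C (n + 1) \<rightarrow> 0\<close>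
  shows that the Hilbert function has eventually constant increments, and since it returns below a
  fixed bound infinitely often it is eventually constant.\<close>
theorem hilbert_function_eventually_constant:
  assumes "finite X" "X \<subseteq> carrier R"
    and "\<And>n. submodule (U n) R M" "\<And>n. submodule (V n) R M" "\<And>n. U n \<subseteq> V n"
    and "shift_closed M X U" "shift_closed M X V"
    and "asc_chain_cond (graded_family R M X U V)"
    and "\<And>n. rel_length R M (U n) (V n) \<noteq> \<infinity>"
    and "\<And>m. \<exists>n\<ge>m. rel_length R M (U n) (V n) \<le> enat C"
  shows "\<exists>c N. \<forall>n\<ge>N. rel_length R M (U n) (V n) = enat c"
  using assms
proof (induct X arbitrary: U V)
  case empty
  let ?f = "\<lambda>k n. if n < k then V n else U n"
  have "graded_family R M {} U V (?f k)" for k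
    using empty by (auto simp: graded_family_def shift_closed_def)
  moreover have "?f k \<le> ?f (Suc k)" for k using empty.prems(4) by (auto simp: le_fun_def)
  ultimately obtain k where k: "\<And>j. j \<ge> k \<Longrightarrow> ?f j = ?f k"
    using asc_chain_condD[OF empty.prems(7), of ?f] by metis
  have "V n = U n" if "n \<ge> k" for n
  proof -
    have "?f (Suc n) n = ?f k n" using k[of "Suc n"] that by (metis le_SucI)
    then show ?thesis using that by simp
  qed
  then have "\<forall>n\<ge>k. rel_length R M (U n) (V n) = enat 0" by (simp add: rel_length_refl zero_enat_def)
  then show ?case by blast
next
  case (insert x X)
  note U = insert.prems(2) and V = insert.prems(3) and UV = insert.prems(4) and fin = insert.prems(8)
  have x: "x \<in> carrier R" "X \<subseteq> carrier R" using insert.prems(1) by auto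
  define K where "K n = {v \<in> V n. x \<odot>\<^bsub>M\<^esub> v \<in> U (Suc n)}" for n
  define xV where "xV n = (\<lambda>v. x \<odot>\<^bsub>M\<^esub> v) ` V n" for n
  define B where "B n = (case n of 0 \<Rightarrow> U 0 | Suc n \<Rightarrow> U (Suc n) <+>\<^bsub>M\<^esub> xV n)" for n
  have sU: "y \<odot>\<^bsub>M\<^esub> u \<in> U (Suc n)" if "y \<in> insert x X" "u \<in> U n" for y u n
    using shift_closedD[OF insert.prems(5) that] .
  have sV: "y \<odot>\<^bsub>M\<^esub> u \<in> V (Suc n)" if "y \<in> insert x X" "u \<in> V n" for y u n
    using shift_closedD[OF insert.prems(6) that] .
  have Vc: "v \<in> carrier M" if "v \<in> V n" for v n using submodule_in_carrier[OF V that] .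
  have KM: "submodule (K n) R M" "U n \<subseteq> K n" "K n \<subseteq> V n" for n
    using submodule_smult_preimage[OF x(1) V U, of n "Suc n"] UV[of n] sU[of x _ n] by (auto simp: K_def)
  have xVM: "submodule (xV n) R M" "xV n \<subseteq> V (Suc n)" for n
    using submodule_smult_image[OF x(1) V[of n]] sV[of x _ n] by (auto simp: xV_def)
  have BM: "submodule (B n) R M" "U n \<subseteq> B n" "B n \<subseteq> V n" for n
  proof -
    show "submodule (B n) R M" "U n \<subseteq> B n"
      using U submodule_sum[OF U xVM(1)] sum_upper(1)[OF U xVM(1)] by (auto simp: B_def split: nat.split)
    show "B n \<subseteq> V n"
      using UV sum_least[OF V UV xVM(2)] by (cases n) (auto simp: B_def)
  qed
  have xB: "x \<odot>\<^bsub>M\<^esub> v \<in> B (Suc n)" if "v \<in> V n" for v n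
    using sum_upper(2)[OF U[of "Suc n"] xVM(1)[of n]] that by (auto simp: B_def xV_def)
  have shK: "shift_closed M X K" unfolding shift_closed_def
  proof (intro ballI allI)
    fix y n v assume y: "y \<in> X" and v: "v \<in> K n"
    have "x \<odot>\<^bsub>M\<^esub> (y \<odot>\<^bsub>M\<^esub> v) = y \<odot>\<^bsub>M\<^esub> (x \<odot>\<^bsub>M\<^esub> v)" using x y v Vc by (intro smult_comm) (auto simp: K_def)
    then show "y \<odot>\<^bsub>M\<^esub> v \<in> K (Suc n)" using sV[of y v n] sU[of y "x \<odot>\<^bsub>M\<^esub> v" "Suc n"] y v by (auto simp: K_def)
  qed
  have shB: "shift_closed M X B" unfolding shift_closed_def
  proof (intro ballI allI)
    fix y n v assume y: "y \<in> X" and v: "v \<in> B n"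
    have yc: "y \<in> carrier R" using y x by blast
    show "y \<odot>\<^bsub>M\<^esub> v \<in> B (Suc n)"
    proof (cases n)
      case 0 then show ?thesis using sU[of y v 0] y v BM(2)[of "Suc 0"] by (auto simp: B_def)
    next
      case (Suc m)
      then obtain u w where uw: "u \<in> U (Suc m)" "w \<in> V m" "v = u \<oplus>\<^bsub>M\<^esub> x \<odot>\<^bsub>M\<^esub> w"
        using v by (auto simp: mem_set_add B_def xV_def)
      have "y \<odot>\<^bsub>M\<^esub> v = y \<odot>\<^bsub>M\<^esub> u \<oplus>\<^bsub>M\<^esub> x \<odot>\<^bsub>M\<^esub> (y \<odot>\<^bsub>M\<^esub> w)"
        using uw Vc[OF uw(2)] submodule_in_carrier[OF U uw(1)] x yc smult_comm[of x y w]
        by (simp add: smult_r_distr)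
      moreover have "y \<odot>\<^bsub>M\<^esub> u \<in> B (Suc n)" using sU[of y u "Suc m"] y uw BM(2)[of "Suc n"] Suc by blast
      moreover have "x \<odot>\<^bsub>M\<^esub> (y \<odot>\<^bsub>M\<^esub> w) \<in> B (Suc n)" using xB[of _ n] sV[of y w m] y uw Suc by blast
      ultimately show ?thesis using submodule_add[OF BM(1)] by metis
    qed
  qed
  have shU: "shift_closed M X U" "shift_closed M X V"
    using insert.prems(5,6) by (auto simp: shift_closed_def)
  have "asc_chain_cond (graded_family R M X U K)"
  proof (rule asc_chain_cond_mono[OF insert.prems(7)])
    fix W assume W: "graded_family R M X U K W"
    then have W': "U n \<subseteq> W n" "W n \<subseteq> K n" "submodule (W n) R M" for n unfolding graded_family_def by blast+
    have xW: "x \<odot>\<^bsub>M\<^esub> w \<in> W (Suc n)" if "w \<in> W n" for w n using W'(1)[of "Suc n"] W'(2)[of n] that unfolding K_def by blast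
    have sh: "shift_closed M X W" using W unfolding graded_family_def by blast
    have "shift_closed M (insert x X) W" using sh xW unfolding shift_closed_def by blast
    moreover have "W n \<subseteq> V n" for n using W'(2)[of n] KM(3)[of n] by blast
    ultimately show "graded_family R M (insert x X) U V W"
      using W'(1,3) unfolding graded_family_def by blast
  qed
  moreover have lenK: "rel_length R M (U n) (K n) \<le> rel_length R M (U n) (V n)" for n
    using rel_length_mono[OF U U KM(1) V _ KM(2,3)] by blast
  moreover have "rel_length R M (U n) (K n) \<noteq> \<infinity>" for n using lenK[of n] fin[of n] by (rule enat_le_finite)
  moreover have "\<exists>n\<ge>m. rel_length R M (U n) (K n) \<le> enat C" for m
    using insert.prems(9)[of m] lenK order_trans by blast
  ultimately have "\<exists>c N. \<forall>n\<ge>N. rel_length R M (U n) (K n) = enat c"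
    by (intro insert.hyps(3)[OF x(2) U KM(1,2) shU(1) shK])
  then obtain k N1 where k: "\<And>n. n \<ge> N1 \<Longrightarrow> rel_length R M (U n) (K n) = enat k" by blast
  have "asc_chain_cond (graded_family R M X B V)"
  proof (rule asc_chain_cond_mono[OF insert.prems(7)])
    fix W assume W: "graded_family R M X B V W"
    then have W': "B n \<subseteq> W n" "W n \<subseteq> V n" "submodule (W n) R M" for n unfolding graded_family_def by blast+
    have xW: "x \<odot>\<^bsub>M\<^esub> w \<in> W (Suc n)" if "w \<in> W n" for w n using xB[of w n] W'(1)[of "Suc n"] W'(2)[of n] that by blast
    have sh: "shift_closed M X W" using W unfolding graded_family_def by blast
    have "shift_closed M (insert x X) W" using sh xW unfolding shift_closed_def by blast
    moreover have "U n \<subseteq> W n" for n using W'(1)[of n] BM(2)[of n] by blast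
    ultimately show "graded_family R M (insert x X) U V W"
      using W'(2,3) unfolding graded_family_def by blast
  qed
  moreover have lenB: "rel_length R M (B n) (V n) \<le> rel_length R M (U n) (V n)" for n
    using rel_length_mono[OF U BM(1) V V BM(2,3)] by blast
  moreover have "rel_length R M (B n) (V n) \<noteq> \<infinity>" for n using lenB[of n] fin[of n] by (rule enat_le_finite)
  moreover have "\<exists>n\<ge>m. rel_length R M (B n) (V n) \<le> enat C" for m
    using insert.prems(9)[of m] lenB order_trans by blast
  ultimately have "\<exists>c N. \<forall>n\<ge>N. rel_length R M (B n) (V n) = enat c"
    by (intro insert.hyps(3)[OF x(2) BM(1) V BM(3) shB shU(2)])
  then obtain c N2 where c: "\<And>n. n \<ge> N2 \<Longrightarrow> rel_length R M (B n) (V n) = enat c" by blast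
  define h where "h n = the_enat (rel_length R M (U n) (V n))" for n
  have h: "rel_length R M (U n) (V n) = enat (h n)" for n using fin[of n] unfolding h_def by (metis enat.exhaust the_enat.simps)
  let ?N = "max N1 N2"
  have "h (Suc n) + k = h n + c" if "n \<ge> ?N" for n
  proof -
    have "rel_length R M (U n) (V n) = rel_length R M (U n) (K n) + rel_length R M (K n) (V n)"
      by (rule rel_length_add[OF U KM(1) V KM(2,3)])
    moreover have "rel_length R M (K n) (V n) = rel_length R M (U (Suc n)) (B (Suc n))"
      using rel_length_linear[OF module_axioms V linear_on_smult[OF x(1)] U, of n "Suc n"] Vc by (auto simp: K_def B_def xV_def)
    moreover have "rel_length R M (U (Suc n)) (V (Suc n))
        = rel_length R M (U (Suc n)) (B (Suc n)) + rel_length R M (B (Suc n)) (V (Suc n))"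
      by (rule rel_length_add[OF U BM(1) V BM(2,3)])
    ultimately have "enat (h n) = enat k + rel_length R M (U (Suc n)) (B (Suc n))"
      "enat (h (Suc n)) = rel_length R M (U (Suc n)) (B (Suc n)) + enat c"
      using k[of n] c[of "Suc n"] that h by auto
    then show ?thesis by (cases "rel_length R M (U (Suc n)) (B (Suc n))") auto
  qed
  moreover have "\<exists>n\<ge>m. h n \<le> C" for m
  proof -
    obtain n where "n \<ge> m" "enat (h n) \<le> enat C" using insert.prems(9)[of m] unfolding h by blast
    then show ?thesis by auto
  qed
  ultimately have "\<forall>n\<ge>?N. h n = h ?N" by (rule eventually_constant_increments)
  then have "\<forall>n\<ge>?N. rel_length R M (U n) (V n) = enat (h ?N)" unfolding h by blast
  then show ?case by blast
qed

end


section \<open>Noetherian modules\<close>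

lemma asc_chain_cond_ideals:
  assumes "noetherian_ring R" shows "asc_chain_cond (\<lambda>J. ideal J R)"
  unfolding asc_chain_cond_def
proof (intro allI impI, elim conjE)
  interpret noetherian_ring R by fact
  fix f :: "nat \<Rightarrow> 'a set" assume id: "\<forall>n. ideal (f n) R" and mf: "mono f"
  have "subset.chain {I. ideal I R} (range f)"
    unfolding subset_chain_def using id mf by (auto simp: mono_def) (meson nat_le_linear subsetD)
  then have "\<Union>(range f) \<in> range f" by (intro ideal_chain_is_trivial) auto
  then obtain k where k: "\<Union>(range f) = f k" by blast
  have "f n = f k" if "n \<ge> k" for n
  proof
    show "f n \<subseteq> f k" using k by blast
    show "f k \<subseteq> f n" using monoD[OF mf that] .
  qed
  then show "\<exists>k. \<forall>n\<ge>k. f n = f k" by blast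
qed

context module
begin

definition acc_between :: "'c set \<Rightarrow> 'c set \<Rightarrow> bool" where
  "acc_between U V \<longleftrightarrow> asc_chain_cond (\<lambda>W. submodule W R M \<and> U \<subseteq> W \<and> W \<subseteq> V)"

text \<open>By the modular law, comparable submodules between \<open>U\<close> and \<open>W\<close> are equal if they have the same
  intersection and the same sum with \<open>V\<close>.\<close>
lemma acc_between_trans:
  assumes V: "submodule V R M" and UV: "acc_between U V" and VW: "acc_between V W"
    and "U \<subseteq> V" "submodule W R M" "V \<subseteq> W"
  shows "acc_between U W"
  unfolding acc_between_def
proof (rule asc_chain_cond_transfer_finite[where J="UNIV :: bool set"
      and Q="\<lambda>b X. submodule X R M \<and> (if b then U \<subseteq> X \<and> X \<subseteq> V else V \<subseteq> X \<and> X \<subseteq> W)"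
      and g="\<lambda>b X. if b then X \<inter> V else X <+>\<^bsub>M\<^esub> V"])
  show "asc_chain_cond (\<lambda>X. submodule X R M \<and> (if b then U \<subseteq> X \<and> X \<subseteq> V else V \<subseteq> X \<and> X \<subseteq> W))" for b
    using UV VW by (cases b) (auto simp: acc_between_def)
  fix X assume X: "submodule X R M \<and> U \<subseteq> X \<and> X \<subseteq> W"
  show "submodule (if b then X \<inter> V else X <+>\<^bsub>M\<^esub> V) R M \<and>
      (if b then U \<subseteq> (if b then X \<inter> V else X <+>\<^bsub>M\<^esub> V) \<and> (if b then X \<inter> V else X <+>\<^bsub>M\<^esub> V) \<subseteq> V
       else V \<subseteq> (if b then X \<inter> V else X <+>\<^bsub>M\<^esub> V) \<and> (if b then X \<inter> V else X <+>\<^bsub>M\<^esub> V) \<subseteq> W)" for b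
    using X V assms submodule_Int[of X V] submodule_sum[of X V] sum_upper(2)[of X V] sum_least[of W X V]
    by (cases b) auto
  fix Y assume Y: "submodule Y R M \<and> U \<subseteq> Y \<and> Y \<subseteq> W" and le: "X \<le> Y"
  show "(if b then X \<inter> V else X <+>\<^bsub>M\<^esub> V) \<le> (if b then Y \<inter> V else Y <+>\<^bsub>M\<^esub> V)" for b
    using le by (cases b) (fastforce simp: mem_set_add)+
  assume eq: "\<And>b. b \<in> UNIV \<Longrightarrow> (if b then X \<inter> V else X <+>\<^bsub>M\<^esub> V) = (if b then Y \<inter> V else Y <+>\<^bsub>M\<^esub> V)"
  show "X = Y" by (rule modular_law[of X Y V]) (use X Y V le eq[of True] eq[of False] in auto)
qed auto

lemma colon_ideal:
  assumes Ws: "submodule W R M" and v: "v \<in> carrier M"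
  shows "ideal {a \<in> carrier R. a \<odot>\<^bsub>M\<^esub> v \<in> W} R"
proof (rule idealI)
  show "ring R" by (rule R.ring_axioms)
  show "subgroup {a \<in> carrier R. a \<odot>\<^bsub>M\<^esub> v \<in> W} (add_monoid R)"
    by (rule R.add.subgroupI)
       (use v Ws submodule_zero[OF Ws] R.zero_closed in \<open>auto simp: submoduleD smult_l_distr smult_l_minus simp flip: a_inv_def\<close>)
  fix a b assume "a \<in> {a \<in> carrier R. a \<odot>\<^bsub>M\<^esub> v \<in> W}" and b: "b \<in> carrier R"
  then have a: "a \<in> carrier R" "a \<odot>\<^bsub>M\<^esub> v \<in> W" by auto
  have "(b \<otimes> a) \<odot>\<^bsub>M\<^esub> v \<in> W" using submodule_smult[OF Ws b a(2)] a b v by (simp add: smult_assoc1)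
  then show "b \<otimes> a \<in> {a \<in> carrier R. a \<odot>\<^bsub>M\<^esub> v \<in> W}" "a \<otimes> b \<in> {a \<in> carrier R. a \<odot>\<^bsub>M\<^esub> v \<in> W}"
    using a b R.m_comm by auto
qed

text \<open>A submodule \<open>W\<close> between \<open>U\<close> and \<open>U + R v\<close> is determined by the ideal \<open>(W : v)\<close>.\<close>
lemma acc_between_cyclic:
  assumes noeth: "noetherian_ring R" and U: "submodule U R M" and v: "v \<in> carrier M"
  shows "acc_between U (U <+>\<^bsub>M\<^esub> {a \<odot>\<^bsub>M\<^esub> v | a. a \<in> carrier R})"
  unfolding acc_between_def
proof (rule asc_chain_cond_transfer[OF asc_chain_cond_ideals[OF noeth], of _ "\<lambda>W. {a \<in> carrier R. a \<odot>\<^bsub>M\<^esub> v \<in> W}"])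
  fix W assume W: "submodule W R M \<and> U \<subseteq> W \<and> W \<subseteq> U <+>\<^bsub>M\<^esub> {a \<odot>\<^bsub>M\<^esub> v | a. a \<in> carrier R}"
  then have Ws: "submodule W R M" by blast
  show "ideal {a \<in> carrier R. a \<odot>\<^bsub>M\<^esub> v \<in> W} R" by (rule colon_ideal[OF Ws v])
  fix W' assume W': "submodule W' R M \<and> U \<subseteq> W' \<and> W' \<subseteq> U <+>\<^bsub>M\<^esub> {a \<odot>\<^bsub>M\<^esub> v | a. a \<in> carrier R}"
    and le: "W \<le> W'"
  show "{a \<in> carrier R. a \<odot>\<^bsub>M\<^esub> v \<in> W} \<le> {a \<in> carrier R. a \<odot>\<^bsub>M\<^esub> v \<in> W'}" using le by blast
  assume eq: "{a \<in> carrier R. a \<odot>\<^bsub>M\<^esub> v \<in> W} = {a \<in> carrier R. a \<odot>\<^bsub>M\<^esub> v \<in> W'}"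
  have "w \<in> W" if w: "w \<in> W'" for w
  proof -
    obtain u a where ua: "u \<in> U" "a \<in> carrier R" "w = u \<oplus>\<^bsub>M\<^esub> a \<odot>\<^bsub>M\<^esub> v"
      using w W' by (auto simp: mem_set_add subset_iff)
    have uc: "u \<in> carrier M" using submodule_in_carrier[OF U ua(1)] .
    have "a \<odot>\<^bsub>M\<^esub> v \<oplus>\<^bsub>M\<^esub> u \<in> W'" using w ua uc v by (simp add: M.a_comm)
    then have "a \<odot>\<^bsub>M\<^esub> v \<in> W'" using submodule_add_cancel[of W' "a \<odot>\<^bsub>M\<^esub> v" u] W' ua v by blast
    then have "a \<odot>\<^bsub>M\<^esub> v \<in> W" using eq ua(2) by blast
    then show ?thesis using submodule_add[OF Ws] W ua by blast
  qed
  then show "W = W'" using le by blast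
qed

theorem noeth_module_fin_gen:
  assumes noeth: "noetherian_ring R" and fg: "fin_gen_module R M"
  shows "noeth_module R M"
proof -
  have "acc_between {\<zero>\<^bsub>M\<^esub>} (submodule_gen R M S)" if "finite S" "S \<subseteq> carrier M" for S
    using that
  proof (induct S)
    case empty
    have "submodule_gen R M {} \<subseteq> {\<zero>\<^bsub>M\<^esub>}" by (rule submodule_gen_least[OF zero_submodule]) simp
    then show ?case unfolding acc_between_def asc_chain_cond_def by (metis subset_antisym subset_trans)
  next
    case (insert v S)
    let ?C = "{a \<odot>\<^bsub>M\<^esub> v | a. a \<in> carrier R}" and ?G = "submodule_gen R M S"
    have v: "v \<in> carrier M" and S: "S \<subseteq> carrier M" using insert by auto
    have G: "submodule ?G R M" by (rule submodule_gen_submodule[OF S])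
    have GC: "submodule (?G <+>\<^bsub>M\<^esub> ?C) R M" by (rule submodule_sum[OF G submodule_cyclic[OF v]])
    have "acc_between {\<zero>\<^bsub>M\<^esub>} (?G <+>\<^bsub>M\<^esub> ?C)"
      by (rule acc_between_trans[OF G insert.hyps(3)[OF S] acc_between_cyclic[OF noeth G v] _ GC])
         (use submodule_zero[OF G] sum_upper(1)[OF G submodule_cyclic[OF v]] in auto)
    moreover have "submodule_gen R M (insert v S) \<subseteq> ?G <+>\<^bsub>M\<^esub> ?C"
      using sum_upper[OF G submodule_cyclic[OF v]] submodule_gen_upper[of S] cyclic_self[OF v]
      by (intro submodule_gen_least[OF GC]) blast
    ultimately show ?case unfolding acc_between_def
      by (elim asc_chain_cond_mono) (meson order_trans)
  qed
  moreover obtain S where "finite S" "S \<subseteq> carrier M" "submodule_gen R M S = carrier M"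
    using fg unfolding fin_gen_module_def by blast
  ultimately have "acc_between {\<zero>\<^bsub>M\<^esub>} (carrier M)" by metis
  then show ?thesis unfolding acc_between_def noeth_module_def
    by (rule asc_chain_cond_mono) (auto dest: submodule_in_carrier submodule_zero)
qed

lemma noeth_submodule_fin_gen:
  assumes noeth: "noeth_module R M" and U: "submodule U R M"
  obtains S where "finite S" "S \<subseteq> U" "U = submodule_gen R M S"
proof -
  let ?Q = "\<lambda>W. \<exists>S. finite S \<and> S \<subseteq> U \<and> W = submodule_gen R M S"
  have Uc: "U \<subseteq> carrier M" using submodule_in_carrier[OF U] by blast
  have "?Q (submodule_gen R M {})" by blast
  then obtain W where W: "?Q W" and max: "\<And>W'. ?Q W' \<Longrightarrow> W \<subseteq> W' \<Longrightarrow> W' = W"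
    by (rule asc_chain_cond_maximal[OF noeth[unfolded noeth_module_def], of ?Q])
       (use submodule_gen_submodule Uc in \<open>blast+\<close>)
  then obtain S where S: "finite S" "S \<subseteq> U" "W = submodule_gen R M S" by blast
  have "u \<in> W" if "u \<in> U" for u
  proof -
    let ?W' = "submodule_gen R M (insert u S)"
    have "W \<subseteq> ?W'" unfolding S(3)
      by (rule submodule_gen_least[OF submodule_gen_submodule]) (use that S Uc submodule_gen_upper[of "insert u S"] in auto)
    then have "?W' = W" using max[of ?W'] S that by (metis finite_insert insert_subset)
    then show ?thesis using submodule_gen_upper[of "insert u S"] by blast
  qed
  then have "U = W" using S submodule_gen_least[OF U S(2)] by blast
  then show ?thesis using that S by blast
qed

lemma fin_gen_of_noeth:
  assumes "noeth_module R M" shows "fin_gen_module R M"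
proof -
  obtain S where "finite S" "S \<subseteq> carrier M" "carrier M = submodule_gen R M S"
    using noeth_submodule_fin_gen[OF assms carrier_is_submodule] by blast
  then show ?thesis unfolding fin_gen_module_def using module_axioms by metis
qed

end

lemma (in cring) module_self: "module R (self_module R)"
proof -
  have "abelian_group (self_module R)"
    by (rule abelian_groupI)
       (use add.l_inv_ex in \<open>auto simp: self_module_def a_ac\<close>)
  then show ?thesis
    by (intro moduleI) (auto simp: self_module_def l_distr r_distr m_assoc is_cring)
qed

lemma (in cring) submodule_self_iff: "submodule J R (self_module R) \<longleftrightarrow> ideal J R"
proof
  interpret S: module R "self_module R" by (rule module_self)
  assume J: "submodule J R (self_module R)"
  note D = submoduleD[OF J]
  have inv: "a_inv (self_module R) = a_inv R" by (simp add: a_inv_def self_module_def m_inv_def fun_eq_iff)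
  show "ideal J R"
  proof (rule idealI)
    show "subgroup J (add_monoid R)"
      by (rule add.subgroupI)
         (use D inv in \<open>auto simp: self_module_def simp flip: a_inv_def\<close>)
    fix a b assume "a \<in> J" "b \<in> carrier R"
    then show "b \<otimes> a \<in> J" "a \<otimes> b \<in> J" using D(5)[of b a] D(1)[of a] m_comm[of a b] by (auto simp: self_module_def)
  qed (rule ring_axioms)
next
  interpret S: module R "self_module R" by (rule module_self)
  assume J: "ideal J R"
  interpret J: ideal J R by fact
  have inv: "a_inv (self_module R) = a_inv R" by (simp add: a_inv_def self_module_def m_inv_def fun_eq_iff)
  show "submodule J R (self_module R)"
    by (rule S.submoduleI) (use J.I_l_closed inv in \<open>auto simp: self_module_def\<close>)
qed

lemma (in cring) noetherian_ring_iff: "noetherian_ring R \<longleftrightarrow> noeth_module R (self_module R)"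
proof
  assume "noetherian_ring R"
  then show "noeth_module R (self_module R)"
    using asc_chain_cond_ideals by (simp add: noeth_module_def submodule_self_iff)
next
  interpret S: module R "self_module R" by (rule module_self)
  assume noeth: "noeth_module R (self_module R)"
  show "noetherian_ring R"
  proof (rule noetherian_ringI)
    fix J assume J: "ideal J R"
    then obtain A where A: "finite A" "A \<subseteq> J" "J = submodule_gen R (self_module R) A"
      using S.noeth_submodule_fin_gen[OF noeth, of J] by (auto simp: submodule_self_iff)
    have "J = Idl A" unfolding A(3) submodule_gen_def genideal_def by (simp add: submodule_self_iff)
    then show "\<exists>A\<subseteq>carrier R. finite A \<and> J = Idl A"
      using A ideal.Icarr[OF J] by blast
  qed
qed


section \<open>Prime ideals\<close>

lemma primeidealD:
  assumes "primeideal P R"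
  shows "ideal P R" "carrier R \<noteq> P" "\<one>\<^bsub>R\<^esub> \<notin> P"
    and "\<lbrakk>a \<in> carrier R; b \<in> carrier R; a \<otimes>\<^bsub>R\<^esub> b \<in> P\<rbrakk> \<Longrightarrow> a \<in> P \<or> b \<in> P"
proof -
  interpret primeideal P R by fact
  show "ideal P R" by (rule is_ideal)
  show "carrier R \<noteq> P" by (rule I_notcarr)
  show "\<one>\<^bsub>R\<^esub> \<notin> P" using one_imp_carrier I_notcarr by blast
  show "\<lbrakk>a \<in> carrier R; b \<in> carrier R; a \<otimes>\<^bsub>R\<^esub> b \<in> P\<rbrakk> \<Longrightarrow> a \<in> P \<or> b \<in> P" by (rule I_prime)
qed

context cring
begin

lemma ideal_closed:
  assumes "ideal J R"
  shows "x \<in> J \<Longrightarrow> x \<in> carrier R" "\<zero> \<in> J" "x \<in> J \<Longrightarrow> y \<in> J \<Longrightarrow> x \<oplus> y \<in> J"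
    "a \<in> carrier R \<Longrightarrow> x \<in> J \<Longrightarrow> a \<otimes> x \<in> J" "x \<in> J \<Longrightarrow> a \<in> carrier R \<Longrightarrow> x \<otimes> a \<in> J"
    "x \<in> J \<Longrightarrow> \<ominus> x \<in> J"
proof -
  interpret J: ideal J R by fact
  show "x \<in> J \<Longrightarrow> x \<in> carrier R" by (rule J.Icarr)
  show "\<zero> \<in> J" by simp
  show "x \<in> J \<Longrightarrow> y \<in> J \<Longrightarrow> x \<oplus> y \<in> J" by simp
  show "a \<in> carrier R \<Longrightarrow> x \<in> J \<Longrightarrow> a \<otimes> x \<in> J" by (rule J.I_l_closed)
  show "x \<in> J \<Longrightarrow> a \<in> carrier R \<Longrightarrow> x \<otimes> a \<in> J" by (rule J.I_r_closed)
  show "x \<in> J \<Longrightarrow> \<ominus> x \<in> J" by simp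
qed

lemma exists_maximal_ideal:
  assumes noeth: "noetherian_ring R" and J: "ideal J R" "J \<noteq> carrier R"
  obtains P where "maximalideal P R" "J \<subseteq> P"
proof -
  obtain P where P: "ideal P R \<and> P \<noteq> carrier R" "J \<subseteq> P"
    and max: "\<And>Q. ideal Q R \<and> Q \<noteq> carrier R \<Longrightarrow> P \<subseteq> Q \<Longrightarrow> Q = P"
    by (rule asc_chain_cond_maximal[OF asc_chain_cond_ideals[OF noeth], of "\<lambda>P. ideal P R \<and> P \<noteq> carrier R" J])
       (use J in auto)
  have "maximalideal P R" by (rule maximalidealI) (use P max in auto)
  then show ?thesis using P(2) that by blast
qed

lemma local_unit:
  assumes "noetherian_local_ring R \<mm>" "r \<in> carrier R" "r \<notin> \<mm>"
  obtains s where "s \<in> carrier R" "s \<otimes> r = \<one>"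
proof -
  have "PIdl r = carrier R"
  proof (rule ccontr)
    assume "PIdl r \<noteq> carrier R"
    then obtain P where P: "maximalideal P R" "PIdl r \<subseteq> P"
      using exists_maximal_ideal[of "PIdl r"] assms cgenideal_ideal unfolding noetherian_local_ring_def by blast
    then have "r \<in> \<mm>" using assms cgenideal_self[OF assms(2)] unfolding noetherian_local_ring_def by blast
    then show False using assms(3) by blast
  qed
  then have "\<one> \<in> PIdl r" by simp
  then show ?thesis using that unfolding cgenideal_def by auto
qed

text \<open>An ideal that is maximal among those disjoint from a multiplicative set is prime; it exists by the
  chain condition.\<close>
lemma prime_avoiding:
  assumes noeth: "noetherian_ring R" and J: "ideal J R" and S: "\<one> \<in> S" "S \<subseteq> carrier R"
    "\<And>a b. a \<in> S \<Longrightarrow> b \<in> S \<Longrightarrow> a \<otimes> b \<in> S" and disj: "J \<inter> S = {}"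
  obtains P where "primeideal P R" "J \<subseteq> P" "P \<inter> S = {}"
proof -
  obtain P where P: "ideal P R \<and> P \<inter> S = {}" "J \<subseteq> P"
    and max: "\<And>Q. ideal Q R \<and> Q \<inter> S = {} \<Longrightarrow> P \<subseteq> Q \<Longrightarrow> Q = P"
    by (rule asc_chain_cond_maximal[OF asc_chain_cond_ideals[OF noeth], of "\<lambda>P. ideal P R \<and> P \<inter> S = {}" J])
       (use J disj in auto)
  have Pi: "ideal P R" using P by blast
  note Pc = ideal_closed[OF Pi]
  have meets: "\<exists>p r. p \<in> P \<and> r \<in> carrier R \<and> p \<oplus> r \<otimes> a \<in> S" if a: "a \<in> carrier R" "a \<notin> P" for a
  proof -
    have Q: "ideal (P <+>\<^bsub>R\<^esub> PIdl a) R" using Pi cgenideal_ideal[OF a(1)] by (rule add_ideals)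
    have PQ: "P \<subseteq> P <+>\<^bsub>R\<^esub> PIdl a"
    proof
      fix p assume "p \<in> P"
      then have "p = p \<oplus> \<zero>" "\<zero> \<in> PIdl a" using Pc ideal_closed(2)[OF cgenideal_ideal[OF a(1)]] by auto
      then show "p \<in> P <+>\<^bsub>R\<^esub> PIdl a" using \<open>p \<in> P\<close> unfolding mem_set_add by blast
    qed
    have "a = \<zero> \<oplus> a" using a by simp
    then have "a \<in> P <+>\<^bsub>R\<^esub> PIdl a" using Pc(2) cgenideal_self[OF a(1)] unfolding mem_set_add by blast
    then have "(P <+>\<^bsub>R\<^esub> PIdl a) \<inter> S \<noteq> {}" using max[of "P <+>\<^bsub>R\<^esub> PIdl a"] Q PQ a(2) by blast
    then show ?thesis unfolding mem_set_add cgenideal_def by (fastforce simp: mem_set_add)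
  qed
  have "primeideal P R"
  proof (rule primeidealI[OF Pi is_cring])
    show "carrier R \<noteq> P" using P S by blast
    fix a b assume ab: "a \<in> carrier R" "b \<in> carrier R" "a \<otimes> b \<in> P"
    show "a \<in> P \<or> b \<in> P"
    proof (rule ccontr)
      assume "\<not> (a \<in> P \<or> b \<in> P)"
      then obtain p r q s where h: "p \<in> P" "r \<in> carrier R" "p \<oplus> r \<otimes> a \<in> S" "q \<in> P" "s \<in> carrier R" "q \<oplus> s \<otimes> b \<in> S"
        using meets ab by metis
      have pc: "p \<in> carrier R" "q \<in> carrier R" using h Pc by auto
      have "(p \<oplus> r \<otimes> a) \<otimes> (q \<oplus> s \<otimes> b) = p \<otimes> (q \<oplus> s \<otimes> b) \<oplus> ((r \<otimes> a) \<otimes> q \<oplus> (r \<otimes> s) \<otimes> (a \<otimes> b))"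
        using h(2,5) pc ab by algebra
      also have "\<dots> \<in> P" using h pc ab Pc by simp
      finally show False using S(3)[OF h(3,6)] P by blast
    qed
  qed
  then show ?thesis using that P by blast
qed

text \<open>The multiplicative set consists of the products \<open>p\<^sup>n s\<close> with \<open>s\<close> outside \<open>Q\<close>; a prime avoiding it
  lies inside \<open>Q\<close> and misses \<open>p\<close>.\<close>
lemma prime_strictly_below:
  assumes noeth: "noetherian_ring R" and J: "ideal J R" and Q: "primeideal Q R" and p: "p \<in> Q"
    and reg: "\<And>n s. s \<in> carrier R \<Longrightarrow> p [^] (n::nat) \<otimes> s \<in> J \<Longrightarrow> s \<in> Q"
  obtains P where "primeideal P R" "J \<subseteq> P" "P \<subset> Q"
proof -
  note Qi = primeidealD(1)[OF Q]
  have pc: "p \<in> carrier R" using ideal_closed(1)[OF Qi p] .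
  define S where "S = {p [^] n \<otimes> s | (n::nat) s. s \<in> carrier R - Q}"
  have one: "\<one> \<in> carrier R - Q" using primeidealD(3)[OF Q] by simp
  have S0: "s \<in> S" if "s \<in> carrier R - Q" for s
  proof -
    have "s = p [^] (0::nat) \<otimes> s" using that by simp
    then show ?thesis unfolding S_def using that by blast
  qed
  have p1: "p \<in> S"
  proof -
    have "p = p [^] (1::nat) \<otimes> \<one>" using pc by simp
    then show ?thesis unfolding S_def using one by blast
  qed
  have mult: "a \<otimes> b \<in> S" if "a \<in> S" "b \<in> S" for a b
  proof -
    from that obtain n m :: nat and s t where h: "a = p [^] n \<otimes> s" "b = p [^] m \<otimes> t" "s \<in> carrier R - Q" "t \<in> carrier R - Q"
      unfolding S_def by blast
    have "a \<otimes> b = p [^] (n + m) \<otimes> (s \<otimes> t)"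
      using h pc by (simp add: m_ac flip: nat_pow_mult)
    moreover have "s \<otimes> t \<in> carrier R - Q" using h primeidealD(4)[OF Q] by auto
    ultimately show ?thesis unfolding S_def by blast
  qed
  have "J \<inter> S = {}" using reg unfolding S_def by blast
  moreover have "S \<subseteq> carrier R" unfolding S_def using pc by auto
  ultimately obtain P where P: "primeideal P R" "J \<subseteq> P" "P \<inter> S = {}"
    using prime_avoiding[OF noeth J S0[OF one] _ mult] by metis
  have "P \<subseteq> Q" using S0 P(3) ideal_closed(1)[OF primeidealD(1)[OF P(1)]] by blast
  then show ?thesis using that P p p1 by blast
qed

text \<open>A product of elements of \<open>Q - P\<close>, one for each \<open>Q \<in> T\<close>.\<close>
lemma outside_prime:
  assumes P: "primeideal P R" and "finite T" and T: "\<And>Q. Q \<in> T \<Longrightarrow> ideal Q R \<and> \<not> Q \<subseteq> P"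
  shows "\<exists>w\<in>carrier R - P. \<forall>Q\<in>T. w \<in> Q"
  using assms(2,3)
proof (induct T)
  case empty
  show ?case using primeidealD(3)[OF P] by auto
next
  case (insert Q T)
  then obtain w where w: "w \<in> carrier R - P" "\<forall>Q\<in>T. w \<in> Q" by auto
  have Q: "ideal Q R" using insert.prems by blast
  obtain q where q: "q \<in> Q" "q \<notin> P" using insert.prems by blast
  have "w \<otimes> q \<in> Q'" if "Q' \<in> insert Q T" for Q'
  proof (cases "Q' = Q")
    case True then show ?thesis using w q ideal_closed(4)[OF Q] by blast
  next
    case False
    then have "ideal Q' R" "w \<in> Q'" using that w insert.prems[of Q'] by auto
    then show ?thesis using ideal_closed(5) ideal_closed(1)[OF Q q(1)] by blast
  qed
  moreover have "w \<otimes> q \<notin> P" using primeidealD(4)[OF P] w q ideal_closed(1)[OF Q] by blast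
  ultimately show ?case using w q ideal_closed(1)[OF Q] by blast
qed

lemma prime_avoidance:
  assumes "finite S" and S: "\<And>P. P \<in> S \<Longrightarrow> primeideal P R" and J: "ideal J R" and cover: "J \<subseteq> \<Union>S"
  obtains P where "P \<in> S" "J \<subseteq> P"
proof -
  have "\<exists>P\<in>S. J \<subseteq> P"
    using assms
  proof (induct S rule: finite_psubset_induct)
    case (psubset S)
    show ?case
    proof (cases "\<exists>P\<in>S. J \<subseteq> \<Union>(S - {P})")
      case True
      then obtain P where P: "P \<in> S" "J \<subseteq> \<Union>(S - {P})" by blast
      then have "\<exists>Q\<in>S - {P}. J \<subseteq> Q" using psubset.hyps(2)[of "S - {P}"] psubset.prems by blast
      then show ?thesis by blast
    next
      case False
      have "S \<noteq> {}" using psubset.prems(3) ideal_closed(2)[OF J] by blast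
      then obtain P where P: "P \<in> S" by blast
      have Pp: "primeideal P R" using psubset.prems(1)[OF P] .
      have only: "\<exists>y\<in>J. y \<in> Q \<and> (\<forall>Q'\<in>S - {Q}. y \<notin> Q')" if "Q \<in> S" for Q
      proof -
        obtain y where "y \<in> J" "y \<notin> \<Union>(S - {Q})" using False \<open>Q \<in> S\<close> by (meson subsetI)
        moreover from this have "y \<in> \<Union>S" using psubset.prems(3) by (meson subsetD)
        ultimately show ?thesis by (intro bexI[of _ y]) auto
      qed
      then obtain y where y: "y \<in> J" "y \<in> P" "\<forall>Q\<in>S - {P}. y \<notin> Q" using P by blast
      show ?thesis
      proof (cases "J \<subseteq> P")
        case False
        then obtain j where j: "j \<in> J" "j \<notin> P" by blast
        have "\<not> Q \<subseteq> P" if "Q \<in> S - {P}" for Q using only[of Q] P that by blast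
        then obtain w where w: "w \<in> carrier R - P" "\<forall>Q\<in>S - {P}. w \<in> Q"
          using outside_prime[OF Pp, of "S - {P}"] psubset.hyps(1) psubset.prems(1) primeidealD(1) by (metis DiffD1 finite_Diff)
        \<comment> \<open>\<open>y\<close> lies in \<open>P\<close> only and \<open>j w\<close> in all members but \<open>P\<close>, so that the sum escapes the cover.\<close>
        let ?z = "y \<oplus> j \<otimes> w"
        have jc: "j \<in> carrier R" "y \<in> carrier R" using j y ideal_closed(1)[OF J] by auto
        have zJ: "?z \<in> J" using ideal_closed[OF J] y j w by auto
        have canc: "a \<in> Q" if "ideal Q R" "a \<oplus> b \<in> Q" "b \<in> Q" "a \<in> carrier R" for a b Q
        proof -
          have bc: "b \<in> carrier R" using ideal_closed(1)[OF that(1,3)] .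
          have "(a \<oplus> b) \<oplus> \<ominus> b \<in> Q" using that ideal_closed(3,6)[OF that(1)] by blast
          then show ?thesis using that(4) bc by (simp add: a_assoc r_neg)
        qed
        have "?z \<notin> P"
        proof
          assume "?z \<in> P"
          then have "j \<otimes> w \<in> P" using canc[OF primeidealD(1)[OF Pp], of "j \<otimes> w" y] y jc w by (auto simp: a_comm)
          then show False using primeidealD(4)[OF Pp, of j w] j w jc by blast
        qed
        moreover have "?z \<notin> Q" if Q: "Q \<in> S - {P}" for Q
        proof
          have Qi: "ideal Q R" using psubset.prems(1) Q primeidealD(1) by blast
          assume "?z \<in> Q"
          moreover have "j \<otimes> w \<in> Q" using w Q ideal_closed(4)[OF Qi] jc by blast
          ultimately show False using canc[OF Qi, of y "j \<otimes> w"] jc y Q by blast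
        qed
        ultimately show ?thesis using zJ psubset.prems(3) by blast
      qed (use P in blast)
    qed
  qed
  then show ?thesis using that by blast
qed

end

definition prime_chain_over :: "('a, 'c) ring_scheme \<Rightarrow> 'a set \<Rightarrow> nat \<Rightarrow> bool" where
  "prime_chain_over R J n \<longleftrightarrow> (\<exists>P :: nat \<Rightarrow> 'a set.
    (\<forall>i\<le>n. primeideal (P i) R \<and> J \<subseteq> P i) \<and> (\<forall>i<n. P i \<subset> P (Suc i)))"

lemma prime_chain_over_antimono: "prime_chain_over R J n \<Longrightarrow> m \<le> n \<Longrightarrow> prime_chain_over R J m"
  unfolding prime_chain_over_def by (meson less_le_trans order_trans)

lemma prime_chain_over_1: "prime_chain_over R J 1 \<longleftrightarrow>
    (\<exists>P Q. primeideal P R \<and> primeideal Q R \<and> J \<subseteq> P \<and> P \<subset> Q)"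
proof
  assume "prime_chain_over R J 1"
  then obtain P where "\<forall>i\<le>1. primeideal (P i) R \<and> J \<subseteq> P i" "\<forall>i<1. P i \<subset> P (Suc i)"
    unfolding prime_chain_over_def by blast
  then have "primeideal (P 0) R" "J \<subseteq> P 0" "primeideal (P 1) R" "P 0 \<subset> P 1" by auto
  then show "\<exists>P Q. primeideal P R \<and> primeideal Q R \<and> J \<subseteq> P \<and> P \<subset> Q" by blast
next
  assume "\<exists>P Q. primeideal P R \<and> primeideal Q R \<and> J \<subseteq> P \<and> P \<subset> Q"
  then obtain P Q where "primeideal P R" "primeideal Q R" "J \<subseteq> P" "P \<subset> Q" by blast
  then show "prime_chain_over R J 1" unfolding prime_chain_over_def
    by (intro exI[of _ "\<lambda>i. if i = 0 then P else Q"]) auto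
qed

lemma prime_chain_over_2: "prime_chain_over R J 2 \<longleftrightarrow>
    (\<exists>P Q T. primeideal P R \<and> primeideal Q R \<and> primeideal T R \<and> J \<subseteq> P \<and> P \<subset> Q \<and> Q \<subset> T)"
proof
  assume "prime_chain_over R J 2"
  then obtain P where P: "\<forall>i\<le>2. primeideal (P i) R \<and> J \<subseteq> P i" "\<forall>i<2. P i \<subset> P (Suc i)"
    unfolding prime_chain_over_def by blast
  have "primeideal (P 0) R" "J \<subseteq> P 0" "primeideal (P (Suc 0)) R" "primeideal (P (Suc (Suc 0))) R"
    using P(1) by auto
  moreover have "P 0 \<subset> P (Suc 0)" "P (Suc 0) \<subset> P (Suc (Suc 0))" using P(2) by auto
  ultimately show "\<exists>P Q T. primeideal P R \<and> primeideal Q R \<and> primeideal T R \<and> J \<subseteq> P \<and> P \<subset> Q \<and> Q \<subset> T" by blast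
next
  assume "\<exists>P Q T. primeideal P R \<and> primeideal Q R \<and> primeideal T R \<and> J \<subseteq> P \<and> P \<subset> Q \<and> Q \<subset> T"
  then obtain P Q T where "primeideal P R" "primeideal Q R" "primeideal T R" "J \<subseteq> P" "P \<subset> Q" "Q \<subset> T" by blast
  then show "prime_chain_over R J 2" unfolding prime_chain_over_def
    by (intro exI[of _ "\<lambda>i. if i = 0 then P else if i = 1 then Q else T"]) (auto simp: less_Suc_eq numeral_2_eq_2)
qed

lemma primeideal_vimage:
  assumes R: "cring R" and S: "cring S" and h: "h \<in> ring_hom R S" and P: "primeideal P S"
  shows "primeideal {a \<in> carrier R. h a \<in> P} R"
proof -
  interpret h: ring_hom_cring R S h
    using R S h by (intro ring_hom_cring.intro ring_hom_cring_axioms.intro)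
  show ?thesis
  proof (rule primeidealI[OF h.ring.ideal_vimage[OF primeidealD(1)[OF P]] R])
    have "\<one>\<^bsub>R\<^esub> \<notin> {a \<in> carrier R. h a \<in> P}" using primeidealD(3)[OF P] by simp
    then show "carrier R \<noteq> {a \<in> carrier R. h a \<in> P}" using h.R.one_closed by blast
    fix a b assume ab: "a \<in> carrier R" "b \<in> carrier R" "a \<otimes>\<^bsub>R\<^esub> b \<in> {a \<in> carrier R. h a \<in> P}"
    then have "h a \<otimes>\<^bsub>S\<^esub> h b \<in> P" by auto
    then show "a \<in> {a \<in> carrier R. h a \<in> P} \<or> b \<in> {a \<in> carrier R. h a \<in> P}"
      using primeidealD(4)[OF P, of "h a" "h b"] ab by auto
  qed
qed

lemma (in cring) primeideal_image_Quot:
  assumes J: "ideal J R" and P: "primeideal P R" and JP: "J \<subseteq> P"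
  shows "primeideal ((+>) J ` P) (R Quot J)" and "\<And>a. a \<in> carrier R \<Longrightarrow> J +> a \<in> (+>) J ` P \<longleftrightarrow> a \<in> P"
proof -
  interpret J: ideal J R by fact
  note Pc = ideal_closed[OF primeidealD(1)[OF P]]
  have hom: "(+>) J \<in> ring_hom R (R Quot J)" by (rule J.rcos_ring_hom)
  show mem: "J +> a \<in> (+>) J ` P \<longleftrightarrow> a \<in> P" if a: "a \<in> carrier R" for a
  proof
    assume "J +> a \<in> (+>) J ` P"
    then obtain p where p: "p \<in> P" "J +> a = J +> p" by blast
    have "a \<in> J +> p" using J.a_rcos_self[OF a] p(2) by simp
    then obtain j where "j \<in> J" "a = j \<oplus> p" by (auto simp: a_r_coset_def' )
    then show "a \<in> P" using Pc(3) p JP by blast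
  qed blast
  have Qc: "carrier (R Quot J) = {J +> a | a. a \<in> carrier R}" by (auto simp: FactRing_def A_RCOSETS_def')
  show "primeideal ((+>) J ` P) (R Quot J)"
  proof (rule primeidealI[OF ring_ideal_imp_quot_ideal[OF J primeidealD(1)[OF P]] J.quotient_is_cring[OF is_cring]])
    have "J +> \<one> \<notin> (+>) J ` P" using mem primeidealD(3)[OF P] by simp
    then show "carrier (R Quot J) \<noteq> (+>) J ` P" unfolding Qc by blast
    fix x y assume "x \<in> carrier (R Quot J)" "y \<in> carrier (R Quot J)" and xy: "x \<otimes>\<^bsub>R Quot J\<^esub> y \<in> (+>) J ` P"
    then obtain a b where ab: "a \<in> carrier R" "b \<in> carrier R" "x = J +> a" "y = J +> b" unfolding Qc by blast
    then have "J +> (a \<otimes> b) \<in> (+>) J ` P" using xy ring_hom_mult[OF hom, of a b] by simp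
    then have "a \<otimes> b \<in> P" using mem ab by simp
    then show "x \<in> (+>) J ` P \<or> y \<in> (+>) J ` P" using primeidealD(4)[OF P] ab by blast
  qed
qed

lemma (in cring) krull_dim_Quot:
  assumes J: "ideal J R"
  shows "krull_dim (R Quot J) = Sup {enat n | n. prime_chain_over R J n}"
proof -
  interpret J: ideal J R by fact
  have hom: "(+>) J \<in> ring_hom R (R Quot J)" by (rule J.rcos_ring_hom)
  have Qc: "carrier (R Quot J) = {J +> a | a. a \<in> carrier R}" by (auto simp: FactRing_def A_RCOSETS_def')
  have "(\<exists>P. (\<forall>i\<le>n. primeideal (P i) (R Quot J)) \<and> (\<forall>i<n. P i \<subset> P (Suc i))) \<longleftrightarrow> prime_chain_over R J n" for n
  proof
    assume "\<exists>P. (\<forall>i\<le>n. primeideal (P i) (R Quot J)) \<and> (\<forall>i<n. P i \<subset> P (Suc i))"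
    then obtain P where P: "\<And>i. i \<le> n \<Longrightarrow> primeideal (P i) (R Quot J)" "\<And>i. i < n \<Longrightarrow> P i \<subset> P (Suc i)" by blast
    define P' where "P' i = {a \<in> carrier R. J +> a \<in> P i}" for i
    have "primeideal (P' i) R" if "i \<le> n" for i
      unfolding P'_def by (rule primeideal_vimage[OF is_cring J.quotient_is_cring[OF is_cring] hom P(1)[OF that]])
    moreover have "J \<subseteq> P' i" if "i \<le> n" for i
    proof
      fix a assume a: "a \<in> J"
      then have "J +> a = \<zero>\<^bsub>R Quot J\<^esub>" using J.a_rcos_const by (simp add: FactRing_def)
      then show "a \<in> P' i" using a cring.ideal_closed(2)[OF J.quotient_is_cring[OF is_cring] primeidealD(1)[OF P(1)[OF that]]]
        unfolding P'_def by auto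
    qed
    moreover have "P' i \<subset> P' (Suc i)" if i: "i < n" for i
    proof
      show "P' i \<subseteq> P' (Suc i)" using P(2)[OF i] unfolding P'_def by blast
      obtain x where x: "x \<in> P (Suc i)" "x \<notin> P i" using P(2)[OF i] by blast
      then have "x \<in> carrier (R Quot J)"
        using cring.ideal_closed(1)[OF J.quotient_is_cring[OF is_cring] primeidealD(1)[OF P(1)[of "Suc i"]]] i by simp
      then obtain a where "a \<in> carrier R" "x = J +> a" unfolding Qc by blast
      then show "P' i \<noteq> P' (Suc i)" using x unfolding P'_def by blast
    qed
    ultimately show "prime_chain_over R J n" unfolding prime_chain_over_def by blast
  next
    assume "prime_chain_over R J n"
    then obtain P where P: "\<And>i. i \<le> n \<Longrightarrow> primeideal (P i) R \<and> J \<subseteq> P i" "\<And>i. i < n \<Longrightarrow> P i \<subset> P (Suc i)"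
      unfolding prime_chain_over_def by blast
    have "primeideal ((+>) J ` P i) (R Quot J)" if "i \<le> n" for i
      using primeideal_image_Quot(1)[OF J] P(1)[OF that] by blast
    moreover have "(+>) J ` P i \<subset> (+>) J ` P (Suc i)" if i: "i < n" for i
    proof
      show "(+>) J ` P i \<subseteq> (+>) J ` P (Suc i)" using P(2)[OF i] by blast
      obtain a where a: "a \<in> P (Suc i)" "a \<notin> P i" using P(2)[OF i] by blast
      have "primeideal (P (Suc i)) R" using P(1)[of "Suc i"] i by simp
      then have "a \<in> carrier R" using a ideal_closed(1)[OF primeidealD(1)] by blast
      then have "J +> a \<notin> (+>) J ` P i" using primeideal_image_Quot(2)[OF J] P(1)[of i] i a by auto
      then show "(+>) J ` P i \<noteq> (+>) J ` P (Suc i)" using a by blast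
    qed
    ultimately show "\<exists>P. (\<forall>i\<le>n. primeideal (P i) (R Quot J)) \<and> (\<forall>i<n. P i \<subset> P (Suc i))" 
      by (intro exI[of _ "\<lambda>i. (+>) J ` P i"]) blast
  qed
  then show ?thesis unfolding krull_dim_def by simp
qed

lemma Sup_enat_eq_1:
  assumes down: "\<And>m n. Q n \<Longrightarrow> m \<le> n \<Longrightarrow> Q m"
  shows "Sup {enat n | n. Q n} = 1 \<longleftrightarrow> Q 1 \<and> \<not> Q (2::nat)"
proof
  assume sup: "Sup {enat n | n. Q n} = 1"
  have "\<not> Q 2"
  proof
    assume "Q 2"
    then have "enat 2 \<le> 1" using Sup_upper[of "enat 2" "{enat n | n. Q n}"] sup by auto
    then show False by (simp add: one_enat_def)
  qed
  moreover have "Q 1"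
  proof (rule ccontr)
    assume "\<not> Q 1"
    then have "n = 0" if "Q n" for n using down[OF that, of 1] by (cases n) auto
    then have "Sup {enat n | n. Q n} \<le> 0" by (intro Sup_least) (auto simp: zero_enat_def)
    then show False using sup by simp
  qed
  ultimately show "Q 1 \<and> \<not> Q 2" by blast
next
  assume Q: "Q 1 \<and> \<not> Q 2"
  have "n \<le> 1" if "Q n" for n using down[OF that, of 2] Q by (metis Suc_1 not_less_eq_eq)
  then have "Sup {enat n | n. Q n} \<le> 1" by (intro Sup_least) (auto simp: one_enat_def)
  moreover have "1 \<le> Sup {enat n | n. Q n}" using Q by (intro Sup_upper) (auto simp: one_enat_def)
  ultimately show "Sup {enat n | n. Q n} = 1" by (rule antisym)
qed

lemma (in module) annihilator_ideal: "ideal (annihilator R M) R"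
proof -
  have "annihilator R M = (if carrier M = {} then carrier R else \<Inter>((\<lambda>v. {a \<in> carrier R. a \<odot>\<^bsub>M\<^esub> v \<in> {\<zero>\<^bsub>M\<^esub>}}) ` carrier M))"
    by (auto simp: annihilator_def)
  moreover have "ideal (\<Inter>((\<lambda>v. {a \<in> carrier R. a \<odot>\<^bsub>M\<^esub> v \<in> {\<zero>\<^bsub>M\<^esub>}}) ` carrier M)) R"
    by (rule R.i_Intersect) (use colon_ideal[OF zero_submodule] M.zero_closed in auto)
  ultimately show ?thesis using M.zero_closed by auto
qed

lemma (in module) module_dim_1_iff:
  "module_dim R M = 1 \<longleftrightarrow> prime_chain_over R (annihilator R M) 1 \<and> \<not> prime_chain_over R (annihilator R M) 2"
  unfolding module_dim_def R.krull_dim_Quot[OF annihilator_ideal]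
  by (rule Sup_enat_eq_1) (rule prime_chain_over_antimono)


section \<open>Powers of ideals\<close>

context cring
begin

lemma ideal_pow_0: "ideal_pow R I 0 = carrier R"
  by (simp add: nat_pow_def ideals_set_def)

lemma ideal_pow_Suc: "ideal_pow R I (Suc n) = ideal_prod R (ideal_pow R I n) I"
  by (simp add: nat_pow_def ideals_set_def)

lemma ideal_pow_ideal: "ideal I R \<Longrightarrow> ideal (ideal_pow R I n) R"
proof (induct n)
  case 0 show ?case unfolding ideal_pow_0 by (rule oneideal)
next
  case (Suc n) then show ?case unfolding ideal_pow_Suc by (intro ideal_prod_is_ideal)
qed

lemma ideal_pow_add:
  assumes "ideal I R" shows "ideal_pow R I (n + m) = ideal_prod R (ideal_pow R I n) (ideal_pow R I m)"
proof -
  interpret S: comm_monoid "ideals_set R" by (rule ideals_set_is_comm_monoid)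
  have I: "I \<in> carrier (ideals_set R)" using assms by (simp add: ideals_set_def)
  have "ideal_prod R (ideal_pow R I n) (ideal_pow R I m) = ideal_pow R I n \<otimes>\<^bsub>ideals_set R\<^esub> ideal_pow R I m"
    by (simp add: ideals_set_def)
  also have "\<dots> = ideal_pow R I (n + m)" by (rule S.nat_pow_mult[OF I])
  finally show ?thesis by simp
qed

lemma ideal_pow_mult:
  assumes "ideal I R" "a \<in> ideal_pow R I n" "b \<in> ideal_pow R I m"
  shows "a \<otimes> b \<in> ideal_pow R I (n + m)"
  unfolding ideal_pow_add[OF assms(1)] using assms(2,3) by (rule ideal_prod.prod)

lemma ideal_pow_antimono:
  assumes "ideal I R" "n \<le> m" shows "ideal_pow R I m \<subseteq> ideal_pow R I n"
proof -
  obtain k where m: "m = n + k" using assms(2) le_Suc_ex by blast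
  show ?thesis unfolding m ideal_pow_add[OF assms(1)]
    using ideal_prod_inter[OF ideal_pow_ideal ideal_pow_ideal, OF assms(1) assms(1)] by blast
qed

lemma ideal_pow_in_carrier: "ideal I R \<Longrightarrow> a \<in> ideal_pow R I n \<Longrightarrow> a \<in> carrier R"
  using ideal_closed(1)[OF ideal_pow_ideal] .

lemma ideal_pow_1: "ideal I R \<Longrightarrow> ideal_pow R I (Suc 0) = I"
  unfolding ideal_pow_Suc ideal_pow_0
  using ideal_prod_commute[of "carrier R" I] ideal_prod_one[of I] oneideal by simp

lemma ideal_pow_pow:
  assumes I: "ideal I R" and x: "x \<in> I" shows "x [^] n \<in> ideal_pow R I n"
proof (induct n)
  case (Suc n) then show ?case unfolding ideal_pow_Suc using ideal_prod.prod[OF Suc x, of R] by simp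
qed (simp add: ideals_set_def)

lemma ideal_pow_mono:
  assumes I: "ideal I R" and J: "ideal J R" and IJ: "I \<subseteq> J"
  shows "ideal_pow R I n \<subseteq> ideal_pow R J n"
proof (induct n)
  case (Suc n)
  show ?case
  proof
    fix a assume "a \<in> ideal_pow R I (Suc n)"
    then show "a \<in> ideal_pow R J (Suc n)" unfolding ideal_pow_Suc
      by induct (use Suc IJ in \<open>auto intro: ideal_prod.intros\<close>)
  qed
qed (simp add: ideals_set_def)

end

context module
begin

lemma submodule_colon:
  assumes D: "submodule D R M" and L: "L \<subseteq> carrier R"
  shows "submodule (module_colon M D L) R M"
proof (rule submoduleI)
  note d = submoduleD[OF D]
  have c: "x \<in> carrier M" "a \<in> L \<Longrightarrow> a \<odot>\<^bsub>M\<^esub> x \<in> D" if "x \<in> module_colon M D L" for x a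
    using that by (auto simp: module_colon_def)
  show "module_colon M D L \<subseteq> carrier M" using c by blast
  show "\<zero>\<^bsub>M\<^esub> \<in> module_colon M D L" using d(2) L by (auto simp: module_colon_def subset_iff)
  show "\<ominus>\<^bsub>M\<^esub> a \<in> module_colon M D L" if "a \<in> module_colon M D L" for a
    using c[OF that] d(4) L by (auto simp: module_colon_def subset_iff smult_r_minus)
  show "a \<oplus>\<^bsub>M\<^esub> b \<in> module_colon M D L" if "a \<in> module_colon M D L" "b \<in> module_colon M D L" for a b
    using c[OF that(1)] c[OF that(2)] d(3) L by (auto simp: module_colon_def subset_iff smult_r_distr)
  show "r \<odot>\<^bsub>M\<^esub> x \<in> module_colon M D L" if r: "r \<in> carrier R" and x: "x \<in> module_colon M D L" for r x
  proof -
    have "a \<odot>\<^bsub>M\<^esub> (r \<odot>\<^bsub>M\<^esub> x) \<in> D" if a: "a \<in> L" for a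
      using smult_comm[of a r x] c[OF x] a r L d(5)[OF r c(2)[OF x a]] by auto
    then show ?thesis using c(1)[OF x] r by (auto simp: module_colon_def)
  qed
qed

lemma ideal_prod_smult:
  assumes W: "submodule W R M" and v: "v \<in> carrier M" and J: "ideal J R" and L: "ideal L R"
    and h: "\<And>b c. b \<in> J \<Longrightarrow> c \<in> L \<Longrightarrow> b \<odot>\<^bsub>M\<^esub> (c \<odot>\<^bsub>M\<^esub> v) \<in> W" and a: "a \<in> ideal_prod R J L"
  shows "a \<odot>\<^bsub>M\<^esub> v \<in> W"
proof -
  have "a \<in> carrier R \<and> a \<odot>\<^bsub>M\<^esub> v \<in> W"
    using a
  proof induct
    case (prod b c)
    then have "b \<in> carrier R" "c \<in> carrier R" using R.ideal_closed(1)[OF J] R.ideal_closed(1)[OF L] by auto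
    then show ?case using h[OF prod] v by (simp add: smult_assoc1)
  next
    case (sum s t) then show ?case using submodule_add[OF W] v by (simp add: smult_l_distr)
  qed
  then show ?thesis by blast
qed

lemma ideal_pow_smult:
  assumes W: "submodule W R M" and v: "v \<in> carrier M" and I: "ideal I R"
    and h: "\<And>b c. b \<in> ideal_pow R I n \<Longrightarrow> c \<in> ideal_pow R I m \<Longrightarrow> b \<odot>\<^bsub>M\<^esub> (c \<odot>\<^bsub>M\<^esub> v) \<in> W"
    and a: "a \<in> ideal_pow R I (n + m)"
  shows "a \<odot>\<^bsub>M\<^esub> v \<in> W"
  by (rule ideal_prod_smult[OF W v R.ideal_pow_ideal[OF I] R.ideal_pow_ideal[OF I] h])
     (use a R.ideal_pow_add[OF I] in auto)

lemma Idl_smult: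
  assumes W: "submodule W R M" and v: "v \<in> carrier M" and S: "S \<subseteq> carrier R"
    and h: "\<And>s. s \<in> S \<Longrightarrow> s \<odot>\<^bsub>M\<^esub> v \<in> W" and a: "a \<in> Idl S"
  shows "a \<odot>\<^bsub>M\<^esub> v \<in> W"
proof -
  have "Idl S \<subseteq> {a \<in> carrier R. a \<odot>\<^bsub>M\<^esub> v \<in> W}"
    by (rule R.genideal_minimal[OF colon_ideal[OF W v]]) (use S h in auto)
  then show ?thesis using a by blast
qed

lemma regular_mod_power:
  assumes a: "a \<in> carrier R" and reg: "\<And>v. v \<in> carrier M \<Longrightarrow> a \<odot>\<^bsub>M\<^esub> v \<in> D \<Longrightarrow> v \<in> D"
  shows "v \<in> carrier M \<Longrightarrow> (a [^] (n::nat)) \<odot>\<^bsub>M\<^esub> v \<in> D \<Longrightarrow> v \<in> D"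
proof (induct n arbitrary: v)
  case (Suc n)
  have "(a [^] n) \<odot>\<^bsub>M\<^esub> (a \<odot>\<^bsub>M\<^esub> v) \<in> D" using Suc.prems a by (simp add: smult_assoc1)
  then have "a \<odot>\<^bsub>M\<^esub> v \<in> D" using Suc.hyps[of "a \<odot>\<^bsub>M\<^esub> v"] Suc.prems(1) a by blast
  then show ?case using Suc.prems(1) reg by blast
qed simp

text \<open>If the generators of \<open>J\<close> act locally nilpotently on \<open>M / D\<close>, then a power of \<open>J\<close> annihilates
  \<open>M / D\<close>: the ascending chain \<open>(D : J\<^sup>k)\<close> stops at some \<open>B\<close> with \<open>(B : J) = B\<close>, and if \<open>B \<noteq> M\<close>,
  multiplying an element outside \<open>B\<close> by the highest power of each generator in turn that keeps it
  outside \<open>B\<close> yields an element of \<open>(B : J)\<close> outside \<open>B\<close>.\<close>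
lemma nilpotent_power:
  assumes noeth: "noeth_module R M" and J: "ideal J R" "J = Idl S" "finite S" "S \<subseteq> carrier R"
    and D: "submodule D R M"
    and nil: "\<And>a v. a \<in> S \<Longrightarrow> v \<in> carrier M \<Longrightarrow> \<exists>n::nat. (a [^] n) \<odot>\<^bsub>M\<^esub> v \<in> D"
  shows "\<exists>k. \<forall>a\<in>ideal_pow R J k. \<forall>v\<in>carrier M. a \<odot>\<^bsub>M\<^esub> v \<in> D"
proof -
  define B where "B k = module_colon M D (ideal_pow R J k)" for k
  have Jc: "ideal_pow R J k \<subseteq> carrier R" for k using R.ideal_pow_in_carrier[OF J(1)] by blast
  have Bs: "submodule (B k) R M" for k unfolding B_def by (rule submodule_colon[OF D Jc])
  have asc: "B k \<subseteq> B (Suc k)" for k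
    using R.ideal_pow_antimono[OF J(1), of k "Suc k"] unfolding B_def module_colon_def by auto
  obtain k where k: "\<And>n. n \<ge> k \<Longrightarrow> B n = B k"
    using asc_chain_condD[OF noeth[unfolded noeth_module_def], of B] Bs asc by metis
  have DB: "D \<subseteq> B k" using submodule_smult[OF D] submodule_in_carrier[OF D] Jc[of k]
    unfolding B_def module_colon_def by blast
  have colon: "y \<in> B k" if y: "y \<in> carrier M" and Jy: "\<And>a. a \<in> J \<Longrightarrow> a \<odot>\<^bsub>M\<^esub> y \<in> B k" for y
  proof -
    have "a \<odot>\<^bsub>M\<^esub> y \<in> D" if "a \<in> ideal_pow R J (Suc k)" for a
      by (rule ideal_prod_smult[OF D y R.ideal_pow_ideal[OF J(1)] J(1), of k])
         (use Jy that[unfolded R.ideal_pow_Suc] in \<open>auto simp: B_def module_colon_def\<close>)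
    then have "y \<in> B (Suc k)" unfolding B_def module_colon_def using y by blast
    then show ?thesis using k[of "Suc k"] by simp
  qed
  have "v \<in> B k" if v: "v \<in> carrier M" for v
  proof (rule ccontr)
    assume nv: "v \<notin> B k"
    have "\<exists>y\<in>carrier M - B k. \<forall>a\<in>S'. a \<odot>\<^bsub>M\<^esub> y \<in> B k" if "S' \<subseteq> S" "finite S'" for S'
      using that(2,1)
    proof (induct S')
      case empty then show ?case using v nv by blast
    next
      case (insert a S')
      then obtain y where y: "y \<in> carrier M" "y \<notin> B k" "\<And>b. b \<in> S' \<Longrightarrow> b \<odot>\<^bsub>M\<^esub> y \<in> B k" by auto
      have a: "a \<in> carrier R" "a \<in> S" using insert.prems J(4) by auto
      define n where "n = (LEAST n::nat. (a [^] n) \<odot>\<^bsub>M\<^esub> y \<in> B k)"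
      obtain n' where "(a [^] (n'::nat)) \<odot>\<^bsub>M\<^esub> y \<in> B k" using nil[OF a(2) y(1)] DB by blast
      then have n: "(a [^] n) \<odot>\<^bsub>M\<^esub> y \<in> B k" unfolding n_def by (rule LeastI)
      then have "n \<noteq> 0" using y(1,2) by (intro notI) simp
      then obtain m where m: "n = Suc m" using not0_implies_Suc by blast
      let ?y = "(a [^] m) \<odot>\<^bsub>M\<^esub> y"
      have "?y \<notin> B k" using not_less_Least[of m "\<lambda>n. (a [^] n) \<odot>\<^bsub>M\<^esub> y \<in> B k"] m n_def by simp
      moreover have "a \<odot>\<^bsub>M\<^esub> ?y \<in> B k"
        using n a y(1) smult_assoc1[of a "a [^] m" y] R.m_comm[of a "a [^] m"] by (simp add: m)
      moreover have "b \<odot>\<^bsub>M\<^esub> ?y \<in> B k" if b: "b \<in> S'" for b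
      proof -
        have bc: "b \<in> carrier R" using b insert.prems J(4) by blast
        then have "b \<odot>\<^bsub>M\<^esub> ?y = (a [^] m) \<odot>\<^bsub>M\<^esub> (b \<odot>\<^bsub>M\<^esub> y)" using a y(1) by (intro smult_comm) auto
        then show ?thesis using submodule_smult[OF Bs _ y(3)[OF b]] a by simp
      qed
      ultimately show ?case using a y(1) by (intro bexI[of _ ?y]) auto
    qed
    then obtain y where y: "y \<in> carrier M" "y \<notin> B k" "\<And>a. a \<in> S \<Longrightarrow> a \<odot>\<^bsub>M\<^esub> y \<in> B k" using J(3) by (meson DiffD1 DiffD2 subset_refl)
    have "a \<odot>\<^bsub>M\<^esub> y \<in> B k" if "a \<in> J" for a
      using Idl_smult[OF Bs y(1) J(4) y(3)] that J(2) by blast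
    then show False using colon[OF y(1)] y(2) by blast
  qed
  then show ?thesis unfolding B_def module_colon_def by blast
qed

text \<open>The maximal members of \<open>{(D : v) | v \<notin> D}\<close> are primes, and there are only finitely many of them: choose
  \<open>v\<^sub>P\<close> with \<open>P = (D : v\<^sub>P)\<close>; the submodule generated by all \<open>v\<^sub>P\<close> is already generated by
  finitely many, so each such \<open>P\<close> contains the intersection of finitely many others, hence equals one
  of them. An ideal of zero divisors lies in their union, so prime avoidance puts it into one \<open>P\<close>.\<close>
theorem zero_divisor_ideal:
  assumes R: "noetherian_ring R" and noeth: "noeth_module R M" and D: "submodule D R M"
    and J: "ideal J R"
    and zd: "\<And>a. a \<in> J \<Longrightarrow> \<exists>v\<in>carrier M - D. a \<odot>\<^bsub>M\<^esub> v \<in> D"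
  obtains v where "v \<in> carrier M - D" "\<And>a. a \<in> J \<Longrightarrow> a \<odot>\<^bsub>M\<^esub> v \<in> D"
proof -
  define q where "q v = {a \<in> carrier R. a \<odot>\<^bsub>M\<^esub> v \<in> D}" for v
  have qi: "ideal (q v) R" if "v \<in> carrier M" for v unfolding q_def by (rule colon_ideal[OF D that])
  define A where "A = {q v | v. v \<in> carrier M - D}"
  define T where "T = {P \<in> A. \<forall>Q\<in>A. P \<subseteq> Q \<longrightarrow> Q = P}"
  have below: "\<exists>P\<in>T. Q \<subseteq> P" if Q: "Q \<in> A" for Q
  proof -
    obtain P where "P \<in> A" "Q \<subseteq> P" "\<And>Q'. Q' \<in> A \<Longrightarrow> P \<subseteq> Q' \<Longrightarrow> Q' = P"
      by (rule asc_chain_cond_maximal[OF asc_chain_cond_ideals[OF R], of "\<lambda>P. P \<in> A" Q])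
         (use Q qi in \<open>auto simp: A_def\<close>)
    then show ?thesis unfolding T_def by blast
  qed
  have prime: "primeideal P R" if P: "P \<in> T" for P
  proof -
    obtain v where v: "v \<in> carrier M" "v \<notin> D" "P = q v" using P unfolding T_def A_def by blast
    show ?thesis
    proof (rule primeidealI)
      show "ideal P R" using qi v by simp
      show "cring R" by (rule R.is_cring)
      have "\<one> \<notin> P" unfolding v(3) q_def using v(1,2) by simp
      then show "carrier R \<noteq> P" using R.one_closed by blast
      fix a b assume ab: "a \<in> carrier R" "b \<in> carrier R" "a \<otimes> b \<in> P"
      show "a \<in> P \<or> b \<in> P"
      proof (cases "b \<in> P")
        case False
        then have "b \<odot>\<^bsub>M\<^esub> v \<in> carrier M - D" using ab v unfolding q_def by auto
        then have "q (b \<odot>\<^bsub>M\<^esub> v) \<in> A" unfolding A_def by blast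
        moreover have "P \<subseteq> q (b \<odot>\<^bsub>M\<^esub> v)"
        proof
          fix c assume c: "c \<in> P"
          then have cc: "c \<in> carrier R" "c \<odot>\<^bsub>M\<^esub> v \<in> D" unfolding v(3) q_def by auto
          have "c \<odot>\<^bsub>M\<^esub> (b \<odot>\<^bsub>M\<^esub> v) = b \<odot>\<^bsub>M\<^esub> (c \<odot>\<^bsub>M\<^esub> v)" using cc ab v by (intro smult_comm) auto
          then show "c \<in> q (b \<odot>\<^bsub>M\<^esub> v)" unfolding q_def using cc submodule_smult[OF D ab(2) cc(2)] by simp
        qed
        ultimately have "q (b \<odot>\<^bsub>M\<^esub> v) = P" using P unfolding T_def by blast
        moreover have "a \<in> q (b \<odot>\<^bsub>M\<^esub> v)" unfolding q_def using ab v by (auto simp: q_def smult_assoc1)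
        ultimately show ?thesis by blast
      qed simp
    qed
  qed
  have "\<forall>P\<in>T. \<exists>v. v \<in> carrier M - D \<and> P = q v" unfolding T_def A_def by blast
  then obtain y where y: "\<And>P. P \<in> T \<Longrightarrow> y P \<in> carrier M - D \<and> P = q (y P)" by metis
  define G where "G W \<longleftrightarrow> (\<exists>F. finite F \<and> F \<subseteq> T \<and> W = submodule_gen R M (y ` F))" for W
  have yc: "y ` F \<subseteq> carrier M" if "F \<subseteq> T" for F using that y by blast
  have "G (submodule_gen R M (y ` {}))" unfolding G_def by blast
  then obtain W where W: "G W" and maxW: "\<And>W'. G W' \<Longrightarrow> W \<subseteq> W' \<Longrightarrow> W' = W"
    by (rule asc_chain_cond_maximal[OF noeth[unfolded noeth_module_def], of G])
       (use submodule_gen_submodule yc in \<open>auto simp: G_def\<close>)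
  then obtain F where F: "finite F" "F \<subseteq> T" "W = submodule_gen R M (y ` F)" unfolding G_def by blast
  have "P \<in> F" if P: "P \<in> T" for P
  proof (rule ccontr)
    assume PF: "P \<notin> F"
    let ?W' = "submodule_gen R M (y ` insert P F)"
    have "W \<subseteq> ?W'" unfolding F(3)
      by (rule submodule_gen_least[OF submodule_gen_submodule[OF yc]])
         (use P F submodule_gen_upper[of "y ` insert P F"] in auto)
    moreover have "G ?W'" unfolding G_def using F P by blast
    ultimately have "?W' = W" using maxW by blast
    then have yP: "y P \<in> W" using submodule_gen_upper[of "y ` insert P F"] by blast
    have "\<not> Q \<subseteq> P" if Q: "Q \<in> F" for Q
      using Q P F(2) PF unfolding T_def by blast
    moreover have "ideal Q R" if "Q \<in> F" for Q using prime primeidealD(1) that F(2) by blast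
    ultimately obtain w where w: "w \<in> carrier R - P" "\<forall>Q\<in>F. w \<in> Q"
      using R.outside_prime[OF prime[OF P] F(1)] by blast
    have "W \<subseteq> {v \<in> carrier M. w \<odot>\<^bsub>M\<^esub> v \<in> D}" unfolding F(3)
    proof (rule submodule_gen_least)
      show "submodule {v \<in> carrier M. w \<odot>\<^bsub>M\<^esub> v \<in> D} R M"
        using submodule_smult_preimage[OF _ carrier_is_submodule D] w by blast
      have "w \<odot>\<^bsub>M\<^esub> y Q \<in> D" if Q: "Q \<in> F" for Q
      proof -
        have "w \<in> q (y Q)" using y[of Q] w(2) Q F(2) by blast
        then show ?thesis unfolding q_def by blast
      qed
      then show "y ` F \<subseteq> {v \<in> carrier M. w \<odot>\<^bsub>M\<^esub> v \<in> D}" using yc[OF F(2)] by blast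
    qed
    then have "w \<in> q (y P)" using yP w unfolding q_def by blast
    then show False using y[OF P] w by blast
  qed
  then have "finite T" using F(1) finite_subset[of T F] by blast
  moreover have "J \<subseteq> \<Union>T"
  proof
    fix a assume a: "a \<in> J"
    then obtain v where v: "v \<in> carrier M - D" "a \<odot>\<^bsub>M\<^esub> v \<in> D" using zd by blast
    then have "q v \<in> A" "a \<in> q v" unfolding A_def q_def using a R.ideal_closed(1)[OF J] by auto
    then show "a \<in> \<Union>T" using below by blast
  qed
  ultimately obtain P where P: "P \<in> T" "J \<subseteq> P" using R.prime_avoidance prime J by metis
  have "y P \<in> carrier M - D" using y[OF P(1)] by blast
  moreover have "a \<odot>\<^bsub>M\<^esub> y P \<in> D" if "a \<in> J" for a
  proof -
    have "a \<in> q (y P)" using y[OF P(1)] P(2) that by blast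
    then show ?thesis unfolding q_def by blast
  qed
  ultimately show ?thesis using that by blast
qed

text \<open>Over a local ring, if the primes over the annihilator of \<open>M\<close> form no chain of length two, an
  element \<open>x\<close> of the maximal ideal that is regular on \<open>M / D\<close> is a parameter for it: a prime \<open>P \<noteq> \<mm>\<close>
  over the annihilator of \<open>M / (D + x M)\<close> would contain \<open>x\<close> and, since \<open>x\<close> is regular, would
  contain a strictly smaller prime over the annihilator of \<open>M\<close>.\<close>
theorem regular_element_parameter:
  assumes local: "noetherian_local_ring R \<mm>" and dim: "\<not> prime_chain_over R (annihilator R M) 2"
    and D: "submodule D R M" and x: "x \<in> \<mm>"
    and reg: "\<And>v. v \<in> carrier M \<Longrightarrow> x \<odot>\<^bsub>M\<^esub> v \<in> D \<Longrightarrow> v \<in> D"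
    and y: "y \<in> \<mm>"
  obtains n :: nat where "\<And>v. v \<in> carrier M \<Longrightarrow> (y [^] n) \<odot>\<^bsub>M\<^esub> v \<in> D <+>\<^bsub>M\<^esub> (\<lambda>v. x \<odot>\<^bsub>M\<^esub> v) ` carrier M"
proof -
  have noeth: "noetherian_ring R" and max: "maximalideal \<mm> R" and uniq: "\<And>J. maximalideal J R \<Longrightarrow> J = \<mm>"
    using local unfolding noetherian_local_ring_def by auto
  have mp: "primeideal \<mm> R" by (rule R.maximalideal_prime[OF max])
  have mi: "ideal \<mm> R" by (rule primeidealD(1)[OF mp])
  have xc: "x \<in> carrier R" and yc: "y \<in> carrier R" using x y R.ideal_closed(1)[OF mi] by auto
  let ?E = "D <+>\<^bsub>M\<^esub> (\<lambda>v. x \<odot>\<^bsub>M\<^esub> v) ` carrier M"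
  have xM: "submodule ((\<lambda>v. x \<odot>\<^bsub>M\<^esub> v) ` carrier M) R M" by (rule submodule_smult_image[OF xc carrier_is_submodule])
  have E: "submodule ?E R M" "D \<subseteq> ?E" "(\<lambda>v. x \<odot>\<^bsub>M\<^esub> v) ` carrier M \<subseteq> ?E"
    using submodule_sum[OF D xM] sum_upper[OF D xM] by auto
  define \<aa> where "\<aa> = {r \<in> carrier R. \<forall>v\<in>carrier M. r \<odot>\<^bsub>M\<^esub> v \<in> ?E}"
  have "\<aa> = \<Inter>((\<lambda>v. {a \<in> carrier R. a \<odot>\<^bsub>M\<^esub> v \<in> ?E}) ` carrier M)"
    unfolding \<aa>_def using M.zero_closed by auto
  then have ai: "ideal \<aa> R"
    using R.i_Intersect[of "(\<lambda>v. {a \<in> carrier R. a \<odot>\<^bsub>M\<^esub> v \<in> ?E}) ` carrier M"] colon_ideal[OF E(1)] M.zero_closed by auto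
  have ann: "annihilator R M \<subseteq> \<aa>" unfolding \<aa>_def annihilator_def using submodule_zero[OF E(1)] by auto
  have regn: "v \<in> D" if "v \<in> carrier M" "(x [^] (n::nat)) \<odot>\<^bsub>M\<^esub> v \<in> D" for v n
    by (rule regular_mod_power[OF xc reg that])
  have "\<exists>n::nat. y [^] n \<in> \<aa>"
  proof (rule ccontr)
    assume no: "\<not> ?thesis"
    define S where "S = {y [^] n | n::nat. True}"
    have "y [^] (n::nat) \<in> S" for n unfolding S_def by blast
    then have one: "\<one> \<in> S" and yS: "y \<in> S" using R.nat_pow_0[of y] R.nat_pow_eone[OF yc] by metis+
    have mult: "a \<otimes> b \<in> S" if ab: "a \<in> S" "b \<in> S" for a b
    proof -
      obtain n m :: nat where "a = y [^] n" "b = y [^] m" using ab unfolding S_def by blast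
      then have "a \<otimes> b = y [^] (n + m)" using yc by (simp add: R.nat_pow_mult)
      then show ?thesis unfolding S_def by blast
    qed
    have "S \<subseteq> carrier R" "\<aa> \<inter> S = {}" using yc no unfolding S_def by auto
    then obtain P where P: "primeideal P R" "\<aa> \<subseteq> P" "P \<inter> S = {}"
      using R.prime_avoiding[OF noeth ai one _ mult] by metis
    obtain P' where "maximalideal P' R" "P \<subseteq> P'"
      using R.exists_maximal_ideal[OF noeth primeidealD(1)[OF P(1)]] primeidealD(2)[OF P(1)] by metis
    then have "P \<subseteq> \<mm>" using uniq by blast
    then have Pm: "P \<subset> \<mm>" using y yS P(3) by blast
    have xa: "x \<in> \<aa>" unfolding \<aa>_def using xc E(3) by blast
    have "s \<in> P" if s: "s \<in> carrier R" "x [^] (n::nat) \<otimes> s \<in> annihilator R M" for n s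
    proof -
      have "s \<odot>\<^bsub>M\<^esub> v \<in> D" if v: "v \<in> carrier M" for v
      proof (rule regn)
        have "(x [^] n) \<odot>\<^bsub>M\<^esub> (s \<odot>\<^bsub>M\<^esub> v) = \<zero>\<^bsub>M\<^esub>"
          using s v xc by (simp add: annihilator_def smult_assoc1)
        then show "(x [^] n) \<odot>\<^bsub>M\<^esub> (s \<odot>\<^bsub>M\<^esub> v) \<in> D" using submodule_zero[OF D] by simp
      qed (use s v in auto)
      then have "s \<in> \<aa>" unfolding \<aa>_def using s(1) E(2) by blast
      then show ?thesis using P(2) by blast
    qed
    then obtain P'' where "primeideal P'' R" "annihilator R M \<subseteq> P''" "P'' \<subset> P"
      using R.prime_strictly_below[OF noeth annihilator_ideal P(1), of x] xa P(2) by blast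
    then have "prime_chain_over R (annihilator R M) 2"
      unfolding prime_chain_over_2 using P(1) mp Pm by blast
    then show False using dim by blast
  qed
  then show ?thesis using that unfolding \<aa>_def by blast
qed


section \<open>Finite length over a local ring\<close>

text \<open>\<open>(W + R v) / W\<close> is a quotient of the residue field.\<close>
lemma rel_length_simple:
  assumes local: "noetherian_local_ring R \<mm>" and W: "submodule W R M" and v: "v \<in> carrier M"
    and kill: "\<And>a. a \<in> \<mm> \<Longrightarrow> a \<odot>\<^bsub>M\<^esub> v \<in> W"
  shows "rel_length R M W (W <+>\<^bsub>M\<^esub> {a \<odot>\<^bsub>M\<^esub> v | a. a \<in> carrier R}) \<le> 1"
proof (rule rel_length_leI)
  let ?V = "W <+>\<^bsub>M\<^esub> {a \<odot>\<^bsub>M\<^esub> v | a. a \<in> carrier R}"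
  have top: "?V \<subseteq> U" if U: "submodule U R M" and WU: "W \<subset> U" and UV: "U \<subseteq> ?V" for U
  proof -
    obtain u where u: "u \<in> U" "u \<notin> W" using WU by blast
    then obtain w r where wr: "w \<in> W" "r \<in> carrier R" "u = w \<oplus>\<^bsub>M\<^esub> r \<odot>\<^bsub>M\<^esub> v"
      using UV by (fastforce simp: mem_set_add)
    have wc: "w \<in> carrier M" using submodule_in_carrier[OF W wr(1)] .
    have "r \<notin> \<mm>" using kill u(2) wr submodule_add[OF W] by blast
    then obtain s where s: "s \<in> carrier R" "s \<otimes> r = \<one>" using R.local_unit[OF local wr(2)] by blast
    have "r \<odot>\<^bsub>M\<^esub> v \<in> U"
      using submodule_add_cancel[OF U, of "r \<odot>\<^bsub>M\<^esub> v" w] u(1) wr wc WU v by (auto simp: M.a_comm)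
    then have "s \<odot>\<^bsub>M\<^esub> (r \<odot>\<^bsub>M\<^esub> v) \<in> U" using submodule_smult[OF U s(1)] by blast
    then have vU: "v \<in> U" using s wr(2) v smult_assoc1[of s r v] by simp
    show ?thesis by (rule sum_least[OF U]) (use WU vU submodule_smult[OF U] in auto)
  qed
  fix n assume ch: "submodule_chain R M W ?V n"
  show "enat n \<le> 1"
  proof (cases n)
    case (Suc m)
    obtain V1 where V1: "submodule_chain R M W V1 m" "V1 \<subset> ?V"
      using ch[unfolded Suc] by (cases rule: submodule_chain.cases) blast
    have "m = 0"
    proof (cases m)
      case (Suc l)
      obtain V2 where "submodule_chain R M W V2 l" "V2 \<subset> V1" "submodule V1 R M"
        using V1(1)[unfolded Suc] by (cases rule: submodule_chain.cases) blast
      then have "?V \<subseteq> V1" using top[of V1] V1(2) submodule_chain_submodules(3)[of R M W V2 l] by blast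
      then show ?thesis using V1(2) by blast
    qed
    then show ?thesis using Suc by (simp add: one_enat_def)
  qed (simp add: zero_enat_def flip: zero_enat_def)
qed

text \<open>Take a submodule that is maximal among those between \<open>W\<close> and \<open>V\<close> of finite length over \<open>W\<close>;
  adjoining a further element of \<open>V\<close> would add at most one to the length.\<close>
lemma rel_length_finite_max:
  assumes local: "noetherian_local_ring R \<mm>" and noeth: "noeth_module R M"
    and W: "submodule W R M" and V: "submodule V R M" and WV: "W \<subseteq> V"
    and kill: "\<And>a v. a \<in> \<mm> \<Longrightarrow> v \<in> V \<Longrightarrow> a \<odot>\<^bsub>M\<^esub> v \<in> W"
  shows "rel_length R M W V \<noteq> \<infinity>"
proof -
  define S where "S U \<longleftrightarrow> submodule U R M \<and> W \<subseteq> U \<and> U \<subseteq> V \<and> rel_length R M W U \<noteq> \<infinity>" for U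
  have "S W" unfolding S_def using W WV by (simp add: rel_length_refl)
  then obtain U where U: "S U" and max: "\<And>U'. S U' \<Longrightarrow> U \<subseteq> U' \<Longrightarrow> U' = U"
    by (rule asc_chain_cond_maximal[OF noeth[unfolded noeth_module_def], of S]) (auto simp: S_def)
  have Us: "submodule U R M" and WU: "W \<subseteq> U" and UV: "U \<subseteq> V" and Ufin: "rel_length R M W U \<noteq> \<infinity>"
    using U unfolding S_def by auto
  have "v \<in> U" if v: "v \<in> V" for v
  proof -
    have vc: "v \<in> carrier M" using submodule_in_carrier[OF V v] .
    let ?C = "{a \<odot>\<^bsub>M\<^esub> v | a. a \<in> carrier R}"
    have C: "submodule ?C R M" by (rule submodule_cyclic[OF vc])
    have s: "submodule (U <+>\<^bsub>M\<^esub> ?C) R M" "U \<subseteq> U <+>\<^bsub>M\<^esub> ?C" "?C \<subseteq> U <+>\<^bsub>M\<^esub> ?C"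
      using submodule_sum[OF Us C] sum_upper[OF Us C] by auto
    have "rel_length R M U (U <+>\<^bsub>M\<^esub> ?C) \<le> 1"
      by (rule rel_length_simple[OF local Us vc]) (use kill v WU in blast)
    then have "rel_length R M U (U <+>\<^bsub>M\<^esub> ?C) \<noteq> \<infinity>" by (rule enat_le_finite) simp
    then have "rel_length R M W (U <+>\<^bsub>M\<^esub> ?C) \<noteq> \<infinity>"
      using rel_length_add[OF W Us s(1) WU s(2)] Ufin by (auto simp: plus_eq_infty_iff_enat)
    moreover have "U <+>\<^bsub>M\<^esub> ?C \<subseteq> V"
      by (rule sum_least[OF V UV]) (use submodule_smult[OF V _ v] in blast)
    ultimately have "S (U <+>\<^bsub>M\<^esub> ?C)" unfolding S_def using s WU by blast
    then show ?thesis using max s(2,3) cyclic_self[OF vc] by blast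
  qed
  then have "U = V" using UV by blast
  then show ?thesis using Ufin by simp
qed

text \<open>Induction on \<open>k\<close> along \<open>W \<subseteq> V \<inter> (W : J) \<subseteq> V\<close>: the lower quotient is killed by \<open>J\<close>, the upper one by a smaller
  power of \<open>J\<close>. The base case is a hypothesis so that the induction can be run first for \<open>\<mm>\<close> and then for
  an \<open>\<mm>\<close>-primary ideal.\<close>
lemma rel_length_finite_power:
  assumes J: "ideal J R"
    and base: "\<And>W V. submodule W R M \<Longrightarrow> submodule V R M \<Longrightarrow> W \<subseteq> V \<Longrightarrow>
      (\<And>a v. a \<in> J \<Longrightarrow> v \<in> V \<Longrightarrow> a \<odot>\<^bsub>M\<^esub> v \<in> W) \<Longrightarrow> rel_length R M W V \<noteq> \<infinity>"
    and W: "submodule W R M" and V: "submodule V R M" and WV: "W \<subseteq> V"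
    and kill: "\<And>a v. a \<in> ideal_pow R J k \<Longrightarrow> v \<in> V \<Longrightarrow> a \<odot>\<^bsub>M\<^esub> v \<in> W"
  shows "rel_length R M W V \<noteq> \<infinity>"
  using W WV kill
proof (induct k arbitrary: W)
  case 0
  have "v \<in> W" if "v \<in> V" for v
    using "0.prems"(3)[of \<one> v] that submodule_in_carrier[OF V] by (simp add: ideals_set_def)
  then have "V = W" using "0.prems"(2) by blast
  then show ?case by (simp add: rel_length_refl)
next
  case (Suc k)
  let ?U = "V \<inter> module_colon M W J"
  have Jc: "J \<subseteq> carrier R" using R.ideal_closed(1)[OF J] by blast
  have U: "submodule ?U R M" by (rule submodule_Int[OF V submodule_colon[OF Suc.prems(1) Jc]])
  have WU: "W \<subseteq> ?U"
    using Suc.prems(2) submodule_smult[OF Suc.prems(1)] submodule_in_carrier[OF Suc.prems(1)] Jc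
    unfolding module_colon_def by blast
  have "rel_length R M W ?U \<noteq> \<infinity>"
    by (rule base[OF Suc.prems(1) U WU]) (auto simp: module_colon_def)
  moreover have "rel_length R M ?U V \<noteq> \<infinity>"
  proof (rule Suc.hyps[OF U])
    fix a v assume a: "a \<in> ideal_pow R J k" and v: "v \<in> V"
    have ac: "a \<in> carrier R" and vc: "v \<in> carrier M"
      using R.ideal_pow_in_carrier[OF J a] submodule_in_carrier[OF V v] by auto
    have "b \<odot>\<^bsub>M\<^esub> (a \<odot>\<^bsub>M\<^esub> v) \<in> W" if b: "b \<in> J" for b
    proof -
      have "b \<otimes> a = a \<otimes> b" using b ac Jc by (intro R.m_comm) auto
      then have "b \<otimes> a \<in> ideal_pow R J (Suc k)" unfolding R.ideal_pow_Suc using ideal_prod.prod[OF a b] by simp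
      then show ?thesis using Suc.prems(3)[OF _ v] b ac vc Jc by (auto simp flip: smult_assoc1)
    qed
    then show "a \<odot>\<^bsub>M\<^esub> v \<in> ?U"
      using submodule_smult[OF V ac v] ac vc unfolding module_colon_def by auto
  qed auto
  ultimately show ?case using rel_length_add[OF Suc.prems(1) U V WU] by (auto simp: plus_eq_infty_iff_enat)
qed


text \<open>Nakayama's lemma for a quotient \<open>M / D\<close>, in the form that \<open>\<mm> (M / D)\<close> lies in a proper
  submodule: any maximal proper submodule \<open>D'\<close> over \<open>D\<close> will do.\<close>
lemma nakayama_proper:
  assumes local: "noetherian_local_ring R \<mm>" and noeth: "noeth_module R M"
    and D: "submodule D R M" "D \<noteq> carrier M"
  obtains D' where "submodule D' R M" "D \<subseteq> D'" "D' \<noteq> carrier M"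
    "\<And>a v. a \<in> \<mm> \<Longrightarrow> v \<in> carrier M \<Longrightarrow> a \<odot>\<^bsub>M\<^esub> v \<in> D'"
proof -
  have max: "maximalideal \<mm> R" using local unfolding noetherian_local_ring_def by blast
  have mi: "ideal \<mm> R" by (rule primeidealD(1)[OF R.maximalideal_prime[OF max]])
  have one: "\<one> \<notin> \<mm>" by (rule primeidealD(3)[OF R.maximalideal_prime[OF max]])
  obtain D' where D': "submodule D' R M \<and> D' \<noteq> carrier M" "D \<subseteq> D'"
    and mx: "\<And>U. submodule U R M \<and> U \<noteq> carrier M \<Longrightarrow> D' \<subseteq> U \<Longrightarrow> U = D'"
    by (rule asc_chain_cond_maximal[OF noeth[unfolded noeth_module_def], of "\<lambda>U. submodule U R M \<and> U \<noteq> carrier M" D])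
       (use D in auto)
  have Ds: "submodule D' R M" using D' by blast
  have "a \<odot>\<^bsub>M\<^esub> v \<in> D'" if a: "a \<in> \<mm>" and v: "v \<in> carrier M" for a v
  proof (rule ccontr)
    assume no: "a \<odot>\<^bsub>M\<^esub> v \<notin> D'"
    have ac: "a \<in> carrier R" using R.ideal_closed(1)[OF mi a] .
    have avc: "a \<odot>\<^bsub>M\<^esub> v \<in> carrier M" using ac v by simp
    let ?C = "{r \<odot>\<^bsub>M\<^esub> (a \<odot>\<^bsub>M\<^esub> v) | r. r \<in> carrier R}"
    have C: "submodule ?C R M" by (rule submodule_cyclic[OF avc])
    have "D' <+>\<^bsub>M\<^esub> ?C = carrier M"
      using mx[of "D' <+>\<^bsub>M\<^esub> ?C"] submodule_sum[OF Ds C] sum_upper[OF Ds C] cyclic_self[OF avc] no by blast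
    then obtain d r where dr: "d \<in> D'" "r \<in> carrier R" "v = d \<oplus>\<^bsub>M\<^esub> r \<odot>\<^bsub>M\<^esub> (a \<odot>\<^bsub>M\<^esub> v)"
      using v by (fastforce simp: mem_set_add)
    have dc: "d \<in> carrier M" using submodule_in_carrier[OF Ds dr(1)] .
    let ?u = "\<one> \<oplus> \<ominus> (r \<otimes> a)"
    have "?u \<odot>\<^bsub>M\<^esub> v = v \<oplus>\<^bsub>M\<^esub> \<ominus>\<^bsub>M\<^esub> (r \<odot>\<^bsub>M\<^esub> (a \<odot>\<^bsub>M\<^esub> v))"
      using ac dr(2) v by (simp add: smult_l_distr smult_l_minus smult_assoc1)
    also have "\<dots> = (d \<oplus>\<^bsub>M\<^esub> r \<odot>\<^bsub>M\<^esub> (a \<odot>\<^bsub>M\<^esub> v)) \<oplus>\<^bsub>M\<^esub> \<ominus>\<^bsub>M\<^esub> (r \<odot>\<^bsub>M\<^esub> (a \<odot>\<^bsub>M\<^esub> v))"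
      using dr(3) by simp
    also have "\<dots> = d" using dc dr(2) avc by (simp add: M.a_assoc M.r_neg)
    finally have u: "?u \<odot>\<^bsub>M\<^esub> v = d" .
    have "?u \<notin> \<mm>"
    proof
      assume "?u \<in> \<mm>"
      then have "?u \<oplus> r \<otimes> a \<in> \<mm>" using R.ideal_closed(3,4)[OF mi] dr(2) a by blast
      then show False using one ac dr(2) by (simp add: R.a_assoc R.l_neg)
    qed
    then obtain s where s: "s \<in> carrier R" "s \<otimes> ?u = \<one>" using R.local_unit[OF local, of ?u] ac dr(2) by auto
    have "s \<odot>\<^bsub>M\<^esub> d = v" using s ac dr(2) v u smult_assoc1[of s ?u v] by simp
    then have "v \<in> D'" using submodule_smult[OF Ds s(1) dr(1)] by simp
    then show False using no submodule_smult[OF Ds ac] by blast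
  qed
  then show ?thesis using that D' by blast
qed

end


section \<open>Submodules of the form \<open>I\<^sup>n M\<close>\<close>

context module
begin

lemma ideal_smult_submodule:
  assumes "J \<subseteq> carrier R" shows "submodule (ideal_smult R J M) R M"
  unfolding ideal_smult_def by (rule submodule_gen_submodule) (use assms in auto)

lemma ideal_smult_mem: "a \<in> J \<Longrightarrow> v \<in> carrier M \<Longrightarrow> a \<odot>\<^bsub>M\<^esub> v \<in> ideal_smult R J M"
  unfolding ideal_smult_def by (rule subsetD[OF submodule_gen_upper]) blast

lemma ideal_smult_least:
  assumes "submodule W R M" "\<And>a v. a \<in> J \<Longrightarrow> v \<in> carrier M \<Longrightarrow> a \<odot>\<^bsub>M\<^esub> v \<in> W"
  shows "ideal_smult R J M \<subseteq> W"
  unfolding ideal_smult_def by (rule submodule_gen_least[OF assms(1)]) (use assms(2) in blast)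

abbreviation pow_mult :: "'a set \<Rightarrow> nat \<Rightarrow> 'c set" where
  "pow_mult I n \<equiv> ideal_smult R (ideal_pow R I n) M"

context
  fixes I assumes I: "ideal I R"
begin

lemma pow_mult_submodule: "submodule (pow_mult I n) R M"
  by (rule ideal_smult_submodule) (use R.ideal_pow_in_carrier[OF I] in blast)

lemma pow_mult_smult:
  assumes "a \<in> ideal_pow R I n" "u \<in> pow_mult I m" shows "a \<odot>\<^bsub>M\<^esub> u \<in> pow_mult I (n + m)"
proof -
  have ac: "a \<in> carrier R" by (rule R.ideal_pow_in_carrier[OF I assms(1)])
  have "pow_mult I m \<subseteq> {u \<in> carrier M. a \<odot>\<^bsub>M\<^esub> u \<in> pow_mult I (n + m)}"
  proof (rule ideal_smult_least)
    show "submodule {u \<in> carrier M. a \<odot>\<^bsub>M\<^esub> u \<in> pow_mult I (n + m)} R M"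
      by (rule submodule_smult_preimage[OF ac carrier_is_submodule pow_mult_submodule])
    fix b v assume b: "b \<in> ideal_pow R I m" and v: "v \<in> carrier M"
    have bc: "b \<in> carrier R" by (rule R.ideal_pow_in_carrier[OF I b])
    have "(a \<otimes> b) \<odot>\<^bsub>M\<^esub> v \<in> pow_mult I (n + m)" by (rule ideal_smult_mem[OF R.ideal_pow_mult[OF I assms(1) b] v])
    then show "b \<odot>\<^bsub>M\<^esub> v \<in> {u \<in> carrier M. a \<odot>\<^bsub>M\<^esub> u \<in> pow_mult I (n + m)}"
      using ac bc v by (simp add: smult_assoc1)
  qed
  then show ?thesis using assms(2) by blast
qed

lemma pow_mult_antimono: "n \<le> m \<Longrightarrow> pow_mult I m \<subseteq> pow_mult I n"
  by (rule ideal_smult_least[OF pow_mult_submodule])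
     (use R.ideal_pow_antimono[OF I] ideal_smult_mem in blast)

lemma pow_mult_add_least:
  assumes W: "submodule W R M" and h: "\<And>a u. a \<in> ideal_pow R I n \<Longrightarrow> u \<in> pow_mult I m \<Longrightarrow> a \<odot>\<^bsub>M\<^esub> u \<in> W"
  shows "pow_mult I (n + m) \<subseteq> W"
proof (rule ideal_smult_least[OF W])
  fix a v assume a: "a \<in> ideal_pow R I (n + m)" and v: "v \<in> carrier M"
  show "a \<odot>\<^bsub>M\<^esub> v \<in> W"
    by (rule ideal_pow_smult[OF W v I _ a]) (use h ideal_smult_mem v in blast)
qed

lemma pow_mult_Suc_least:
  assumes W: "submodule W R M" and X: "I = Idl X" "X \<subseteq> carrier R"
    and h: "\<And>x u. x \<in> X \<Longrightarrow> u \<in> pow_mult I n \<Longrightarrow> x \<odot>\<^bsub>M\<^esub> u \<in> W"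
  shows "pow_mult I (Suc n) \<subseteq> W"
proof -
  have "pow_mult I (Suc 0 + n) \<subseteq> W"
  proof (rule pow_mult_add_least[OF W])
    fix a u assume a: "a \<in> ideal_pow R I (Suc 0)" and u: "u \<in> pow_mult I n"
    show "a \<odot>\<^bsub>M\<^esub> u \<in> W"
      by (rule Idl_smult[OF W submodule_in_carrier[OF pow_mult_submodule u] X(2) h[OF _ u]])
         (use a X(1) R.ideal_pow_1[OF I] in auto)
  qed
  then show ?thesis by simp
qed

end

end


lemma module_colon_antimono: "L \<subseteq> L' \<Longrightarrow> module_colon M A L' \<subseteq> module_colon M A L"
  unfolding module_colon_def by blast


section \<open>One-dimensional modules over a local ring\<close>

locale one_dim_module =
  fixes R :: "('a, 'c) ring_scheme" and M :: "('a, 'b, 'd) module_scheme" (structure)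
    and \<mm> I :: "'a set"
  assumes local: "noetherian_local_ring R \<mm>" and primary: "primary_to R \<mm> I"
    and fin_gen: "fin_gen_module R M" and dim_one: "module_dim R M = 1"

sublocale one_dim_module \<subseteq> module R M
  using fin_gen unfolding fin_gen_module_def by blast

context one_dim_module
begin

lemma noeth_R: "noetherian_ring R" and max: "maximalideal \<mm> R"
  and max_unique: "maximalideal J R \<Longrightarrow> J = \<mm>"
  using local unfolding noetherian_local_ring_def by auto

lemma noeth_M: "noeth_module R M" by (rule noeth_module_fin_gen[OF noeth_R fin_gen])

lemma prime_m: "primeideal \<mm> R" by (rule R.maximalideal_prime[OF max])

lemma ideal_m: "ideal \<mm> R" by (rule primeidealD(1)[OF prime_m])

lemma ideal_I: "ideal I R" and I_proper: "I \<noteq> carrier R"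
  and m_radical: "x \<in> \<mm> \<longleftrightarrow> x \<in> carrier R \<and> (\<exists>n::nat. x [^]\<^bsub>R\<^esub> n \<in> I)"
  using primary unfolding primary_to_def primary_ideal_def radical_def by auto

lemma I_carrier: "x \<in> I \<Longrightarrow> x \<in> carrier R" by (rule R.ideal_closed(1)[OF ideal_I])

lemma I_le_m: "I \<subseteq> \<mm>"
proof
  fix x assume x: "x \<in> I"
  have "x [^]\<^bsub>R\<^esub> (1::nat) \<in> I" using x I_carrier[OF x] by simp
  then show "x \<in> \<mm>" unfolding m_radical using I_carrier[OF x] by blast
qed

lemma m_power_le_I:
  obtains k where "ideal_pow R \<mm> k \<subseteq> I"
proof -
  interpret S: module R "self_module R" by (rule R.module_self)
  obtain S where S: "S \<subseteq> carrier R" "finite S" "\<mm> = Idl\<^bsub>R\<^esub> S"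
    using noetherian_ring.finetely_gen[OF noeth_R ideal_m] by blast
  have "S \<subseteq> \<mm>" unfolding S(3) by (rule R.genideal_self[OF S(1)])
  have "\<exists>k. \<forall>a\<in>ideal_pow R \<mm> k. \<forall>v\<in>carrier (self_module R). a \<odot>\<^bsub>self_module R\<^esub> v \<in> I"
  proof (rule S.nilpotent_power[OF _ ideal_m S(3,2,1)])
    show "noeth_module R (self_module R)" using R.noetherian_ring_iff noeth_R by blast
    show "submodule I R (self_module R)" using R.submodule_self_iff ideal_I by blast
    fix a v assume a: "a \<in> S" and v: "v \<in> carrier (self_module R)"
    then obtain n :: nat where "a [^]\<^bsub>R\<^esub> n \<in> I" using m_radical \<open>S \<subseteq> \<mm>\<close> by blast
    then have "a [^]\<^bsub>R\<^esub> n \<otimes>\<^bsub>R\<^esub> v \<in> I" using R.ideal_closed(5)[OF ideal_I] v by (simp add: self_module_def)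
    then show "\<exists>n::nat. a [^]\<^bsub>R\<^esub> n \<odot>\<^bsub>self_module R\<^esub> v \<in> I" by (auto simp: self_module_def)
  qed
  then obtain k where k: "\<And>a v. a \<in> ideal_pow R \<mm> k \<Longrightarrow> v \<in> carrier (self_module R) \<Longrightarrow> a \<odot>\<^bsub>self_module R\<^esub> v \<in> I"
    by blast
  have "a \<in> I" if "a \<in> ideal_pow R \<mm> k" for a
    using k[OF that, of "\<one>\<^bsub>R\<^esub>"] R.ideal_pow_in_carrier[OF ideal_m that] by (simp add: self_module_def)
  then show ?thesis using that by blast
qed

lemma length_finite:
  assumes "submodule W R M" "submodule V R M" "W \<subseteq> V"
    and "\<And>a v. a \<in> ideal_pow R I n \<Longrightarrow> v \<in> V \<Longrightarrow> a \<odot> v \<in> W"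
  shows "rel_length R M W V \<noteq> \<infinity>"
proof (rule rel_length_finite_power[OF ideal_I _ assms])
  fix W V assume W: "submodule W R M" and V: "submodule V R M" and WV: "W \<subseteq> V"
    and kill: "\<And>a v. a \<in> I \<Longrightarrow> v \<in> V \<Longrightarrow> a \<odot> v \<in> W"
  obtain k where k: "ideal_pow R \<mm> k \<subseteq> I" by (rule m_power_le_I)
  show "rel_length R M W V \<noteq> \<infinity>"
    by (rule rel_length_finite_power[OF ideal_m rel_length_finite_max[OF local noeth_M] W V WV, of k])
       (use kill k in blast)+
qed

lemma length_pow_mult_finite:
  assumes "submodule W R M" "pow_mult I n \<subseteq> W"
  shows "rel_length R M W (carrier M) \<noteq> \<infinity>"
  by (rule length_finite[OF assms(1) carrier_is_submodule, of n])
     (use assms submodule_in_carrier[OF assms(1)] ideal_smult_mem in blast)+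

abbreviation torsion :: "'b set" where "torsion \<equiv> local_cohomology_0 R \<mm> M"

lemma torsion_eq: "torsion = (\<Union>n. module_colon M {\<zero>\<^bsub>M\<^esub>} (ideal_pow R \<mm> n))"
proof -
  have *: "module_colon M {\<zero>\<^bsub>M\<^esub>} (ideal_pow R \<mm> n) \<subseteq> module_colon M {\<zero>\<^bsub>M\<^esub>} (ideal_pow R \<mm> (Suc n))" for n
    by (rule module_colon_antimono[OF R.ideal_pow_antimono[OF ideal_m]]) simp
  show ?thesis
  proof
    show "torsion \<subseteq> (\<Union>n. module_colon M {\<zero>\<^bsub>M\<^esub>} (ideal_pow R \<mm> n))"
      unfolding local_cohomology_0_def module_colon_def by blast
    have "module_colon M {\<zero>\<^bsub>M\<^esub>} (ideal_pow R \<mm> n) \<subseteq> torsion" for n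
    proof -
      have "module_colon M {\<zero>\<^bsub>M\<^esub>} (ideal_pow R \<mm> (Suc n)) \<subseteq> torsion"
        unfolding local_cohomology_0_def module_colon_def by (auto intro!: exI[of _ "Suc n"])
      then show ?thesis using * by blast
    qed
    then show "(\<Union>n. module_colon M {\<zero>\<^bsub>M\<^esub>} (ideal_pow R \<mm> n)) \<subseteq> torsion" by blast
  qed
qed

lemma torsion_bounded:
  obtains k where "torsion = module_colon M {\<zero>\<^bsub>M\<^esub>} (ideal_pow R \<mm> k)"
proof -
  let ?f = "\<lambda>n. module_colon M {\<zero>\<^bsub>M\<^esub>} (ideal_pow R \<mm> n)"
  have s: "submodule (?f n) R M" for n
    by (rule submodule_colon[OF zero_submodule]) (use R.ideal_pow_in_carrier[OF ideal_m] in blast)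
  have *: "?f n \<subseteq> ?f (Suc n)" for n
    by (rule module_colon_antimono[OF R.ideal_pow_antimono[OF ideal_m]]) simp
  obtain k where k: "\<And>n. n \<ge> k \<Longrightarrow> ?f n = ?f k"
    using asc_chain_condD[OF noeth_M[unfolded noeth_module_def], of ?f] s * by metis
  have "?f n \<subseteq> ?f k" for n
  proof (cases "n \<ge> k")
    case False
    then have "ideal_pow R \<mm> k \<subseteq> ideal_pow R \<mm> n" by (intro R.ideal_pow_antimono[OF ideal_m]) auto
    then show ?thesis unfolding module_colon_def by blast
  qed (use k in blast)
  then have "torsion = ?f k" unfolding torsion_eq by blast
  then show ?thesis using that by blast
qed

lemma torsion_submodule: "submodule torsion R M"
proof -
  obtain k where k: "torsion = module_colon M {\<zero>\<^bsub>M\<^esub>} (ideal_pow R \<mm> k)" by (rule torsion_bounded)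
  show ?thesis unfolding k
    by (rule submodule_colon[OF zero_submodule]) (use R.ideal_pow_in_carrier[OF ideal_m] in blast)
qed

lemma torsion_killed:
  obtains k where "\<And>a h. a \<in> ideal_pow R I k \<Longrightarrow> h \<in> torsion \<Longrightarrow> a \<odot> h = \<zero>\<^bsub>M\<^esub>"
proof -
  obtain k where k: "torsion = module_colon M {\<zero>\<^bsub>M\<^esub>} (ideal_pow R \<mm> k)" by (rule torsion_bounded)
  have "a \<odot> h = \<zero>\<^bsub>M\<^esub>" if "a \<in> ideal_pow R I k" "h \<in> torsion" for a h
    using that R.ideal_pow_mono[OF ideal_I ideal_m I_le_m, of k] unfolding k module_colon_def by blast
  then show ?thesis using that by blast
qed

lemma torsion_carrier: "h \<in> torsion \<Longrightarrow> h \<in> carrier M" by (rule submodule_in_carrier[OF torsion_submodule])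

lemma torsion_length_finite: "rel_length R M {\<zero>\<^bsub>M\<^esub>} torsion \<noteq> \<infinity>"
proof -
  obtain k where k: "\<And>a h. a \<in> ideal_pow R I k \<Longrightarrow> h \<in> torsion \<Longrightarrow> a \<odot> h = \<zero>\<^bsub>M\<^esub>" using torsion_killed by blast
  show ?thesis by (rule length_finite[OF zero_submodule torsion_submodule, of k]) (use k submodule_zero[OF torsion_submodule] in auto)
qed

lemma torsion_colon:
  assumes v: "v \<in> carrier M" and mv: "\<And>a. a \<in> \<mm> \<Longrightarrow> a \<odot> v \<in> torsion"
  shows "v \<in> torsion"
proof -
  obtain k where k: "torsion = module_colon M {\<zero>\<^bsub>M\<^esub>} (ideal_pow R \<mm> k)" by (rule torsion_bounded)
  have "a \<odot> v \<in> {\<zero>\<^bsub>M\<^esub>}" if a: "a \<in> ideal_pow R \<mm> (Suc k)" for a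
    by (rule ideal_prod_smult[OF zero_submodule v R.ideal_pow_ideal[OF ideal_m] ideal_m, of k])
       (use a[unfolded R.ideal_pow_Suc] mv k in \<open>auto simp: module_colon_def\<close>)
  then have "v \<in> module_colon M {\<zero>\<^bsub>M\<^esub>} (ideal_pow R \<mm> (Suc k))" unfolding module_colon_def using v by blast
  then show ?thesis unfolding torsion_eq by blast
qed

text \<open>\<open>\<mm>\<close> kills no nonzero element of \<open>M / H\<close> with \<open>H\<close> the torsion, so \<open>\<mm>\<close> contains an element that
  is regular there; a power of it lies in \<open>I\<close>.\<close>
lemma regular_element:
  obtains x where "x \<in> I" "\<And>v. v \<in> carrier M \<Longrightarrow> x \<odot> v \<in> torsion \<Longrightarrow> v \<in> torsion"
proof -
  have "\<exists>a\<in>\<mm>. \<forall>v\<in>carrier M. a \<odot> v \<in> torsion \<longrightarrow> v \<in> torsion"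
  proof (rule ccontr)
    assume "\<not> ?thesis"
    then have "\<And>a. a \<in> \<mm> \<Longrightarrow> \<exists>v\<in>carrier M - torsion. a \<odot> v \<in> torsion" by blast
    then obtain v where "v \<in> carrier M - torsion" "\<And>a. a \<in> \<mm> \<Longrightarrow> a \<odot> v \<in> torsion"
      using zero_divisor_ideal[OF noeth_R noeth_M torsion_submodule ideal_m] by metis
    then show False using torsion_colon by blast
  qed
  then obtain a where a: "a \<in> \<mm>" "\<And>v. v \<in> carrier M \<Longrightarrow> a \<odot> v \<in> torsion \<Longrightarrow> v \<in> torsion" by blast
  then obtain n :: nat where n: "a [^]\<^bsub>R\<^esub> n \<in> I" using m_radical by blast
  have ac: "a \<in> carrier R" using a(1) m_radical by blast
  have "v \<in> torsion" if "v \<in> carrier M" "(a [^]\<^bsub>R\<^esub> (j::nat)) \<odot> v \<in> torsion" for v j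
    by (rule regular_mod_power[OF ac a(2) that])
  then show ?thesis using that n by blast
qed

lemma no_long_chain: "\<not> prime_chain_over R (annihilator R M) 2"
  and short_chain: "prime_chain_over R (annihilator R M) 1"
  using dim_one module_dim_1_iff by auto

text \<open>Otherwise \<open>M\<close> is killed by a power of \<open>\<mm>\<close>, every prime over its annihilator is \<open>\<mm>\<close>, and the
  dimension is zero.\<close>
lemma torsion_proper: "torsion \<noteq> carrier M"
proof
  assume H: "torsion = carrier M"
  obtain k where k: "torsion = module_colon M {\<zero>\<^bsub>M\<^esub>} (ideal_pow R \<mm> k)" by (rule torsion_bounded)
  have ann: "ideal_pow R \<mm> k \<subseteq> annihilator R M"
    using k[unfolded H] R.ideal_pow_in_carrier[OF ideal_m] unfolding annihilator_def module_colon_def by blast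
  have only: "\<mm> \<subseteq> P" if P: "primeideal P R" "annihilator R M \<subseteq> P" for P
  proof
    fix a assume a: "a \<in> \<mm>"
    have ac: "a \<in> carrier R" using a m_radical by blast
    have "a [^]\<^bsub>R\<^esub> k \<in> P" using R.ideal_pow_pow[OF ideal_m a] ann P(2) by blast
    then show "a \<in> P"
    proof (induct k)
      case 0 then show ?case using primeidealD(3)[OF P(1)] by simp
    next
      case (Suc k) then show ?case using primeidealD(4)[OF P(1), of "a [^]\<^bsub>R\<^esub> k" a] ac by auto
    qed
  qed
  obtain P Q where PQ: "primeideal P R" "primeideal Q R" "annihilator R M \<subseteq> P" "P \<subset> Q"
    using short_chain unfolding prime_chain_over_1 by blast
  then have mQ: "\<mm> \<subset> Q" using only[of P] by blast
  obtain P' where "maximalideal P' R" "Q \<subseteq> P'"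
    using R.exists_maximal_ideal[OF noeth_R primeidealD(1)[OF PQ(2)]] primeidealD(2)[OF PQ(2)] by metis
  then show False using max_unique mQ by blast
qed

definition x0 :: 'a where
  "x0 = (SOME x. x \<in> I \<and> (\<forall>v\<in>carrier M. x \<odot> v \<in> torsion \<longrightarrow> v \<in> torsion))"

lemma x0_I: "x0 \<in> I" and x0_regular: "v \<in> carrier M \<Longrightarrow> x0 \<odot> v \<in> torsion \<Longrightarrow> v \<in> torsion"
proof -
  have "\<exists>x. x \<in> I \<and> (\<forall>v\<in>carrier M. x \<odot> v \<in> torsion \<longrightarrow> v \<in> torsion)" using regular_element by metis
  from someI_ex[OF this] show "x0 \<in> I" "v \<in> carrier M \<Longrightarrow> x0 \<odot> v \<in> torsion \<Longrightarrow> v \<in> torsion"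
    unfolding x0_def[symmetric] by blast+
qed

lemma x0_carrier: "x0 \<in> carrier R" by (rule I_carrier[OF x0_I])

abbreviation x0_mult :: "nat \<Rightarrow> 'b set \<Rightarrow> 'b set" where
  "x0_mult n V \<equiv> (\<lambda>v. (x0 [^]\<^bsub>R\<^esub> n) \<odot> v) ` V"

lemma x0_mult_submodule: "submodule V R M \<Longrightarrow> submodule (x0_mult n V) R M"
  by (rule submodule_smult_image) (use x0_carrier in auto)

lemma x0_pow_regular: "v \<in> carrier M \<Longrightarrow> (x0 [^]\<^bsub>R\<^esub> (n::nat)) \<odot> v \<in> torsion \<Longrightarrow> v \<in> torsion"
  by (rule regular_mod_power[OF x0_carrier x0_regular])

text \<open>Write \<open>H\<close> for the torsion and \<open>x\<close> for the chosen regular element \<open>x0\<close>. As \<open>x\<close> is a parameter for \<open>M / H\<close>,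
  \<open>I\<^sup>j M \<subseteq> H + x M\<close> for some \<open>j\<close>. Multiplying by \<open>I\<^sup>n\<^sup>+\<^sup>k\<close>, where \<open>I\<^sup>k\<close> kills \<open>H\<close>, removes \<open>H\<close>.\<close>
lemma pow_mult_into_x0:
  obtains k j where "\<And>n. pow_mult I (n + k + j) \<subseteq> (\<lambda>v. x0 \<odot> v) ` (pow_mult I (n + k))"
    and "\<And>a h. a \<in> ideal_pow R I k \<Longrightarrow> h \<in> torsion \<Longrightarrow> a \<odot> h = \<zero>\<^bsub>M\<^esub>"
    and "\<And>v. v \<in> pow_mult I j \<Longrightarrow> v \<in> torsion <+>\<^bsub>M\<^esub> (\<lambda>v. x0 \<odot> v) ` (carrier M)"
proof -
  let ?E = "torsion <+>\<^bsub>M\<^esub> (\<lambda>v. x0 \<odot> v) ` carrier M"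
  have E: "submodule ?E R M"
    by (rule submodule_sum[OF torsion_submodule submodule_smult_image[OF x0_carrier carrier_is_submodule]])
  obtain S where S: "S \<subseteq> carrier R" "finite S" "\<mm> = Idl\<^bsub>R\<^esub> S"
    using noetherian_ring.finetely_gen[OF noeth_R ideal_m] by blast
  have Sm: "S \<subseteq> \<mm>" unfolding S(3) by (rule R.genideal_self[OF S(1)])
  have "x0 \<in> \<mm>" using x0_I I_le_m by blast
  have "\<exists>j. \<forall>a\<in>ideal_pow R \<mm> j. \<forall>v\<in>carrier M. a \<odot> v \<in> ?E"
  proof (rule nilpotent_power[OF noeth_M ideal_m S(3,2,1) E])
    fix a v assume a: "a \<in> S" and v: "v \<in> carrier M"
    obtain n :: nat where "\<And>v. v \<in> carrier M \<Longrightarrow> (a [^]\<^bsub>R\<^esub> n) \<odot> v \<in> ?E"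
      using regular_element_parameter[OF local no_long_chain torsion_submodule \<open>x0 \<in> \<mm>\<close> x0_regular, of a] a Sm by blast
    then show "\<exists>n::nat. (a [^]\<^bsub>R\<^esub> n) \<odot> v \<in> ?E" using v by blast
  qed
  then obtain j where j: "\<And>a v. a \<in> ideal_pow R \<mm> j \<Longrightarrow> v \<in> carrier M \<Longrightarrow> a \<odot> v \<in> ?E" by blast
  obtain k where k: "\<And>a h. a \<in> ideal_pow R I k \<Longrightarrow> h \<in> torsion \<Longrightarrow> a \<odot> h = \<zero>\<^bsub>M\<^esub>" using torsion_killed by blast
  have IjE: "pow_mult I j \<subseteq> ?E"
    by (rule ideal_smult_least[OF E]) (use j R.ideal_pow_mono[OF ideal_I ideal_m I_le_m] in blast)
  have "pow_mult I (n + k + j) \<subseteq> (\<lambda>v. x0 \<odot> v) ` (pow_mult I (n + k))" for n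
  proof (rule pow_mult_add_least[OF ideal_I submodule_smult_image[OF x0_carrier pow_mult_submodule[OF ideal_I]]])
    fix a u assume a: "a \<in> ideal_pow R I (n + k)" and u: "u \<in> pow_mult I j"
    have ac: "a \<in> carrier R" by (rule R.ideal_pow_in_carrier[OF ideal_I a])
    obtain h v where hv: "h \<in> torsion" "v \<in> carrier M" "u = h \<oplus> x0 \<odot> v" using IjE u by (fastforce simp: mem_set_add)
    have "a \<in> ideal_pow R I k" using a R.ideal_pow_antimono[OF ideal_I, of k "n + k"] by auto
    then have "a \<odot> h = \<zero>" using k hv(1) by blast
    then have "a \<odot> u = x0 \<odot> (a \<odot> v)"
      using hv ac x0_carrier torsion_carrier[OF hv(1)] smult_comm[of a x0 v] by (simp add: smult_r_distr)
    moreover have "a \<odot> v \<in> pow_mult I (n + k)" by (rule ideal_smult_mem[OF a hv(2)])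
    ultimately show "a \<odot> u \<in> (\<lambda>v. x0 \<odot> v) ` (pow_mult I (n + k))" using x0_carrier by simp
  qed
  moreover have "v \<in> torsion <+>\<^bsub>M\<^esub> (\<lambda>v. x0 \<odot> v) ` (carrier M)" if "v \<in> pow_mult I j" for v
    using IjE that x0_carrier by auto
  ultimately show ?thesis using that k by blast
qed

text \<open>An element deep enough in the \<open>I\<close>-adic filtration has the form \<open>x\<^sup>k z\<close>. If it is torsion, so is \<open>z\<close>, and
  \<open>x\<^sup>k\<close> kills \<open>z\<close>.\<close>
lemma pow_mult_torsion_disjoint:
  obtains N where "\<And>n. n \<ge> N \<Longrightarrow> pow_mult I n \<inter> torsion = {\<zero>\<^bsub>M\<^esub>}"
proof -
  obtain k j where kj: "\<And>n. pow_mult I (n + k + j) \<subseteq> (\<lambda>v. x0 \<odot> v) ` (pow_mult I (n + k))"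
    and k: "\<And>a h. a \<in> ideal_pow R I k \<Longrightarrow> h \<in> torsion \<Longrightarrow> a \<odot> h = \<zero>\<^bsub>M\<^esub>" by (rule pow_mult_into_x0) blast
  have it: "pow_mult I (k + s * j) \<subseteq> x0_mult s (pow_mult I k)" for s
  proof (induct s)
    case 0
    have "v = (x0 [^]\<^bsub>R\<^esub> (0::nat)) \<odot> v" if "v \<in> pow_mult I k" for v
      using submodule_in_carrier[OF pow_mult_submodule[OF ideal_I] that] by simp
    then show ?case by auto
  next
    case (Suc s)
    show ?case
    proof
      fix u assume u: "u \<in> pow_mult I (k + Suc s * j)"
      have "u \<in> pow_mult I (s * j + k + j)" using u by (simp add: ac_simps)
      then have "u \<in> (\<lambda>v. x0 \<odot> v) ` (pow_mult I (s * j + k))" using kj[of "s * j"] by blast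
      then obtain w where w: "w \<in> pow_mult I (k + s * j)" "u = x0 \<odot> w"
        using x0_carrier by (auto simp: add.commute)
      then obtain v where v: "v \<in> pow_mult I k" "w = (x0 [^]\<^bsub>R\<^esub> s) \<odot> v" using Suc by blast
      have "v \<in> carrier M" by (rule submodule_in_carrier[OF pow_mult_submodule[OF ideal_I] v(1)])
      then have "u = (x0 [^]\<^bsub>R\<^esub> Suc s) \<odot> v"
        using w(2) v(2) x0_carrier smult_assoc1[of x0 "x0 [^]\<^bsub>R\<^esub> s" v] R.m_comm[of x0 "x0 [^]\<^bsub>R\<^esub> s"] by simp
      then show "u \<in> x0_mult (Suc s) (pow_mult I k)" using v(1) by blast
    qed
  qed
  have "pow_mult I n \<inter> torsion = {\<zero>\<^bsub>M\<^esub>}" if n: "n \<ge> k + k * j" for n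
  proof
    show "{\<zero>\<^bsub>M\<^esub>} \<subseteq> pow_mult I n \<inter> torsion"
      using submodule_zero[OF pow_mult_submodule[OF ideal_I]] submodule_zero[OF torsion_submodule] by blast
    show "pow_mult I n \<inter> torsion \<subseteq> {\<zero>\<^bsub>M\<^esub>}"
    proof
      fix y assume y: "y \<in> pow_mult I n \<inter> torsion"
      then have "y \<in> x0_mult k (pow_mult I k)" using it[of k] pow_mult_antimono[OF ideal_I n] by blast
      then obtain z where z: "z \<in> pow_mult I k" "y = (x0 [^]\<^bsub>R\<^esub> k) \<odot> z" by blast
      have "z \<in> torsion" using x0_pow_regular[of z k] submodule_in_carrier[OF pow_mult_submodule[OF ideal_I] z(1)] y z(2) by blast
      then have "y = \<zero>\<^bsub>M\<^esub>" unfolding z(2) using k R.ideal_pow_pow[OF ideal_I x0_I] by blast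
      then show "y \<in> {\<zero>\<^bsub>M\<^esub>}" by blast
    qed
  qed
  then show ?thesis using that by blast
qed


section \<open>The filtration \<open>I\<^sup>n M + H\<close>\<close>

definition Fil :: "nat \<Rightarrow> 'b set" where "Fil n = pow_mult I n <+>\<^bsub>M\<^esub> torsion"

lemma Fil_submodule: "submodule (Fil n) R M"
  unfolding Fil_def by (rule submodule_sum[OF pow_mult_submodule[OF ideal_I] torsion_submodule])

lemma Fil_upper: "pow_mult I n \<subseteq> Fil n" "torsion \<subseteq> Fil n"
  unfolding Fil_def using sum_upper[OF pow_mult_submodule[OF ideal_I] torsion_submodule] by auto

lemma Fil_least: "submodule W R M \<Longrightarrow> pow_mult I n \<subseteq> W \<Longrightarrow> torsion \<subseteq> W \<Longrightarrow> Fil n \<subseteq> W"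
  unfolding Fil_def by (rule sum_least)

lemma Fil_antimono: "n \<le> m \<Longrightarrow> Fil m \<subseteq> Fil n"
  by (rule Fil_least[OF Fil_submodule]) (use Fil_upper pow_mult_antimono[OF ideal_I] in blast)+

lemma Fil_smult:
  assumes a: "a \<in> ideal_pow R I n" and u: "u \<in> Fil m" shows "a \<odot> u \<in> Fil (n + m)"
proof -
  have ac: "a \<in> carrier R" by (rule R.ideal_pow_in_carrier[OF ideal_I a])
  have "Fil m \<subseteq> {u \<in> carrier M. a \<odot> u \<in> Fil (n + m)}"
  proof (rule Fil_least)
    show "submodule {u \<in> carrier M. a \<odot> u \<in> Fil (n + m)} R M"
      by (rule submodule_smult_preimage[OF ac carrier_is_submodule Fil_submodule])
    show "pow_mult I m \<subseteq> {u \<in> carrier M. a \<odot> u \<in> Fil (n + m)}"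
      using pow_mult_smult[OF ideal_I a] Fil_upper(1) submodule_in_carrier[OF pow_mult_submodule[OF ideal_I]] by blast
    show "torsion \<subseteq> {u \<in> carrier M. a \<odot> u \<in> Fil (n + m)}"
      using submodule_smult[OF torsion_submodule ac] Fil_upper(2) torsion_carrier by blast
  qed
  then show ?thesis using u by blast
qed

lemma Fil_smult_I: "a \<in> I \<Longrightarrow> u \<in> Fil n \<Longrightarrow> a \<odot> u \<in> Fil (Suc n)"
  using Fil_smult[of a "Suc 0" u n] R.ideal_pow_1[OF ideal_I] by simp

definition gens :: "'a set" where
  "gens = (SOME X. X \<subseteq> carrier R \<and> finite X \<and> I = Idl\<^bsub>R\<^esub> X)"

lemma gens: "gens \<subseteq> carrier R" "finite gens" "I = Idl\<^bsub>R\<^esub> gens" "gens \<subseteq> I"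
proof -
  have "\<exists>X. X \<subseteq> carrier R \<and> finite X \<and> I = Idl\<^bsub>R\<^esub> X"
    using noetherian_ring.finetely_gen[OF noeth_R ideal_I] by blast
  from someI_ex[OF this] show *: "gens \<subseteq> carrier R" "finite gens" "I = Idl\<^bsub>R\<^esub> gens" unfolding gens_def[symmetric] by auto
  show "gens \<subseteq> I" using R.genideal_self[OF *(1)] *(3) by simp
qed

lemma Fil_graded_noetherian: "asc_chain_cond (graded_family R M gens (\<lambda>n. Fil (Suc n)) Fil)"
proof (rule graded_family_noetherian[OF gens(2,1) noeth_M Fil_submodule _ Fil_submodule, where N=0])
  show "shift_closed M gens (\<lambda>n. Fil (Suc n))" unfolding shift_closed_def using Fil_smult_I gens(4) by blast
  show "Fil (Suc n) \<subseteq> Fil n" for n by (rule Fil_antimono) simp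
  fix n W assume W: "submodule W R M" "Fil (Suc (Suc n)) \<subseteq> W"
    and h: "\<And>x v. x \<in> gens \<Longrightarrow> v \<in> Fil n \<Longrightarrow> x \<odot> v \<in> W"
  show "Fil (Suc n) \<subseteq> W"
    by (rule Fil_least[OF W(1)]) (use pow_mult_Suc_least[OF ideal_I W(1) gens(3,1)] h W(2) Fil_upper in blast)+
qed

text \<open>The elements of \<open>gr Fil\<close> that are killed by all of \<open>I / I\<^sup>2\<close> form a graded submodule; as it is
  finitely generated and multiplication by \<open>I / I\<^sup>2\<close> is zero on it, it vanishes in high degrees.\<close>
lemma Fil_socle_vanishes:
  obtains N where "\<And>n y. n \<ge> N \<Longrightarrow> y \<in> Fil n \<Longrightarrow> (\<And>a. a \<in> I \<Longrightarrow> a \<odot> y \<in> Fil (Suc (Suc n))) \<Longrightarrow> y \<in> Fil (Suc n)"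
proof -
  define Z where "Z n = Fil n \<inter> module_colon M (Fil (Suc (Suc n))) I" for n
  have Zs: "submodule (Z n) R M" for n
    unfolding Z_def using I_carrier by (intro submodule_Int Fil_submodule submodule_colon) auto
  have FZ: "Fil (Suc n) \<subseteq> Z n" for n
    using Fil_antimono[of n "Suc n"] Fil_smult_I[of _ _ "Suc n"] submodule_in_carrier[OF Fil_submodule]
    unfolding Z_def module_colon_def by auto
  define f where "f k n = (if n < k then Z n else Fil (Suc n))" for k n
  have "graded_family R M gens (\<lambda>n. Fil (Suc n)) Fil (f k)" for k
    unfolding graded_family_def
  proof (intro conjI allI)
    show "submodule (f k n) R M" "Fil (Suc n) \<subseteq> f k n" for n unfolding f_def using Zs Fil_submodule FZ by auto
    show "f k n \<subseteq> Fil n" for n unfolding f_def Z_def using Fil_antimono[of n "Suc n"] by auto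
    show "shift_closed M gens (f k)" unfolding shift_closed_def
    proof (intro ballI allI)
      fix x n u assume x: "x \<in> gens" and u: "u \<in> f k n"
      have "x \<odot> u \<in> Fil (Suc (Suc n))"
        using u x gens(4) Fil_smult_I[of x u "Suc n"] unfolding f_def Z_def module_colon_def by (auto split: if_splits)
      then show "x \<odot> u \<in> f k (Suc n)" unfolding f_def using FZ[of "Suc n"] by auto
    qed
  qed
  moreover have "f k \<le> f (Suc k)" for k unfolding f_def le_fun_def using FZ by auto
  ultimately obtain N where N: "\<And>k. k \<ge> N \<Longrightarrow> f k = f N"
    using asc_chain_condD[OF Fil_graded_noetherian, of f] by metis
  have "Z n = Fil (Suc n)" if "n \<ge> N" for n
  proof -
    have "f (Suc n) n = f N n" using N[of "Suc n"] that by simp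
    then show ?thesis using that unfolding f_def by simp
  qed
  then have "y \<in> Fil (Suc n)" if "n \<ge> N" "y \<in> Fil n" "\<And>a. a \<in> I \<Longrightarrow> a \<odot> y \<in> Fil (Suc (Suc n))" for n y
    using that submodule_in_carrier[OF Fil_submodule that(2)] unfolding Z_def module_colon_def by blast
  then show ?thesis using that by blast
qed

text \<open>Because \<open>x\<close> is regular modulo torsion and \<open>I\<^sup>N M \<subseteq> x I\<^sup>n M\<close> for large \<open>N\<close>, an element that \<open>I\<close>
  multiplies deep into the filtration is itself at least at depth \<open>n\<close>; from there on the vanishing
  of the socle pushes it down one step at a time.\<close>
lemma Fil_colon:
  obtains N where "\<And>n v. n \<ge> N \<Longrightarrow> v \<in> carrier M \<Longrightarrow> (\<And>a. a \<in> I \<Longrightarrow> a \<odot> v \<in> Fil (Suc n)) \<Longrightarrow> v \<in> Fil n"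
proof -
  obtain n0 where n0: "\<And>n y. n \<ge> n0 \<Longrightarrow> y \<in> Fil n \<Longrightarrow> (\<And>a. a \<in> I \<Longrightarrow> a \<odot> y \<in> Fil (Suc (Suc n))) \<Longrightarrow> y \<in> Fil (Suc n)"
    by (rule Fil_socle_vanishes) blast
  obtain k j where kj: "\<And>n. pow_mult I (n + k + j) \<subseteq> (\<lambda>v. x0 \<odot> v) ` (pow_mult I (n + k))" by (rule pow_mult_into_x0) blast
  let ?N = "n0 + k + j"
  have "v \<in> Fil n" if n: "n \<ge> ?N" and v: "v \<in> carrier M" and Iv: "\<And>a. a \<in> I \<Longrightarrow> a \<odot> v \<in> Fil (Suc n)" for n v
  proof -
    have "x0 \<odot> v \<in> Fil (n0 + k + j)" using Iv[OF x0_I] Fil_antimono[of ?N "Suc n"] n by auto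
    then obtain w h where wh: "w \<in> pow_mult I (n0 + k + j)" "h \<in> torsion" "x0 \<odot> v = w \<oplus> h"
      unfolding Fil_def by (auto simp: mem_set_add)
    then obtain u where u: "u \<in> pow_mult I (n0 + k)" "w = x0 \<odot> u" using kj[of n0] x0_carrier by auto
    have uc: "u \<in> carrier M" by (rule submodule_in_carrier[OF pow_mult_submodule[OF ideal_I] u(1)])
    have hc: "h \<in> carrier M" by (rule torsion_carrier[OF wh(2)])
    have "x0 \<odot> (v \<oplus> \<ominus>\<^bsub>M\<^esub> u) = (w \<oplus> h) \<oplus> \<ominus>\<^bsub>M\<^esub> w"
      using u(2) wh(3) uc v x0_carrier by (simp add: smult_r_distr smult_r_minus)
    also have "\<dots> = h" using hc uc x0_carrier unfolding u(2) by (simp add: M.a_ac M.r_neg)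
    finally have "v \<oplus> \<ominus>\<^bsub>M\<^esub> u \<in> torsion" using x0_regular[of "v \<oplus> \<ominus>\<^bsub>M\<^esub> u"] uc v wh(2) by simp
    then have "v \<oplus> \<ominus>\<^bsub>M\<^esub> u \<in> Fil n0" using Fil_upper(2) by blast
    moreover have "\<ominus>\<^bsub>M\<^esub> u \<in> Fil n0"
      using submodule_neg[OF Fil_submodule] u(1) Fil_upper(1)[of n0] pow_mult_antimono[OF ideal_I, of n0 "n0 + k"] by auto
    ultimately have base: "v \<in> Fil n0" using submodule_add_cancel[OF Fil_submodule, of v "\<ominus>\<^bsub>M\<^esub> u" n0] v by blast
    have "v \<in> Fil (n0 + i)" if "n0 + i \<le> n" for i
      using that
    proof (induct i)
      case (Suc i)
      have "a \<odot> v \<in> Fil (Suc (Suc (n0 + i)))" if "a \<in> I" for a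
        using Iv[OF that] Fil_antimono[of "Suc (Suc (n0 + i))" "Suc n"] Suc.prems by auto
      then show ?case using n0[of "n0 + i" v] Suc by auto
    qed (use base in simp)
    from this[of "n - n0"] show ?thesis using n by simp
  qed
  then show ?thesis using that by blast
qed

text \<open>If \<open>I\<^sup>k v \<subseteq> I\<^sup>n\<^sup>+\<^sup>k M\<close>, the factors \<open>I\<close> are stripped off one at a time by \<open>Fil_colon\<close>. Conversely,
  a power of \<open>I\<close> that kills the torsion sends \<open>I\<^sup>n M + H\<close> into the corresponding \<open>I\<^sup>n\<^sup>+\<^sup>k M\<close>.\<close>
lemma ratliff_rush_eq_Fil:
  obtains N where "\<And>n. n \<ge> N \<Longrightarrow> ratliff_rush R I M n = Fil n"
proof -
  obtain N where N: "\<And>n v. n \<ge> N \<Longrightarrow> v \<in> carrier M \<Longrightarrow> (\<And>a. a \<in> I \<Longrightarrow> a \<odot> v \<in> Fil (Suc n)) \<Longrightarrow> v \<in> Fil n"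
    by (rule Fil_colon) blast
  have deep: "v \<in> Fil n" if "n \<ge> N" "v \<in> carrier M" "\<And>a. a \<in> ideal_pow R I k \<Longrightarrow> a \<odot> v \<in> Fil (n + k)" for n v k
    using that
  proof (induct k arbitrary: v)
    case 0
    from "0.prems"(3)[of "\<one>\<^bsub>R\<^esub>"] "0.prems"(2) show ?case by (simp add: ideals_set_def)
  next
    case (Suc k)
    show ?case
    proof (rule Suc.hyps[OF Suc.prems(1,2)])
      fix b assume b: "b \<in> ideal_pow R I k"
      have bc: "b \<in> carrier R" by (rule R.ideal_pow_in_carrier[OF ideal_I b])
      show "b \<odot> v \<in> Fil (n + k)"
      proof (rule N)
        fix a assume a: "a \<in> I"
        have "b \<otimes>\<^bsub>R\<^esub> a \<in> ideal_pow R I (Suc k)" unfolding R.ideal_pow_Suc using ideal_prod.prod[OF b a] .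
        then have "(b \<otimes>\<^bsub>R\<^esub> a) \<odot> v \<in> Fil (n + Suc k)" by (rule Suc.prems(3))
        then show "a \<odot> (b \<odot> v) \<in> Fil (Suc (n + k))"
          using bc I_carrier[OF a] Suc.prems(2) R.m_comm[of a b] by (simp flip: smult_assoc1)
      qed (use Suc.prems bc in auto)
    qed
  qed
  obtain k0 where k0: "\<And>a h. a \<in> ideal_pow R I k0 \<Longrightarrow> h \<in> torsion \<Longrightarrow> a \<odot> h = \<zero>\<^bsub>M\<^esub>" using torsion_killed by blast
  have "ratliff_rush R I M n = Fil n" if n: "n \<ge> Suc N" for n
  proof
    show "ratliff_rush R I M n \<subseteq> Fil n"
    proof
      fix v assume "v \<in> ratliff_rush R I M n"
      then obtain k where "v \<in> module_colon M (pow_mult I (n + k)) (ideal_pow R I k)"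
        using n unfolding ratliff_rush_def by auto
      then have "v \<in> carrier M" "\<And>a. a \<in> ideal_pow R I k \<Longrightarrow> a \<odot> v \<in> Fil (n + k)"
        unfolding module_colon_def using Fil_upper(1) by blast+
      then show "v \<in> Fil n" using deep[of n v k] n by simp
    qed
    show "Fil n \<subseteq> ratliff_rush R I M n"
    proof
      fix v assume vF: "v \<in> Fil n"
      then obtain u h where uh: "u \<in> pow_mult I n" "h \<in> torsion" "v = u \<oplus> h"
        unfolding Fil_def by (auto simp: mem_set_add)
      have c: "u \<in> carrier M" "h \<in> carrier M"
        using submodule_in_carrier[OF pow_mult_submodule[OF ideal_I] uh(1)] torsion_carrier[OF uh(2)] by auto
      have "a \<odot> v \<in> pow_mult I (n + Suc k0)" if a: "a \<in> ideal_pow R I (Suc k0)" for a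
      proof -
        have "a \<in> ideal_pow R I k0" using a R.ideal_pow_antimono[OF ideal_I, of k0 "Suc k0"] by auto
        then have "a \<odot> v = a \<odot> u"
          using k0[OF _ uh(2)] c R.ideal_pow_in_carrier[OF ideal_I a] by (simp add: uh(3) smult_r_distr)
        then show ?thesis using pow_mult_smult[OF ideal_I a uh(1)] by (simp add: add.commute)
      qed
      then have "v \<in> module_colon M (pow_mult I (n + Suc k0)) (ideal_pow R I (Suc k0))"
        unfolding module_colon_def using submodule_in_carrier[OF Fil_submodule vF] by blast
      then have "v \<in> (\<Union>k\<in>{1..}. module_colon M (pow_mult I (n + k)) (ideal_pow R I k))" by (rule UN_I[rotated]) simp
      then show "v \<in> ratliff_rush R I M n" using n unfolding ratliff_rush_def by simp
    qed
  qed
  then show ?thesis using that by blast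
qed

end


section \<open>Quotient modules and module length\<close>

lemma submodule_chain_iff:
  "submodule_chain R M U V n \<longleftrightarrow> (\<exists>N :: nat \<Rightarrow> _. N 0 = U \<and> N n = V \<and>
    (\<forall>i\<le>n. submodule (N i) R M) \<and> (\<forall>i<n. N i \<subset> N (Suc i)))"
proof
  assume "submodule_chain R M U V n"
  then show "\<exists>N :: nat \<Rightarrow> _. N 0 = U \<and> N n = V \<and> (\<forall>i\<le>n. submodule (N i) R M) \<and> (\<forall>i<n. N i \<subset> N (Suc i))"
  proof induct
    case refl then show ?case by (intro exI[of _ "\<lambda>_. U"]) auto
  next
    case (step V n W)
    then obtain N where N: "N 0 = U" "N n = V" "\<forall>i\<le>n. submodule (N i) R M" "\<forall>i<n. N i \<subset> N (Suc i)" by blast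
    let ?N = "N(Suc n := W)"
    have "\<forall>i\<le>Suc n. submodule (?N i) R M" using N(3) step(3) by (simp add: le_Suc_eq)
    moreover have "?N i \<subset> ?N (Suc i)" if "i < Suc n" for i
      using that N(2,4) step(4) by (cases "i = n") simp_all
    moreover have "?N 0 = U" "?N (Suc n) = W" using N(1) by auto
    ultimately show ?case by blast
  qed
next
  assume "\<exists>N :: nat \<Rightarrow> _. N 0 = U \<and> N n = V \<and> (\<forall>i\<le>n. submodule (N i) R M) \<and> (\<forall>i<n. N i \<subset> N (Suc i))"
  then show "submodule_chain R M U V n"
  proof (induct n arbitrary: V)
    case 0 then show ?case by (auto intro: submodule_chain.refl)
  next
    case (Suc n)
    then obtain N where N: "N 0 = U" "N (Suc n) = V" "\<forall>i\<le>Suc n. submodule (N i) R M" "\<forall>i<Suc n. N i \<subset> N (Suc i)" by blast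
    have "\<forall>i\<le>n. submodule (N i) R M" "\<forall>i<n. N i \<subset> N (Suc i)"
      using N(3,4) by (meson le_SucI less_SucI)+
    then have "submodule_chain R M U (N n) n" using N(1) Suc.hyps by blast
    moreover have "submodule V R M" "N n \<subset> V" using N(2-4) by blast+
    ultimately show ?case by (rule submodule_chain.step)
  qed
qed

lemma module_length_eq_rel_length: "module_length R M = rel_length R M {\<zero>\<^bsub>M\<^esub>} (carrier M)"
  unfolding module_length_def rel_length_def submodule_chain_iff ..

context module
begin

lemma submodule_iff: "submodule W R M \<longleftrightarrow> W \<subseteq> carrier M \<and> \<zero>\<^bsub>M\<^esub> \<in> W \<and>
    (\<forall>x\<in>W. \<forall>y\<in>W. x \<oplus>\<^bsub>M\<^esub> y \<in> W) \<and> (\<forall>a\<in>carrier R. \<forall>x\<in>W. a \<odot>\<^bsub>M\<^esub> x \<in> W)"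
proof
  assume W: "submodule W R M"
  note d = submoduleD[OF W]
  show "W \<subseteq> carrier M \<and> \<zero>\<^bsub>M\<^esub> \<in> W \<and> (\<forall>x\<in>W. \<forall>y\<in>W. x \<oplus>\<^bsub>M\<^esub> y \<in> W) \<and> (\<forall>a\<in>carrier R. \<forall>x\<in>W. a \<odot>\<^bsub>M\<^esub> x \<in> W)"
    using d(1) d(2) d(3) d(5) by blast
next
  assume W: "W \<subseteq> carrier M \<and> \<zero>\<^bsub>M\<^esub> \<in> W \<and> (\<forall>x\<in>W. \<forall>y\<in>W. x \<oplus>\<^bsub>M\<^esub> y \<in> W) \<and> (\<forall>a\<in>carrier R. \<forall>x\<in>W. a \<odot>\<^bsub>M\<^esub> x \<in> W)"
  show "submodule W R M"
  proof (rule submoduleI)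
    fix a assume a: "a \<in> W"
    have "(\<ominus> \<one>) \<odot>\<^bsub>M\<^esub> a \<in> W" using W a by blast
    moreover have "(\<ominus> \<one>) \<odot>\<^bsub>M\<^esub> a = \<ominus>\<^bsub>M\<^esub> a" using W a by (auto simp: smult_l_minus)
    ultimately show "\<ominus>\<^bsub>M\<^esub> a \<in> W" by simp
  qed (use W in auto)
qed

lemma restrict_module: "submodule H R M \<Longrightarrow> module R (M\<lparr>carrier := H\<rparr>)"
  using submodule.submodule_is_module module_axioms by blast

lemma submodule_restrict_iff:
  assumes H: "submodule H R M"
  shows "submodule W R (M\<lparr>carrier := H\<rparr>) \<longleftrightarrow> submodule W R M \<and> W \<subseteq> H"
proof -
  interpret H: module R "M\<lparr>carrier := H\<rparr>" by (rule restrict_module[OF H])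
  show ?thesis unfolding submodule_iff H.submodule_iff using submodule_in_carrier[OF H] by auto
qed

lemma module_length_restrict:
  assumes H: "submodule H R M"
  shows "module_length R (M\<lparr>carrier := H\<rparr>) = rel_length R M {\<zero>\<^bsub>M\<^esub>} H"
proof -
  have "rel_length R (M\<lparr>carrier := H\<rparr>) {\<zero>\<^bsub>M\<^esub>} H = rel_length R M {\<zero>\<^bsub>M\<^esub>} H"
    by (rule antisym)
       (rule rel_length_le_map[where f="\<lambda>x. x"]; simp add: submodule_restrict_iff[OF H])+
  then show ?thesis by (simp add: module_length_eq_rel_length)
qed

context
  fixes N assumes N: "submodule N R M"
begin

lemma abelian_subgroup_N: "abelian_subgroup N M"
  by (rule abelian_subgroupI3) (use submodule.axioms(1)[OF N] M.abelian_group_axioms in \<open>auto simp: additive_subgroup_def\<close>)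

lemma coset_mem_iff:
  assumes "u \<in> carrier M" shows "w \<in> N +>\<^bsub>M\<^esub> u \<longleftrightarrow> w \<in> carrier M \<and> w \<ominus>\<^bsub>M\<^esub> u \<in> N"
proof
  assume "w \<in> N +>\<^bsub>M\<^esub> u"
  then obtain n where n: "n \<in> N" "w = n \<oplus>\<^bsub>M\<^esub> u" by (auto simp: a_r_coset_def')
  have "n \<in> carrier M" by (rule submodule_in_carrier[OF N n(1)])
  then show "w \<in> carrier M \<and> w \<ominus>\<^bsub>M\<^esub> u \<in> N" using n assms a_diff_cancel by auto
next
  assume w: "w \<in> carrier M \<and> w \<ominus>\<^bsub>M\<^esub> u \<in> N"
  then have "w = (w \<ominus>\<^bsub>M\<^esub> u) \<oplus>\<^bsub>M\<^esub> u" using assms by (simp add: a_minus_def M.a_assoc M.l_neg)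
  then show "w \<in> N +>\<^bsub>M\<^esub> u" using w unfolding a_r_coset_def' by blast
qed

lemma coset_eq_iff:
  assumes "u \<in> carrier M" "v \<in> carrier M"
  shows "N +>\<^bsub>M\<^esub> u = N +>\<^bsub>M\<^esub> v \<longleftrightarrow> u \<ominus>\<^bsub>M\<^esub> v \<in> N"
proof
  assume "N +>\<^bsub>M\<^esub> u = N +>\<^bsub>M\<^esub> v"
  moreover have "u \<in> N +>\<^bsub>M\<^esub> u" using assms(1) submodule_zero[OF N] by (simp add: coset_mem_iff a_minus_def M.r_neg)
  ultimately show "u \<ominus>\<^bsub>M\<^esub> v \<in> N" using coset_mem_iff[OF assms(2)] by blast
next
  assume "u \<ominus>\<^bsub>M\<^esub> v \<in> N"
  then have "u \<in> N +>\<^bsub>M\<^esub> v" using coset_mem_iff[OF assms(2)] assms(1) by blast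
  then show "N +>\<^bsub>M\<^esub> u = N +>\<^bsub>M\<^esub> v"
    using abelian_subgroup.a_repr_independence'[OF abelian_subgroup_N, of u v] assms by simp
qed

lemma coset_zero_iff: "u \<in> carrier M \<Longrightarrow> N +>\<^bsub>M\<^esub> u = N \<longleftrightarrow> u \<in> N"
proof -
  assume u: "u \<in> carrier M"
  have "N +>\<^bsub>M\<^esub> \<zero>\<^bsub>M\<^esub> = N" using submodule_in_carrier[OF N] by (intro a_coset_add_zero) blast
  then show "N +>\<^bsub>M\<^esub> u = N \<longleftrightarrow> u \<in> N" using coset_eq_iff[OF u M.zero_closed] a_diff_cancel[OF u M.zero_closed] u by simp
qed

lemma coset_add: "u \<in> carrier M \<Longrightarrow> v \<in> carrier M \<Longrightarrow> (N +>\<^bsub>M\<^esub> u) <+>\<^bsub>M\<^esub> (N +>\<^bsub>M\<^esub> v) = N +>\<^bsub>M\<^esub> (u \<oplus>\<^bsub>M\<^esub> v)"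
  by (rule abelian_subgroup.a_rcos_sum[OF abelian_subgroup_N])

lemma coset_smult:
  assumes a: "a \<in> carrier R" and u: "u \<in> carrier M"
  shows "(\<Union>x\<in>N +>\<^bsub>M\<^esub> u. N +>\<^bsub>M\<^esub> (a \<odot>\<^bsub>M\<^esub> x)) = N +>\<^bsub>M\<^esub> (a \<odot>\<^bsub>M\<^esub> u)"
proof -
  have "N +>\<^bsub>M\<^esub> (a \<odot>\<^bsub>M\<^esub> x) = N +>\<^bsub>M\<^esub> (a \<odot>\<^bsub>M\<^esub> u)" if x: "x \<in> N +>\<^bsub>M\<^esub> u" for x
  proof -
    have x': "x \<in> carrier M" "x \<ominus>\<^bsub>M\<^esub> u \<in> N" using x coset_mem_iff[OF u] by auto
    have "a \<odot>\<^bsub>M\<^esub> x \<ominus>\<^bsub>M\<^esub> a \<odot>\<^bsub>M\<^esub> u = a \<odot>\<^bsub>M\<^esub> (x \<ominus>\<^bsub>M\<^esub> u)"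
      using a u x' by (simp add: a_minus_def smult_r_distr smult_r_minus)
    then show ?thesis using coset_eq_iff[of "a \<odot>\<^bsub>M\<^esub> x" "a \<odot>\<^bsub>M\<^esub> u"] submodule_smult[OF N a x'(2)] a u x'(1) by simp
  qed
  moreover have "u \<in> N +>\<^bsub>M\<^esub> u" using coset_mem_iff[OF u] u submodule_zero[OF N] by (simp add: a_minus_def M.r_neg)
  ultimately show ?thesis by blast
qed

lemma quot_carrier: "carrier (quot_module M N) = {N +>\<^bsub>M\<^esub> u | u. u \<in> carrier M}"
  by (auto simp: quot_module_def A_RCOSETS_def')

lemma quot_zero: "\<zero>\<^bsub>quot_module M N\<^esub> = N"
  by (simp add: quot_module_def)

lemma quot_add: "u \<in> carrier M \<Longrightarrow> v \<in> carrier M \<Longrightarrow>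
    (N +>\<^bsub>M\<^esub> u) \<oplus>\<^bsub>quot_module M N\<^esub> (N +>\<^bsub>M\<^esub> v) = N +>\<^bsub>M\<^esub> (u \<oplus>\<^bsub>M\<^esub> v)"
  by (simp add: quot_module_def coset_add)

lemma quot_smult: "a \<in> carrier R \<Longrightarrow> u \<in> carrier M \<Longrightarrow>
    a \<odot>\<^bsub>quot_module M N\<^esub> (N +>\<^bsub>M\<^esub> u) = N +>\<^bsub>M\<^esub> (a \<odot>\<^bsub>M\<^esub> u)"
  by (simp add: quot_module_def coset_smult)

lemma quot_is_module: "module R (quot_module M N)"
proof (rule moduleI)
  have cl: "N +>\<^bsub>M\<^esub> u \<in> carrier (quot_module M N)" if "u \<in> carrier M" for u using that quot_carrier by blast
  have z: "\<zero>\<^bsub>quot_module M N\<^esub> = N +>\<^bsub>M\<^esub> \<zero>\<^bsub>M\<^esub>"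
    unfolding quot_zero using coset_zero_iff[OF M.zero_closed] submodule_zero[OF N] by simp
  show "abelian_group (quot_module M N)"
  proof (rule abelian_groupI)
    fix x assume "x \<in> carrier (quot_module M N)"
    then obtain u where u: "u \<in> carrier M" "x = N +>\<^bsub>M\<^esub> u" unfolding quot_carrier by blast
    then have "(N +>\<^bsub>M\<^esub> (\<ominus>\<^bsub>M\<^esub> u)) \<oplus>\<^bsub>quot_module M N\<^esub> x = \<zero>\<^bsub>quot_module M N\<^esub>"
      by (simp add: quot_add z M.l_neg)
    then show "\<exists>y\<in>carrier (quot_module M N). y \<oplus>\<^bsub>quot_module M N\<^esub> x = \<zero>\<^bsub>quot_module M N\<^esub>"
      using cl[of "\<ominus>\<^bsub>M\<^esub> u"] u by blast
  qed (auto simp: quot_carrier quot_add z M.a_ac intro: M.a_closed)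
qed (auto simp: quot_carrier quot_add quot_smult smult_l_distr smult_r_distr smult_assoc1 R.is_cring
      intro: M.a_closed smult_closed)

lemma linear_on_coset: "linear_on R M (quot_module M N) (carrier M) ((+>\<^bsub>M\<^esub>) N)"
  unfolding linear_on_def by (auto simp: quot_carrier quot_add quot_smult)

lemma module_length_quot: "module_length R (quot_module M N) = rel_length R M N (carrier M)"
proof -
  let ?Q = "quot_module M N"
  interpret Q: module R ?Q by (rule quot_is_module)
  have "rel_length R M {v \<in> carrier M. N +>\<^bsub>M\<^esub> v \<in> {\<zero>\<^bsub>?Q\<^esub>}} (carrier M)
      = rel_length R ?Q {\<zero>\<^bsub>?Q\<^esub>} ({\<zero>\<^bsub>?Q\<^esub>} <+>\<^bsub>?Q\<^esub> (\<lambda>v. N +>\<^bsub>M\<^esub> v) ` carrier M)"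
    by (rule rel_length_linear[OF quot_is_module carrier_is_submodule linear_on_coset Q.zero_submodule])
  moreover have "{v \<in> carrier M. N +>\<^bsub>M\<^esub> v \<in> {\<zero>\<^bsub>?Q\<^esub>}} = N"
    using coset_zero_iff submodule_in_carrier[OF N] by (auto simp: quot_zero)
  moreover have "{\<zero>\<^bsub>?Q\<^esub>} <+>\<^bsub>?Q\<^esub> (\<lambda>v. N +>\<^bsub>M\<^esub> v) ` carrier M = carrier ?Q"
  proof -
    have "(\<lambda>v. N +>\<^bsub>M\<^esub> v) ` carrier M = carrier ?Q" by (auto simp: quot_carrier)
    then show ?thesis using Q.sum_upper(2)[OF Q.zero_submodule Q.carrier_is_submodule]
        Q.sum_least[OF Q.carrier_is_submodule, of "{\<zero>\<^bsub>?Q\<^esub>}" "carrier ?Q"] by auto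
  qed
  ultimately show ?thesis by (simp add: module_length_eq_rel_length)
qed

end

end


section \<open>Hilbert coefficients\<close>

context one_dim_module
begin

lemma Fil_length_finite: "rel_length R M (Fil n) (carrier M) \<noteq> \<infinity>"
  by (rule length_pow_mult_finite[OF Fil_submodule Fil_upper(1)])

lemma Fil_carrier: "Fil n \<subseteq> carrier M"
  using submodule_in_carrier[OF Fil_submodule] by blast

definition hFil :: "nat \<Rightarrow> nat" where "hFil n = the_enat (rel_length R M (Fil (Suc n)) (Fil n))"
definition lFil :: "nat \<Rightarrow> nat" where "lFil n = the_enat (rel_length R M (Fil n) (carrier M))"

lemma lFil: "rel_length R M (Fil n) (carrier M) = enat (lFil n)"
  using Fil_length_finite[of n] unfolding lFil_def by (metis enat.exhaust the_enat.simps)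

lemma hFil: "rel_length R M (Fil (Suc n)) (Fil n) = enat (hFil n)"
proof -
  have "rel_length R M (Fil (Suc n)) (Fil n) \<noteq> \<infinity>"
    by (rule enat_le_finite[OF rel_length_mono[OF Fil_submodule Fil_submodule Fil_submodule carrier_is_submodule] Fil_length_finite])
       (use Fil_antimono[of n "Suc n"] Fil_carrier in auto)
  then show ?thesis unfolding hFil_def by (metis enat.exhaust the_enat.simps)
qed

lemma lFil_Suc: "lFil (Suc n) = hFil n + lFil n"
proof -
  have "rel_length R M (Fil (Suc n)) (carrier M) = rel_length R M (Fil (Suc n)) (Fil n) + rel_length R M (Fil n) (carrier M)"
    by (rule rel_length_add[OF Fil_submodule Fil_submodule carrier_is_submodule])
       (use Fil_antimono[of n "Suc n"] Fil_carrier in auto)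
  then show ?thesis unfolding lFil hFil by simp
qed

text \<open>\<open>x\<^sup>n M \<subseteq> I\<^sup>n M\<close>, and each step \<open>x\<^sup>n M / x\<^sup>n\<^sup>+\<^sup>1 M\<close> is modulo torsion a quotient of \<open>M / x M\<close>.\<close>
lemma lFil_linear_bound: "\<exists>C. \<forall>n. lFil n \<le> C * n"
proof -
  define X where "X n = x0_mult n (carrier M) <+>\<^bsub>M\<^esub> torsion" for n
  have xs: "submodule (x0_mult n (carrier M)) R M" for n by (rule x0_mult_submodule[OF carrier_is_submodule])
  have X: "submodule (X n) R M" "x0_mult n (carrier M) \<subseteq> X n" "torsion \<subseteq> X n" "X n \<subseteq> carrier M" for n
    unfolding X_def using submodule_sum[OF xs torsion_submodule] sum_upper[OF xs torsion_submodule]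
      submodule_in_carrier[OF submodule_sum[OF xs torsion_submodule]] by auto
  have Xn: "x0_mult n (carrier M) \<subseteq> pow_mult I n" for n
    using R.ideal_pow_pow[OF ideal_I x0_I, of n] by (auto intro: ideal_smult_mem)
  then have XF: "X n \<subseteq> Fil n" for n
    unfolding X_def by (intro sum_least[OF Fil_submodule]) (use Fil_upper in blast)+
  have pow: "(x0 [^]\<^bsub>R\<^esub> Suc n) \<odot> v = (x0 [^]\<^bsub>R\<^esub> n) \<odot> (x0 \<odot> v)" if "v \<in> carrier M" for n v
    using that x0_carrier by (simp add: smult_assoc1)
  have dec: "X (Suc n) \<subseteq> X n" for n
    unfolding X_def[of "Suc n"]
    by (rule sum_least[OF X(1) _ X(3)]) (use X(2)[of n] pow[of _ n] x0_carrier in \<open>force simp del: nat_pow_Suc\<close>)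
  obtain k j where "\<And>v. v \<in> pow_mult I j \<Longrightarrow> v \<in> torsion <+>\<^bsub>M\<^esub> (\<lambda>v. x0 \<odot> v) ` (carrier M)"
    by (rule pow_mult_into_x0) blast
  then have "pow_mult I j \<subseteq> X 1"
    using sum_least[OF X(1) X(3), of "(\<lambda>v. x0 \<odot> v) ` carrier M" 1] X(2)[of 1] x0_carrier by auto
  then have fin1: "rel_length R M (X 1) (carrier M) \<noteq> \<infinity>" by (rule length_pow_mult_finite[OF X(1)])
  then obtain C where C: "rel_length R M (X 1) (carrier M) = enat C" by blast
  have step: "rel_length R M (X (Suc n)) (X n) \<le> enat C" for n
  proof -
    have cx: "x0 [^]\<^bsub>R\<^esub> n \<in> carrier R" using x0_carrier by simp
    let ?K = "{v \<in> carrier M. (x0 [^]\<^bsub>R\<^esub> n) \<odot> v \<in> X (Suc n)}"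
    have "rel_length R M ?K (carrier M) = rel_length R M (X (Suc n)) (X (Suc n) <+>\<^bsub>M\<^esub> x0_mult n (carrier M))"
      by (rule rel_length_linear[OF module_axioms carrier_is_submodule linear_on_smult[OF cx] X(1)]) simp
    moreover have "X (Suc n) <+>\<^bsub>M\<^esub> x0_mult n (carrier M) = X n"
    proof
      show "X (Suc n) <+>\<^bsub>M\<^esub> x0_mult n (carrier M) \<subseteq> X n" by (rule sum_least[OF X(1) dec X(2)])
      show "X n \<subseteq> X (Suc n) <+>\<^bsub>M\<^esub> x0_mult n (carrier M)"
        unfolding X_def[of n]
        by (rule sum_least[OF submodule_sum[OF X(1) xs]]) (use sum_upper[OF X(1) xs] X(3) in blast)+
    qed
    moreover have "X 1 \<subseteq> ?K"
    proof -
      have K: "submodule ?K R M" by (rule submodule_smult_preimage[OF cx carrier_is_submodule X(1)])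
      show ?thesis unfolding X_def[of 1]
      proof (rule sum_least[OF K])
        show "x0_mult 1 (carrier M) \<subseteq> ?K"
          using X(2)[of "Suc n"] pow[of _ n] x0_carrier by (auto simp del: nat_pow_Suc)
        show "torsion \<subseteq> ?K" using submodule_smult[OF torsion_submodule cx] X(3) torsion_carrier by blast
      qed
    qed
    ultimately show ?thesis
      using rel_length_mono[OF X(1)[of 1] submodule_smult_preimage[OF cx carrier_is_submodule X(1)[of "Suc n"]] carrier_is_submodule carrier_is_submodule] C
      by auto
  qed
  have bound: "rel_length R M (X n) (carrier M) \<le> enat (C * n)" for n
  proof (induct n)
    case 0
    have "v \<in> X 0" if "v \<in> carrier M" for v
    proof -
      have "(x0 [^]\<^bsub>R\<^esub> (0::nat)) \<odot> v \<in> X 0" using X(2)[of 0] that by blast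
      then show ?thesis using that by simp
    qed
    then have "X 0 = carrier M" using X(4)[of 0] by blast
    then show ?case by (simp add: rel_length_refl)
  next
    case (Suc n)
    have "rel_length R M (X (Suc n)) (carrier M) = rel_length R M (X (Suc n)) (X n) + rel_length R M (X n) (carrier M)"
      by (rule rel_length_add[OF X(1) X(1) carrier_is_submodule dec X(4)])
    also have "\<dots> \<le> enat C + enat (C * n)" by (rule add_mono[OF step Suc])
    finally show ?case by simp
  qed
  have "lFil n \<le> C * n" for n
  proof -
    have "rel_length R M (Fil n) (carrier M) \<le> rel_length R M (X n) (carrier M)"
      by (rule rel_length_mono[OF X(1) Fil_submodule carrier_is_submodule carrier_is_submodule XF Fil_carrier]) simp
    then have "enat (lFil n) \<le> enat (C * n)" using bound[of n] unfolding lFil by (rule order_trans)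
    then show ?thesis by simp
  qed
  then show ?thesis by blast
qed

text \<open>A linearly bounded length function has bounded increments infinitely often, so that the theorem on Hilbert
  functions applies.\<close>
lemma hFil_eventually_constant: obtains c N where "\<And>n. n \<ge> N \<Longrightarrow> hFil n = c"
proof -
  obtain C where C: "\<And>n. lFil n \<le> C * n" using lFil_linear_bound by blast
  have "\<exists>n\<ge>m. hFil n \<le> C" for m
  proof -
    obtain n where "n \<ge> m" "lFil (n + 1) \<le> lFil n + C * 1" using linear_growth_gap[of lFil C 0 m 1] C by auto
    then show ?thesis using lFil_Suc[of n] by auto
  qed
  then have "\<exists>n\<ge>m. rel_length R M (Fil (Suc n)) (Fil n) \<le> enat C" for m by (simp add: hFil)
  moreover have "shift_closed M gens Fil" "shift_closed M gens (\<lambda>n. Fil (Suc n))"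
    unfolding shift_closed_def using Fil_smult_I gens(4) by blast+
  ultimately have "\<exists>c N. \<forall>n\<ge>N. rel_length R M (Fil (Suc n)) (Fil n) = enat c"
    by (intro hilbert_function_eventually_constant[OF gens(2,1) Fil_submodule Fil_submodule _ _ _ Fil_graded_noetherian])
       (use Fil_antimono hFil in auto)
  then show ?thesis using that by (auto simp: hFil)
qed

lemma lFil_eventually_linear:
  obtains c :: nat and d :: int and N where "\<And>n. n \<ge> N \<Longrightarrow> int (lFil n) = int c * int n - d"
proof -
  obtain c N where c: "\<And>n. n \<ge> N \<Longrightarrow> hFil n = c" by (rule hFil_eventually_constant) blast
  have "int (lFil (N + i)) = int c * int (N + i) - (int c * int N - int (lFil N))" for i
  proof (induct i)
    case (Suc i) then show ?case using lFil_Suc[of "N + i"] c[of "N + i"] by (simp add: algebra_simps)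
  qed simp
  then show ?thesis using that[of N c "int c * int N - int (lFil N)"] by (metis le_Suc_ex)
qed

lemma length_mod_pow_mult:
  obtains N where "\<And>n. n \<ge> N \<Longrightarrow> rel_length R M (pow_mult I n) (carrier M)
    = enat (lFil n) + rel_length R M {\<zero>\<^bsub>M\<^esub>} torsion"
proof -
  obtain N where N: "\<And>n. n \<ge> N \<Longrightarrow> pow_mult I n \<inter> torsion = {\<zero>\<^bsub>M\<^esub>}" by (rule pow_mult_torsion_disjoint) blast
  have "rel_length R M (pow_mult I n) (carrier M) = enat (lFil n) + rel_length R M {\<zero>\<^bsub>M\<^esub>} torsion" if n: "n \<ge> N" for n
  proof -
    note P = pow_mult_submodule[OF ideal_I, of n]
    have "rel_length R M (pow_mult I n) (carrier M) = rel_length R M (pow_mult I n) (Fil n) + enat (lFil n)"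
      using rel_length_add[OF P Fil_submodule carrier_is_submodule Fil_upper(1) Fil_carrier] lFil by simp
    moreover have "rel_length R M (pow_mult I n) (Fil n) = rel_length R M {\<zero>\<^bsub>M\<^esub>} torsion"
      using rel_length_Int_sum[OF P torsion_submodule] N[OF n] by (simp add: Fil_def)
    ultimately show ?thesis by (simp add: add.commute)
  qed
  then show ?thesis using that by blast
qed

lemma hilbert_coeffs_unique:
  assumes "has_hilbert_coeffs R I M a b" "has_hilbert_coeffs R I M a' b'"
  shows "a = a' \<and> b = b'"
proof -
  have "\<forall>\<^sub>F n in sequentially. a * (int n + 1) - b = a' * (int n + 1) - b'"
    using eventually_conj[OF assms[unfolded has_hilbert_coeffs_def]]
    by eventually_elim (auto simp: Let_def)
  then obtain N where N: "\<And>n. n \<ge> N \<Longrightarrow> a * (int n + 1) - b = a' * (int n + 1) - b'"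
    by (auto simp: eventually_sequentially)
  have "a = a'" using N[of N] N[of "Suc N"] by (simp add: algebra_simps)
  then show ?thesis using N[of N] by simp
qed

text \<open>For large \<open>n\<close> the Ratliff-Rush submodule is \<open>I\<^sup>n M + H\<close>, and \<open>H \<inter> I\<^sup>n M = 0\<close>: the lengths of \<open>M / I\<^sup>n M\<close> and
  \<open>M / (I\<^sup>n M + H)\<close> differ by the length of \<open>H\<close>, and both are linear in \<open>n\<close>.\<close>
theorem ratliff_rush_hilbert:
  shows "module_length R (M\<lparr>carrier := torsion\<rparr>) \<noteq> \<infinity>"
    and "\<forall>\<^sub>F n in sequentially.
        module_length R (quot_module M (ratliff_rush R I M (n + 1))) \<noteq> \<infinity> \<and>
        int (the_enat (module_length R (quot_module M (ratliff_rush R I M (n + 1))))) =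
          hilbert_e0 R I M * (int n + 1) - hilbert_e1 R I M
          - int (the_enat (module_length R (M\<lparr>carrier := torsion\<rparr>)))"
proof -
  have tl: "module_length R (M\<lparr>carrier := torsion\<rparr>) = rel_length R M {\<zero>\<^bsub>M\<^esub>} torsion"
    by (rule module_length_restrict[OF torsion_submodule])
  then show fin: "module_length R (M\<lparr>carrier := torsion\<rparr>) \<noteq> \<infinity>" using torsion_length_finite by simp
  then obtain t where t: "rel_length R M {\<zero>\<^bsub>M\<^esub>} torsion = enat t" unfolding tl by blast
  obtain c d N1 where l: "\<And>n. n \<ge> N1 \<Longrightarrow> int (lFil n) = int c * int n - d"
    by (rule lFil_eventually_linear) blast
  obtain N2 where p: "\<And>n. n \<ge> N2 \<Longrightarrow> rel_length R M (pow_mult I n) (carrier M)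
    = enat (lFil n) + rel_length R M {\<zero>\<^bsub>M\<^esub>} torsion" by (rule length_mod_pow_mult) blast
  obtain N3 where r: "\<And>n. n \<ge> N3 \<Longrightarrow> ratliff_rush R I M n = Fil n" by (rule ratliff_rush_eq_Fil) blast
  have hc: "has_hilbert_coeffs R I M (int c) (d - int t)"
    unfolding has_hilbert_coeffs_def eventually_sequentially
  proof (intro exI[of _ "max N1 N2"] allI impI)
    fix n assume n: "n \<ge> max N1 N2"
    have "module_length R (quot_module M (pow_mult I (n + 1))) = enat (lFil (n + 1) + t)"
    proof -
      have "n + 1 \<ge> N2" using n by simp
      then show ?thesis unfolding module_length_quot[OF pow_mult_submodule[OF ideal_I]] p[OF \<open>n + 1 \<ge> N2\<close>] t by simp
    qed
    then show "let l = module_length R (quot_module M (pow_mult I (n + 1))) in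
        l \<noteq> \<infinity> \<and> int (the_enat l) = int c * (int n + 1) - (d - int t)"
      using l[of "n + 1"] n by (simp add: Let_def)
  qed
  have e0: "hilbert_e0 R I M = int c" unfolding hilbert_e0_def
    by (rule the_equality) (use hc hilbert_coeffs_unique in blast)+
  have e1: "hilbert_e1 R I M = d - int t" unfolding hilbert_e1_def
    by (rule the_equality) (use hc hilbert_coeffs_unique in blast)+
  show "\<forall>\<^sub>F n in sequentially.
        module_length R (quot_module M (ratliff_rush R I M (n + 1))) \<noteq> \<infinity> \<and>
        int (the_enat (module_length R (quot_module M (ratliff_rush R I M (n + 1))))) =
          hilbert_e0 R I M * (int n + 1) - hilbert_e1 R I M
          - int (the_enat (module_length R (M\<lparr>carrier := torsion\<rparr>)))"
    unfolding eventually_sequentially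
  proof (intro exI[of _ "max N1 N3"] allI impI)
    fix n assume n: "n \<ge> max N1 N3"
    have "module_length R (quot_module M (ratliff_rush R I M (n + 1))) = enat (lFil (n + 1))"
      using r[of "n + 1"] n by (simp add: module_length_quot[OF Fil_submodule] lFil)
    then show "module_length R (quot_module M (ratliff_rush R I M (n + 1))) \<noteq> \<infinity> \<and>
        int (the_enat (module_length R (quot_module M (ratliff_rush R I M (n + 1))))) =
          hilbert_e0 R I M * (int n + 1) - hilbert_e1 R I M
          - int (the_enat (module_length R (M\<lparr>carrier := torsion\<rparr>)))"
      using l[of "n + 1"] n unfolding e0 e1 tl t by simp
  qed
qed

end


section \<open>Convolution\<close>

context module
begin

text \<open>The action of polynomials over \<open>R\<close> on polynomials over \<open>M\<close>. The graded ring and its graded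
  modules inherit their laws from it, by passing to cosets.\<close>
definition conv :: "(nat \<Rightarrow> 'a) \<Rightarrow> (nat \<Rightarrow> 'c) \<Rightarrow> nat \<Rightarrow> 'c" where
  "conv a y n = (\<Oplus>\<^bsub>M\<^esub>i\<in>{..n}. a i \<odot>\<^bsub>M\<^esub> y (n - i))"

definition ring_conv :: "(nat \<Rightarrow> 'a) \<Rightarrow> (nat \<Rightarrow> 'a) \<Rightarrow> nat \<Rightarrow> 'a" where
  "ring_conv a b n = (\<Oplus>i\<in>{..n}. a i \<otimes> b (n - i))"

lemma finsum_smult_rdistr:
  "\<lbrakk>finite A; x \<in> carrier M; f \<in> A \<rightarrow> carrier R\<rbrakk> \<Longrightarrow>
    (\<Oplus>i\<in>A. f i) \<odot>\<^bsub>M\<^esub> x = (\<Oplus>\<^bsub>M\<^esub>i\<in>A. f i \<odot>\<^bsub>M\<^esub> x)"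
proof (induct set: finite)
  case (insert j A)
  then show ?case by (simp add: Pi_def smult_l_distr)
qed simp

lemma submodule_finsum:
  assumes W: "submodule W R M" and "finite A" and f: "\<And>i. i \<in> A \<Longrightarrow> f i \<in> W"
  shows "(\<Oplus>\<^bsub>M\<^esub>i\<in>A. f i) \<in> W"
  using assms(2,3)
proof (induct A)
  case empty then show ?case using submodule_zero[OF W] by simp
next
  case (insert j A)
  have "f \<in> A \<rightarrow> carrier M" "f j \<in> carrier M" using insert.prems submodule_in_carrier[OF W] by auto
  then show ?case using insert submodule_add[OF W] by simp
qed

text \<open>Cutting the inner sums off at \<open>k - j\<close> instead of \<open>n - j\<close> makes the identity accessible to induction
  on \<open>k\<close>.\<close>
lemma conv_assoc_upto:
  assumes a: "\<And>i. a i \<in> carrier R" and b: "\<And>i. b i \<in> carrier R" and y: "\<And>i. y i \<in> carrier M"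
  shows "k \<le> (n::nat) \<Longrightarrow> (\<Oplus>\<^bsub>M\<^esub>j\<in>{..k}. (\<Oplus>i\<in>{..j}. a i \<otimes> b (j - i)) \<odot>\<^bsub>M\<^esub> y (n - j))
    = (\<Oplus>\<^bsub>M\<^esub>j\<in>{..k}. a j \<odot>\<^bsub>M\<^esub> (\<Oplus>\<^bsub>M\<^esub>i\<in>{..k - j}. b i \<odot>\<^bsub>M\<^esub> y (n - j - i)))"
proof (induct k)
  case 0 then show ?case using a b y by (simp add: Pi_def smult_assoc1)
next
  case (Suc k)
  define s where "s j = (\<Oplus>\<^bsub>M\<^esub>i\<in>{..k - j}. b i \<odot>\<^bsub>M\<^esub> y (n - j - i))" for j
  have sc: "s j \<in> carrier M" for j unfolding s_def using b y by (intro M.finsum_closed) auto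
  have ab: "(\<lambda>i. a i \<otimes> b (Suc k - i)) \<in> A \<rightarrow> carrier R" for A using a b by auto
  have "(\<Oplus>\<^bsub>M\<^esub>j\<in>{..Suc k}. a j \<odot>\<^bsub>M\<^esub> (\<Oplus>\<^bsub>M\<^esub>i\<in>{..Suc k - j}. b i \<odot>\<^bsub>M\<^esub> y (n - j - i)))
      = a (Suc k) \<odot>\<^bsub>M\<^esub> (b 0 \<odot>\<^bsub>M\<^esub> y (n - Suc k)) \<oplus>\<^bsub>M\<^esub>
        (\<Oplus>\<^bsub>M\<^esub>j\<in>{..k}. a j \<odot>\<^bsub>M\<^esub> (\<Oplus>\<^bsub>M\<^esub>i\<in>{..Suc k - j}. b i \<odot>\<^bsub>M\<^esub> y (n - j - i)))"
    using a b y by (subst M.finsum_Suc) (auto simp: Pi_def intro!: smult_closed M.finsum_closed)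
  also have "(\<Oplus>\<^bsub>M\<^esub>j\<in>{..k}. a j \<odot>\<^bsub>M\<^esub> (\<Oplus>\<^bsub>M\<^esub>i\<in>{..Suc k - j}. b i \<odot>\<^bsub>M\<^esub> y (n - j - i)))
      = (\<Oplus>\<^bsub>M\<^esub>j\<in>{..k}. (a j \<otimes> b (Suc k - j)) \<odot>\<^bsub>M\<^esub> y (n - Suc k) \<oplus>\<^bsub>M\<^esub> a j \<odot>\<^bsub>M\<^esub> s j)"
  proof (rule M.finsum_cong')
    fix j assume j: "j \<in> {..k}"
    then have "Suc k - j = Suc (k - j)" by auto
    then have "(\<Oplus>\<^bsub>M\<^esub>i\<in>{..Suc k - j}. b i \<odot>\<^bsub>M\<^esub> y (n - j - i))
        = b (Suc k - j) \<odot>\<^bsub>M\<^esub> y (n - j - (Suc k - j)) \<oplus>\<^bsub>M\<^esub> s j"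
      unfolding s_def using b y by (simp add: Pi_def)
    moreover have "n - j - (Suc k - j) = n - Suc k" using j by auto
    ultimately show "a j \<odot>\<^bsub>M\<^esub> (\<Oplus>\<^bsub>M\<^esub>i\<in>{..Suc k - j}. b i \<odot>\<^bsub>M\<^esub> y (n - j - i))
      = (a j \<otimes> b (Suc k - j)) \<odot>\<^bsub>M\<^esub> y (n - Suc k) \<oplus>\<^bsub>M\<^esub> a j \<odot>\<^bsub>M\<^esub> s j"
      using a b y sc by (simp add: smult_r_distr smult_assoc1)
  qed (use a b y sc in auto)
  also have "\<dots> = (\<Oplus>\<^bsub>M\<^esub>j\<in>{..k}. (a j \<otimes> b (Suc k - j)) \<odot>\<^bsub>M\<^esub> y (n - Suc k)) \<oplus>\<^bsub>M\<^esub> (\<Oplus>\<^bsub>M\<^esub>j\<in>{..k}. a j \<odot>\<^bsub>M\<^esub> s j)"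
    using a b y sc by (intro M.finsum_addf) auto
  also have "(\<Oplus>\<^bsub>M\<^esub>j\<in>{..k}. (a j \<otimes> b (Suc k - j)) \<odot>\<^bsub>M\<^esub> y (n - Suc k))
      = (\<Oplus>j\<in>{..k}. a j \<otimes> b (Suc k - j)) \<odot>\<^bsub>M\<^esub> y (n - Suc k)"
    using ab y by (subst finsum_smult_rdistr) auto
  also have "(\<Oplus>\<^bsub>M\<^esub>j\<in>{..k}. a j \<odot>\<^bsub>M\<^esub> s j)
      = (\<Oplus>\<^bsub>M\<^esub>j\<in>{..k}. (\<Oplus>i\<in>{..j}. a i \<otimes> b (j - i)) \<odot>\<^bsub>M\<^esub> y (n - j))"
    unfolding s_def using Suc by simp
  finally have rhs: "(\<Oplus>\<^bsub>M\<^esub>j\<in>{..Suc k}. a j \<odot>\<^bsub>M\<^esub> (\<Oplus>\<^bsub>M\<^esub>i\<in>{..Suc k - j}. b i \<odot>\<^bsub>M\<^esub> y (n - j - i)))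
    = a (Suc k) \<odot>\<^bsub>M\<^esub> (b 0 \<odot>\<^bsub>M\<^esub> y (n - Suc k)) \<oplus>\<^bsub>M\<^esub> ((\<Oplus>j\<in>{..k}. a j \<otimes> b (Suc k - j)) \<odot>\<^bsub>M\<^esub> y (n - Suc k)
      \<oplus>\<^bsub>M\<^esub> (\<Oplus>\<^bsub>M\<^esub>j\<in>{..k}. (\<Oplus>i\<in>{..j}. a i \<otimes> b (j - i)) \<odot>\<^bsub>M\<^esub> y (n - j)))" .
  have c1: "(\<Oplus>j\<in>{..k}. a j \<otimes> b (Suc k - j)) \<in> carrier R" using a b by (intro R.finsum_closed) auto
  have c2: "(\<Oplus>i\<in>{..j}. a i \<otimes> b (j - i)) \<in> carrier R" for j using a b by (intro R.finsum_closed) auto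
  have c3: "(\<Oplus>\<^bsub>M\<^esub>j\<in>{..k}. (\<Oplus>i\<in>{..j}. a i \<otimes> b (j - i)) \<odot>\<^bsub>M\<^esub> y (n - j)) \<in> carrier M"
    using c2 y by (intro M.finsum_closed) auto
  have "(\<Oplus>\<^bsub>M\<^esub>j\<in>{..Suc k}. (\<Oplus>i\<in>{..j}. a i \<otimes> b (j - i)) \<odot>\<^bsub>M\<^esub> y (n - j))
    = (\<Oplus>i\<in>{..Suc k}. a i \<otimes> b (Suc k - i)) \<odot>\<^bsub>M\<^esub> y (n - Suc k) \<oplus>\<^bsub>M\<^esub>
      (\<Oplus>\<^bsub>M\<^esub>j\<in>{..k}. (\<Oplus>i\<in>{..j}. a i \<otimes> b (j - i)) \<odot>\<^bsub>M\<^esub> y (n - j))"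
    using c2 y by (subst M.finsum_Suc) auto
  also have "(\<Oplus>i\<in>{..Suc k}. a i \<otimes> b (Suc k - i)) = a (Suc k) \<otimes> b 0 \<oplus> (\<Oplus>j\<in>{..k}. a j \<otimes> b (Suc k - j))"
    using a b by (subst R.finsum_Suc) auto
  finally show ?case unfolding rhs using a b y c1 c3 by (simp add: smult_l_distr smult_assoc1 M.a_assoc)
qed

lemma conv_assoc:
  assumes "\<And>i. a i \<in> carrier R" "\<And>i. b i \<in> carrier R" "\<And>i. y i \<in> carrier M"
  shows "conv (ring_conv a b) y n = conv a (conv b y) n"
  unfolding conv_def ring_conv_def using conv_assoc_upto[of a b y n n] assms by simp

lemma conv_add_left:
  assumes "\<And>i. a i \<in> carrier R" "\<And>i. b i \<in> carrier R" "\<And>i. y i \<in> carrier M"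
  shows "conv (\<lambda>i. a i \<oplus> b i) y n = conv a y n \<oplus>\<^bsub>M\<^esub> conv b y n"
proof -
  have "conv (\<lambda>i. a i \<oplus> b i) y n = (\<Oplus>\<^bsub>M\<^esub>i\<in>{..n}. a i \<odot>\<^bsub>M\<^esub> y (n - i) \<oplus>\<^bsub>M\<^esub> b i \<odot>\<^bsub>M\<^esub> y (n - i))"
    unfolding conv_def using assms by (intro M.finsum_cong') (auto simp: smult_l_distr)
  then show ?thesis unfolding conv_def using assms by (simp add: Pi_def)
qed

lemma conv_add_right:
  assumes "\<And>i. a i \<in> carrier R" "\<And>i. y i \<in> carrier M" "\<And>i. z i \<in> carrier M"
  shows "conv a (\<lambda>i. y i \<oplus>\<^bsub>M\<^esub> z i) n = conv a y n \<oplus>\<^bsub>M\<^esub> conv a z n"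
proof -
  have "conv a (\<lambda>i. y i \<oplus>\<^bsub>M\<^esub> z i) n = (\<Oplus>\<^bsub>M\<^esub>i\<in>{..n}. a i \<odot>\<^bsub>M\<^esub> y (n - i) \<oplus>\<^bsub>M\<^esub> a i \<odot>\<^bsub>M\<^esub> z (n - i))"
    unfolding conv_def using assms by (intro M.finsum_cong') (auto simp: smult_r_distr)
  then show ?thesis unfolding conv_def using assms by (simp add: Pi_def)
qed

lemma conv_monomial:
  assumes r: "r \<in> carrier R" and y: "\<And>i. y i \<in> carrier M"
  shows "conv (\<lambda>j. if j = i then r else \<zero>) y n = (if i \<le> n then r \<odot>\<^bsub>M\<^esub> y (n - i) else \<zero>\<^bsub>M\<^esub>)"
proof (cases "i \<le> n")
  case True
  have "conv (\<lambda>j. if j = i then r else \<zero>) y n = (\<Oplus>\<^bsub>M\<^esub>j\<in>{..n}. if i = j then r \<odot>\<^bsub>M\<^esub> y (n - j) else \<zero>\<^bsub>M\<^esub>)"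
    unfolding conv_def using assms by (intro M.finsum_cong') auto
  also have "\<dots> = r \<odot>\<^bsub>M\<^esub> y (n - i)" using True assms by (intro M.finsum_singleton) auto
  finally show ?thesis using True by simp
next
  case False
  have "conv (\<lambda>j. if j = i then r else \<zero>) y n = (\<Oplus>\<^bsub>M\<^esub>j\<in>{..n}. \<zero>\<^bsub>M\<^esub>)"
    unfolding conv_def using assms False by (intro M.finsum_cong') auto
  then show ?thesis using False by simp
qed

lemma conv_below:
  assumes a: "\<And>i. a i \<in> carrier R" and y: "\<And>i. y i \<in> carrier M"
    and za: "\<And>i. i \<ge> p \<Longrightarrow> a i = \<zero>" and zy: "\<And>i. i \<ge> q \<Longrightarrow> y i = \<zero>\<^bsub>M\<^esub>" and n: "n \<ge> p + q"
  shows "conv a y n = \<zero>\<^bsub>M\<^esub>"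
proof -
  have "a i \<odot>\<^bsub>M\<^esub> y (n - i) = \<zero>\<^bsub>M\<^esub>" for i
    using za[of i] zy[of "n - i"] n a[of i] y[of "n - i"] by (cases "i \<ge> p") auto
  then show ?thesis unfolding conv_def by simp
qed

lemma ring_conv_commute:
  assumes "\<And>i. a i \<in> carrier R" "\<And>i. b i \<in> carrier R"
  shows "ring_conv a b n = ring_conv b a n"
proof -
  have "ring_conv b a n = (\<Oplus>i\<in>{..n}. a (n - i) \<otimes> b i)"
    unfolding ring_conv_def using assms by (intro R.finsum_cong') (auto simp: R.m_comm)
  also have "\<dots> = (\<Oplus>i\<in>(\<lambda>i. n - i) ` {..n}. a (n - i) \<otimes> b i)"
  proof -
    have "i \<in> (\<lambda>i. n - i) ` {..n}" if "i \<le> n" for i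
      using that by (intro image_eqI[of _ _ "n - i"]) auto
    then have "(\<lambda>i. n - i) ` {..n} = {..n}" by auto
    then show ?thesis by simp
  qed
  also have "\<dots> = (\<Oplus>i\<in>{..n}. a (n - (n - i)) \<otimes> b (n - i))"
    by (rule R.finsum_reindex) (use assms in \<open>auto simp: inj_on_def\<close>)
  also have "\<dots> = ring_conv a b n"
    unfolding ring_conv_def using assms by (intro R.finsum_cong') auto
  finally show ?thesis by simp
qed

lemma ring_conv_eq_self_conv: "ring_conv a b n = module.conv (self_module R) a b n"
proof -
  interpret S: module R "self_module R" by (rule R.module_self)
  show ?thesis unfolding ring_conv_def S.conv_def by (simp add: finsum_def finprod_def self_module_def)
qed

end


section \<open>Associated graded modules\<close>

locale filtered_module = module R M for R (structure) and M (structure) +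
  fixes I :: "'a set" and F :: "nat \<Rightarrow> 'c set"
  assumes ideal_I: "ideal I R" and F_submodule: "\<And>n. submodule (F n) R M"
    and F_Suc: "\<And>n. F (Suc n) \<subseteq> F n"
    and F_smult: "\<And>a x i j. a \<in> ideal_pow R I i \<Longrightarrow> x \<in> F j \<Longrightarrow> a \<odot>\<^bsub>M\<^esub> x \<in> F (i + j)"
begin

abbreviation "Gr \<equiv> assoc_graded_module M F"
abbreviation "GrR \<equiv> assoc_graded_ring R I"

text \<open>Elements of the graded objects are represented by finitely supported sequences of representatives;
  the operations on cosets then become componentwise addition and convolution.\<close>

definition seqs :: "(nat \<Rightarrow> 'c) set" where
  "seqs = {y. (\<forall>n. y n \<in> F n) \<and> (\<exists>d. \<forall>n\<ge>d. y n = \<zero>\<^bsub>M\<^esub>)}"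

definition rseqs :: "(nat \<Rightarrow> 'a) set" where
  "rseqs = {a. (\<forall>n. a n \<in> ideal_pow R I n) \<and> (\<exists>d. \<forall>n\<ge>d. a n = \<zero>)}"

definition cls :: "(nat \<Rightarrow> 'c) \<Rightarrow> nat \<Rightarrow> 'c set" where
  "cls y n = F (Suc n) +>\<^bsub>M\<^esub> y n"

definition rcls :: "(nat \<Rightarrow> 'a) \<Rightarrow> nat \<Rightarrow> 'a set" where
  "rcls a n = ideal_pow R I (Suc n) +> a n"

lemma F_carrier: "x \<in> F n \<Longrightarrow> x \<in> carrier M" by (rule submodule_in_carrier[OF F_submodule])

lemma F_mono: "n \<le> m \<Longrightarrow> F m \<subseteq> F n"
  by (induct rule: dec_induct) (use F_Suc in blast)+

lemma seqsD: "y \<in> seqs \<Longrightarrow> y n \<in> F n" "y \<in> seqs \<Longrightarrow> y n \<in> carrier M"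
  unfolding seqs_def using F_carrier by blast+

lemma rseqsD: "a \<in> rseqs \<Longrightarrow> a n \<in> ideal_pow R I n" "a \<in> rseqs \<Longrightarrow> a n \<in> carrier R"
  unfolding rseqs_def using R.ideal_pow_in_carrier[OF ideal_I] by blast+

lemma coset_restrict: "N +>\<^bsub>M\<lparr>carrier := H\<rparr>\<^esub> u = N +>\<^bsub>M\<^esub> u"
  by (simp add: a_r_coset_def')

lemma piece_submodule: "submodule (F (Suc n)) R (M\<lparr>carrier := F n\<rparr>)"
  unfolding submodule_restrict_iff[OF F_submodule] using F_submodule F_Suc by blast

lemma piece_carrier: "carrier (gr_piece M F n) = {F (Suc n) +>\<^bsub>M\<^esub> u | u. u \<in> F n}"
  unfolding gr_piece_def module.quot_carrier[OF restrict_module[OF F_submodule] piece_submodule]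
  by (simp add: coset_restrict)

lemma piece_zero: "\<zero>\<^bsub>gr_piece M F n\<^esub> = F (Suc n)"
  by (simp add: gr_piece_def quot_module_def)

lemma piece_add: "u \<in> F n \<Longrightarrow> v \<in> F n \<Longrightarrow>
    (F (Suc n) +>\<^bsub>M\<^esub> u) \<oplus>\<^bsub>gr_piece M F n\<^esub> (F (Suc n) +>\<^bsub>M\<^esub> v) = F (Suc n) +>\<^bsub>M\<^esub> (u \<oplus>\<^bsub>M\<^esub> v)"
  unfolding gr_piece_def
  using module.quot_add[OF restrict_module[OF F_submodule] piece_submodule, of u n v]
  by (simp add: coset_restrict)

lemma piece_abelian_group: "abelian_group (gr_piece M F n)"
  unfolding gr_piece_def
  using module.quot_is_module[OF restrict_module[OF F_submodule] piece_submodule] module.axioms(2) by blast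

lemma piece_finsum:
  assumes "finite A" "\<And>i. i \<in> A \<Longrightarrow> u i \<in> F n"
  shows "(\<Oplus>\<^bsub>gr_piece M F n\<^esub>i\<in>A. F (Suc n) +>\<^bsub>M\<^esub> u i) = F (Suc n) +>\<^bsub>M\<^esub> (\<Oplus>\<^bsub>M\<^esub>i\<in>A. u i)"
  using assms
proof (induct A)
  interpret Q: abelian_group "gr_piece M F n" by (rule piece_abelian_group)
  case empty
  then show ?case using coset_zero_iff[OF F_submodule M.zero_closed] submodule_zero[OF F_submodule] by (simp add: piece_zero)
next
  interpret Q: abelian_group "gr_piece M F n" by (rule piece_abelian_group)
  case (insert j A)
  have s: "(\<Oplus>\<^bsub>M\<^esub>i\<in>A. u i) \<in> F n" by (rule submodule_finsum[OF F_submodule]) (use insert in auto)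
  have "(\<lambda>i. F (Suc n) +>\<^bsub>M\<^esub> u i) \<in> A \<rightarrow> carrier (gr_piece M F n)" using insert.prems by (auto simp: piece_carrier)
  moreover have "u \<in> A \<rightarrow> carrier M" "u j \<in> carrier M" using insert.prems F_carrier by auto
  moreover have "F (Suc n) +>\<^bsub>M\<^esub> u j \<in> carrier (gr_piece M F n)" using insert.prems by (auto simp: piece_carrier)
  ultimately show ?case using insert s by (simp add: piece_add)
qed

lemma cls_eq_iff:
  assumes "\<And>n. y n \<in> F n" "\<And>n. z n \<in> F n"
  shows "cls y = cls z \<longleftrightarrow> (\<forall>n. y n \<ominus>\<^bsub>M\<^esub> z n \<in> F (Suc n))"
proof -
  have "cls y n = cls z n \<longleftrightarrow> y n \<ominus>\<^bsub>M\<^esub> z n \<in> F (Suc n)" for n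
    unfolding cls_def using coset_eq_iff[OF F_submodule F_carrier F_carrier] assms by blast
  then show ?thesis unfolding fun_eq_iff by blast
qed

lemma cls_zero_iff: "y n \<in> F n \<Longrightarrow> cls y n = F (Suc n) \<longleftrightarrow> y n \<in> F (Suc n)"
  unfolding cls_def using coset_zero_iff[OF F_submodule] F_carrier by blast

lemma Gr_carrier: "carrier Gr = cls ` seqs"
proof
  show "carrier Gr \<subseteq> cls ` seqs"
  proof
    fix f assume "f \<in> carrier Gr"
    then have f: "\<And>n. f n \<in> carrier (gr_piece M F n)" "finite {n. f n \<noteq> F (Suc n)}"
      by (auto simp: assoc_graded_module_def gr_carrier_def piece_zero Let_def)
    have "\<exists>u. u \<in> F n \<and> f n = F (Suc n) +>\<^bsub>M\<^esub> u \<and> (f n = F (Suc n) \<longrightarrow> u = \<zero>\<^bsub>M\<^esub>)" for n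
    proof (cases "f n = F (Suc n)")
      case True
      then show ?thesis using coset_zero_iff[OF F_submodule M.zero_closed] submodule_zero[OF F_submodule] by metis
    next
      case False then show ?thesis using f(1)[of n] unfolding piece_carrier by blast
    qed
    then obtain y where y: "\<And>n. y n \<in> F n \<and> f n = F (Suc n) +>\<^bsub>M\<^esub> y n \<and> (f n = F (Suc n) \<longrightarrow> y n = \<zero>\<^bsub>M\<^esub>)" by metis
    obtain d where d: "\<And>n. f n \<noteq> F (Suc n) \<Longrightarrow> n < d"
      using f(2) finite_nat_set_iff_bounded[of "{n. f n \<noteq> F (Suc n)}"] by blast
    have "y n = \<zero>\<^bsub>M\<^esub>" if "n \<ge> d" for n using d[of n] y[of n] that by auto
    then have "y \<in> seqs" unfolding seqs_def using y by blast
    moreover have "f = cls y" unfolding cls_def using y by blast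
    ultimately show "f \<in> cls ` seqs" by blast
  qed
  show "cls ` seqs \<subseteq> carrier Gr"
  proof
    fix f assume "f \<in> cls ` seqs"
    then obtain y d where y: "y \<in> seqs" "f = cls y" "\<And>n. n \<ge> d \<Longrightarrow> y n = \<zero>\<^bsub>M\<^esub>" unfolding seqs_def by blast
    have "f n = F (Suc n)" if "n \<ge> d" for n
      unfolding y(2) cls_zero_iff[OF seqsD(1)[OF y(1)]] using y(3)[OF that] submodule_zero[OF F_submodule] by simp
    then have "n < d" if "f n \<noteq> F (Suc n)" for n using that by (metis not_le)
    then have "{n. f n \<noteq> F (Suc n)} \<subseteq> {..<d}" by blast
    then have "finite {n. f n \<noteq> F (Suc n)}" using finite_subset by blast
    moreover have "f n \<in> carrier (gr_piece M F n)" for n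
      unfolding piece_carrier y(2) cls_def using seqsD(1)[OF y(1)] by blast
    ultimately show "f \<in> carrier Gr" by (simp add: assoc_graded_module_def gr_carrier_def piece_zero Let_def)
  qed
qed

lemma Gr_zero: "\<zero>\<^bsub>Gr\<^esub> = cls (\<lambda>_. \<zero>\<^bsub>M\<^esub>)"
proof -
  have "cls (\<lambda>_. \<zero>\<^bsub>M\<^esub>) n = F (Suc n)" for n
    using cls_zero_iff[of "\<lambda>_. \<zero>\<^bsub>M\<^esub>" n] submodule_zero[OF F_submodule] by simp
  then show ?thesis by (simp add: assoc_graded_module_def piece_zero fun_eq_iff Let_def)
qed

lemma Gr_add: "y \<in> seqs \<Longrightarrow> z \<in> seqs \<Longrightarrow> cls y \<oplus>\<^bsub>Gr\<^esub> cls z = cls (\<lambda>n. y n \<oplus>\<^bsub>M\<^esub> z n)"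
  using seqsD(1) by (simp add: assoc_graded_module_def cls_def piece_add fun_eq_iff Let_def)

lemma zero_seqs: "(\<lambda>_. \<zero>\<^bsub>M\<^esub>) \<in> seqs"
  unfolding seqs_def using submodule_zero[OF F_submodule] by blast

lemma add_seqs: "y \<in> seqs \<Longrightarrow> z \<in> seqs \<Longrightarrow> (\<lambda>n. y n \<oplus>\<^bsub>M\<^esub> z n) \<in> seqs"
proof -
  assume yz: "y \<in> seqs" "z \<in> seqs"
  then obtain d e where "\<And>n. n \<ge> d \<Longrightarrow> y n = \<zero>\<^bsub>M\<^esub>" "\<And>n. n \<ge> e \<Longrightarrow> z n = \<zero>\<^bsub>M\<^esub>" unfolding seqs_def by blast
  then have "\<forall>n\<ge>max d e. y n \<oplus>\<^bsub>M\<^esub> z n = \<zero>\<^bsub>M\<^esub>" by simp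
  moreover have "y n \<oplus>\<^bsub>M\<^esub> z n \<in> F n" for n using submodule_add[OF F_submodule] seqsD(1) yz by blast
  ultimately show ?thesis unfolding seqs_def by blast
qed

lemma neg_seqs: "y \<in> seqs \<Longrightarrow> (\<lambda>n. \<ominus>\<^bsub>M\<^esub> y n) \<in> seqs"
proof -
  assume y: "y \<in> seqs"
  then obtain d where "\<And>n. n \<ge> d \<Longrightarrow> y n = \<zero>\<^bsub>M\<^esub>" unfolding seqs_def by blast
  then have "\<forall>n\<ge>d. \<ominus>\<^bsub>M\<^esub> y n = \<zero>\<^bsub>M\<^esub>" using M.minus_equality by auto
  moreover have "\<ominus>\<^bsub>M\<^esub> y n \<in> F n" for n using submodule_neg[OF F_submodule] seqsD(1) y by blast
  ultimately show ?thesis unfolding seqs_def by blast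
qed

lemma Gr_abelian_group: "abelian_group Gr"
proof (rule abelian_groupI)
  fix f assume "f \<in> carrier Gr"
  then obtain y where y: "y \<in> seqs" "f = cls y" unfolding Gr_carrier by blast
  have "cls (\<lambda>n. \<ominus>\<^bsub>M\<^esub> y n) \<oplus>\<^bsub>Gr\<^esub> f = \<zero>\<^bsub>Gr\<^esub>"
    using y neg_seqs[OF y(1)] seqsD(2)[OF y(1)] by (simp add: Gr_add Gr_zero M.l_neg)
  then show "\<exists>g\<in>carrier Gr. g \<oplus>\<^bsub>Gr\<^esub> f = \<zero>\<^bsub>Gr\<^esub>" using neg_seqs[OF y(1)] unfolding Gr_carrier by blast
qed (auto simp: Gr_carrier Gr_add Gr_zero add_seqs zero_seqs seqsD M.a_ac)

lemma F_smult_Suc: "a \<in> ideal_pow R I (Suc i) \<Longrightarrow> x \<in> F j \<Longrightarrow> a \<odot>\<^bsub>M\<^esub> x \<in> F (Suc (i + j))"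
  using F_smult[of a "Suc i" x j] by simp

lemma conv_F:
  assumes "a \<in> rseqs" "y \<in> seqs" shows "conv a y n \<in> F n"
  unfolding conv_def
proof (rule submodule_finsum[OF F_submodule])
  fix i assume "i \<in> {..n}"
  then show "a i \<odot>\<^bsub>M\<^esub> y (n - i) \<in> F n" using F_smult[OF rseqsD(1)[OF assms(1)] seqsD(1)[OF assms(2)], of i "n - i"] by simp
qed simp

lemma conv_seqs: "a \<in> rseqs \<Longrightarrow> y \<in> seqs \<Longrightarrow> conv a y \<in> seqs"
proof -
  assume ay: "a \<in> rseqs" "y \<in> seqs"
  then obtain d e where "\<And>n. n \<ge> d \<Longrightarrow> a n = \<zero>" "\<And>n. n \<ge> e \<Longrightarrow> y n = \<zero>\<^bsub>M\<^esub>" unfolding seqs_def rseqs_def by blast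
  then have "\<forall>n\<ge>d + e. conv a y n = \<zero>\<^bsub>M\<^esub>" using conv_below[of a y d e] rseqsD(2)[OF ay(1)] seqsD(2)[OF ay(2)] by blast
  then show ?thesis unfolding seqs_def using conv_F[OF ay] by blast
qed

text \<open>Changing \<open>a\<close> modulo \<open>I\<^sup>i\<^sup>+\<^sup>1\<close> and \<open>x\<close> modulo \<open>F (j + 1)\<close> changes \<open>a x\<close> by an element of \<open>F (i + j + 1)\<close>.\<close>
lemma coset_product:
  assumes a: "a \<in> ideal_pow R I i" and x: "x \<in> F j" and a': "a' \<in> ideal_pow R I (Suc i) +> a"
    and x': "x' \<in> F (Suc j) +>\<^bsub>M\<^esub> x"
  shows "F (Suc (i + j)) +>\<^bsub>M\<^esub> (a' \<odot>\<^bsub>M\<^esub> x') = F (Suc (i + j)) +>\<^bsub>M\<^esub> (a \<odot>\<^bsub>M\<^esub> x)"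
proof -
  obtain c where c: "c \<in> ideal_pow R I (Suc i)" "a' = c \<oplus> a" using a' by (auto simp: a_r_coset_def')
  obtain z where z: "z \<in> F (Suc j)" "x' = z \<oplus>\<^bsub>M\<^esub> x" using x' by (auto simp: a_r_coset_def')
  have car: "c \<in> carrier R" "a \<in> carrier R" "z \<in> carrier M" "x \<in> carrier M"
    using R.ideal_pow_in_carrier[OF ideal_I] a c(1) F_carrier z(1) x by blast+
  have "a' \<odot>\<^bsub>M\<^esub> x' \<ominus>\<^bsub>M\<^esub> a \<odot>\<^bsub>M\<^esub> x = (c \<odot>\<^bsub>M\<^esub> z \<oplus>\<^bsub>M\<^esub> a \<odot>\<^bsub>M\<^esub> z \<oplus>\<^bsub>M\<^esub> c \<odot>\<^bsub>M\<^esub> x) \<oplus>\<^bsub>M\<^esub> (a \<odot>\<^bsub>M\<^esub> x \<oplus>\<^bsub>M\<^esub> \<ominus>\<^bsub>M\<^esub> (a \<odot>\<^bsub>M\<^esub> x))"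
    unfolding c(2) z(2) a_minus_def using car by (simp add: smult_l_distr smult_r_distr M.a_ac)
  also have "\<dots> = c \<odot>\<^bsub>M\<^esub> z \<oplus>\<^bsub>M\<^esub> a \<odot>\<^bsub>M\<^esub> z \<oplus>\<^bsub>M\<^esub> c \<odot>\<^bsub>M\<^esub> x" using car by (simp add: M.r_neg)
  also have "\<dots> \<in> F (Suc (i + j))"
  proof (intro submodule_add[OF F_submodule])
    show "c \<odot>\<^bsub>M\<^esub> z \<in> F (Suc (i + j))" using F_smult_Suc[OF c(1), of z j] z(1) F_Suc[of j] by blast
    show "a \<odot>\<^bsub>M\<^esub> z \<in> F (Suc (i + j))" using F_smult[OF a z(1)] by simp
    show "c \<odot>\<^bsub>M\<^esub> x \<in> F (Suc (i + j))" using F_smult_Suc[OF c(1) x] .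
  qed
  finally have d: "a' \<odot>\<^bsub>M\<^esub> x' \<ominus>\<^bsub>M\<^esub> a \<odot>\<^bsub>M\<^esub> x \<in> F (Suc (i + j))" .
  have "a' \<odot>\<^bsub>M\<^esub> x' \<in> carrier M" "a \<odot>\<^bsub>M\<^esub> x \<in> carrier M" unfolding c(2) z(2) using car by auto
  then show ?thesis using coset_eq_iff[OF F_submodule] d by blast
qed

lemma rcoset_self: "a \<in> carrier R \<Longrightarrow> a \<in> ideal_pow R I n +> a"
proof -
  assume a: "a \<in> carrier R"
  have "a = \<zero> \<oplus> a" using a by simp
  then show ?thesis unfolding a_r_coset_def' using R.ideal_closed(2)[OF R.ideal_pow_ideal[OF ideal_I]] by blast
qed

lemma Gr_smult:
  assumes a: "a \<in> rseqs" and y: "y \<in> seqs"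
  shows "rcls a \<odot>\<^bsub>Gr\<^esub> cls y = cls (conv a y)"
proof (rule ext)
  fix n
  have prod: "(\<Union>a'\<in>rcls a i. \<Union>x\<in>cls y (n - i). F (Suc n) +>\<^bsub>M\<^esub> (a' \<odot>\<^bsub>M\<^esub> x))
      = F (Suc n) +>\<^bsub>M\<^esub> (a i \<odot>\<^bsub>M\<^esub> y (n - i))" if i: "i \<in> {..n}" for i
  proof -
    have e: "i + (n - i) = n" using i by simp
    have "F (Suc n) +>\<^bsub>M\<^esub> (a' \<odot>\<^bsub>M\<^esub> x) = F (Suc n) +>\<^bsub>M\<^esub> (a i \<odot>\<^bsub>M\<^esub> y (n - i))" if "a' \<in> rcls a i" "x \<in> cls y (n - i)" for a' x
      using coset_product[OF rseqsD(1)[OF a] seqsD(1)[OF y], of a' i x "n - i"] that unfolding rcls_def cls_def e by blast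
    moreover have "a i \<in> rcls a i" unfolding rcls_def by (rule rcoset_self[OF rseqsD(2)[OF a]])
    moreover have "y (n - i) \<in> cls y (n - i)" unfolding cls_def
      using coset_mem_iff[OF F_submodule] seqsD(2)[OF y] submodule_zero[OF F_submodule] by (simp add: a_minus_def M.r_neg)
    ultimately show ?thesis by blast
  qed
  have "(rcls a \<odot>\<^bsub>Gr\<^esub> cls y) n = (\<Oplus>\<^bsub>gr_piece M F n\<^esub>i\<in>{..n}. \<Union>a'\<in>rcls a i. \<Union>x\<in>cls y (n - i). F (Suc n) +>\<^bsub>M\<^esub> (a' \<odot>\<^bsub>M\<^esub> x))"
    by (simp add: assoc_graded_module_def Let_def)
  also have "\<dots> = (\<Oplus>\<^bsub>gr_piece M F n\<^esub>i\<in>{..n}. F (Suc n) +>\<^bsub>M\<^esub> (a i \<odot>\<^bsub>M\<^esub> y (n - i)))"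
  proof (rule abelian_monoid.finsum_cong'[OF abelian_group.axioms(1)[OF piece_abelian_group]])
    show "(\<lambda>i. F (Suc n) +>\<^bsub>M\<^esub> (a i \<odot>\<^bsub>M\<^esub> y (n - i))) \<in> {..n} \<rightarrow> carrier (gr_piece M F n)"
    proof
      fix i assume "i \<in> {..n}"
      then have "a i \<odot>\<^bsub>M\<^esub> y (n - i) \<in> F n" using F_smult[OF rseqsD(1)[OF a] seqsD(1)[OF y], of i "n - i"] by simp
      then show "F (Suc n) +>\<^bsub>M\<^esub> (a i \<odot>\<^bsub>M\<^esub> y (n - i)) \<in> carrier (gr_piece M F n)" unfolding piece_carrier by blast
    qed
  qed (use prod in auto)
  also have "\<dots> = F (Suc n) +>\<^bsub>M\<^esub> (\<Oplus>\<^bsub>M\<^esub>i\<in>{..n}. a i \<odot>\<^bsub>M\<^esub> y (n - i))"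
  proof (rule piece_finsum)
    fix i assume "i \<in> {..n}"
    then show "a i \<odot>\<^bsub>M\<^esub> y (n - i) \<in> F n" using F_smult[OF rseqsD(1)[OF a] seqsD(1)[OF y], of i "n - i"] by simp
  qed simp
  also have "\<dots> = cls (conv a y) n" unfolding cls_def conv_def ..
  finally show "(rcls a \<odot>\<^bsub>Gr\<^esub> cls y) n = cls (conv a y) n" .
qed

text \<open>The graded ring is at the same time the graded module of the \<open>I\<close>-adic filtration of \<open>R\<close>; the facts about
  graded modules thereby become facts about the ring.\<close>
lemma self_filtered: "filtered_module R (self_module R) I (ideal_pow R I)"
proof -
  interpret S: module R "self_module R" by (rule R.module_self)
  show ?thesis
  proof (intro filtered_module.intro filtered_module_axioms.intro)
    show "submodule (ideal_pow R I n) R (self_module R)" for n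
      unfolding R.submodule_self_iff by (rule R.ideal_pow_ideal[OF ideal_I])
    show "ideal_pow R I (Suc n) \<subseteq> ideal_pow R I n" for n by (rule R.ideal_pow_antimono[OF ideal_I]) simp
    show "a \<odot>\<^bsub>self_module R\<^esub> x \<in> ideal_pow R I (i + j)" if "a \<in> ideal_pow R I i" "x \<in> ideal_pow R I j" for a x i j
      using R.ideal_pow_mult[OF ideal_I that] by (simp add: self_module_def)
  qed (rule S.module_axioms ideal_I)+
qed

lemma self_seqs: "filtered_module.seqs (self_module R) (ideal_pow R I) = rseqs"
proof -
  interpret S: filtered_module R "self_module R" I "ideal_pow R I" by (rule self_filtered)
  show ?thesis unfolding S.seqs_def rseqs_def by (simp add: self_module_def)
qed

lemma self_cls: "filtered_module.cls (self_module R) (ideal_pow R I) = rcls"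
proof -
  interpret S: filtered_module R "self_module R" I "ideal_pow R I" by (rule self_filtered)
  show ?thesis unfolding S.cls_def rcls_def fun_eq_iff by (simp add: self_module_def a_r_coset_def')
qed

lemma self_Gr:
  shows "carrier GrR = carrier (assoc_graded_module (self_module R) (ideal_pow R I))"
    and "zero GrR = zero (assoc_graded_module (self_module R) (ideal_pow R I))"
    and "add GrR = add (assoc_graded_module (self_module R) (ideal_pow R I))"
    and "monoid.mult GrR = smult (assoc_graded_module (self_module R) (ideal_pow R I))"
  by (simp_all add: assoc_graded_ring_def assoc_graded_module_def rcoset_mult_def self_module_def a_r_coset_def' Let_def fun_eq_iff)

lemma GrR_carrier: "carrier GrR = rcls ` rseqs"
  unfolding self_Gr filtered_module.Gr_carrier[OF self_filtered] self_seqs self_cls ..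

lemma GrR_add: "a \<in> rseqs \<Longrightarrow> b \<in> rseqs \<Longrightarrow> rcls a \<oplus>\<^bsub>GrR\<^esub> rcls b = rcls (\<lambda>n. a n \<oplus> b n)"
  using filtered_module.Gr_add[OF self_filtered, of a b] unfolding self_Gr self_seqs self_cls by (simp add: self_module_def)

lemma GrR_mult: "a \<in> rseqs \<Longrightarrow> b \<in> rseqs \<Longrightarrow> rcls a \<otimes>\<^bsub>GrR\<^esub> rcls b = rcls (ring_conv a b)"
proof -
  interpret S: filtered_module R "self_module R" I "ideal_pow R I" by (rule self_filtered)
  assume "a \<in> rseqs" "b \<in> rseqs"
  then show ?thesis using S.Gr_smult[of a b] unfolding self_Gr self_seqs self_cls
    by (simp add: ring_conv_eq_self_conv[abs_def] fun_eq_iff)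
qed

lemma GrR_one: "\<one>\<^bsub>GrR\<^esub> = rcls (\<lambda>n. if n = 0 then \<one> else \<zero>)"
  by (simp add: assoc_graded_ring_def rcls_def fun_eq_iff Let_def)

lemma ring_conv_rseqs: "a \<in> rseqs \<Longrightarrow> b \<in> rseqs \<Longrightarrow> ring_conv a b \<in> rseqs"
proof -
  interpret S: filtered_module R "self_module R" I "ideal_pow R I" by (rule self_filtered)
  assume "a \<in> rseqs" "b \<in> rseqs"
  then show ?thesis using S.conv_seqs[of a b] unfolding self_seqs by (simp add: ring_conv_eq_self_conv[abs_def])
qed

lemma add_rseqs: "a \<in> rseqs \<Longrightarrow> b \<in> rseqs \<Longrightarrow> (\<lambda>n. a n \<oplus> b n) \<in> rseqs"
  using filtered_module.add_seqs[OF self_filtered, of a b] unfolding self_seqs by (simp add: self_module_def)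

lemma monomial_rseqs: "r \<in> ideal_pow R I i \<Longrightarrow> (\<lambda>n. if n = i then r else \<zero>) \<in> rseqs"
proof -
  assume r: "r \<in> ideal_pow R I i"
  have "\<exists>d. \<forall>n\<ge>d. (if n = i then r else \<zero>) = \<zero>" by (intro exI[of _ "Suc i"]) simp
  moreover have "\<forall>n. (if n = i then r else \<zero>) \<in> ideal_pow R I n"
    using r R.ideal_closed(2)[OF R.ideal_pow_ideal[OF ideal_I]] by simp
  ultimately show ?thesis unfolding rseqs_def by (intro CollectI conjI)
qed

lemma one_rseqs: "(\<lambda>n. if n = 0 then \<one> else \<zero>) \<in> rseqs"
  by (rule monomial_rseqs) (simp add: ideals_set_def)

lemma conv_one: "(\<And>i. y i \<in> carrier M) \<Longrightarrow> conv (\<lambda>n. if n = 0 then \<one> else \<zero>) y = y"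
  using conv_monomial[OF R.one_closed, of y 0] by (auto simp: fun_eq_iff)

theorem GrR_cring: "cring GrR"
proof (rule cringI)
  interpret S: filtered_module R "self_module R" I "ideal_pow R I" by (rule self_filtered)
  show "abelian_group GrR"
  proof (rule abelian_groupI)
    note G = abelian_groupE[OF S.Gr_abelian_group]
    show "x \<oplus>\<^bsub>GrR\<^esub> y \<in> carrier GrR" if "x \<in> carrier GrR" "y \<in> carrier GrR" for x y using G(1) that unfolding self_Gr by blast
    show "\<zero>\<^bsub>GrR\<^esub> \<in> carrier GrR" using G(2) unfolding self_Gr by blast
    show "x \<oplus>\<^bsub>GrR\<^esub> y \<oplus>\<^bsub>GrR\<^esub> z = x \<oplus>\<^bsub>GrR\<^esub> (y \<oplus>\<^bsub>GrR\<^esub> z)" if "x \<in> carrier GrR" "y \<in> carrier GrR" "z \<in> carrier GrR" for x y z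
      using G(3) that unfolding self_Gr by blast
    show "x \<oplus>\<^bsub>GrR\<^esub> y = y \<oplus>\<^bsub>GrR\<^esub> x" if "x \<in> carrier GrR" "y \<in> carrier GrR" for x y using G(4) that unfolding self_Gr by blast
    show "\<zero>\<^bsub>GrR\<^esub> \<oplus>\<^bsub>GrR\<^esub> x = x" if "x \<in> carrier GrR" for x using G(5) that unfolding self_Gr by blast
    show "\<exists>y\<in>carrier GrR. y \<oplus>\<^bsub>GrR\<^esub> x = \<zero>\<^bsub>GrR\<^esub>" if "x \<in> carrier GrR" for x using G(6) that unfolding self_Gr by blast
  qed
  have one: "ring_conv (\<lambda>n. if n = 0 then \<one> else \<zero>) a = a" if "a \<in> rseqs" for a
    using S.conv_one[of a] rseqsD(2)[OF that] by (simp add: ring_conv_eq_self_conv[abs_def] self_module_def)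
  show "comm_monoid GrR"
  proof (rule comm_monoidI)
    fix x y assume "x \<in> carrier GrR" "y \<in> carrier GrR"
    then obtain a b where ab: "a \<in> rseqs" "b \<in> rseqs" "x = rcls a" "y = rcls b" unfolding GrR_carrier by blast
    show "x \<otimes>\<^bsub>GrR\<^esub> y \<in> carrier GrR" unfolding ab GrR_mult[OF ab(1,2)] GrR_carrier using ring_conv_rseqs[OF ab(1,2)] by blast
    have "ring_conv a b = ring_conv b a" using ring_conv_commute[of a b] rseqsD(2) ab(1,2) by blast
    then show "x \<otimes>\<^bsub>GrR\<^esub> y = y \<otimes>\<^bsub>GrR\<^esub> x" unfolding ab by (simp add: GrR_mult ab(1,2))
    fix z assume "z \<in> carrier GrR"
    then obtain c where c: "c \<in> rseqs" "z = rcls c" unfolding GrR_carrier by blast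
    have "ring_conv (ring_conv a b) c = ring_conv a (ring_conv b c)"
      using S.conv_assoc[of a b c] rseqsD(2) ab(1,2) c(1)
      by (simp add: ring_conv_eq_self_conv[abs_def] S.ring_conv_eq_self_conv[abs_def] self_module_def fun_eq_iff)
    then show "x \<otimes>\<^bsub>GrR\<^esub> y \<otimes>\<^bsub>GrR\<^esub> z = x \<otimes>\<^bsub>GrR\<^esub> (y \<otimes>\<^bsub>GrR\<^esub> z)"
      unfolding ab c by (simp add: GrR_mult ab(1,2) c(1) ring_conv_rseqs)
  next
    show "\<one>\<^bsub>GrR\<^esub> \<in> carrier GrR" unfolding GrR_one GrR_carrier using one_rseqs by blast
    fix x assume "x \<in> carrier GrR"
    then obtain a where a: "a \<in> rseqs" "x = rcls a" unfolding GrR_carrier by blast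
    show "\<one>\<^bsub>GrR\<^esub> \<otimes>\<^bsub>GrR\<^esub> x = x" unfolding GrR_one a(2) GrR_mult[OF one_rseqs a(1)] one[OF a(1)] ..
  qed
  fix x y z assume "x \<in> carrier GrR" "y \<in> carrier GrR" "z \<in> carrier GrR"
  then obtain a b c where abc: "a \<in> rseqs" "b \<in> rseqs" "c \<in> rseqs" "x = rcls a" "y = rcls b" "z = rcls c"
    unfolding GrR_carrier by blast
  have "ring_conv (\<lambda>n. a n \<oplus> b n) c = (\<lambda>n. ring_conv a c n \<oplus> ring_conv b c n)"
    using S.conv_add_left[of a b c] rseqsD(2) abc(1-3)
    by (simp add: ring_conv_eq_self_conv[abs_def] self_module_def fun_eq_iff)
  then show "(x \<oplus>\<^bsub>GrR\<^esub> y) \<otimes>\<^bsub>GrR\<^esub> z = x \<otimes>\<^bsub>GrR\<^esub> z \<oplus>\<^bsub>GrR\<^esub> y \<otimes>\<^bsub>GrR\<^esub> z"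
    unfolding abc by (simp add: GrR_mult GrR_add abc(1-3) add_rseqs ring_conv_rseqs)
qed

theorem Gr_module: "module GrR Gr"
proof (rule moduleI[OF GrR_cring Gr_abelian_group])
  fix x f assume "x \<in> carrier GrR" "f \<in> carrier Gr"
  then obtain a y where ay: "a \<in> rseqs" "y \<in> seqs" "x = rcls a" "f = cls y" unfolding GrR_carrier Gr_carrier by blast
  show "x \<odot>\<^bsub>Gr\<^esub> f \<in> carrier Gr" unfolding ay Gr_smult[OF ay(1,2)] Gr_carrier using conv_seqs[OF ay(1,2)] by blast
  note c = rseqsD(2)[OF ay(1)] seqsD(2)[OF ay(2)]
  {
    fix x' assume "x' \<in> carrier GrR"
    then obtain b where b: "b \<in> rseqs" "x' = rcls b" unfolding GrR_carrier by blast
    have "conv (\<lambda>n. a n \<oplus> b n) y = (\<lambda>n. conv a y n \<oplus>\<^bsub>M\<^esub> conv b y n)" 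
      using conv_add_left[of a b y] c rseqsD(2)[OF b(1)] by blast
    then show "(x \<oplus>\<^bsub>GrR\<^esub> x') \<odot>\<^bsub>Gr\<^esub> f = x \<odot>\<^bsub>Gr\<^esub> f \<oplus>\<^bsub>Gr\<^esub> x' \<odot>\<^bsub>Gr\<^esub> f"
      unfolding ay b by (simp add: GrR_add Gr_smult Gr_add ay(1,2) b(1) add_rseqs conv_seqs)
    have "conv (ring_conv a b) y = conv a (conv b y)" 
      using conv_assoc[of a b y] c rseqsD(2)[OF b(1)] by blast
    then show "(x \<otimes>\<^bsub>GrR\<^esub> x') \<odot>\<^bsub>Gr\<^esub> f = x \<odot>\<^bsub>Gr\<^esub> (x' \<odot>\<^bsub>Gr\<^esub> f)"
      unfolding ay b by (simp add: GrR_mult Gr_smult ay(1,2) b(1) ring_conv_rseqs conv_seqs)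
  }
  fix g assume "g \<in> carrier Gr"
  then obtain z where z: "z \<in> seqs" "g = cls z" unfolding Gr_carrier by blast
  have "conv a (\<lambda>n. y n \<oplus>\<^bsub>M\<^esub> z n) = (\<lambda>n. conv a y n \<oplus>\<^bsub>M\<^esub> conv a z n)" 
    using conv_add_right[of a y z] c seqsD(2)[OF z(1)] by blast
  then show "x \<odot>\<^bsub>Gr\<^esub> (f \<oplus>\<^bsub>Gr\<^esub> g) = x \<odot>\<^bsub>Gr\<^esub> f \<oplus>\<^bsub>Gr\<^esub> x \<odot>\<^bsub>Gr\<^esub> g"
    unfolding ay z by (simp add: Gr_add Gr_smult ay(1,2) z(1) add_seqs conv_seqs)
next
  fix f assume "f \<in> carrier Gr"
  then obtain y where y: "y \<in> seqs" "f = cls y" unfolding Gr_carrier by blast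
  show "\<one>\<^bsub>GrR\<^esub> \<odot>\<^bsub>Gr\<^esub> f = f" unfolding GrR_one y(2) Gr_smult[OF one_rseqs y(1)]
    using conv_one[of y] seqsD(2)[OF y(1)] by simp
qed

definition monom :: "nat \<Rightarrow> 'a \<Rightarrow> nat \<Rightarrow> 'a set" where
  "monom i r = rcls (\<lambda>n. if n = i then r else \<zero>)"

lemma monom_carrier: "r \<in> ideal_pow R I i \<Longrightarrow> monom i r \<in> carrier GrR"
  unfolding monom_def GrR_carrier using monomial_rseqs by blast

lemma monom_smult:
  assumes "r \<in> ideal_pow R I i" "y \<in> seqs"
  shows "monom i r \<odot>\<^bsub>Gr\<^esub> cls y = cls (\<lambda>n. if i \<le> n then r \<odot>\<^bsub>M\<^esub> y (n - i) else \<zero>\<^bsub>M\<^esub>)"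
  unfolding monom_def Gr_smult[OF monomial_rseqs[OF assms(1)] assms(2)]
  using conv_monomial[OF R.ideal_pow_in_carrier[OF ideal_I assms(1)], of y i] seqsD(2)[OF assms(2)]
  by (metis (no_types, lifting) ext)

lemma scalar_smult:
  assumes "r \<in> carrier R" "y \<in> seqs"
  shows "monom 0 r \<odot>\<^bsub>Gr\<^esub> cls y = cls (\<lambda>n. r \<odot>\<^bsub>M\<^esub> y n)"
  using monom_smult[of r 0 y] assms by (simp add: ideals_set_def)

lemma Gr_neg: "y \<in> seqs \<Longrightarrow> \<ominus>\<^bsub>Gr\<^esub> cls y = cls (\<lambda>n. \<ominus>\<^bsub>M\<^esub> y n)"
proof -
  interpret G: module GrR Gr by (rule Gr_module)
  assume y: "y \<in> seqs"
  have "cls (\<lambda>n. \<ominus>\<^bsub>M\<^esub> y n) \<oplus>\<^bsub>Gr\<^esub> cls y = \<zero>\<^bsub>Gr\<^esub>"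
    using y neg_seqs[OF y] seqsD(2)[OF y] by (simp add: Gr_add Gr_zero M.l_neg)
  moreover have "cls y \<in> carrier Gr" "cls (\<lambda>n. \<ominus>\<^bsub>M\<^esub> y n) \<in> carrier Gr" unfolding Gr_carrier using y neg_seqs[OF y] by blast+
  ultimately show ?thesis by (rule G.M.minus_equality)
qed

lemma single_seqs: "u \<in> F n \<Longrightarrow> (\<lambda>m. if m = n then u else \<zero>\<^bsub>M\<^esub>) \<in> seqs"
proof -
  assume u: "u \<in> F n"
  have "\<exists>d. \<forall>m\<ge>d. (if m = n then u else \<zero>\<^bsub>M\<^esub>) = \<zero>\<^bsub>M\<^esub>" by (intro exI[of _ "Suc n"]) simp
  moreover have "\<forall>m. (if m = n then u else \<zero>\<^bsub>M\<^esub>) \<in> F m" using u submodule_zero[OF F_submodule] by simp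
  ultimately show ?thesis unfolding seqs_def by (intro CollectI conjI)
qed

definition top_part :: "(nat \<Rightarrow> 'c set) set \<Rightarrow> nat \<Rightarrow> 'c set" where
  "top_part J n = {y n | y. y \<in> seqs \<and> cls y \<in> J \<and> (\<forall>m>n. y m = \<zero>\<^bsub>M\<^esub>)}"

lemma top_part_family:
  assumes J: "submodule J GrR Gr" and X: "X \<subseteq> I"
  shows "graded_family R M X (\<lambda>n. F (Suc n)) F (top_part J)"
  unfolding graded_family_def
proof (intro conjI allI)
  interpret G: module GrR Gr by (rule Gr_module)
  fix n
  show "submodule (top_part J n) R M"
    unfolding submodule_iff
  proof (intro conjI ballI)
    show "top_part J n \<subseteq> carrier M" unfolding top_part_def using seqsD(2) by blast
    show "\<zero>\<^bsub>M\<^esub> \<in> top_part J n" unfolding top_part_def using submodule_zero[OF J] zero_seqs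
      by (auto simp: Gr_zero intro!: exI[of _ "\<lambda>_. \<zero>\<^bsub>M\<^esub>"])
  next
    fix u v assume "u \<in> top_part J n" "v \<in> top_part J n"
    then obtain y z where yz: "y \<in> seqs" "cls y \<in> J" "\<forall>m>n. y m = \<zero>\<^bsub>M\<^esub>" "u = y n"
      "z \<in> seqs" "cls z \<in> J" "\<forall>m>n. z m = \<zero>\<^bsub>M\<^esub>" "v = z n" unfolding top_part_def by blast
    have "cls (\<lambda>n. y n \<oplus>\<^bsub>M\<^esub> z n) \<in> J" using submodule_add[OF J yz(2,6)] Gr_add[OF yz(1,5)] by simp
    moreover have "\<forall>m>n. y m \<oplus>\<^bsub>M\<^esub> z m = \<zero>\<^bsub>M\<^esub>" using yz(3,7) by simp
    ultimately show "u \<oplus>\<^bsub>M\<^esub> v \<in> top_part J n" unfolding top_part_def using add_seqs[OF yz(1,5)] yz(4,8)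
      by (auto intro!: exI[of _ "\<lambda>n. y n \<oplus>\<^bsub>M\<^esub> z n"])
  next
    fix r u assume r: "r \<in> carrier R" and "u \<in> top_part J n"
    then obtain y where y: "y \<in> seqs" "cls y \<in> J" "\<forall>m>n. y m = \<zero>\<^bsub>M\<^esub>" "u = y n" unfolding top_part_def by blast
    have r0: "r \<in> ideal_pow R I 0" using r by (simp add: ideals_set_def)
    have "cls (\<lambda>n. r \<odot>\<^bsub>M\<^esub> y n) \<in> J" using submodule_smult[OF J monom_carrier[OF r0] y(2)] scalar_smult[OF r y(1)] by simp
    moreover have "(\<lambda>n. r \<odot>\<^bsub>M\<^esub> y n) \<in> seqs"
    proof -
      have "r \<odot>\<^bsub>M\<^esub> y n \<in> F n" for n using submodule_smult[OF F_submodule r seqsD(1)[OF y(1)]] .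
      moreover have "\<forall>m\<ge>Suc n. r \<odot>\<^bsub>M\<^esub> y m = \<zero>\<^bsub>M\<^esub>" using y(3) r by simp
      ultimately show ?thesis unfolding seqs_def by blast
    qed
    moreover have "\<forall>m>n. r \<odot>\<^bsub>M\<^esub> y m = \<zero>\<^bsub>M\<^esub>" using y(3) r by simp
    ultimately show "r \<odot>\<^bsub>M\<^esub> u \<in> top_part J n" unfolding top_part_def using y(4)
      by (auto intro!: exI[of _ "\<lambda>n. r \<odot>\<^bsub>M\<^esub> y n"])
  qed
  show "top_part J n \<subseteq> F n" unfolding top_part_def using seqsD(1) by blast
  show "F (Suc n) \<subseteq> top_part J n"
  proof
    fix u assume u: "u \<in> F (Suc n)"
    then have un: "u \<in> F n" using F_Suc by blast
    let ?y = "\<lambda>m. if m = n then u else \<zero>\<^bsub>M\<^esub>"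
    have "cls ?y = cls (\<lambda>_. \<zero>\<^bsub>M\<^esub>)"
      by (subst cls_eq_iff) (use u un submodule_zero[OF F_submodule] submodule_minus[OF F_submodule] in auto)
    then have "cls ?y \<in> J" using submodule_zero[OF J] by (simp add: Gr_zero)
    then show "u \<in> top_part J n" unfolding top_part_def using single_seqs[OF un] by (auto intro!: exI[of _ ?y])
  qed
next
  interpret G: module GrR Gr by (rule Gr_module)
  show "shift_closed M X (top_part J)"
    unfolding shift_closed_def
  proof (intro ballI allI)
    fix x n u assume x: "x \<in> X" and "u \<in> top_part J n"
    then obtain y where y: "y \<in> seqs" "cls y \<in> J" "\<forall>m>n. y m = \<zero>\<^bsub>M\<^esub>" "u = y n" unfolding top_part_def by blast
    let ?z = "\<lambda>n. if Suc 0 \<le> n then x \<odot>\<^bsub>M\<^esub> y (n - Suc 0) else \<zero>\<^bsub>M\<^esub>"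
    have xc: "x \<in> carrier R" and x1: "x \<in> ideal_pow R I (Suc 0)" using x X R.ideal_closed(1)[OF ideal_I] R.ideal_pow_1[OF ideal_I] by auto
    have "cls ?z \<in> J" using submodule_smult[OF J monom_carrier[OF x1] y(2)] monom_smult[OF x1 y(1)] by simp
    moreover have "?z m \<in> F m" for m
      using F_smult[OF x1 seqsD(1)[OF y(1)], of "m - Suc 0"] submodule_zero[OF F_submodule] by auto
    moreover have z: "\<forall>m\<ge>Suc (Suc n). ?z m = \<zero>\<^bsub>M\<^esub>" using y(3) xc by auto
    ultimately have "?z \<in> seqs" "cls ?z \<in> J" "\<forall>m>Suc n. ?z m = \<zero>\<^bsub>M\<^esub>" unfolding seqs_def by (blast, blast, simp)
    then show "x \<odot>\<^bsub>M\<^esub> u \<in> top_part J (Suc n)" unfolding top_part_def using y(4)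
      by (intro CollectI exI[of _ ?z]) simp
  qed
qed

text \<open>Comparable submodules of \<open>Gr\<close>, graded or not, are equal if their top-degree components agree:
  subtracting an element with the same leading component lowers the degree.\<close>
theorem Gr_noetherian:
  assumes X: "X \<subseteq> I" and acc: "asc_chain_cond (graded_family R M X (\<lambda>n. F (Suc n)) F)"
  shows "noeth_module GrR Gr"
  unfolding noeth_module_def
proof (rule asc_chain_cond_transfer[OF acc, of _ top_part])
  interpret G: module GrR Gr by (rule Gr_module)
  show "graded_family R M X (\<lambda>n. F (Suc n)) F (top_part J)" if "submodule J GrR Gr" for J
    using top_part_family[OF that X] .
  show "top_part J \<le> top_part J'" if "J \<le> J'" for J J' using that unfolding top_part_def le_fun_def by blast
  fix J J' assume J: "submodule J GrR Gr" and J': "submodule J' GrR Gr" and le: "J \<subseteq> J'" and eq: "top_part J = top_part J'"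
  have "cls y \<in> J" if "y \<in> seqs" "cls y \<in> J'" "\<And>m. m \<ge> d \<Longrightarrow> y m = \<zero>\<^bsub>M\<^esub>" for y d
    using that
  proof (induct d arbitrary: y)
    case 0
    then have "y = (\<lambda>_. \<zero>\<^bsub>M\<^esub>)" by auto
    then show ?case using submodule_zero[OF J] by (simp add: Gr_zero)
  next
    case (Suc n)
    then have "y n \<in> top_part J' n" unfolding top_part_def by (auto simp: Suc_le_eq)
    then have "y n \<in> top_part J n" using eq by simp
    then obtain z where z: "z \<in> seqs" "cls z \<in> J" "\<forall>m>n. z m = \<zero>\<^bsub>M\<^esub>" "y n = z n" unfolding top_part_def by blast
    let ?w = "\<lambda>m. y m \<oplus>\<^bsub>M\<^esub> \<ominus>\<^bsub>M\<^esub> z m"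
    have w: "?w \<in> seqs" using add_seqs[OF Suc.prems(1) neg_seqs[OF z(1)]] .
    have cw: "cls ?w = cls y \<oplus>\<^bsub>Gr\<^esub> \<ominus>\<^bsub>Gr\<^esub> cls z" using Gr_add[OF Suc.prems(1) neg_seqs[OF z(1)]] Gr_neg[OF z(1)] by simp
    have "cls z \<in> J'" using z(2) le by blast
    then have "cls ?w \<in> J'" unfolding cw using submodule_add[OF J' Suc.prems(2)] submodule_neg[OF J'] by blast
    moreover have "?w m = \<zero>\<^bsub>M\<^esub>" if "m \<ge> n" for m
    proof (cases "m = n")
      case True then show ?thesis using z(4) seqsD(2)[OF z(1)] by (simp add: M.r_neg)
    next
      case False
      then have "y m = \<zero>\<^bsub>M\<^esub>" "z m = \<zero>\<^bsub>M\<^esub>" using that Suc.prems(3)[of m] z(3) by auto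
      then show ?thesis using M.r_neg[OF M.zero_closed] by simp
    qed
    ultimately have "cls ?w \<in> J" using Suc.hyps[OF w] by blast
    then have "cls y \<oplus>\<^bsub>Gr\<^esub> \<ominus>\<^bsub>Gr\<^esub> cls z \<in> J" unfolding cw .
    moreover have "cls y \<in> carrier Gr" unfolding Gr_carrier using Suc.prems(1) by blast
    ultimately show ?case using G.submodule_add_cancel[OF J] submodule_neg[OF J z(2)] by blast
  qed
  then have "J' \<subseteq> J" using submodule_in_carrier[OF J'] unfolding Gr_carrier seqs_def by blast
  then show "J = J'" using le by blast
qed

end


section \<open>Cohen-Macaulay modules of dimension one over a local ring\<close>

context module
begin

lemma quot_nonzerodivisor_iff:
  assumes N: "submodule N R M" and a: "a \<in> carrier R"
  shows "nonzerodivisor_on (quot_module M N) a \<longleftrightarrow> (\<forall>u\<in>carrier M. a \<odot>\<^bsub>M\<^esub> u \<in> N \<longrightarrow> u \<in> N)"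
proof -
  have "(a \<odot>\<^bsub>quot_module M N\<^esub> (N +>\<^bsub>M\<^esub> u) = N \<longrightarrow> N +>\<^bsub>M\<^esub> u = N) \<longleftrightarrow> (a \<odot>\<^bsub>M\<^esub> u \<in> N \<longrightarrow> u \<in> N)"
    if "u \<in> carrier M" for u
    using that a coset_zero_iff[OF N] by (simp add: quot_smult[OF N])
  moreover have "nonzerodivisor_on (quot_module M N) a \<longleftrightarrow>
      (\<forall>u\<in>carrier M. a \<odot>\<^bsub>quot_module M N\<^esub> (N +>\<^bsub>M\<^esub> u) = N \<longrightarrow> N +>\<^bsub>M\<^esub> u = N)"
    unfolding nonzerodivisor_on_def quot_carrier[OF N] quot_zero[OF N] Setcompr_eq_image by simp
  ultimately show ?thesis by simp
qed

lemma quot_nontrivial_iff: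
  assumes N: "submodule N R M"
  shows "carrier (quot_module M N) \<noteq> {\<zero>\<^bsub>quot_module M N\<^esub>} \<longleftrightarrow> N \<noteq> carrier M"
proof -
  have "carrier (quot_module M N) = {\<zero>\<^bsub>quot_module M N\<^esub>} \<longleftrightarrow> (\<forall>u\<in>carrier M. N +>\<^bsub>M\<^esub> u = N)"
    unfolding quot_carrier[OF N] quot_zero[OF N] using M.zero_closed by blast
  also have "\<dots> \<longleftrightarrow> carrier M \<subseteq> N" using coset_zero_iff[OF N] by blast
  also have "\<dots> \<longleftrightarrow> N = carrier M" using submodule_in_carrier[OF N] by blast
  finally show ?thesis by blast
qed

lemma ideal_smult_Idl_empty: "ideal_smult R (Idl {}) M = {\<zero>\<^bsub>M\<^esub>}"
proof -
  have "Idl {} \<subseteq> {\<zero>}" by (rule R.genideal_minimal[OF R.zeroideal]) simp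
  then have "ideal_smult R (Idl {}) M \<subseteq> {\<zero>\<^bsub>M\<^esub>}" by (intro ideal_smult_least[OF zero_submodule]) auto
  moreover have "\<zero>\<^bsub>M\<^esub> \<in> ideal_smult R (Idl {}) M"
    using submodule_zero[OF ideal_smult_submodule] R.ideal_closed(1)[OF R.genideal_ideal[of "{}"]] by blast
  ultimately show ?thesis by blast
qed

lemma ideal_smult_Idl_single:
  assumes x: "x \<in> carrier R" shows "ideal_smult R (Idl {x}) M = (\<lambda>v. x \<odot>\<^bsub>M\<^esub> v) ` carrier M"
proof
  show "ideal_smult R (Idl {x}) M \<subseteq> (\<lambda>v. x \<odot>\<^bsub>M\<^esub> v) ` carrier M"
    by (rule ideal_smult_least[OF submodule_smult_image[OF x carrier_is_submodule]])
       (rule Idl_smult[OF submodule_smult_image[OF x carrier_is_submodule]], use x in auto)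
  have "x \<in> Idl {x}" using R.genideal_self[of "{x}"] x by blast
  then show "(\<lambda>v. x \<odot>\<^bsub>M\<^esub> v) ` carrier M \<subseteq> ideal_smult R (Idl {x}) M" using ideal_smult_mem by blast
qed

lemma pow_regular:
  assumes p: "p \<in> carrier R" "nonzerodivisor_on M p"
  shows "v \<in> carrier M \<Longrightarrow> (p [^] (n::nat)) \<odot>\<^bsub>M\<^esub> v = \<zero>\<^bsub>M\<^esub> \<Longrightarrow> v = \<zero>\<^bsub>M\<^esub>"
  using regular_mod_power[OF p(1), of "{\<zero>\<^bsub>M\<^esub>}" v n] p(2) unfolding nonzerodivisor_on_def by auto

text \<open>A minimal prime of \<open>M\<close> consists of zero divisors, so that \<open>Q\<close> is not minimal.\<close>
lemma prime_chain_of_regular: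
  assumes noeth: "noetherian_ring R" and Q: "primeideal Q R" and p: "p \<in> Q" "nonzerodivisor_on M p"
    and ann: "annihilator R M \<subseteq> Q"
  shows "prime_chain_over R (annihilator R M) 1"
proof -
  have pc: "p \<in> carrier R" using R.ideal_closed(1)[OF primeidealD(1)[OF Q] p(1)] .
  have "s \<in> Q" if s: "s \<in> carrier R" "p [^] (n::nat) \<otimes> s \<in> annihilator R M" for n s
  proof -
    have "s \<odot>\<^bsub>M\<^esub> v = \<zero>\<^bsub>M\<^esub>" if v: "v \<in> carrier M" for v
      using pow_regular[OF pc p(2), of "s \<odot>\<^bsub>M\<^esub> v" n] s v pc by (simp add: annihilator_def smult_assoc1)
    then have "s \<in> annihilator R M" unfolding annihilator_def using s(1) by blast
    then show ?thesis using ann by blast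
  qed
  then obtain P where "primeideal P R" "annihilator R M \<subseteq> P" "P \<subset> Q"
    using R.prime_strictly_below[OF noeth annihilator_ideal Q p(1)] by blast
  then show ?thesis unfolding prime_chain_over_1 using Q by blast
qed

lemma annihilator_proper: "carrier M \<noteq> {\<zero>\<^bsub>M\<^esub>} \<Longrightarrow> annihilator R M \<noteq> carrier R"
proof
  assume "carrier M \<noteq> {\<zero>\<^bsub>M\<^esub>}" and a: "annihilator R M = carrier R"
  then obtain v where v: "v \<in> carrier M" "v \<noteq> \<zero>\<^bsub>M\<^esub>" using M.zero_closed by blast
  have "\<one> \<in> annihilator R M" using a by simp
  then show False using v unfolding annihilator_def by auto
qed

text \<open>Depth at least one is Nakayama's lemma for the regular element \<open>p\<close>. A regular sequence
  \<open>a, b\<close> is impossible: \<open>a\<close> is a parameter, so a power of \<open>b\<close> maps \<open>M\<close> into \<open>a M\<close>, and then \<open>M = a M\<close>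
  because \<open>b\<close> is regular on \<open>M / a M\<close>.\<close>
theorem cohen_macaulay_local_dim_one:
  assumes local: "noetherian_local_ring R \<mm>" and noeth: "noeth_module R M"
    and nz: "carrier M \<noteq> {\<zero>\<^bsub>M\<^esub>}"
    and p: "p \<in> \<mm>" "nonzerodivisor_on M p"
    and dim: "\<not> prime_chain_over R (annihilator R M) 2"
  shows "cohen_macaulay_local R \<mm> M"
proof -
  have nR: "noetherian_ring R" and max: "maximalideal \<mm> R" and uniq: "\<And>J. maximalideal J R \<Longrightarrow> J = \<mm>"
    using local unfolding noetherian_local_ring_def by auto
  have mp: "primeideal \<mm> R" by (rule R.maximalideal_prime[OF max])
  have mc: "x \<in> \<mm> \<Longrightarrow> x \<in> carrier R" for x using R.ideal_closed(1)[OF primeidealD(1)[OF mp]] .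
  obtain P where "maximalideal P R" "annihilator R M \<subseteq> P"
    using R.exists_maximal_ideal[OF nR annihilator_ideal annihilator_proper[OF nz]] by blast
  then have "annihilator R M \<subseteq> \<mm>" using uniq by blast
  then have "prime_chain_over R (annihilator R M) 1" by (rule prime_chain_of_regular[OF nR mp p])
  then have dim1: "module_dim R M = 1" unfolding module_dim_1_iff using dim by blast
  let ?Q = "\<lambda>as i. ideal_smult R (Idl (set (take i as))) M"
  have Qs: "submodule (?Q as i) R M" if "set as \<subseteq> carrier R" for as :: "'a list" and i
  proof (rule ideal_smult_submodule)
    have "set (take i as) \<subseteq> carrier R" using that set_take_subset[of i as] by blast
    then show "Idl (set (take i as)) \<subseteq> carrier R" using R.ideal_closed(1)[OF R.genideal_ideal] by blast
  qed
  have reg: "regular_sequence R M as \<longleftrightarrow> (\<forall>i<length as. \<forall>u\<in>carrier M. (as ! i) \<odot>\<^bsub>M\<^esub> u \<in> ?Q as i \<longrightarrow> u \<in> ?Q as i)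
      \<and> ?Q as (length as) \<noteq> carrier M" if as: "set as \<subseteq> carrier R" for as
  proof -
    have "nonzerodivisor_on (quot_module M (?Q as i)) (as ! i) \<longleftrightarrow> (\<forall>u\<in>carrier M. (as ! i) \<odot>\<^bsub>M\<^esub> u \<in> ?Q as i \<longrightarrow> u \<in> ?Q as i)"
      if "i < length as" for i
      by (rule quot_nonzerodivisor_iff[OF Qs[OF as]]) (use as that nth_mem in blast)
    then show ?thesis unfolding regular_sequence_def Let_def using as quot_nontrivial_iff[OF Qs[OF as]] by blast
  qed
  have pM: "(\<lambda>v. p \<odot>\<^bsub>M\<^esub> v) ` carrier M \<noteq> carrier M"
  proof -
    obtain D' where "submodule D' R M" "D' \<noteq> carrier M" "\<And>a v. a \<in> \<mm> \<Longrightarrow> v \<in> carrier M \<Longrightarrow> a \<odot>\<^bsub>M\<^esub> v \<in> D'"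
      using nakayama_proper[OF local noeth zero_submodule] nz by metis
    note D' = this
    have "(\<lambda>v. p \<odot>\<^bsub>M\<^esub> v) ` carrier M \<subseteq> D'" using D'(3)[OF p(1)] by blast
    moreover have "D' \<subseteq> carrier M" using submodule_in_carrier[OF D'(1)] by blast
    ultimately show ?thesis using D'(2) by blast
  qed
  have "regular_sequence R M [p]"
    using p mc[OF p(1)] pM unfolding nonzerodivisor_on_def
    by (subst reg) (auto simp: ideal_smult_Idl_empty ideal_smult_Idl_single)
  then have ge: "1 \<le> module_depth R \<mm> M"
    unfolding module_depth_def using p(1) by (intro Sup_upper) (auto simp: one_enat_def intro!: exI[of _ "[p]"])
  have "length as \<le> 1" if as: "set as \<subseteq> \<mm>" "regular_sequence R M as" for as
  proof (rule ccontr)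
    assume "\<not> length as \<le> 1"
    then obtain a b bs where abs: "as = a # b # bs" by (metis (no_types) One_nat_def Suc_le_mono le0 length_Cons list.exhaust list.size(3))
    have asc: "set as \<subseteq> carrier R" using as(1) mc by blast
    have ab: "a \<in> \<mm>" "b \<in> \<mm>" "a \<in> carrier R" "b \<in> carrier R" using as(1) abs mc by auto
    note r = as(2)[unfolded reg[OF asc]]
    have "0 < length as" "1 < length as" using abs by auto
    with r have r0: "\<forall>u\<in>carrier M. (as ! 0) \<odot>\<^bsub>M\<^esub> u \<in> ?Q as 0 \<longrightarrow> u \<in> ?Q as 0"
      and r1: "\<forall>u\<in>carrier M. (as ! 1) \<odot>\<^bsub>M\<^esub> u \<in> ?Q as 1 \<longrightarrow> u \<in> ?Q as 1" by blast+
    let ?aM = "(\<lambda>v. a \<odot>\<^bsub>M\<^esub> v) ` carrier M"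
    have a0: "u \<in> {\<zero>\<^bsub>M\<^esub>}" if "u \<in> carrier M" "a \<odot>\<^bsub>M\<^esub> u \<in> {\<zero>\<^bsub>M\<^esub>}" for u
      using r0 that by (simp add: abs ideal_smult_Idl_empty)
    have b1: "u \<in> ?aM" if "u \<in> carrier M" "b \<odot>\<^bsub>M\<^esub> u \<in> ?aM" for u
      using r1 that by (simp add: abs ideal_smult_Idl_single[OF ab(3)])
    have aM: "submodule ?aM R M" by (rule submodule_smult_image[OF ab(3) carrier_is_submodule])
    have z: "{\<zero>\<^bsub>M\<^esub>} <+>\<^bsub>M\<^esub> ?aM \<subseteq> ?aM" by (rule sum_least[OF aM]) (use submodule_zero[OF aM] in auto)
    obtain n :: nat where "\<And>v. v \<in> carrier M \<Longrightarrow> (b [^] n) \<odot>\<^bsub>M\<^esub> v \<in> {\<zero>\<^bsub>M\<^esub>} <+>\<^bsub>M\<^esub> ?aM"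
      using regular_element_parameter[OF local dim zero_submodule ab(1) a0 ab(2)] by metis
    then have n: "(b [^] n) \<odot>\<^bsub>M\<^esub> v \<in> ?aM" if "v \<in> carrier M" for v using z that by blast
    have "v \<in> ?aM" if "v \<in> carrier M" "(b [^] (j::nat)) \<odot>\<^bsub>M\<^esub> v \<in> ?aM" for v j
      by (rule regular_mod_power[OF ab(4) b1 that])
    then have top: "carrier M \<subseteq> ?aM" using n by blast
    have "?aM \<subseteq> ?Q as (length as)"
    proof -
      have "a \<in> Idl (set as)" using R.genideal_self[OF asc] abs by auto
      then show ?thesis using ideal_smult_mem by (auto simp: ideal_smult_mem)
    qed
    then have "?Q as (length as) = carrier M" using top submodule_in_carrier[OF Qs[OF asc]] by blast
    then show False using r by blast
  qed
  then have "module_depth R \<mm> M \<le> 1" unfolding module_depth_def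
    by (intro Sup_least) (auto simp: one_enat_def)
  then have "module_depth R \<mm> M = 1" using ge by (rule antisym)
  then show ?thesis unfolding cohen_macaulay_local_def using local fin_gen_of_noeth[OF noeth] dim1 by simp
qed

end


section \<open>Localization at a prime ideal\<close>

locale localized_module = module R M for R (structure) and M (structure) +
  fixes P :: "'a set" assumes prime: "primeideal P R"
begin

abbreviation "S \<equiv> carrier R - P"
abbreviation "lfrac \<equiv> loc_frac R S M"
abbreviation "rfrac \<equiv> loc_frac R S (self_module R)"
abbreviation "MP \<equiv> loc_module R S M"
abbreviation "RP \<equiv> loc_ring R S"

lemma S_one: "\<one> \<in> S" using primeidealD(3)[OF prime] by simp

lemma S_mult: "s \<in> S \<Longrightarrow> t \<in> S \<Longrightarrow> s \<otimes> t \<in> S" using primeidealD(4)[OF prime] by auto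

lemma frac_mem: "(y, t) \<in> lfrac x s \<longleftrightarrow> y \<in> carrier M \<and> t \<in> S \<and> (\<exists>u\<in>S. u \<odot>\<^bsub>M\<^esub> (t \<odot>\<^bsub>M\<^esub> x) = u \<odot>\<^bsub>M\<^esub> (s \<odot>\<^bsub>M\<^esub> y))"
  by (simp add: loc_frac_def)

text \<open>The witness is \<open>u v t\<close>, built from the witnesses \<open>u\<close>, \<open>v\<close> of the two equalities and the middle denominator.\<close>
lemma frac_trans:
  assumes c: "x \<in> carrier M" "y \<in> carrier M" "z \<in> carrier M" "s \<in> S" "t \<in> S" "r \<in> S"
    and 1: "\<exists>u\<in>S. u \<odot>\<^bsub>M\<^esub> (t \<odot>\<^bsub>M\<^esub> x) = u \<odot>\<^bsub>M\<^esub> (s \<odot>\<^bsub>M\<^esub> y)"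
    and 2: "\<exists>u\<in>S. u \<odot>\<^bsub>M\<^esub> (r \<odot>\<^bsub>M\<^esub> y) = u \<odot>\<^bsub>M\<^esub> (t \<odot>\<^bsub>M\<^esub> z)"
  shows "\<exists>u\<in>S. u \<odot>\<^bsub>M\<^esub> (r \<odot>\<^bsub>M\<^esub> x) = u \<odot>\<^bsub>M\<^esub> (s \<odot>\<^bsub>M\<^esub> z)"
proof -
  from 1 obtain u where u: "u \<in> S" "u \<odot>\<^bsub>M\<^esub> (t \<odot>\<^bsub>M\<^esub> x) = u \<odot>\<^bsub>M\<^esub> (s \<odot>\<^bsub>M\<^esub> y)" by blast
  from 2 obtain v where v: "v \<in> S" "v \<odot>\<^bsub>M\<^esub> (r \<odot>\<^bsub>M\<^esub> y) = v \<odot>\<^bsub>M\<^esub> (t \<odot>\<^bsub>M\<^esub> z)" by blast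
  have car: "u \<in> carrier R" "v \<in> carrier R" "s \<in> carrier R" "t \<in> carrier R" "r \<in> carrier R" using u v c by auto
  have "(u \<otimes> v \<otimes> t) \<odot>\<^bsub>M\<^esub> (r \<odot>\<^bsub>M\<^esub> x) = (v \<otimes> r) \<odot>\<^bsub>M\<^esub> (u \<odot>\<^bsub>M\<^esub> (t \<odot>\<^bsub>M\<^esub> x))"
    using car c by (simp add: R.m_ac flip: smult_assoc1)
  also have "\<dots> = (u \<otimes> s) \<odot>\<^bsub>M\<^esub> (v \<odot>\<^bsub>M\<^esub> (r \<odot>\<^bsub>M\<^esub> y))"
    unfolding u(2) using car c by (simp add: R.m_ac flip: smult_assoc1)
  also have "\<dots> = (u \<otimes> v \<otimes> t) \<odot>\<^bsub>M\<^esub> (s \<odot>\<^bsub>M\<^esub> z)"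
    unfolding v(2) using car c by (simp add: R.m_ac flip: smult_assoc1)
  finally show ?thesis using S_mult u(1) v(1) c(5) by blast
qed

lemma frac_eq_iff:
  assumes c: "x \<in> carrier M" "y \<in> carrier M" "s \<in> S" "t \<in> S"
  shows "lfrac x s = lfrac y t \<longleftrightarrow> (\<exists>u\<in>S. u \<odot>\<^bsub>M\<^esub> (t \<odot>\<^bsub>M\<^esub> x) = u \<odot>\<^bsub>M\<^esub> (s \<odot>\<^bsub>M\<^esub> y))"
proof
  assume eq: "lfrac x s = lfrac y t"
  have "(y, t) \<in> lfrac y t" unfolding frac_mem using c S_one by blast
  then show "\<exists>u\<in>S. u \<odot>\<^bsub>M\<^esub> (t \<odot>\<^bsub>M\<^esub> x) = u \<odot>\<^bsub>M\<^esub> (s \<odot>\<^bsub>M\<^esub> y)" unfolding eq[symmetric] frac_mem by blast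
next
  assume xy: "\<exists>u\<in>S. u \<odot>\<^bsub>M\<^esub> (t \<odot>\<^bsub>M\<^esub> x) = u \<odot>\<^bsub>M\<^esub> (s \<odot>\<^bsub>M\<^esub> y)"
  then have yx: "\<exists>u\<in>S. u \<odot>\<^bsub>M\<^esub> (s \<odot>\<^bsub>M\<^esub> y) = u \<odot>\<^bsub>M\<^esub> (t \<odot>\<^bsub>M\<^esub> x)" by metis
  have "(z, r) \<in> lfrac x s \<longleftrightarrow> (z, r) \<in> lfrac y t" for z r
    unfolding frac_mem using frac_trans[OF c(2,1) _ c(4,3) _ yx] frac_trans[OF c(1,2) _ c(3,4) _ xy] by blast
  then show "lfrac x s = lfrac y t" by auto
qed

lemma frac_cancel: "x \<in> carrier M \<Longrightarrow> s \<in> S \<Longrightarrow> c \<in> S \<Longrightarrow> lfrac (c \<odot>\<^bsub>M\<^esub> x) (c \<otimes> s) = lfrac x s"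
  using S_mult[of c s] S_one by (subst frac_eq_iff) (auto intro!: bexI[of _ "\<one>"] simp: R.m_comm simp flip: smult_assoc1)

lemma frac_self_mem: "x \<in> carrier M \<Longrightarrow> s \<in> S \<Longrightarrow> (x, s) \<in> lfrac x s"
  unfolding frac_mem using S_one by blast

lemma MP_carrier: "carrier MP = {lfrac x s | x s. x \<in> carrier M \<and> s \<in> S}"
  by (simp add: loc_module_def)

lemma MP_zero: "\<zero>\<^bsub>MP\<^esub> = lfrac \<zero>\<^bsub>M\<^esub> \<one>" by (simp add: loc_module_def)

lemma frac_zero_iff:
  assumes "x \<in> carrier M" "s \<in> S"
  shows "lfrac x s = \<zero>\<^bsub>MP\<^esub> \<longleftrightarrow> (\<exists>u\<in>S. u \<odot>\<^bsub>M\<^esub> x = \<zero>\<^bsub>M\<^esub>)"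
  unfolding MP_zero using assms S_one by (subst frac_eq_iff) auto

lemma MP_add:
  assumes c: "x \<in> carrier M" "s \<in> S" "y \<in> carrier M" "t \<in> S"
  shows "lfrac x s \<oplus>\<^bsub>MP\<^esub> lfrac y t = lfrac (t \<odot>\<^bsub>M\<^esub> x \<oplus>\<^bsub>M\<^esub> s \<odot>\<^bsub>M\<^esub> y) (s \<otimes> t)"
proof -
  have "lfrac (t' \<odot>\<^bsub>M\<^esub> x' \<oplus>\<^bsub>M\<^esub> s' \<odot>\<^bsub>M\<^esub> y') (s' \<otimes> t') = lfrac (t \<odot>\<^bsub>M\<^esub> x \<oplus>\<^bsub>M\<^esub> s \<odot>\<^bsub>M\<^esub> y) (s \<otimes> t)"
    if xs: "(x', s') \<in> lfrac x s" and yt: "(y', t') \<in> lfrac y t" for x' s' y' t'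
  proof -
    from xs obtain u where u: "x' \<in> carrier M" "s' \<in> S" "u \<in> S" "u \<odot>\<^bsub>M\<^esub> (s' \<odot>\<^bsub>M\<^esub> x) = u \<odot>\<^bsub>M\<^esub> (s \<odot>\<^bsub>M\<^esub> x')" unfolding frac_mem by blast
    from yt obtain v where v: "y' \<in> carrier M" "t' \<in> S" "v \<in> S" "v \<odot>\<^bsub>M\<^esub> (t' \<odot>\<^bsub>M\<^esub> y) = v \<odot>\<^bsub>M\<^esub> (t \<odot>\<^bsub>M\<^esub> y')" unfolding frac_mem by blast
    have car: "u \<in> carrier R" "v \<in> carrier R" "s \<in> carrier R" "t \<in> carrier R" "s' \<in> carrier R" "t' \<in> carrier R" using u v c by auto
    have "(u \<otimes> v) \<odot>\<^bsub>M\<^esub> ((s \<otimes> t) \<odot>\<^bsub>M\<^esub> (t' \<odot>\<^bsub>M\<^esub> x' \<oplus>\<^bsub>M\<^esub> s' \<odot>\<^bsub>M\<^esub> y'))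
        = (v \<otimes> t \<otimes> t') \<odot>\<^bsub>M\<^esub> (u \<odot>\<^bsub>M\<^esub> (s \<odot>\<^bsub>M\<^esub> x')) \<oplus>\<^bsub>M\<^esub> (u \<otimes> s \<otimes> s') \<odot>\<^bsub>M\<^esub> (v \<odot>\<^bsub>M\<^esub> (t \<odot>\<^bsub>M\<^esub> y'))"
      using car u(1) v(1) by (simp add: smult_r_distr R.m_ac flip: smult_assoc1)
    also have "\<dots> = (u \<otimes> v) \<odot>\<^bsub>M\<^esub> ((s' \<otimes> t') \<odot>\<^bsub>M\<^esub> (t \<odot>\<^bsub>M\<^esub> x \<oplus>\<^bsub>M\<^esub> s \<odot>\<^bsub>M\<^esub> y))"
      unfolding u(4)[symmetric] v(4)[symmetric] using car c by (simp add: smult_r_distr R.m_ac flip: smult_assoc1)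
    finally have eq: "(u \<otimes> v) \<odot>\<^bsub>M\<^esub> ((s \<otimes> t) \<odot>\<^bsub>M\<^esub> (t' \<odot>\<^bsub>M\<^esub> x' \<oplus>\<^bsub>M\<^esub> s' \<odot>\<^bsub>M\<^esub> y'))
      = (u \<otimes> v) \<odot>\<^bsub>M\<^esub> ((s' \<otimes> t') \<odot>\<^bsub>M\<^esub> (t \<odot>\<^bsub>M\<^esub> x \<oplus>\<^bsub>M\<^esub> s \<odot>\<^bsub>M\<^esub> y))" .
    have "t' \<odot>\<^bsub>M\<^esub> x' \<oplus>\<^bsub>M\<^esub> s' \<odot>\<^bsub>M\<^esub> y' \<in> carrier M" "t \<odot>\<^bsub>M\<^esub> x \<oplus>\<^bsub>M\<^esub> s \<odot>\<^bsub>M\<^esub> y \<in> carrier M" using car c u v by auto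
    then show ?thesis using eq S_mult[OF u(3) v(3)] S_mult[OF c(2,4)] S_mult[OF u(2) v(2)] frac_eq_iff by blast
  qed
  moreover have "lfrac x s \<oplus>\<^bsub>MP\<^esub> lfrac y t
      = (\<Union>(x, s)\<in>lfrac x s. \<Union>(y, t)\<in>lfrac y t. lfrac (t \<odot>\<^bsub>M\<^esub> x \<oplus>\<^bsub>M\<^esub> s \<odot>\<^bsub>M\<^esub> y) (s \<otimes> t))"
    by (simp add: loc_module_def)
  ultimately show ?thesis using frac_self_mem[OF c(1,2)] frac_self_mem[OF c(3,4)] by fast
qed

lemma rfrac_mem: "(b, t) \<in> rfrac a s \<longleftrightarrow> b \<in> carrier R \<and> t \<in> S \<and> (\<exists>u\<in>S. u \<otimes> (t \<otimes> a) = u \<otimes> (s \<otimes> b))"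
  by (simp add: loc_frac_def self_module_def)

lemma MP_smult:
  assumes c: "a \<in> carrier R" "s \<in> S" "y \<in> carrier M" "t \<in> S"
  shows "rfrac a s \<odot>\<^bsub>MP\<^esub> lfrac y t = lfrac (a \<odot>\<^bsub>M\<^esub> y) (s \<otimes> t)"
proof -
  have "lfrac (a' \<odot>\<^bsub>M\<^esub> y') (s' \<otimes> t') = lfrac (a \<odot>\<^bsub>M\<^esub> y) (s \<otimes> t)"
    if xs: "(a', s') \<in> rfrac a s" and yt: "(y', t') \<in> lfrac y t" for a' s' y' t'
  proof -
    from xs obtain u where u: "a' \<in> carrier R" "s' \<in> S" "u \<in> S" "u \<otimes> (s' \<otimes> a) = u \<otimes> (s \<otimes> a')" unfolding rfrac_mem by blast
    from yt obtain v where v: "y' \<in> carrier M" "t' \<in> S" "v \<in> S" "v \<odot>\<^bsub>M\<^esub> (t' \<odot>\<^bsub>M\<^esub> y) = v \<odot>\<^bsub>M\<^esub> (t \<odot>\<^bsub>M\<^esub> y')" unfolding frac_mem by blast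
    have car: "u \<in> carrier R" "v \<in> carrier R" "s \<in> carrier R" "t \<in> carrier R" "s' \<in> carrier R" "t' \<in> carrier R" using u v c by auto
    have "(u \<otimes> v) \<odot>\<^bsub>M\<^esub> ((s \<otimes> t) \<odot>\<^bsub>M\<^esub> (a' \<odot>\<^bsub>M\<^esub> y')) = (u \<otimes> (s \<otimes> a')) \<odot>\<^bsub>M\<^esub> (v \<odot>\<^bsub>M\<^esub> (t \<odot>\<^bsub>M\<^esub> y'))"
      using car u(1) v(1) by (simp add: R.m_ac flip: smult_assoc1)
    also have "\<dots> = (u \<otimes> v) \<odot>\<^bsub>M\<^esub> ((s' \<otimes> t') \<odot>\<^bsub>M\<^esub> (a \<odot>\<^bsub>M\<^esub> y))"
      unfolding u(4)[symmetric] v(4)[symmetric] using car c by (simp add: R.m_ac flip: smult_assoc1)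
    finally have eq: "(u \<otimes> v) \<odot>\<^bsub>M\<^esub> ((s \<otimes> t) \<odot>\<^bsub>M\<^esub> (a' \<odot>\<^bsub>M\<^esub> y')) = (u \<otimes> v) \<odot>\<^bsub>M\<^esub> ((s' \<otimes> t') \<odot>\<^bsub>M\<^esub> (a \<odot>\<^bsub>M\<^esub> y))" .
    have "a' \<odot>\<^bsub>M\<^esub> y' \<in> carrier M" "a \<odot>\<^bsub>M\<^esub> y \<in> carrier M" using car c u v by auto
    then show ?thesis using eq S_mult[OF u(3) v(3)] S_mult[OF c(2,4)] S_mult[OF u(2) v(2)] frac_eq_iff by blast
  qed
  moreover have "(a, s) \<in> rfrac a s" unfolding rfrac_mem using c S_one by blast
  moreover have "rfrac a s \<odot>\<^bsub>MP\<^esub> lfrac y t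
      = (\<Union>(a, s)\<in>rfrac a s. \<Union>(y, t)\<in>lfrac y t. lfrac (a \<odot>\<^bsub>M\<^esub> y) (s \<otimes> t))"
    by (simp add: loc_module_def)
  ultimately show ?thesis using frac_self_mem[OF c(3,4)] by fast
qed

lemma MP_abelian_group: "abelian_group MP"
proof (rule abelian_groupI)
  show "\<zero>\<^bsub>MP\<^esub> \<in> carrier MP" unfolding MP_carrier MP_zero using S_one by blast
  fix f assume "f \<in> carrier MP"
  then obtain x s where x: "x \<in> carrier M" "s \<in> S" "f = lfrac x s" unfolding MP_carrier by blast
  have sc: "s \<in> carrier R" using x by blast
  have "lfrac (\<ominus>\<^bsub>M\<^esub> x) s \<oplus>\<^bsub>MP\<^esub> f = \<zero>\<^bsub>MP\<^esub>"
    unfolding x(3) MP_add[OF M.a_inv_closed[OF x(1)] x(2,1,2)]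
    using frac_zero_iff[of "s \<odot>\<^bsub>M\<^esub> (\<ominus>\<^bsub>M\<^esub> x) \<oplus>\<^bsub>M\<^esub> s \<odot>\<^bsub>M\<^esub> x" "s \<otimes> s"] x(1) sc S_mult[OF x(2,2)] S_one
    by (auto simp: smult_r_minus M.l_neg)
  then show "\<exists>g\<in>carrier MP. g \<oplus>\<^bsub>MP\<^esub> f = \<zero>\<^bsub>MP\<^esub>" unfolding MP_carrier using x M.a_inv_closed by blast
  show "\<zero>\<^bsub>MP\<^esub> \<oplus>\<^bsub>MP\<^esub> f = f" unfolding x(3) MP_zero MP_add[OF M.zero_closed S_one x(1,2)] using x sc by simp
  fix g assume "g \<in> carrier MP"
  then obtain y t where y: "y \<in> carrier M" "t \<in> S" "g = lfrac y t" unfolding MP_carrier by blast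
  have tc: "t \<in> carrier R" using y by blast
  have xy: "t \<odot>\<^bsub>M\<^esub> x \<oplus>\<^bsub>M\<^esub> s \<odot>\<^bsub>M\<^esub> y \<in> carrier M" using x y by auto
  show "f \<oplus>\<^bsub>MP\<^esub> g \<in> carrier MP" unfolding x(3) y(3) MP_add[OF x(1,2) y(1,2)] MP_carrier using xy S_mult[OF x(2) y(2)] by blast
  show "f \<oplus>\<^bsub>MP\<^esub> g = g \<oplus>\<^bsub>MP\<^esub> f" unfolding x(3) y(3) MP_add[OF x(1,2) y(1,2)] MP_add[OF y(1,2) x(1,2)]
    using x(1) y(1) sc tc by (simp add: M.a_comm R.m_comm)
  fix h assume "h \<in> carrier MP"
  then obtain z r where z: "z \<in> carrier M" "r \<in> S" "h = lfrac z r" unfolding MP_carrier by blast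
  have rc: "r \<in> carrier R" using z by blast
  have yz: "r \<odot>\<^bsub>M\<^esub> y \<oplus>\<^bsub>M\<^esub> t \<odot>\<^bsub>M\<^esub> z \<in> carrier M" using z y by auto
  show "f \<oplus>\<^bsub>MP\<^esub> g \<oplus>\<^bsub>MP\<^esub> h = f \<oplus>\<^bsub>MP\<^esub> (g \<oplus>\<^bsub>MP\<^esub> h)"
    unfolding x(3) y(3) z(3) MP_add[OF x(1,2) y(1,2)] MP_add[OF y(1,2) z(1,2)]
      MP_add[OF xy S_mult[OF x(2) y(2)] z(1,2)] MP_add[OF x(1,2) yz S_mult[OF y(2) z(2)]]
    using x(1) y(1) z(1) sc tc rc by (simp add: smult_r_distr M.a_assoc R.m_ac flip: smult_assoc1)
qed

lemma self_localized: "localized_module R (self_module R) P"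
  by (intro localized_module.intro localized_module_axioms.intro R.module_self prime)

lemma RP_simps: "carrier RP = carrier (loc_module R S (self_module R))" "\<zero>\<^bsub>RP\<^esub> = \<zero>\<^bsub>loc_module R S (self_module R)\<^esub>"
  "add RP = add (loc_module R S (self_module R))" "monoid.mult RP = smult (loc_module R S (self_module R))"
  "\<one>\<^bsub>RP\<^esub> = rfrac \<one> \<one>"
  by (simp_all add: loc_ring_def Let_def)

lemma RP_carrier: "carrier RP = {rfrac a s | a s. a \<in> carrier R \<and> s \<in> S}"
  unfolding RP_simps localized_module.MP_carrier[OF self_localized] by (simp add: self_module_def)

lemma rfrac_carrier: "a \<in> carrier R \<Longrightarrow> s \<in> S \<Longrightarrow> rfrac a s \<in> carrier RP"
  unfolding RP_carrier by blast

lemma RP_add: "a \<in> carrier R \<Longrightarrow> s \<in> S \<Longrightarrow> b \<in> carrier R \<Longrightarrow> t \<in> S \<Longrightarrow>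
    rfrac a s \<oplus>\<^bsub>RP\<^esub> rfrac b t = rfrac (t \<otimes> a \<oplus> s \<otimes> b) (s \<otimes> t)"
  using localized_module.MP_add[OF self_localized, of a s b t] unfolding RP_simps by (simp add: self_module_def)

lemma RP_mult: "a \<in> carrier R \<Longrightarrow> s \<in> S \<Longrightarrow> b \<in> carrier R \<Longrightarrow> t \<in> S \<Longrightarrow>
    rfrac a s \<otimes>\<^bsub>RP\<^esub> rfrac b t = rfrac (a \<otimes> b) (s \<otimes> t)"
  using localized_module.MP_smult[OF self_localized, of a s b t] unfolding RP_simps by (simp add: self_module_def)

lemma rfrac_eq_iff: "a \<in> carrier R \<Longrightarrow> b \<in> carrier R \<Longrightarrow> s \<in> S \<Longrightarrow> t \<in> S \<Longrightarrow>
    rfrac a s = rfrac b t \<longleftrightarrow> (\<exists>u\<in>S. u \<otimes> (t \<otimes> a) = u \<otimes> (s \<otimes> b))"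
  using localized_module.frac_eq_iff[OF self_localized, of a b s t] by (simp add: self_module_def)

lemma rfrac_cancel: "a \<in> carrier R \<Longrightarrow> s \<in> S \<Longrightarrow> c \<in> S \<Longrightarrow> rfrac (c \<otimes> a) (c \<otimes> s) = rfrac a s"
  using localized_module.frac_cancel[OF self_localized, of a s c] by (simp add: self_module_def)

lemma RP_cring: "cring RP"
proof (rule cringI)
  show "abelian_group RP"
  proof (rule abelian_groupI)
    note G = abelian_groupE[OF localized_module.MP_abelian_group[OF self_localized]]
    show "x \<oplus>\<^bsub>RP\<^esub> y \<in> carrier RP" if "x \<in> carrier RP" "y \<in> carrier RP" for x y using G(1) that unfolding RP_simps by blast
    show "\<zero>\<^bsub>RP\<^esub> \<in> carrier RP" using G(2) unfolding RP_simps by blast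
    show "x \<oplus>\<^bsub>RP\<^esub> y \<oplus>\<^bsub>RP\<^esub> z = x \<oplus>\<^bsub>RP\<^esub> (y \<oplus>\<^bsub>RP\<^esub> z)" if "x \<in> carrier RP" "y \<in> carrier RP" "z \<in> carrier RP" for x y z
      using G(3) that unfolding RP_simps by blast
    show "x \<oplus>\<^bsub>RP\<^esub> y = y \<oplus>\<^bsub>RP\<^esub> x" if "x \<in> carrier RP" "y \<in> carrier RP" for x y using G(4) that unfolding RP_simps by blast
    show "\<zero>\<^bsub>RP\<^esub> \<oplus>\<^bsub>RP\<^esub> x = x" if "x \<in> carrier RP" for x using G(5) that unfolding RP_simps by blast
    show "\<exists>y\<in>carrier RP. y \<oplus>\<^bsub>RP\<^esub> x = \<zero>\<^bsub>RP\<^esub>" if "x \<in> carrier RP" for x using G(6) that unfolding RP_simps by blast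
  qed
  show "comm_monoid RP"
  proof (rule comm_monoidI)
    show "\<one>\<^bsub>RP\<^esub> \<in> carrier RP" unfolding RP_simps(5) using rfrac_carrier S_one by blast
    fix f assume "f \<in> carrier RP"
    then obtain a s where a: "a \<in> carrier R" "s \<in> S" "f = rfrac a s" unfolding RP_carrier by blast
    have sc: "s \<in> carrier R" using a by blast
    show "\<one>\<^bsub>RP\<^esub> \<otimes>\<^bsub>RP\<^esub> f = f" unfolding RP_simps(5) a(3) RP_mult[OF R.one_closed S_one a(1,2)] using a(1) sc by simp
    fix g assume "g \<in> carrier RP"
    then obtain b t where b: "b \<in> carrier R" "t \<in> S" "g = rfrac b t" unfolding RP_carrier by blast
    have tc: "t \<in> carrier R" using b by blast
    show "f \<otimes>\<^bsub>RP\<^esub> g \<in> carrier RP" unfolding a(3) b(3) RP_mult[OF a(1,2) b(1,2)]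
      by (rule rfrac_carrier[OF R.m_closed[OF a(1) b(1)] S_mult[OF a(2) b(2)]])
    show "f \<otimes>\<^bsub>RP\<^esub> g = g \<otimes>\<^bsub>RP\<^esub> f" unfolding a(3) b(3) RP_mult[OF a(1,2) b(1,2)] RP_mult[OF b(1,2) a(1,2)]
      using a(1) b(1) sc tc by (simp add: R.m_comm)
    fix h assume "h \<in> carrier RP"
    then obtain c r where c: "c \<in> carrier R" "r \<in> S" "h = rfrac c r" unfolding RP_carrier by blast
    have rc: "r \<in> carrier R" using c by blast
    show "f \<otimes>\<^bsub>RP\<^esub> g \<otimes>\<^bsub>RP\<^esub> h = f \<otimes>\<^bsub>RP\<^esub> (g \<otimes>\<^bsub>RP\<^esub> h)"
      unfolding a(3) b(3) c(3) RP_mult[OF a(1,2) b(1,2)] RP_mult[OF b(1,2) c(1,2)]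
        RP_mult[OF R.m_closed[OF a(1) b(1)] S_mult[OF a(2) b(2)] c(1,2)] RP_mult[OF a(1,2) R.m_closed[OF b(1) c(1)] S_mult[OF b(2) c(2)]]
      using a(1) b(1) c(1) sc tc rc by (simp add: R.m_assoc)
  qed
  fix f g h assume "f \<in> carrier RP" "g \<in> carrier RP" "h \<in> carrier RP"
  then obtain a s b t c r where a: "a \<in> carrier R" "s \<in> S" "f = rfrac a s" and b: "b \<in> carrier R" "t \<in> S" "g = rfrac b t"
    and c: "c \<in> carrier R" "r \<in> S" "h = rfrac c r" unfolding RP_carrier by blast
  have sc: "s \<in> carrier R" "t \<in> carrier R" "r \<in> carrier R" using a b c by auto
  have ab: "t \<otimes> a \<oplus> s \<otimes> b \<in> carrier R" using a(1) b(1) sc by simp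
  have "(f \<oplus>\<^bsub>RP\<^esub> g) \<otimes>\<^bsub>RP\<^esub> h = rfrac ((t \<otimes> a \<oplus> s \<otimes> b) \<otimes> c) (s \<otimes> t \<otimes> r)"
    unfolding a(3) b(3) c(3) RP_add[OF a(1,2) b(1,2)] RP_mult[OF ab S_mult[OF a(2) b(2)] c(1,2)] ..
  also have "\<dots> = rfrac (r \<otimes> ((t \<otimes> a \<oplus> s \<otimes> b) \<otimes> c)) (r \<otimes> (s \<otimes> t \<otimes> r))"
    using rfrac_cancel[OF R.m_closed[OF ab c(1)] S_mult[OF S_mult[OF a(2) b(2)] c(2)] c(2)] by simp
  also have "r \<otimes> ((t \<otimes> a \<oplus> s \<otimes> b) \<otimes> c) = t \<otimes> r \<otimes> (a \<otimes> c) \<oplus> s \<otimes> r \<otimes> (b \<otimes> c)"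
    using a(1) b(1) c(1) sc by (simp add: R.l_distr R.r_distr R.m_ac)
  also have "r \<otimes> (s \<otimes> t \<otimes> r) = (s \<otimes> r) \<otimes> (t \<otimes> r)" using sc by (simp add: R.m_ac)
  also have "rfrac (t \<otimes> r \<otimes> (a \<otimes> c) \<oplus> s \<otimes> r \<otimes> (b \<otimes> c)) (s \<otimes> r \<otimes> (t \<otimes> r)) = f \<otimes>\<^bsub>RP\<^esub> h \<oplus>\<^bsub>RP\<^esub> g \<otimes>\<^bsub>RP\<^esub> h"
    unfolding a(3) b(3) c(3) RP_mult[OF a(1,2) c(1,2)] RP_mult[OF b(1,2) c(1,2)]
      RP_add[OF R.m_closed[OF a(1) c(1)] S_mult[OF a(2) c(2)] R.m_closed[OF b(1) c(1)] S_mult[OF b(2) c(2)]] ..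
  finally show "(f \<oplus>\<^bsub>RP\<^esub> g) \<otimes>\<^bsub>RP\<^esub> h = f \<otimes>\<^bsub>RP\<^esub> h \<oplus>\<^bsub>RP\<^esub> g \<otimes>\<^bsub>RP\<^esub> h" .
qed

lemma MP_module: "module RP MP"
proof (rule moduleI[OF RP_cring MP_abelian_group])
  fix f x assume "f \<in> carrier RP" "x \<in> carrier MP"
  then obtain a s y t where a: "a \<in> carrier R" "s \<in> S" "f = rfrac a s" and y: "y \<in> carrier M" "t \<in> S" "x = lfrac y t"
    unfolding RP_carrier MP_carrier by blast
  have sc: "s \<in> carrier R" "t \<in> carrier R" using a y by auto
  note ay = smult_closed[OF a(1) y(1)] S_mult[OF a(2) y(2)]
  show "f \<odot>\<^bsub>MP\<^esub> x \<in> carrier MP" unfolding a(3) y(3) MP_smult[OF a(1,2) y(1,2)] MP_carrier using ay by blast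
  {
    fix g assume "g \<in> carrier RP"
    then obtain b r where b: "b \<in> carrier R" "r \<in> S" "g = rfrac b r" unfolding RP_carrier by blast
    have rc: "r \<in> carrier R" using b by auto
    note bY = smult_closed[OF b(1) y(1)] S_mult[OF b(2) y(2)]
    have ab: "r \<otimes> a \<oplus> s \<otimes> b \<in> carrier R" using a(1) b(1) sc rc by simp
    have "(f \<oplus>\<^bsub>RP\<^esub> g) \<odot>\<^bsub>MP\<^esub> x = lfrac ((r \<otimes> a \<oplus> s \<otimes> b) \<odot>\<^bsub>M\<^esub> y) (s \<otimes> r \<otimes> t)"
      unfolding a(3) b(3) y(3) RP_add[OF a(1,2) b(1,2)] MP_smult[OF ab S_mult[OF a(2) b(2)] y(1,2)] ..
    also have "\<dots> = lfrac (t \<odot>\<^bsub>M\<^esub> ((r \<otimes> a \<oplus> s \<otimes> b) \<odot>\<^bsub>M\<^esub> y)) (t \<otimes> (s \<otimes> r \<otimes> t))"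
      using frac_cancel[OF smult_closed[OF ab y(1)] S_mult[OF S_mult[OF a(2) b(2)] y(2)] y(2)] by simp
    also have "t \<odot>\<^bsub>M\<^esub> ((r \<otimes> a \<oplus> s \<otimes> b) \<odot>\<^bsub>M\<^esub> y) = (r \<otimes> t) \<odot>\<^bsub>M\<^esub> (a \<odot>\<^bsub>M\<^esub> y) \<oplus>\<^bsub>M\<^esub> (s \<otimes> t) \<odot>\<^bsub>M\<^esub> (b \<odot>\<^bsub>M\<^esub> y)"
      using a(1) b(1) y(1) sc rc by (simp add: smult_l_distr smult_r_distr R.m_ac flip: smult_assoc1)
    also have "t \<otimes> (s \<otimes> r \<otimes> t) = (s \<otimes> t) \<otimes> (r \<otimes> t)" using sc rc by (simp add: R.m_ac)
    also have "lfrac ((r \<otimes> t) \<odot>\<^bsub>M\<^esub> (a \<odot>\<^bsub>M\<^esub> y) \<oplus>\<^bsub>M\<^esub> (s \<otimes> t) \<odot>\<^bsub>M\<^esub> (b \<odot>\<^bsub>M\<^esub> y)) ((s \<otimes> t) \<otimes> (r \<otimes> t))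
        = f \<odot>\<^bsub>MP\<^esub> x \<oplus>\<^bsub>MP\<^esub> g \<odot>\<^bsub>MP\<^esub> x"
      unfolding a(3) b(3) y(3) MP_smult[OF a(1,2) y(1,2)] MP_smult[OF b(1,2) y(1,2)] MP_add[OF ay bY] ..
    finally show "(f \<oplus>\<^bsub>RP\<^esub> g) \<odot>\<^bsub>MP\<^esub> x = f \<odot>\<^bsub>MP\<^esub> x \<oplus>\<^bsub>MP\<^esub> g \<odot>\<^bsub>MP\<^esub> x" .
    show "(f \<otimes>\<^bsub>RP\<^esub> g) \<odot>\<^bsub>MP\<^esub> x = f \<odot>\<^bsub>MP\<^esub> (g \<odot>\<^bsub>MP\<^esub> x)"
      unfolding a(3) b(3) y(3) RP_mult[OF a(1,2) b(1,2)] MP_smult[OF b(1,2) y(1,2)]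
        MP_smult[OF R.m_closed[OF a(1) b(1)] S_mult[OF a(2) b(2)] y(1,2)] MP_smult[OF a(1,2) bY]
      using a(1) b(1) y(1) sc rc by (simp add: smult_assoc1 R.m_assoc)
  }
  fix w assume "w \<in> carrier MP"
  then obtain z r where z: "z \<in> carrier M" "r \<in> S" "w = lfrac z r" unfolding MP_carrier by blast
  have rc: "r \<in> carrier R" using z by auto
  have yz: "r \<odot>\<^bsub>M\<^esub> y \<oplus>\<^bsub>M\<^esub> t \<odot>\<^bsub>M\<^esub> z \<in> carrier M" using y(1) z(1) sc rc by simp
  note az = smult_closed[OF a(1) z(1)] S_mult[OF a(2) z(2)]
  have "f \<odot>\<^bsub>MP\<^esub> (x \<oplus>\<^bsub>MP\<^esub> w) = lfrac (a \<odot>\<^bsub>M\<^esub> (r \<odot>\<^bsub>M\<^esub> y \<oplus>\<^bsub>M\<^esub> t \<odot>\<^bsub>M\<^esub> z)) (s \<otimes> (t \<otimes> r))"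
    unfolding a(3) y(3) z(3) MP_add[OF y(1,2) z(1,2)] MP_smult[OF a(1,2) yz S_mult[OF y(2) z(2)]] ..
  also have "\<dots> = lfrac (s \<odot>\<^bsub>M\<^esub> (a \<odot>\<^bsub>M\<^esub> (r \<odot>\<^bsub>M\<^esub> y \<oplus>\<^bsub>M\<^esub> t \<odot>\<^bsub>M\<^esub> z))) (s \<otimes> (s \<otimes> (t \<otimes> r)))"
    using frac_cancel[OF smult_closed[OF a(1) yz] S_mult[OF a(2) S_mult[OF y(2) z(2)]] a(2)] by simp
  also have "s \<odot>\<^bsub>M\<^esub> (a \<odot>\<^bsub>M\<^esub> (r \<odot>\<^bsub>M\<^esub> y \<oplus>\<^bsub>M\<^esub> t \<odot>\<^bsub>M\<^esub> z)) = (s \<otimes> r) \<odot>\<^bsub>M\<^esub> (a \<odot>\<^bsub>M\<^esub> y) \<oplus>\<^bsub>M\<^esub> (s \<otimes> t) \<odot>\<^bsub>M\<^esub> (a \<odot>\<^bsub>M\<^esub> z)"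
    using a(1) y(1) z(1) sc rc by (simp add: smult_r_distr R.m_ac flip: smult_assoc1)
  also have "s \<otimes> (s \<otimes> (t \<otimes> r)) = (s \<otimes> t) \<otimes> (s \<otimes> r)" using sc rc by (simp add: R.m_ac)
  also have "lfrac ((s \<otimes> r) \<odot>\<^bsub>M\<^esub> (a \<odot>\<^bsub>M\<^esub> y) \<oplus>\<^bsub>M\<^esub> (s \<otimes> t) \<odot>\<^bsub>M\<^esub> (a \<odot>\<^bsub>M\<^esub> z)) ((s \<otimes> t) \<otimes> (s \<otimes> r))
      = f \<odot>\<^bsub>MP\<^esub> x \<oplus>\<^bsub>MP\<^esub> f \<odot>\<^bsub>MP\<^esub> w"
    unfolding a(3) y(3) z(3) MP_smult[OF a(1,2) y(1,2)] MP_smult[OF a(1,2) z(1,2)] MP_add[OF ay az] ..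
  finally show "f \<odot>\<^bsub>MP\<^esub> (x \<oplus>\<^bsub>MP\<^esub> w) = f \<odot>\<^bsub>MP\<^esub> x \<oplus>\<^bsub>MP\<^esub> f \<odot>\<^bsub>MP\<^esub> w" .
next
  fix x assume "x \<in> carrier MP"
  then obtain y t where y: "y \<in> carrier M" "t \<in> S" "x = lfrac y t" unfolding MP_carrier by blast
  show "\<one>\<^bsub>RP\<^esub> \<odot>\<^bsub>MP\<^esub> x = x" unfolding RP_simps(5) y(3) MP_smult[OF R.one_closed S_one y(1,2)] using y by simp
qed

lemma rfrac_hom: "(\<lambda>a. rfrac a \<one>) \<in> ring_hom R RP"
  by (rule ring_hom_memI) (use S_one in \<open>auto simp: RP_add RP_mult RP_simps(5) intro!: rfrac_carrier\<close>)

definition mP :: "('a \<times> 'a) set set" where "mP = {rfrac a s | a s. a \<in> P \<and> s \<in> S}"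

lemma P_carrier: "a \<in> P \<Longrightarrow> a \<in> carrier R" by (rule R.ideal_closed(1)[OF primeidealD(1)[OF prime]])

lemma mP_mem_iff: "a \<in> carrier R \<Longrightarrow> s \<in> S \<Longrightarrow> rfrac a s \<in> mP \<longleftrightarrow> a \<in> P"
proof
  assume a: "a \<in> carrier R" and s: "s \<in> S" and m: "rfrac a s \<in> mP"
  then obtain b t where b: "b \<in> P" "t \<in> S" "rfrac a s = rfrac b t" unfolding mP_def by blast
  then obtain u where u: "u \<in> S" "u \<otimes> (t \<otimes> a) = u \<otimes> (s \<otimes> b)" using rfrac_eq_iff[OF a P_carrier[OF b(1)] s b(2)] by blast
  note Pi = R.ideal_closed[OF primeidealD(1)[OF prime]]
  have "u \<otimes> (t \<otimes> a) \<in> P" unfolding u(2) using Pi(4) u(1) s b(1) by blast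
  then show "a \<in> P" using primeidealD(4)[OF prime] u(1) b(2) a by (metis DiffD1 DiffD2 R.m_closed)
qed (auto simp: mP_def)

lemma RP_unit: "a \<in> S \<Longrightarrow> s \<in> S \<Longrightarrow> rfrac s a \<otimes>\<^bsub>RP\<^esub> rfrac a s = \<one>\<^bsub>RP\<^esub>"
  unfolding RP_simps(5) using S_one S_mult by (subst RP_mult) (auto simp: rfrac_eq_iff R.m_comm)

lemma mP_ideal: "ideal mP RP"
proof -
  interpret RP: cring RP by (rule RP_cring)
  interpret SR: module RP "self_module RP" by (rule RP.module_self)
  note Pi = R.ideal_closed[OF primeidealD(1)[OF prime]]
  have "submodule mP RP (self_module RP)"
    unfolding SR.submodule_iff
  proof (intro conjI ballI)
    show "mP \<subseteq> carrier (self_module RP)" unfolding mP_def using rfrac_carrier P_carrier by (auto simp: self_module_def)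
    have "\<zero>\<^bsub>RP\<^esub> = rfrac \<zero> \<one>" unfolding RP_simps localized_module.MP_zero[OF self_localized] by (simp add: self_module_def)
    then show "\<zero>\<^bsub>self_module RP\<^esub> \<in> mP" using mP_mem_iff[OF R.zero_closed S_one] Pi(2) by (simp add: self_module_def)
    fix x y assume "x \<in> mP" "y \<in> mP"
    then obtain a s b t where h: "a \<in> P" "s \<in> S" "x = rfrac a s" "b \<in> P" "t \<in> S" "y = rfrac b t" unfolding mP_def by blast
    have "t \<otimes> a \<oplus> s \<otimes> b \<in> P" using Pi(3,4) h by blast
    then show "x \<oplus>\<^bsub>self_module RP\<^esub> y \<in> mP"
      using RP_add[OF P_carrier[OF h(1)] h(2) P_carrier[OF h(4)] h(5)] S_mult[OF h(2,5)] h(3,6) unfolding mP_def by (auto simp: self_module_def)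
  next
    fix x y assume "x \<in> carrier RP" "y \<in> mP"
    then obtain a s b t where h: "a \<in> carrier R" "s \<in> S" "x = rfrac a s" "b \<in> P" "t \<in> S" "y = rfrac b t" unfolding mP_def RP_carrier by blast
    have "a \<otimes> b \<in> P" using Pi(4) h by blast
    then show "x \<odot>\<^bsub>self_module RP\<^esub> y \<in> mP"
      using RP_mult[OF h(1,2) P_carrier[OF h(4)] h(5)] S_mult[OF h(2,5)] h(3,6) unfolding mP_def by (auto simp: self_module_def)
  qed
  then show ?thesis unfolding RP.submodule_self_iff .
qed

lemma ideal_outside_mP:
  assumes J: "ideal J RP" and "\<not> J \<subseteq> mP" shows "J = carrier RP"
proof -
  interpret RP: cring RP by (rule RP_cring)
  obtain x where x: "x \<in> J" "x \<notin> mP" using assms(2) by blast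
  then obtain a s where a: "a \<in> carrier R" "s \<in> S" "x = rfrac a s" using RP.ideal_closed(1)[OF J] unfolding RP_carrier by blast
  then have aS: "a \<in> S" using x(2) mP_mem_iff by blast
  have "rfrac s a \<otimes>\<^bsub>RP\<^esub> x \<in> J" using RP.ideal_closed(4)[OF J rfrac_carrier x(1)] aS a(2) by blast
  then have "\<one>\<^bsub>RP\<^esub> \<in> J" using RP_unit[OF aS a(2)] a(3) by simp
  then show ?thesis using ideal.one_imp_carrier[OF J] by blast
qed

text \<open>An ideal of \<open>R\<^sub>P\<close> is determined by its contraction to \<open>R\<close>.\<close>
lemma RP_noetherian: assumes "noetherian_ring R" shows "noetherian_ring RP"
proof -
  interpret RP: cring RP by (rule RP_cring)
  interpret h: ring_hom_cring R RP "\<lambda>a. rfrac a \<one>"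
    by (intro ring_hom_cring.intro ring_hom_cring_axioms.intro R.is_cring RP_cring rfrac_hom)
  have mem: "rfrac a s \<in> J \<longleftrightarrow> rfrac a \<one> \<in> J" if J: "ideal J RP" and a: "a \<in> carrier R" and s: "s \<in> S" for J a s
  proof -
    have sc: "s \<in> carrier R" using s by blast
    have "rfrac a s = rfrac \<one> s \<otimes>\<^bsub>RP\<^esub> rfrac a \<one>" using a s sc S_one by (simp add: RP_mult)
    moreover have "rfrac a \<one> = rfrac s \<one> \<otimes>\<^bsub>RP\<^esub> rfrac a s"
      using a s sc S_one rfrac_cancel[OF a S_one s] by (simp add: RP_mult)
    ultimately show ?thesis using RP.ideal_closed(4)[OF J] rfrac_carrier[OF R.one_closed s] rfrac_carrier[OF sc S_one] by metis
  qed
  have "asc_chain_cond (\<lambda>J. ideal J RP)"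
  proof (rule asc_chain_cond_transfer[OF asc_chain_cond_ideals[OF assms], of _ "\<lambda>J. {a \<in> carrier R. rfrac a \<one> \<in> J}"])
    show "ideal {a \<in> carrier R. rfrac a \<one> \<in> J} R" if "ideal J RP" for J by (rule h.ring.ideal_vimage[OF that])
    fix J K assume J: "ideal J RP" and K: "ideal K RP" and "J \<subseteq> K"
    show "{a \<in> carrier R. rfrac a \<one> \<in> J} \<subseteq> {a \<in> carrier R. rfrac a \<one> \<in> K}" using \<open>J \<subseteq> K\<close> by blast
    assume eq: "{a \<in> carrier R. rfrac a \<one> \<in> J} = {a \<in> carrier R. rfrac a \<one> \<in> K}"
    have "x \<in> J" if x: "x \<in> K" for x
    proof -
      obtain a s where a: "a \<in> carrier R" "s \<in> S" "x = rfrac a s" using RP.ideal_closed(1)[OF K x] unfolding RP_carrier by blast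
      then show ?thesis using mem[OF J a(1,2)] mem[OF K a(1,2)] eq x by blast
    qed
    then show "J = K" using \<open>J \<subseteq> K\<close> by blast
  qed
  then show ?thesis unfolding RP.noetherian_ring_iff noeth_module_def RP.submodule_self_iff .
qed

lemma MP_noetherian: assumes "noeth_module R M" shows "noeth_module RP MP"
  unfolding noeth_module_def
proof (rule asc_chain_cond_transfer[OF assms[unfolded noeth_module_def], of _ "\<lambda>U. {x \<in> carrier M. lfrac x \<one> \<in> U}"])
  interpret MP: module RP MP by (rule MP_module)
  have mem: "lfrac x s \<in> U \<longleftrightarrow> lfrac x \<one> \<in> U" if U: "submodule U RP MP" and x: "x \<in> carrier M" and s: "s \<in> S" for U x s
  proof -
    have sc: "s \<in> carrier R" using s by blast
    have "lfrac x s = rfrac \<one> s \<odot>\<^bsub>MP\<^esub> lfrac x \<one>" using x s sc S_one by (simp add: MP_smult)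
    moreover have "lfrac x \<one> = rfrac s \<one> \<odot>\<^bsub>MP\<^esub> lfrac x s"
      using x s sc S_one frac_cancel[OF x S_one s] by (simp add: MP_smult)
    ultimately show ?thesis using submodule_smult[OF U] rfrac_carrier[OF R.one_closed s] rfrac_carrier[OF sc S_one] by metis
  qed
  fix U assume U: "submodule U RP MP"
  show "submodule {x \<in> carrier M. lfrac x \<one> \<in> U} R M"
    unfolding submodule_iff
  proof (intro conjI ballI)
    show "\<zero>\<^bsub>M\<^esub> \<in> {x \<in> carrier M. lfrac x \<one> \<in> U}" using submodule_zero[OF U] by (simp add: MP_zero)
    show "x \<oplus>\<^bsub>M\<^esub> y \<in> {x \<in> carrier M. lfrac x \<one> \<in> U}" if "x \<in> {x \<in> carrier M. lfrac x \<one> \<in> U}" "y \<in> {x \<in> carrier M. lfrac x \<one> \<in> U}" for x y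
      using submodule_add[OF U, of "lfrac x \<one>" "lfrac y \<one>"] that S_one by (simp add: MP_add)
    show "a \<odot>\<^bsub>M\<^esub> x \<in> {x \<in> carrier M. lfrac x \<one> \<in> U}" if "a \<in> carrier R" "x \<in> {x \<in> carrier M. lfrac x \<one> \<in> U}" for a x
      using submodule_smult[OF U rfrac_carrier[of a \<one>], of "lfrac x \<one>"] that S_one by (simp add: MP_smult)
  qed auto
  fix W assume W: "submodule W RP MP" and le: "U \<subseteq> W"
  show "{x \<in> carrier M. lfrac x \<one> \<in> U} \<subseteq> {x \<in> carrier M. lfrac x \<one> \<in> W}" using le by blast
  assume eq: "{x \<in> carrier M. lfrac x \<one> \<in> U} = {x \<in> carrier M. lfrac x \<one> \<in> W}"
  have "x \<in> U" if x: "x \<in> W" for x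
  proof -
    obtain y s where y: "y \<in> carrier M" "s \<in> S" "x = lfrac y s" using submodule_in_carrier[OF W x] unfolding MP_carrier by blast
    then show ?thesis using mem[OF U y(1,2)] mem[OF W y(1,2)] eq x by blast
  qed
  then show "U = W" using le by blast
qed

lemma RP_local: assumes "noetherian_ring R" shows "noetherian_local_ring RP mP"
proof -
  interpret RP: cring RP by (rule RP_cring)
  have ne: "carrier RP \<noteq> mP" using mP_mem_iff[OF R.one_closed S_one] rfrac_carrier[OF R.one_closed S_one] primeidealD(3)[OF prime] by blast
  have max: "maximalideal mP RP"
  proof (rule maximalidealI[OF mP_ideal ne])
    fix J assume J: "ideal J RP" "mP \<subseteq> J"
    then show "J = mP \<or> J = carrier RP" using ideal_outside_mP[OF J(1)] by blast
  qed
  have "J = mP" if "maximalideal J RP" for J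
  proof -
    interpret J: maximalideal J RP by fact
    have "J \<subseteq> mP" using ideal_outside_mP[OF J.is_ideal] J.I_notcarr by blast
    moreover have "mP \<subseteq> carrier RP" using RP.ideal_closed(1)[OF mP_ideal] by blast
    ultimately show ?thesis using J.I_maximal[OF mP_ideal] ne by blast
  qed
  then show ?thesis unfolding noetherian_local_ring_def using RP_cring RP_noetherian[OF assms] max by blast
qed

lemma MP_regular:
  assumes p: "p \<in> carrier R" "nonzerodivisor_on M p" shows "nonzerodivisor_on MP (rfrac p \<one>)"
  unfolding nonzerodivisor_on_def
proof (intro ballI impI)
  fix x assume "x \<in> carrier MP" and px: "rfrac p \<one> \<odot>\<^bsub>MP\<^esub> x = \<zero>\<^bsub>MP\<^esub>"
  then obtain y s where y: "y \<in> carrier M" "s \<in> S" "x = lfrac y s" unfolding MP_carrier by blast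
  have "lfrac (p \<odot>\<^bsub>M\<^esub> y) (\<one> \<otimes> s) = \<zero>\<^bsub>MP\<^esub>" using px unfolding y(3) MP_smult[OF p(1) S_one y(1,2)] .
  then obtain u where u: "u \<in> S" "u \<odot>\<^bsub>M\<^esub> (p \<odot>\<^bsub>M\<^esub> y) = \<zero>\<^bsub>M\<^esub>"
    using frac_zero_iff[of "p \<odot>\<^bsub>M\<^esub> y" "\<one> \<otimes> s"] p(1) y S_mult[OF S_one y(2)] by auto
  have uc: "u \<in> carrier R" using u by blast
  have "p \<odot>\<^bsub>M\<^esub> (u \<odot>\<^bsub>M\<^esub> y) = \<zero>\<^bsub>M\<^esub>" using u(2) smult_comm[OF p(1) uc y(1)] by simp
  then have "u \<odot>\<^bsub>M\<^esub> y = \<zero>\<^bsub>M\<^esub>" using p(2) uc y(1) unfolding nonzerodivisor_on_def by blast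
  then show "x = \<zero>\<^bsub>MP\<^esub>" unfolding y(3) using frac_zero_iff[OF y(1,2)] u(1) by blast
qed

lemma MP_no_long_chain:
  assumes "\<not> prime_chain_over R (annihilator R M) 2"
  shows "\<not> prime_chain_over RP (annihilator RP MP) 2"
proof
  interpret RP: cring RP by (rule RP_cring)
  assume "prime_chain_over RP (annihilator RP MP) 2"
  then obtain A B C where ABC: "primeideal A RP" "primeideal B RP" "primeideal C RP"
    "annihilator RP MP \<subseteq> A" "A \<subset> B" "B \<subset> C" unfolding prime_chain_over_2 by blast
  let ?c = "\<lambda>Q. {a \<in> carrier R. rfrac a \<one> \<in> Q}"
  have pr: "primeideal (?c Q) R" if "primeideal Q RP" for Q by (rule primeideal_vimage[OF R.is_cring RP_cring rfrac_hom that])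
  have strict: "?c Q \<subset> ?c Q'" if Q: "primeideal Q RP" and Q': "primeideal Q' RP" and "Q \<subset> Q'" for Q Q'
  proof
    show "?c Q \<subseteq> ?c Q'" using \<open>Q \<subset> Q'\<close> by blast
    obtain x where x: "x \<in> Q'" "x \<notin> Q" using \<open>Q \<subset> Q'\<close> by blast
    obtain a s where a: "a \<in> carrier R" "s \<in> S" "x = rfrac a s"
      using RP.ideal_closed(1)[OF primeidealD(1)[OF Q'] x(1)] unfolding RP_carrier by blast
    have sc: "s \<in> carrier R" using a by blast
    have e1: "rfrac a s = rfrac \<one> s \<otimes>\<^bsub>RP\<^esub> rfrac a \<one>" using a sc S_one by (simp add: RP_mult)
    have e2: "rfrac a \<one> = rfrac s \<one> \<otimes>\<^bsub>RP\<^esub> rfrac a s"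
      using a sc S_one rfrac_cancel[OF a(1) S_one a(2)] by (simp add: RP_mult)
    have "rfrac a \<one> \<in> Q'" unfolding e2 using RP.ideal_closed(4)[OF primeidealD(1)[OF Q'] rfrac_carrier[OF sc S_one]] x(1) a(3) by simp
    moreover have "rfrac a \<one> \<notin> Q"
      using RP.ideal_closed(4)[OF primeidealD(1)[OF Q] rfrac_carrier[OF R.one_closed a(2)]] x(2) a(3) e1 by metis
    ultimately show "?c Q \<noteq> ?c Q'" using a(1) by blast
  qed
  have "annihilator R M \<subseteq> ?c A"
  proof
    fix a assume a: "a \<in> annihilator R M"
    then have ac: "a \<in> carrier R" and az: "\<And>x. x \<in> carrier M \<Longrightarrow> a \<odot>\<^bsub>M\<^esub> x = \<zero>\<^bsub>M\<^esub>" unfolding annihilator_def by auto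
    have "rfrac a \<one> \<odot>\<^bsub>MP\<^esub> x = \<zero>\<^bsub>MP\<^esub>" if x: "x \<in> carrier MP" for x
    proof -
      obtain y s where y: "y \<in> carrier M" "s \<in> S" "x = lfrac y s" using x unfolding MP_carrier by blast
      show ?thesis unfolding y(3) MP_smult[OF ac S_one y(1,2)] az[OF y(1)]
        using frac_zero_iff[OF M.zero_closed S_mult[OF S_one y(2)]] S_one by auto
    qed
    then have "rfrac a \<one> \<in> annihilator RP MP" unfolding annihilator_def using rfrac_carrier[OF ac S_one] by blast
    then show "a \<in> ?c A" using ABC(4) ac by blast
  qed
  then have "prime_chain_over R (annihilator R M) 2"
    unfolding prime_chain_over_2
    by (intro exI[of _ "?c A"] exI[of _ "?c B"] exI[of _ "?c C"] conjI pr ABC(1-3) strict ABC(5,6))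
  then show False using assms by blast
qed

end

text \<open>Noetherianity, the regular element and the bound on chains of primes all pass to the localization at
  a maximal ideal.\<close>
theorem (in module) cohen_macaulay_dim_one:
  assumes nR: "noetherian_ring R" and nM: "noeth_module R M"
    and reg: "\<And>P. maximalideal P R \<Longrightarrow> \<exists>p\<in>P. nonzerodivisor_on M p"
    and dim: "\<not> prime_chain_over R (annihilator R M) 2"
  shows "cohen_macaulay_module R M"
  unfolding cohen_macaulay_module_def Let_def
proof (intro conjI allI impI)
  fix P assume P: "maximalideal P R"
    and nz: "carrier (loc_module R (carrier R - P) M) \<noteq> {\<zero>\<^bsub>loc_module R (carrier R - P) M\<^esub>}"
  interpret L: localized_module R M P
    by (intro localized_module.intro localized_module_axioms.intro module_axioms R.maximalideal_prime[OF P])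
  obtain p where p: "p \<in> P" "nonzerodivisor_on M p" using reg[OF P] by blast
  have pc: "p \<in> carrier R" by (rule L.P_carrier[OF p(1)])
  have "cohen_macaulay_local L.RP L.mP L.MP"
    by (rule module.cohen_macaulay_local_dim_one[OF L.MP_module L.RP_local[OF nR] L.MP_noetherian[OF nM] nz _ L.MP_regular[OF pc p(2)] L.MP_no_long_chain[OF dim]])
       (use L.mP_mem_iff[OF pc L.S_one] p(1) in blast)
  then show "\<exists>\<mm>. cohen_macaulay_local (loc_ring R (carrier R - P)) \<mm> (loc_module R (carrier R - P) M)" by blast
qed (use R.is_cring nR fin_gen_of_noeth[OF nM] in auto)


section \<open>Growth and the dimension of graded modules\<close>

lemma (in module) descending_chain_length:
  assumes X: "\<And>i. i \<le> k \<Longrightarrow> submodule (X i) R M" "\<And>i. i < k \<Longrightarrow> X (Suc i) \<subset> X i"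
    and U: "submodule U R M" "U \<subseteq> X k" and V: "submodule V R M" "X 0 \<subseteq> V"
  shows "enat k \<le> rel_length R M U V"
proof -
  have "submodule_chain R M (X k) (X 0) k"
    unfolding submodule_chain_iff
  proof (intro exI[of _ "\<lambda>i. X (k - i)"] conjI allI impI)
    show "X (k - i) \<subset> X (k - Suc i)" if "i < k" for i
    proof -
      have "k - i = Suc (k - Suc i)" using that by simp
      then show ?thesis using X(2)[of "k - Suc i"] that by simp
    qed
  qed (use X(1) in auto)
  then have "enat k \<le> rel_length R M (X k) (X 0)" by (rule chain_le_rel_length)
  moreover have "X k \<subseteq> X 0" using submodule_chain_submodules(3)[OF \<open>submodule_chain R M (X k) (X 0) k\<close>] .
  moreover have "submodule (X k) R M" "submodule (X 0) R M" using X(1) by auto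
  ultimately show ?thesis using rel_length_mono[OF U(1) _ _ V(1) U(2) _ V(2)] by (meson order_trans)
qed

context filtered_module
begin

text \<open>The elements of degree less than \<open>n\<close> form submodules over \<open>R\<close>, though not over the graded ring. To measure their
  lengths, \<open>Gr\<close> and the graded ring are regarded as \<open>R\<close>-modules, \<open>GrS\<close> and \<open>ringS\<close>.\<close>

definition GrS :: "('a, nat \<Rightarrow> 'c set) module" where
  "GrS = \<lparr>carrier = carrier Gr, monoid.mult = undefined, one = undefined,
    zero = \<zero>\<^bsub>Gr\<^esub>, add = add Gr, smult = (\<lambda>r. smult Gr (monom 0 r))\<rparr>"

definition ringS :: "('a, nat \<Rightarrow> 'a set) module" where
  "ringS = \<lparr>carrier = carrier GrR, monoid.mult = undefined, one = undefined,
    zero = \<zero>\<^bsub>GrR\<^esub>, add = add GrR, smult = (\<lambda>r. monoid.mult GrR (monom 0 r))\<rparr>"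

definition below :: "nat \<Rightarrow> (nat \<Rightarrow> 'c set) set" where
  "below n = {cls y | y. y \<in> seqs \<and> (\<forall>j\<ge>n. y j = \<zero>\<^bsub>M\<^esub>)}"

definition ring_below :: "nat \<Rightarrow> (nat \<Rightarrow> 'a set) set" where
  "ring_below n = {rcls a | a. a \<in> rseqs \<and> (\<forall>j\<ge>n. a j = \<zero>)}"

lemma GrS_simps [simp]: "carrier GrS = carrier Gr" "\<zero>\<^bsub>GrS\<^esub> = \<zero>\<^bsub>Gr\<^esub>" "x \<oplus>\<^bsub>GrS\<^esub> y = x \<oplus>\<^bsub>Gr\<^esub> y"
  "r \<odot>\<^bsub>GrS\<^esub> x = monom 0 r \<odot>\<^bsub>Gr\<^esub> x"
  by (simp_all add: GrS_def)

lemma ringS_simps [simp]: "carrier ringS = carrier GrR" "\<zero>\<^bsub>ringS\<^esub> = \<zero>\<^bsub>GrR\<^esub>" "x \<oplus>\<^bsub>ringS\<^esub> y = x \<oplus>\<^bsub>GrR\<^esub> y"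
  "r \<odot>\<^bsub>ringS\<^esub> x = monom 0 r \<otimes>\<^bsub>GrR\<^esub> x"
  by (simp_all add: ringS_def)

lemma scalar_seqs: "r \<in> carrier R \<Longrightarrow> y \<in> seqs \<Longrightarrow> (\<lambda>n. r \<odot>\<^bsub>M\<^esub> y n) \<in> seqs"
proof -
  assume r: "r \<in> carrier R" and y: "y \<in> seqs"
  then obtain d where "\<And>n. n \<ge> d \<Longrightarrow> y n = \<zero>\<^bsub>M\<^esub>" unfolding seqs_def by blast
  then have "\<exists>d. \<forall>n\<ge>d. r \<odot>\<^bsub>M\<^esub> y n = \<zero>\<^bsub>M\<^esub>" using r by (intro exI[of _ d]) simp
  moreover have "r \<odot>\<^bsub>M\<^esub> y n \<in> F n" for n by (rule submodule_smult[OF F_submodule r seqsD(1)[OF y]])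
  ultimately show ?thesis unfolding seqs_def by blast
qed

lemma GrS_module: "module R GrS"
proof (rule moduleI[OF R.is_cring])
  note G = abelian_groupE[OF Gr_abelian_group]
  show "abelian_group GrS"
    by (rule abelian_groupI) (use G in auto)
  fix r f assume r: "r \<in> carrier R" and "f \<in> carrier GrS"
  then obtain y where y: "y \<in> seqs" "f = cls y" unfolding GrS_simps Gr_carrier by blast
  show "r \<odot>\<^bsub>GrS\<^esub> f \<in> carrier GrS" using scalar_smult[OF r y(1)] scalar_seqs[OF r y(1)] y(2) by (auto simp: Gr_carrier)
  {
    fix s assume s: "s \<in> carrier R"
    have rs: "r \<oplus> s \<in> carrier R" "r \<otimes> s \<in> carrier R" using r s by auto
    show "(r \<oplus> s) \<odot>\<^bsub>GrS\<^esub> f = r \<odot>\<^bsub>GrS\<^esub> f \<oplus>\<^bsub>GrS\<^esub> s \<odot>\<^bsub>GrS\<^esub> f"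
      using r s y(2) seqsD(2)[OF y(1)] scalar_seqs[OF r y(1)] scalar_seqs[OF s y(1)]
      by (simp add: scalar_smult[OF _ y(1)] Gr_add smult_l_distr)
    show "(r \<otimes> s) \<odot>\<^bsub>GrS\<^esub> f = r \<odot>\<^bsub>GrS\<^esub> (s \<odot>\<^bsub>GrS\<^esub> f)"
      using r s y(2) seqsD(2)[OF y(1)] scalar_smult[OF r scalar_seqs[OF s y(1)]]
      by (simp add: scalar_smult[OF _ y(1)] smult_assoc1)
  }
  fix g assume "g \<in> carrier GrS"
  then obtain z where z: "z \<in> seqs" "g = cls z" unfolding GrS_simps Gr_carrier by blast
  show "r \<odot>\<^bsub>GrS\<^esub> (f \<oplus>\<^bsub>GrS\<^esub> g) = r \<odot>\<^bsub>GrS\<^esub> f \<oplus>\<^bsub>GrS\<^esub> r \<odot>\<^bsub>GrS\<^esub> g"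
    using r y(2) z(2) seqsD(2)[OF y(1)] seqsD(2)[OF z(1)] scalar_seqs[OF r y(1)] scalar_seqs[OF r z(1)]
      scalar_smult[OF r add_seqs[OF y(1) z(1)]]
    by (simp add: Gr_add y(1) z(1) scalar_smult smult_r_distr)
next
  fix f assume "f \<in> carrier GrS"
  then obtain y where y: "y \<in> seqs" "f = cls y" unfolding GrS_simps Gr_carrier by blast
  show "\<one> \<odot>\<^bsub>GrS\<^esub> f = f" using scalar_smult[OF R.one_closed y(1)] seqsD(2)[OF y(1)] y(2) by simp
qed

lemma self_GrS: "filtered_module.GrS R (self_module R) I (ideal_pow R I) = ringS"
  unfolding filtered_module.GrS_def[OF self_filtered] ringS_def self_Gr ..

lemma self_below: "filtered_module.below (self_module R) (ideal_pow R I) = ring_below"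
  unfolding filtered_module.below_def[OF self_filtered] ring_below_def self_seqs self_cls fun_eq_iff
  by (simp add: self_module_def)

lemma ringS_module: "module R ringS"
  using filtered_module.GrS_module[OF self_filtered] unfolding self_GrS .

lemma below_submodule: "submodule (below n) R GrS"
proof -
  interpret G: module R GrS by (rule GrS_module)
  show ?thesis unfolding G.submodule_iff
  proof (intro conjI ballI)
    show "below n \<subseteq> carrier GrS" unfolding below_def by (auto simp: Gr_carrier)
    show "\<zero>\<^bsub>GrS\<^esub> \<in> below n" unfolding below_def using zero_seqs by (auto simp: Gr_zero)
    fix f g assume "f \<in> below n" "g \<in> below n"
    then obtain y z where yz: "y \<in> seqs" "f = cls y" "\<forall>j\<ge>n. y j = \<zero>\<^bsub>M\<^esub>" "z \<in> seqs" "g = cls z" "\<forall>j\<ge>n. z j = \<zero>\<^bsub>M\<^esub>"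
      unfolding below_def by blast
    have "f \<oplus>\<^bsub>GrS\<^esub> g = cls (\<lambda>j. y j \<oplus>\<^bsub>M\<^esub> z j)" unfolding yz GrS_simps by (rule Gr_add[OF yz(1,4)])
    moreover have "\<forall>j\<ge>n. y j \<oplus>\<^bsub>M\<^esub> z j = \<zero>\<^bsub>M\<^esub>" using yz(3,6) by simp
    ultimately show "f \<oplus>\<^bsub>GrS\<^esub> g \<in> below n" unfolding below_def using add_seqs[OF yz(1,4)] by blast
  next
    fix r f assume r: "r \<in> carrier R" and "f \<in> below n"
    then obtain y where y: "y \<in> seqs" "f = cls y" "\<forall>j\<ge>n. y j = \<zero>\<^bsub>M\<^esub>" unfolding below_def by blast
    have "r \<odot>\<^bsub>GrS\<^esub> f = cls (\<lambda>j. r \<odot>\<^bsub>M\<^esub> y j)" unfolding y GrS_simps by (rule scalar_smult[OF r y(1)])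
    moreover have "\<forall>j\<ge>n. r \<odot>\<^bsub>M\<^esub> y j = \<zero>\<^bsub>M\<^esub>" using y(3) r by simp
    ultimately show "r \<odot>\<^bsub>GrS\<^esub> f \<in> below n" unfolding below_def using scalar_seqs[OF r y(1)] by blast
  qed
qed

lemma ring_below_submodule: "submodule (ring_below n) R ringS"
  using filtered_module.below_submodule[OF self_filtered] unfolding self_GrS self_below .

lemma below_mono: "n \<le> m \<Longrightarrow> below n \<subseteq> below m"
  unfolding below_def by auto

lemma ring_below_mono: "n \<le> m \<Longrightarrow> ring_below n \<subseteq> ring_below m"
  unfolding ring_below_def by auto

lemma below_exists: "f \<in> carrier Gr \<Longrightarrow> \<exists>n. f \<in> below n"
  unfolding Gr_carrier below_def seqs_def by blast

lemma ring_below_exists: "f \<in> carrier GrR \<Longrightarrow> \<exists>n. f \<in> ring_below n"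
  unfolding GrR_carrier ring_below_def rseqs_def by blast

lemma below_smult: "f \<in> ring_below n \<Longrightarrow> g \<in> below m \<Longrightarrow> f \<odot>\<^bsub>Gr\<^esub> g \<in> below (n + m)"
proof -
  assume "f \<in> ring_below n" "g \<in> below m"
  then obtain a y where ay: "a \<in> rseqs" "f = rcls a" "\<forall>j\<ge>n. a j = \<zero>" "y \<in> seqs" "g = cls y" "\<forall>j\<ge>m. y j = \<zero>\<^bsub>M\<^esub>"
    unfolding below_def ring_below_def by blast
  have "\<forall>j\<ge>n + m. conv a y j = \<zero>\<^bsub>M\<^esub>"
    using conv_below[of a y n m] rseqsD(2)[OF ay(1)] seqsD(2)[OF ay(4)] ay(3,6) by blast
  then show ?thesis unfolding ay(2,5) Gr_smult[OF ay(1,4)] below_def using conv_seqs[OF ay(1,4)] by blast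
qed

lemma ring_below_mult: "f \<in> ring_below n \<Longrightarrow> g \<in> ring_below m \<Longrightarrow> f \<otimes>\<^bsub>GrR\<^esub> g \<in> ring_below (n + m)"
proof -
  assume "f \<in> ring_below n" "g \<in> ring_below m"
  then show ?thesis using filtered_module.below_smult[OF self_filtered, of f n g m] unfolding self_below self_Gr by simp
qed

lemma ideal_submodule_ringS:
  assumes J: "ideal J GrR" shows "submodule J R ringS"
proof -
  interpret A: cring GrR by (rule GrR_cring)
  interpret S: module R ringS by (rule ringS_module)
  show ?thesis unfolding S.submodule_iff
    using A.ideal_closed[OF J] monom_carrier[of _ 0] by (auto simp: ideals_set_def)
qed

lemma linear_on_right_smult:
  assumes u: "u \<in> carrier Gr" and V: "V \<subseteq> carrier GrR"
  shows "linear_on R ringS GrS V (\<lambda>f. f \<odot>\<^bsub>Gr\<^esub> u)"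
proof -
  interpret G: module GrR Gr by (rule Gr_module)
  have m: "monom 0 r \<in> carrier GrR" if "r \<in> carrier R" for r using monom_carrier[of r 0] that by (simp add: ideals_set_def)
  show ?thesis unfolding linear_on_def
    using u V m by (auto simp: G.smult_l_distr G.smult_assoc1 subset_iff)
qed

lemma linear_on_right_mult:
  assumes u: "u \<in> carrier GrR" and V: "V \<subseteq> carrier GrR"
  shows "linear_on R ringS ringS V (\<lambda>f. f \<otimes>\<^bsub>GrR\<^esub> u)"
proof -
  interpret A: cring GrR by (rule GrR_cring)
  have m: "monom 0 r \<in> carrier GrR" if "r \<in> carrier R" for r using monom_carrier[of r 0] that by (simp add: ideals_set_def)
  show ?thesis unfolding linear_on_def
    using u V m by (auto simp: A.l_distr A.m_assoc subset_iff)
qed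

lemma single_linear: "linear_on R M GrS (F n) (\<lambda>u. cls (\<lambda>m. if m = n then u else \<zero>\<^bsub>M\<^esub>))"
  unfolding linear_on_def
proof (intro conjI ballI)
  fix u assume u: "u \<in> F n"
  show "cls (\<lambda>m. if m = n then u else \<zero>\<^bsub>M\<^esub>) \<in> carrier GrS" using single_seqs[OF u] by (auto simp: Gr_carrier)
  show "cls (\<lambda>m. if m = n then u \<oplus>\<^bsub>M\<^esub> v else \<zero>\<^bsub>M\<^esub>) = cls (\<lambda>m. if m = n then u else \<zero>\<^bsub>M\<^esub>) \<oplus>\<^bsub>GrS\<^esub> cls (\<lambda>m. if m = n then v else \<zero>\<^bsub>M\<^esub>)"
    if v: "v \<in> F n" for v
  proof -
    have "(\<lambda>m. if m = n then u \<oplus>\<^bsub>M\<^esub> v else \<zero>\<^bsub>M\<^esub>) = (\<lambda>m. (if m = n then u else \<zero>\<^bsub>M\<^esub>) \<oplus>\<^bsub>M\<^esub> (if m = n then v else \<zero>\<^bsub>M\<^esub>))"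
      by (rule ext) simp
    then show ?thesis using Gr_add[OF single_seqs[OF u] single_seqs[OF v]] by simp
  qed
next
  fix r u assume r: "r \<in> carrier R" and u: "u \<in> F n"
  have "(\<lambda>m. if m = n then r \<odot>\<^bsub>M\<^esub> u else \<zero>\<^bsub>M\<^esub>) = (\<lambda>m. r \<odot>\<^bsub>M\<^esub> (if m = n then u else \<zero>\<^bsub>M\<^esub>))"
    using r by (intro ext) simp
  then show "cls (\<lambda>m. if m = n then r \<odot>\<^bsub>M\<^esub> u else \<zero>\<^bsub>M\<^esub>) = r \<odot>\<^bsub>GrS\<^esub> cls (\<lambda>m. if m = n then u else \<zero>\<^bsub>M\<^esub>)"
    using scalar_smult[OF r single_seqs[OF u]] by simp
qed

text \<open>Passing from degrees below \<open>n\<close> to degrees up to \<open>n\<close> adds an image of \<open>F n\<close> in which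
  \<open>F (n + 1)\<close> vanishes.\<close>
lemma below_length:
  assumes F0: "F 0 = carrier M"
  shows "rel_length R GrS {\<zero>\<^bsub>GrS\<^esub>} (below n) \<le> rel_length R M (F n) (carrier M)"
proof (induct n)
  interpret G: module R GrS by (rule GrS_module)
  case 0
  have "f = \<zero>\<^bsub>GrS\<^esub>" if f: "f \<in> below 0" for f
  proof -
    obtain y where "f = cls y" "\<forall>j. y j = \<zero>\<^bsub>M\<^esub>" using f unfolding below_def by auto
    moreover from this have "y = (\<lambda>_. \<zero>\<^bsub>M\<^esub>)" by blast
    ultimately show ?thesis by (simp add: Gr_zero)
  qed
  then have "below 0 = {\<zero>\<^bsub>GrS\<^esub>}" using submodule_zero[OF below_submodule] by blast
  then show ?case by (simp add: rel_length_refl)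
next
  interpret G: module R GrS by (rule GrS_module)
  case (Suc n)
  let ?\<phi> = "\<lambda>u. cls (\<lambda>m. if m = n then u else \<zero>\<^bsub>M\<^esub>)"
  let ?K = "{u \<in> F n. ?\<phi> u \<in> below n}"
  have "below (Suc n) \<subseteq> below n <+>\<^bsub>GrS\<^esub> ?\<phi> ` F n"
  proof
    fix f assume "f \<in> below (Suc n)"
    then obtain y where y: "y \<in> seqs" "f = cls y" "\<forall>j\<ge>Suc n. y j = \<zero>\<^bsub>M\<^esub>" unfolding below_def by blast
    let ?z = "\<lambda>m. if m < n then y m else \<zero>\<^bsub>M\<^esub>"
    have "\<exists>d. \<forall>m\<ge>d. ?z m = \<zero>\<^bsub>M\<^esub>" by (intro exI[of _ n]) simp
    moreover have "?z m \<in> F m" for m using seqsD(1)[OF y(1)] submodule_zero[OF F_submodule] by simp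
    ultimately have z: "?z \<in> seqs" unfolding seqs_def by blast
    have "y = (\<lambda>m. ?z m \<oplus>\<^bsub>M\<^esub> (if m = n then y n else \<zero>\<^bsub>M\<^esub>))"
    proof
      fix m
      show "y m = ?z m \<oplus>\<^bsub>M\<^esub> (if m = n then y n else \<zero>\<^bsub>M\<^esub>)"
        using y(3) seqsD(2)[OF y(1), of m] by (cases m n rule: linorder_cases) auto
    qed
    then have "f = cls ?z \<oplus>\<^bsub>GrS\<^esub> ?\<phi> (y n)"
      using Gr_add[OF z single_seqs[OF seqsD(1)[OF y(1), of n]]] y(2) by simp
    moreover have "cls ?z \<in> below n" unfolding below_def using z by auto
    ultimately show "f \<in> below n <+>\<^bsub>GrS\<^esub> ?\<phi> ` F n" unfolding mem_set_add using seqsD(1)[OF y(1), of n] by blast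
  qed
  moreover have "below n <+>\<^bsub>GrS\<^esub> ?\<phi> ` F n \<subseteq> below (Suc n)"
  proof (rule G.sum_least[OF below_submodule below_mono])
    show "?\<phi> ` F n \<subseteq> below (Suc n)" unfolding below_def using single_seqs by auto
  qed simp
  ultimately have eq: "below n <+>\<^bsub>GrS\<^esub> ?\<phi> ` F n = below (Suc n)" by blast
  have K: "submodule ?K R M" by (rule submodule_preimage[OF GrS_module F_submodule single_linear below_submodule])
  have FK: "F (Suc n) \<subseteq> ?K"
  proof
    fix u assume u: "u \<in> F (Suc n)"
    then have un: "u \<in> F n" using F_Suc by blast
    have "?\<phi> u = cls (\<lambda>_. \<zero>\<^bsub>M\<^esub>)"
      by (subst cls_eq_iff) (use u un submodule_zero[OF F_submodule] submodule_minus[OF F_submodule] in auto)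
    then have "?\<phi> u \<in> below n" using submodule_zero[OF below_submodule] by (simp add: Gr_zero)
    then show "u \<in> ?K" using un by blast
  qed
  have "rel_length R GrS (below n) (below (Suc n)) = rel_length R M ?K (F n)"
    using rel_length_linear[OF GrS_module F_submodule single_linear below_submodule, of n n] unfolding eq by (rule sym)
  also have "\<dots> \<le> rel_length R M (F (Suc n)) (F n)"
    by (rule rel_length_mono[OF F_submodule K F_submodule F_submodule FK]) auto
  finally have "rel_length R GrS {\<zero>\<^bsub>GrS\<^esub>} (below n) + rel_length R GrS (below n) (below (Suc n))
      \<le> rel_length R M (F n) (carrier M) + rel_length R M (F (Suc n)) (F n)" using Suc by (intro add_mono)
  moreover have "rel_length R GrS {\<zero>\<^bsub>GrS\<^esub>} (below (Suc n))
      = rel_length R GrS {\<zero>\<^bsub>GrS\<^esub>} (below n) + rel_length R GrS (below n) (below (Suc n))"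
    by (rule G.rel_length_add[OF G.zero_submodule below_submodule below_submodule])
       (use submodule_zero[OF below_submodule] below_mono[of n "Suc n"] in auto)
  moreover have "rel_length R M (F (Suc n)) (carrier M) = rel_length R M (F (Suc n)) (F n) + rel_length R M (F n) (carrier M)"
    by (rule rel_length_add[OF F_submodule F_submodule carrier_is_submodule F_Suc]) (use F_carrier in blast)
  ultimately show ?case by (simp add: add.commute)
qed

text \<open>Let \<open>P \<subset> Q \<subset> T\<close> be primes over the annihilator. Some \<open>u\<close> has \<open>(0 : u) \<subseteq> P\<close>, so the length of the
  part of \<open>Gr\<^sub>I(R) / P\<close> in degrees below \<open>n\<close> is at most that of a comparable part of \<open>Gr\<close>, and grows
  at most linearly. For \<open>y \<in> Q - P\<close> multiplication by \<open>y\<close> is injective modulo \<open>P\<close> and shifts degrees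
  by a bounded amount \<open>c\<close>; linear growth therefore bounds the length of the part of
  \<open>Gr\<^sub>I(R) / (P + (y))\<close> in low degrees for infinitely many \<open>n\<close>. But the powers of an element
  \<open>z \<in> T - Q\<close> give arbitrarily long chains \<open>Q + (z\<^sup>i)\<close> above \<open>P + (y)\<close>.\<close>
theorem Gr_no_long_prime_chain:
  assumes noeth: "noeth_module GrR Gr" and F0: "F 0 = carrier M"
    and bound: "\<And>n. rel_length R M (F n) (carrier M) \<le> enat (C * (n + K))"
  shows "\<not> prime_chain_over GrR (annihilator GrR Gr) 2"
proof
  interpret A: cring GrR by (rule GrR_cring)
  interpret G: module GrR Gr by (rule Gr_module)
  interpret S: module R ringS by (rule ringS_module)
  interpret N: module R GrS by (rule GrS_module)
  assume "prime_chain_over GrR (annihilator GrR Gr) 2"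
  then obtain P Q T where P: "primeideal P GrR" and Q: "primeideal Q GrR" and T: "primeideal T GrR"
    and ann: "annihilator GrR Gr \<subseteq> P" and PQ: "P \<subset> Q" and QT: "Q \<subset> T" unfolding prime_chain_over_2 by blast
  note Pi = primeidealD(1)[OF P] and Qi = primeidealD(1)[OF Q] and Ti = primeidealD(1)[OF T]
  have "\<exists>u\<in>carrier Gr. {a \<in> carrier GrR. a \<odot>\<^bsub>Gr\<^esub> u = \<zero>\<^bsub>Gr\<^esub>} \<subseteq> P"
  proof (rule ccontr)
    assume no: "\<not> ?thesis"
    obtain X where X: "finite X" "X \<subseteq> carrier Gr" "carrier Gr = submodule_gen GrR Gr X"
      using G.noeth_submodule_fin_gen[OF noeth G.carrier_is_submodule] by blast
    let ?ann = "\<lambda>u. {a \<in> carrier GrR. a \<odot>\<^bsub>Gr\<^esub> u \<in> {\<zero>\<^bsub>Gr\<^esub>}}"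
    have "\<exists>w\<in>carrier GrR - P. \<forall>J\<in>?ann ` X. w \<in> J"
    proof (rule A.outside_prime[OF P])
      show "finite (?ann ` X)" using X(1) by simp
      fix J assume "J \<in> ?ann ` X"
      then obtain u where u: "u \<in> carrier Gr" "J = ?ann u" using X(2) by blast
      show "ideal J GrR \<and> \<not> J \<subseteq> P" unfolding u(2) using G.colon_ideal[OF G.zero_submodule u(1)] no u(1) by auto
    qed
    then obtain w where w: "w \<in> carrier GrR" "w \<notin> P" "\<And>u. u \<in> X \<Longrightarrow> w \<odot>\<^bsub>Gr\<^esub> u = \<zero>\<^bsub>Gr\<^esub>" by auto
    have "submodule_gen GrR Gr X \<subseteq> {v \<in> carrier Gr. w \<odot>\<^bsub>Gr\<^esub> v \<in> {\<zero>\<^bsub>Gr\<^esub>}}"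
      by (rule G.submodule_gen_least[OF G.submodule_smult_preimage[OF w(1) G.carrier_is_submodule G.zero_submodule]])
         (use X(2) w(3) in auto)
    then have "w \<in> annihilator GrR Gr" unfolding annihilator_def using w(1) X(3) by auto
    then show False using ann w(2) by blast
  qed
  then obtain u where u: "u \<in> carrier Gr" and annu: "\<And>a. a \<in> carrier GrR \<Longrightarrow> a \<odot>\<^bsub>Gr\<^esub> u = \<zero>\<^bsub>Gr\<^esub> \<Longrightarrow> a \<in> P" by blast
  obtain e where e: "u \<in> below e" using below_exists[OF u] by blast
  obtain y where y: "y \<in> Q" "y \<notin> P" using PQ by blast
  obtain z where z: "z \<in> T" "z \<notin> Q" using QT by blast
  have yc: "y \<in> carrier GrR" and zc: "z \<in> carrier GrR" using A.ideal_closed(1)[OF Qi y(1)] A.ideal_closed(1)[OF Ti z(1)] by auto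
  obtain c where c: "y \<in> ring_below c" using ring_below_exists[OF yc] by blast
  have Ps: "submodule P R ringS" by (rule ideal_submodule_ringS[OF Pi])
  have Qs: "submodule Q R ringS" by (rule ideal_submodule_ringS[OF Qi])
  have bc: "ring_below n \<subseteq> carrier GrR" for n using submodule_in_carrier[OF ring_below_submodule] by auto
  define W where "W n = P <+>\<^bsub>ringS\<^esub> ring_below n" for n
  have W: "submodule (W n) R ringS" "P \<subseteq> W n" "ring_below n \<subseteq> W n" for n
    unfolding W_def using S.submodule_sum[OF Ps ring_below_submodule] S.sum_upper[OF Ps ring_below_submodule] by auto
  have W_len: "rel_length R ringS P (W n) = rel_length R ringS (P \<inter> ring_below n) (ring_below n)" for n
    unfolding W_def by (rule S.rel_length_Int_sum[OF Ps ring_below_submodule, symmetric])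
  have W_bound: "rel_length R ringS P (W n) \<le> enat (C * (n + (e + K)))" for n
  proof -
    let ?A = "{f \<in> ring_below n. f \<odot>\<^bsub>Gr\<^esub> u \<in> {\<zero>\<^bsub>GrS\<^esub>}}"
    note lin = linear_on_right_smult[OF u bc[of n]]
    have As: "submodule ?A R ringS" by (rule S.submodule_preimage[OF GrS_module ring_below_submodule lin N.zero_submodule])
    have im: "submodule ((\<lambda>f. f \<odot>\<^bsub>Gr\<^esub> u) ` ring_below n) R GrS" by (rule S.submodule_image[OF GrS_module ring_below_submodule lin])
    have "?A \<subseteq> P \<inter> ring_below n" using annu bc by auto
    then have "rel_length R ringS (P \<inter> ring_below n) (ring_below n) \<le> rel_length R ringS ?A (ring_below n)"
      by (intro S.rel_length_mono[OF As S.submodule_Int[OF Ps ring_below_submodule] ring_below_submodule ring_below_submodule]) auto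
    also have "\<dots> = rel_length R GrS {\<zero>\<^bsub>GrS\<^esub>} ({\<zero>\<^bsub>GrS\<^esub>} <+>\<^bsub>GrS\<^esub> (\<lambda>f. f \<odot>\<^bsub>Gr\<^esub> u) ` ring_below n)"
      by (rule S.rel_length_linear[OF GrS_module ring_below_submodule lin N.zero_submodule])
    also have "\<dots> \<le> rel_length R GrS {\<zero>\<^bsub>GrS\<^esub>} (below (n + e))"
    proof (rule N.rel_length_mono[OF N.zero_submodule N.zero_submodule N.submodule_sum[OF N.zero_submodule im] below_submodule])
      show "{\<zero>\<^bsub>GrS\<^esub>} <+>\<^bsub>GrS\<^esub> (\<lambda>f. f \<odot>\<^bsub>Gr\<^esub> u) ` ring_below n \<subseteq> below (n + e)"
        by (rule N.sum_least[OF below_submodule]) (use submodule_zero[OF below_submodule] below_smult[OF _ e] in auto)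
    qed (use N.sum_upper(1)[OF N.zero_submodule im] in auto)
    also have "\<dots> \<le> rel_length R M (F (n + e)) (carrier M)" by (rule below_length[OF F0])
    also have "\<dots> \<le> enat (C * ((n + e) + K))" by (rule bound)
    finally show ?thesis unfolding W_len by (simp add: add.assoc)
  qed
  define w where "w n = the_enat (rel_length R ringS P (W n))" for n
  have w: "rel_length R ringS P (W n) = enat (w n)" for n
    using enat_le_finite[OF W_bound[of n]] unfolding w_def by (metis enat.exhaust enat.distinct(1) the_enat.simps)
  have "w n \<le> C * (n + (e + K))" for n using W_bound[of n] unfolding w by simp
  note gap = linear_growth_gap[of w C "e + K", OF this]
  let ?k = "Suc (C * c)"
  have "\<exists>d. \<forall>i\<le>?k. z [^]\<^bsub>GrR\<^esub> i \<in> ring_below d"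
  proof -
    have "\<exists>d. z [^]\<^bsub>GrR\<^esub> i \<in> ring_below d" for i :: nat using ring_below_exists zc by simp
    then obtain d where d: "\<And>i::nat. z [^]\<^bsub>GrR\<^esub> i \<in> ring_below (d i)" by metis
    have "z [^]\<^bsub>GrR\<^esub> i \<in> ring_below (Max (d ` {..?k}))" if "i \<le> ?k" for i
      using d[of i] ring_below_mono[of "d i" "Max (d ` {..?k})"] that by (simp add: subset_iff)
    then show ?thesis by blast
  qed
  then obtain d where d: "\<And>i. i \<le> ?k \<Longrightarrow> z [^]\<^bsub>GrR\<^esub> i \<in> ring_below d" by blast
  obtain n where n: "n \<ge> d" "w (n + c) \<le> w n + C * c" using gap[of d c] by blast
  define Y where "Y = P <+>\<^bsub>ringS\<^esub> (\<lambda>f. f \<otimes>\<^bsub>GrR\<^esub> y) ` ring_below n"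
  note lin = linear_on_right_mult[OF yc bc[of n]]
  have im: "submodule ((\<lambda>f. f \<otimes>\<^bsub>GrR\<^esub> y) ` ring_below n) R ringS" by (rule S.submodule_image[OF ringS_module ring_below_submodule lin])
  have Y: "submodule Y R ringS" "P \<subseteq> Y" unfolding Y_def using S.submodule_sum[OF Ps im] S.sum_upper[OF Ps im] by auto
  have YW: "Y \<subseteq> W (n + c)" unfolding Y_def
    by (rule S.sum_least[OF W(1) W(2)]) (use ring_below_mult[OF _ c] W(3) in blast)
  have YQ: "Y \<subseteq> Q" unfolding Y_def
    by (rule S.sum_least[OF Qs]) (use PQ A.ideal_closed(4)[OF Qi _ y(1)] bc in auto)
  have "{f \<in> ring_below n. f \<otimes>\<^bsub>GrR\<^esub> y \<in> P} = P \<inter> ring_below n"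
    using primeidealD(4)[OF P _ yc] y(2) A.ideal_closed(5)[OF Pi _ yc] bc[of n] by blast
  then have "rel_length R ringS P Y = enat (w n)"
    using S.rel_length_linear[OF ringS_module ring_below_submodule lin Ps] W_len[of n] w[of n] unfolding Y_def by simp
  then have "enat (w (n + c)) = enat (w n) + rel_length R ringS Y (W (n + c))"
    using S.rel_length_add[OF Ps Y(1) W(1)[of "n + c"] Y(2) YW] w[of "n + c"] by simp
  then have small: "rel_length R ringS Y (W (n + c)) \<le> enat (C * c)"
    using n(2) by (cases "rel_length R ringS Y (W (n + c))") auto
  have zi: "z [^]\<^bsub>GrR\<^esub> i \<in> carrier GrR" for i :: nat using zc by simp
  define J where "J i = Q <+>\<^bsub>GrR\<^esub> PIdl\<^bsub>GrR\<^esub> (z [^]\<^bsub>GrR\<^esub> (i::nat))" for i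
  have J: "ideal (J i) GrR" for i unfolding J_def by (rule A.add_ideals[OF Qi A.cgenideal_ideal[OF zi]])
  have QJ: "Q \<subseteq> J i" and zJ: "z [^]\<^bsub>GrR\<^esub> i \<in> J i" for i
  proof -
    have s: "submodule (PIdl\<^bsub>GrR\<^esub> (z [^]\<^bsub>GrR\<^esub> i)) R ringS" by (rule ideal_submodule_ringS[OF A.cgenideal_ideal[OF zi]])
    have "Q <+>\<^bsub>ringS\<^esub> PIdl\<^bsub>GrR\<^esub> (z [^]\<^bsub>GrR\<^esub> i) = J i" unfolding J_def by (simp add: set_add_def')
    then show "Q \<subseteq> J i" "z [^]\<^bsub>GrR\<^esub> i \<in> J i" using S.sum_upper[OF Qs s] A.cgenideal_self[OF zi] by auto
  qed
  have Jdec: "J (Suc i) \<subseteq> J i" for i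
  proof
    fix f assume "f \<in> J (Suc i)"
    then obtain q a where qa: "q \<in> Q" "a \<in> carrier GrR" "f = q \<oplus>\<^bsub>GrR\<^esub> a \<otimes>\<^bsub>GrR\<^esub> (z [^]\<^bsub>GrR\<^esub> Suc i)"
      unfolding J_def cgenideal_def by (fastforce simp: mem_set_add)
    have eq: "a \<otimes>\<^bsub>GrR\<^esub> (z [^]\<^bsub>GrR\<^esub> Suc i) = (a \<otimes>\<^bsub>GrR\<^esub> z) \<otimes>\<^bsub>GrR\<^esub> (z [^]\<^bsub>GrR\<^esub> i)" using qa(2) zc by (simp add: A.m_ac)
    have "(a \<otimes>\<^bsub>GrR\<^esub> z) \<otimes>\<^bsub>GrR\<^esub> (z [^]\<^bsub>GrR\<^esub> i) \<in> J i" using A.ideal_closed(4)[OF J A.m_closed[OF qa(2) zc] zJ] .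
    then show "f \<in> J i" unfolding qa(3) eq using A.ideal_closed(3)[OF J] QJ qa(1) by blast
  qed
  have zn: "z [^]\<^bsub>GrR\<^esub> i \<notin> J (Suc i)" for i
  proof
    assume "z [^]\<^bsub>GrR\<^esub> i \<in> J (Suc i)"
    then obtain q a where qa: "q \<in> Q" "a \<in> carrier GrR" "z [^]\<^bsub>GrR\<^esub> i = q \<oplus>\<^bsub>GrR\<^esub> a \<otimes>\<^bsub>GrR\<^esub> (z [^]\<^bsub>GrR\<^esub> Suc i)"
      unfolding J_def cgenideal_def by (fastforce simp: mem_set_add)
    have qc: "q \<in> carrier GrR" using A.ideal_closed(1)[OF Qi qa(1)] .
    let ?v = "\<one>\<^bsub>GrR\<^esub> \<oplus>\<^bsub>GrR\<^esub> \<ominus>\<^bsub>GrR\<^esub> (a \<otimes>\<^bsub>GrR\<^esub> z)"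
    have vc: "?v \<in> carrier GrR" using qa(2) zc by simp
    have "z [^]\<^bsub>GrR\<^esub> i \<otimes>\<^bsub>GrR\<^esub> ?v = z [^]\<^bsub>GrR\<^esub> i \<oplus>\<^bsub>GrR\<^esub> \<ominus>\<^bsub>GrR\<^esub> (a \<otimes>\<^bsub>GrR\<^esub> (z [^]\<^bsub>GrR\<^esub> Suc i))"
      using qa(2) zc by (simp add: A.r_distr A.r_minus A.m_ac)
    also have "\<dots> = (q \<oplus>\<^bsub>GrR\<^esub> a \<otimes>\<^bsub>GrR\<^esub> (z [^]\<^bsub>GrR\<^esub> Suc i)) \<oplus>\<^bsub>GrR\<^esub> \<ominus>\<^bsub>GrR\<^esub> (a \<otimes>\<^bsub>GrR\<^esub> (z [^]\<^bsub>GrR\<^esub> Suc i))" using qa(3) by simp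
    also have "\<dots> = q" using qc qa(2) zc by (simp add: A.a_assoc A.r_neg del: nat_pow_Suc)
    finally have "z [^]\<^bsub>GrR\<^esub> i \<otimes>\<^bsub>GrR\<^esub> ?v \<in> Q" using qa(1) by simp
    moreover have "z [^]\<^bsub>GrR\<^esub> i \<notin> Q"
    proof (induct i)
      case 0 show ?case using primeidealD(3)[OF Q] by simp
    next
      case (Suc i) then show ?case using primeidealD(4)[OF Q zi zc] z(2) by auto
    qed
    ultimately have "?v \<in> T" using primeidealD(4)[OF Q zi vc] QT by blast
    then have "?v \<oplus>\<^bsub>GrR\<^esub> a \<otimes>\<^bsub>GrR\<^esub> z \<in> T" using A.ideal_closed(3,4)[OF Ti] qa(2) z(1) by blast
    then have "\<one>\<^bsub>GrR\<^esub> \<in> T" using qa(2) zc by (simp add: A.a_assoc A.l_neg)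
    then show False using primeidealD(3)[OF T] by blast
  qed
  have dW: "ring_below d \<subseteq> W (n + c)" using ring_below_mono[of d "n + c"] n(1) W(3)[of "n + c"] by auto
  have "enat ?k \<le> rel_length R ringS Y (W (n + c))"
  proof (rule S.descending_chain_length[where X="\<lambda>i. J i \<inter> W (n + c)"])
    show "submodule (J i \<inter> W (n + c)) R ringS" for i by (rule S.submodule_Int[OF ideal_submodule_ringS[OF J] W(1)])
    show "J (Suc i) \<inter> W (n + c) \<subset> J i \<inter> W (n + c)" if "i < ?k" for i
      using Jdec[of i] zn[of i] zJ[of i] d[of i] dW that by auto
    show "Y \<subseteq> J ?k \<inter> W (n + c)" using YQ QJ[of ?k] YW by blast
  qed (use Y(1) W(1) in auto)
  then have "enat ?k \<le> enat (C * c)" using small by (rule order_trans)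
  then show False by simp
qed

text \<open>If all elements of \<open>P\<close> were zero divisors on \<open>Gr\<close>, then \<open>P\<close> would kill some \<open>v \<noteq> 0\<close>. If \<open>P\<close> contains the
  degree-one forms of all elements of \<open>I\<close>, then these forms kill \<open>v\<close>, and \<open>v = 0\<close> by the hypothesis on the socle. Otherwise
  \<open>1 = p + g x\<close> with \<open>p \<in> P\<close> and \<open>x\<close> of degree one, so that \<open>v = x (g v)\<close> has no component of
  lowest degree.\<close>
theorem Gr_regular_in_maximal:
  assumes nR: "noetherian_ring GrR" and nG: "noeth_module GrR Gr"
    and socle: "\<And>n u. u \<in> F n \<Longrightarrow> (\<And>x. x \<in> I \<Longrightarrow> x \<odot>\<^bsub>M\<^esub> u \<in> F (Suc (Suc n))) \<Longrightarrow> u \<in> F (Suc n)"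
    and P: "maximalideal P GrR"
  shows "\<exists>p\<in>P. nonzerodivisor_on Gr p"
proof (rule ccontr)
  interpret A: cring GrR by (rule GrR_cring)
  interpret G: module GrR Gr by (rule Gr_module)
  interpret P: maximalideal P GrR by (rule P)
  assume "\<not> ?thesis"
  then have "\<exists>v\<in>carrier Gr - {\<zero>\<^bsub>Gr\<^esub>}. a \<odot>\<^bsub>Gr\<^esub> v \<in> {\<zero>\<^bsub>Gr\<^esub>}" if "a \<in> P" for a
    using that unfolding nonzerodivisor_on_def by blast
  then obtain v where v: "v \<in> carrier Gr" "v \<noteq> \<zero>\<^bsub>Gr\<^esub>" and Pv: "\<And>a. a \<in> P \<Longrightarrow> a \<odot>\<^bsub>Gr\<^esub> v = \<zero>\<^bsub>Gr\<^esub>"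
    using G.zero_divisor_ideal[OF nR nG G.zero_submodule P.is_ideal] by (metis DiffD1 DiffD2 singletonD singletonI)
  have x1: "x \<in> ideal_pow R I (Suc 0)" if "x \<in> I" for x using that R.ideal_pow_1[OF ideal_I] by simp
  have Gz: "\<zero>\<^bsub>Gr\<^esub> m = F (Suc m)" for m
    unfolding Gr_zero using cls_zero_iff[of "\<lambda>_. \<zero>\<^bsub>M\<^esub>" m] submodule_zero[OF F_submodule] by simp
  show False
  proof (cases "\<forall>x\<in>I. monom (Suc 0) x \<in> P")
    case True
    obtain y where y: "y \<in> seqs" "v = cls y" using v(1) unfolding Gr_carrier by blast
    have "y n \<in> F (Suc n)" for n
    proof (rule socle[OF seqsD(1)[OF y(1)]])
      fix x assume x: "x \<in> I"
      let ?z = "\<lambda>m. if Suc 0 \<le> m then x \<odot>\<^bsub>M\<^esub> y (m - Suc 0) else \<zero>\<^bsub>M\<^esub>"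
      have "monom (Suc 0) x \<in> P" using True x by blast
      from Pv[OF this] have "cls ?z = \<zero>\<^bsub>Gr\<^esub>" unfolding y(2) monom_smult[OF x1[OF x] y(1)] .
      then have "cls ?z (Suc n) = F (Suc (Suc n))" using Gz by simp
      moreover have "?z (Suc n) \<in> F (Suc n)" using F_smult[OF x1[OF x] seqsD(1)[OF y(1)], of n] by simp
      ultimately have "?z (Suc n) \<in> F (Suc (Suc n))" using cls_zero_iff[of ?z "Suc n"] by simp
      then show "x \<odot>\<^bsub>M\<^esub> y n \<in> F (Suc (Suc n))" by simp
    qed
    then have "cls y = cls (\<lambda>_. \<zero>\<^bsub>M\<^esub>)"
      by (subst cls_eq_iff) (use seqsD(1)[OF y(1)] submodule_zero[OF F_submodule] submodule_minus[OF F_submodule] in auto)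
    then show False using v(2) y(2) by (simp add: Gr_zero)
  next
    case False
    then obtain x where x: "x \<in> I" "monom (Suc 0) x \<notin> P" by blast
    let ?X = "monom (Suc 0) x"
    have Xc: "?X \<in> carrier GrR" by (rule monom_carrier[OF x1[OF x(1)]])
    have "ideal (P <+>\<^bsub>GrR\<^esub> PIdl\<^bsub>GrR\<^esub> ?X) GrR" by (rule A.add_ideals[OF P.is_ideal A.cgenideal_ideal[OF Xc]])
    moreover have "P \<subseteq> P <+>\<^bsub>GrR\<^esub> PIdl\<^bsub>GrR\<^esub> ?X"
    proof
      fix p assume p: "p \<in> P"
      have "p = p \<oplus>\<^bsub>GrR\<^esub> \<zero>\<^bsub>GrR\<^esub>" using P.Icarr[OF p] by simp
      then show "p \<in> P <+>\<^bsub>GrR\<^esub> PIdl\<^bsub>GrR\<^esub> ?X" unfolding mem_set_add using p A.ideal_closed(2)[OF A.cgenideal_ideal[OF Xc]] by blast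
    qed
    moreover have "?X \<in> P <+>\<^bsub>GrR\<^esub> PIdl\<^bsub>GrR\<^esub> ?X"
    proof -
      have "?X = \<zero>\<^bsub>GrR\<^esub> \<oplus>\<^bsub>GrR\<^esub> ?X" using Xc by simp
      then show ?thesis unfolding mem_set_add using A.ideal_closed(2)[OF P.is_ideal] A.cgenideal_self[OF Xc] by blast
    qed
    ultimately have "P <+>\<^bsub>GrR\<^esub> PIdl\<^bsub>GrR\<^esub> ?X = carrier GrR"
      using P.I_maximal[of "P <+>\<^bsub>GrR\<^esub> PIdl\<^bsub>GrR\<^esub> ?X"] x(2) A.ideal_closed(1)[of "P <+>\<^bsub>GrR\<^esub> PIdl\<^bsub>GrR\<^esub> ?X"] by blast
    then have "\<one>\<^bsub>GrR\<^esub> \<in> P <+>\<^bsub>GrR\<^esub> PIdl\<^bsub>GrR\<^esub> ?X" by simp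
    then obtain p g where pg: "p \<in> P" "g \<in> carrier GrR" "\<one>\<^bsub>GrR\<^esub> = p \<oplus>\<^bsub>GrR\<^esub> g \<otimes>\<^bsub>GrR\<^esub> ?X"
      unfolding cgenideal_def by (fastforce simp: mem_set_add)
    have pc: "p \<in> carrier GrR" by (rule P.Icarr[OF pg(1)])
    have "v = (p \<oplus>\<^bsub>GrR\<^esub> g \<otimes>\<^bsub>GrR\<^esub> ?X) \<odot>\<^bsub>Gr\<^esub> v" using v(1) unfolding pg(3)[symmetric] by simp
    also have "\<dots> = (g \<otimes>\<^bsub>GrR\<^esub> ?X) \<odot>\<^bsub>Gr\<^esub> v" using Pv[OF pg(1)] pc pg(2) Xc v(1) by (simp add: G.smult_l_distr)
    also have "\<dots> = ?X \<odot>\<^bsub>Gr\<^esub> (g \<odot>\<^bsub>Gr\<^esub> v)" using pg(2) Xc v(1) by (simp add: A.m_comm[of g] G.smult_assoc1)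
    finally have vX: "v = ?X \<odot>\<^bsub>Gr\<^esub> (g \<odot>\<^bsub>Gr\<^esub> v)" .
    obtain a where a: "a \<in> rseqs" "g = rcls a" using pg(2) unfolding GrR_carrier by blast
    obtain y where y: "y \<in> seqs" "v = cls y" using v(1) unfolding Gr_carrier by blast
    note ay = conv_seqs[OF a(1) y(1)]
    let ?z = "\<lambda>m. if Suc 0 \<le> m then x \<odot>\<^bsub>M\<^esub> conv a y (m - Suc 0) else \<zero>\<^bsub>M\<^esub>"
    have vz: "v = cls ?z"
      using vX unfolding y(2) a(2) Gr_smult[OF a(1) y(1)] monom_smult[OF x1[OF x(1)] ay] .
    have "\<forall>m<n. y m \<in> F (Suc m)" for n
    proof (induct n)
      case (Suc n)
      have "x \<odot>\<^bsub>M\<^esub> conv a y (n - Suc 0) \<in> F (Suc n)" if n: "Suc 0 \<le> n"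
      proof -
        have "conv a y (n - Suc 0) \<in> F n" unfolding conv_def
        proof (rule submodule_finsum[OF F_submodule])
          fix i assume i: "i \<in> {..n - Suc 0}"
          have "n - Suc 0 - i < n" using n by simp
          then have "y (n - Suc 0 - i) \<in> F (Suc (n - Suc 0 - i))" using Suc by blast
          then have "a i \<odot>\<^bsub>M\<^esub> y (n - Suc 0 - i) \<in> F (i + Suc (n - Suc 0 - i))" by (rule F_smult[OF rseqsD(1)[OF a(1)]])
          moreover have "i + Suc (n - Suc 0 - i) = n" using i n by simp
          ultimately show "a i \<odot>\<^bsub>M\<^esub> y (n - Suc 0 - i) \<in> F n" by simp
        qed simp
        then show ?thesis using F_smult[OF x1[OF x(1)], of _ n] by simp
      qed
      then have z: "?z n \<in> F (Suc n)"
        using submodule_zero[OF F_submodule] by simp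
      then have zn: "?z n \<in> F n" using F_Suc[of n] by (rule subsetD[rotated])
      have "cls y n = cls ?z n" using fun_cong[OF vz, of n] unfolding y(2) .
      also have "\<dots> = F (Suc n)" using cls_zero_iff[of ?z n] zn z by blast
      finally have "y n \<in> F (Suc n)" using cls_zero_iff[of y n] seqsD(1)[OF y(1)] by blast
      then show ?case using Suc by (simp add: less_Suc_eq)
    qed simp
    then have "y m \<in> F (Suc m)" for m by blast
    then have "cls y = cls (\<lambda>_. \<zero>\<^bsub>M\<^esub>)"
      by (subst cls_eq_iff) (use seqsD(1)[OF y(1)] submodule_zero[OF F_submodule] submodule_minus[OF F_submodule] in auto)
    then show False using v(2) y(2) by (simp add: Gr_zero)
  qed
qed

text \<open>The \<open>I\<close>-adic filtration of \<open>R\<close> is generated in degree one by \<open>X\<close>, starting from index \<open>0\<close>.\<close>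
lemma GrR_noetherian:
  assumes X: "finite X" "X \<subseteq> carrier R" "I = Idl X" and noeth: "noetherian_ring R"
  shows "noetherian_ring GrR"
proof -
  interpret S: filtered_module R "self_module R" I "ideal_pow R I" by (rule self_filtered)
  interpret A: cring GrR by (rule GrR_cring)
  interpret GM: module GrR S.Gr by (rule S.Gr_module)
  interpret AM: module GrR "self_module GrR" by (rule A.module_self)
  have XI: "X \<subseteq> I" using R.genideal_self[OF X(2)] X(3) by simp
  have "asc_chain_cond (graded_family R (self_module R) X (\<lambda>n. ideal_pow R I (Suc n)) (ideal_pow R I))"
  proof (rule S.graded_family_noetherian[OF X(1,2) _ S.F_submodule _ S.F_submodule S.F_Suc, where N=0])
    show "noeth_module R (self_module R)" using R.noetherian_ring_iff noeth by blast
    show "shift_closed (self_module R) X (\<lambda>n. ideal_pow R I (Suc n))" unfolding shift_closed_def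
    proof (intro ballI allI)
      fix x n u assume x: "x \<in> X" and u: "u \<in> ideal_pow R I (Suc n)"
      have "x \<in> ideal_pow R I (Suc 0)" using x XI R.ideal_pow_1[OF ideal_I] by auto
      from S.F_smult[OF this u] show "x \<odot>\<^bsub>self_module R\<^esub> u \<in> ideal_pow R I (Suc (Suc n))" by simp
    qed
    fix n W assume W: "submodule W R (self_module R)"
      and h: "\<And>x v. x \<in> X \<Longrightarrow> v \<in> ideal_pow R I n \<Longrightarrow> x \<odot>\<^bsub>self_module R\<^esub> v \<in> W"
    show "ideal_pow R I (Suc n) \<subseteq> W"
    proof
      fix a assume "a \<in> ideal_pow R I (Suc n)"
      then have "a \<in> ideal_prod R (ideal_pow R I n) I" unfolding R.ideal_pow_Suc .
      then show "a \<in> W"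
      proof induct
        case (prod b c)
        have bc: "b \<in> carrier R" "c \<in> carrier R" using R.ideal_pow_in_carrier[OF ideal_I prod(1)] R.ideal_closed(1)[OF ideal_I prod(2)] by auto
        have "c \<odot>\<^bsub>self_module R\<^esub> b \<in> W"
          by (rule S.Idl_smult[OF W _ X(2) h[OF _ prod(1)]]) (use bc prod(2) X(3) in \<open>auto simp: self_module_def\<close>)
        then show ?case using bc by (simp add: self_module_def R.m_comm)
      next
        case (sum s t) then show ?case using submodule_add[OF W, of s t] by (simp add: self_module_def)
      qed
    qed
  qed
  then have "noeth_module GrR S.Gr" by (rule S.Gr_noetherian[OF XI])
  moreover have "submodule J GrR (self_module GrR) \<longleftrightarrow> submodule J GrR S.Gr" for J
    unfolding AM.submodule_iff GM.submodule_iff by (simp add: self_module_def self_Gr)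
  ultimately show ?thesis unfolding A.noetherian_ring_iff noeth_module_def by simp
qed

end


section \<open>The graded module of the Ratliff-Rush filtration\<close>

context one_dim_module
begin

abbreviation "RR \<equiv> ratliff_rush R I M"

definition rr_colon :: "nat \<Rightarrow> nat \<Rightarrow> 'b set" where
  "rr_colon n k = module_colon M (pow_mult I (n + k)) (ideal_pow R I k)"

lemma rr_colon_submodule: "submodule (rr_colon n k) R M"
  unfolding rr_colon_def
  by (rule submodule_colon[OF pow_mult_submodule[OF ideal_I]]) (use R.ideal_pow_in_carrier[OF ideal_I] in blast)

lemma rr_colon_Suc: "rr_colon n k \<subseteq> rr_colon n (Suc k)"
proof
  fix x assume x: "x \<in> rr_colon n k"
  have xc: "x \<in> carrier M" by (rule submodule_in_carrier[OF rr_colon_submodule x])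
  have "a \<odot> x \<in> pow_mult I (n + Suc k)" if a: "a \<in> ideal_pow R I (Suc 0 + k)" for a
  proof (rule ideal_pow_smult[OF pow_mult_submodule[OF ideal_I] xc ideal_I _ a])
    fix b c assume b: "b \<in> ideal_pow R I (Suc 0)" and c: "c \<in> ideal_pow R I k"
    have "c \<odot> x \<in> pow_mult I (n + k)" using x c unfolding rr_colon_def module_colon_def by blast
    from pow_mult_smult[OF ideal_I b this] show "b \<odot> (c \<odot> x) \<in> pow_mult I (n + Suc k)" by simp
  qed
  then show "x \<in> rr_colon n (Suc k)" unfolding rr_colon_def module_colon_def using xc by simp
qed

lemma rr_colon_mono: "k \<le> l \<Longrightarrow> rr_colon n k \<subseteq> rr_colon n l"
  by (induct rule: dec_induct) (use rr_colon_Suc in blast)+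

lemma RR_eq: "RR n = (\<Union>k. rr_colon n k)"
proof (cases "n = 0")
  case True
  have "carrier M \<subseteq> rr_colon 0 0" unfolding rr_colon_def module_colon_def by (auto intro: ideal_smult_mem)
  then show ?thesis using True submodule_in_carrier[OF rr_colon_submodule] by (auto simp: ratliff_rush_def)
next
  case False
  have "(\<Union>k. rr_colon n k) = (\<Union>k\<in>{1..}. rr_colon n k)"
  proof
    show "(\<Union>k. rr_colon n k) \<subseteq> (\<Union>k\<in>{1..}. rr_colon n k)"
    proof
      fix x assume "x \<in> (\<Union>k. rr_colon n k)"
      then obtain k where "x \<in> rr_colon n (Suc k)" using rr_colon_Suc by blast
      moreover have "Suc k \<in> {1..}" by simp
      ultimately show "x \<in> (\<Union>k\<in>{1..}. rr_colon n k)" by blast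
    qed
  qed blast
  then show ?thesis using False unfolding ratliff_rush_def rr_colon_def by simp
qed

lemma RR_filtered: "filtered_module R M I RR"
proof (intro filtered_module.intro filtered_module_axioms.intro module_axioms ideal_I)
  show "submodule (RR n) R M" for n
    unfolding RR_eq by (rule submodule_Union_chain[of "rr_colon n", OF rr_colon_submodule rr_colon_Suc])
  show "RR (Suc n) \<subseteq> RR n" for n
  proof -
    have "rr_colon (Suc n) k \<subseteq> rr_colon n k" for k
      unfolding rr_colon_def module_colon_def using pow_mult_antimono[OF ideal_I, of "n + k" "Suc n + k"] by auto
    then show ?thesis unfolding RR_eq by blast
  qed
  fix a x i j assume a: "a \<in> ideal_pow R I i" and "x \<in> RR j"
  then obtain k where x: "x \<in> rr_colon j k" unfolding RR_eq by blast
  have xc: "x \<in> carrier M" by (rule submodule_in_carrier[OF rr_colon_submodule x])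
  have ac: "a \<in> carrier R" by (rule R.ideal_pow_in_carrier[OF ideal_I a])
  have "b \<odot> (a \<odot> x) \<in> pow_mult I (i + j + k)" if b: "b \<in> ideal_pow R I k" for b
  proof -
    have "b \<odot> x \<in> pow_mult I (j + k)" using x b unfolding rr_colon_def module_colon_def by blast
    from pow_mult_smult[OF ideal_I a this] show ?thesis
      using smult_comm[OF R.ideal_pow_in_carrier[OF ideal_I b] ac xc] by (simp add: add.assoc)
  qed
  then have "a \<odot> x \<in> rr_colon (i + j) k" unfolding rr_colon_def module_colon_def using ac xc by auto
  then show "a \<odot> x \<in> RR (i + j)" unfolding RR_eq by blast
qed

text \<open>For each of the finitely many generators \<open>x\<close> of \<open>I\<close> some power of \<open>I\<close> sends \<open>x u\<close> to the right place; one power \<open>I\<^sup>l\<close> then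
  serves for all, and \<open>I\<^sup>l\<^sup>+\<^sup>1\<close> does so for \<open>u\<close>.\<close>
lemma RR_socle:
  assumes uc: "u \<in> carrier M" and h: "\<And>x. x \<in> I \<Longrightarrow> x \<odot> u \<in> RR (Suc (Suc n))"
  shows "u \<in> RR (Suc n)"
proof -
  have "\<forall>x\<in>gens. \<exists>k. x \<odot> u \<in> rr_colon (Suc (Suc n)) k" using h gens(4) unfolding RR_eq by blast
  then obtain k where k: "\<And>x. x \<in> gens \<Longrightarrow> x \<odot> u \<in> rr_colon (Suc (Suc n)) (k x)" by metis
  define l where "l = Max (insert 0 (k ` gens))"
  have "k x \<le> l" if "x \<in> gens" for x unfolding l_def using gens(2) that by (intro Max_ge) auto
  then have gl: "x \<odot> u \<in> rr_colon (Suc (Suc n)) l" if "x \<in> gens" for x using k[OF that] rr_colon_mono that by blast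
  have Il: "x \<odot> u \<in> rr_colon (Suc (Suc n)) l" if "x \<in> I" for x
    by (rule Idl_smult[OF rr_colon_submodule uc gens(1) gl]) (use that gens(3) in auto)
  have "a \<odot> u \<in> pow_mult I (Suc n + Suc l)" if a: "a \<in> ideal_pow R I (Suc l)" for a
  proof (rule ideal_prod_smult[OF pow_mult_submodule[OF ideal_I] uc R.ideal_pow_ideal[OF ideal_I] ideal_I])
    fix b c assume "b \<in> ideal_pow R I l" "c \<in> I"
    then show "b \<odot> (c \<odot> u) \<in> pow_mult I (Suc n + Suc l)" using Il[of c] unfolding rr_colon_def module_colon_def by simp
  qed (use a[unfolded R.ideal_pow_Suc] in simp)
  then have "u \<in> rr_colon (Suc n) (Suc l)" unfolding rr_colon_def module_colon_def using uc by blast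
  then show ?thesis unfolding RR_eq by blast
qed

end

sublocale one_dim_module \<subseteq> RR: filtered_module R M I "ratliff_rush R I M"
  by (rule RR_filtered)

context one_dim_module
begin

lemma RR_graded_noetherian: "asc_chain_cond (graded_family R M gens (\<lambda>n. RR (Suc n)) RR)"
proof -
  obtain N where N: "\<And>n. n \<ge> N \<Longrightarrow> RR n = Fil n" by (rule ratliff_rush_eq_Fil) blast
  have I1: "x \<in> ideal_pow R I (Suc 0)" if "x \<in> gens" for x using that gens(4) R.ideal_pow_1[OF ideal_I] by auto
  show ?thesis
  proof (rule graded_family_noetherian[OF gens(2,1) noeth_M RR.F_submodule _ RR.F_submodule RR.F_Suc, where N=N])
    show "shift_closed M gens (\<lambda>n. RR (Suc n))" unfolding shift_closed_def using RR.F_smult[OF I1] by fastforce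
    fix n W assume n: "N \<le> n" and W: "submodule W R M" "RR (Suc (Suc n)) \<subseteq> W"
      and h: "\<And>x v. x \<in> gens \<Longrightarrow> v \<in> RR n \<Longrightarrow> x \<odot> v \<in> W"
    have "RR (Suc n) = Fil (Suc n)" "RR n = Fil n" "RR (Suc (Suc n)) = Fil (Suc (Suc n))" using N n by auto
    note eq = this
    have "x \<odot> v \<in> W" if "x \<in> gens" "v \<in> pow_mult I n" for x v using h[of x v] that Fil_upper(1)[of n] unfolding eq by blast
    then have "pow_mult I (Suc n) \<subseteq> W" by (rule pow_mult_Suc_least[OF ideal_I W(1) gens(3,1)])
    moreover have "torsion \<subseteq> W" using W(2) Fil_upper(2)[of "Suc (Suc n)"] unfolding eq by blast
    ultimately show "RR (Suc n) \<subseteq> W" unfolding eq by (rule Fil_least[OF W(1)])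
  qed
qed

lemma graded_ring_noetherian: "noetherian_ring (assoc_graded_ring R I)"
  by (rule RR.GrR_noetherian[OF gens(2,1,3) noeth_R])

lemma graded_module_noetherian: "noeth_module (assoc_graded_ring R I) (assoc_graded_module M RR)"
  by (rule RR.Gr_noetherian[OF gens(4) RR_graded_noetherian])

lemma RR_length_bound: "\<exists>C K. \<forall>n. rel_length R M (RR n) (carrier M) \<le> enat (C * (n + K))"
proof -
  obtain N where N: "\<And>n. n \<ge> N \<Longrightarrow> RR n = Fil n" by (rule ratliff_rush_eq_Fil) blast
  obtain C where C: "\<And>n. lFil n \<le> C * n" using lFil_linear_bound by blast
  have "rel_length R M (RR n) (carrier M) \<le> enat (C * (n + N))" for n
  proof -
    have "rel_length R M (RR n) (carrier M) \<le> rel_length R M (RR (n + N)) (carrier M)"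
      by (rule rel_length_mono[OF RR.F_submodule RR.F_submodule carrier_is_submodule carrier_is_submodule])
         (use RR.F_mono[of n "n + N"] RR.F_carrier in auto)
    also have "\<dots> = enat (lFil (n + N))" using N[of "n + N"] lFil by simp
    also have "\<dots> \<le> enat (C * (n + N))" using C by simp
    finally show ?thesis .
  qed
  then show ?thesis by blast
qed

text \<open>Otherwise the filtration is constantly \<open>M\<close>, whereas \<open>I\<^sup>n M + H\<close> is a proper submodule for \<open>n \<ge> 1\<close>
  by Nakayama's lemma.\<close>
lemma graded_module_nonzero: "carrier (assoc_graded_module M RR) \<noteq> {\<zero>\<^bsub>assoc_graded_module M RR\<^esub>}"
proof
  assume zero: "carrier (assoc_graded_module M RR) = {\<zero>\<^bsub>assoc_graded_module M RR\<^esub>}"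
  have step: "RR n \<subseteq> RR (Suc n)" for n
  proof
    fix u assume u: "u \<in> RR n"
    let ?y = "\<lambda>m. if m = n then u else \<zero>\<^bsub>M\<^esub>"
    have "RR.cls ?y = RR.cls (\<lambda>_. \<zero>\<^bsub>M\<^esub>)" using zero RR.single_seqs[OF u] unfolding RR.Gr_carrier RR.Gr_zero by blast
    then have "RR.cls ?y n = RR (Suc n)"
      using RR.cls_zero_iff[of "\<lambda>_. \<zero>\<^bsub>M\<^esub>" n] submodule_zero[OF RR.F_submodule] by simp
    then show "u \<in> RR (Suc n)" using RR.cls_zero_iff[of ?y n] u by simp
  qed
  have "carrier M \<subseteq> RR n" for n
  proof (induct n)
    case 0 show ?case by (simp add: ratliff_rush_def)
  next
    case (Suc n) then show ?case using step[of n] by blast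
  qed
  moreover obtain N where N: "\<And>n. n \<ge> N \<Longrightarrow> RR n = Fil n" by (rule ratliff_rush_eq_Fil) blast
  ultimately have top: "carrier M \<subseteq> Fil (Suc N)" by (metis le_SucI order_refl)
  obtain D where D: "submodule D R M" "torsion \<subseteq> D" "D \<noteq> carrier M" "\<And>a v. a \<in> \<mm> \<Longrightarrow> v \<in> carrier M \<Longrightarrow> a \<odot> v \<in> D"
    using nakayama_proper[OF local noeth_M torsion_submodule torsion_proper] by blast
  have "ideal_pow R I (Suc N) \<subseteq> \<mm>"
    using R.ideal_pow_antimono[OF ideal_I, of "Suc 0" "Suc N"] R.ideal_pow_1[OF ideal_I] I_le_m by auto
  then have "pow_mult I (Suc N) \<subseteq> D" by (intro ideal_smult_least[OF D(1)]) (use D(4) in blast)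
  then have "Fil (Suc N) \<subseteq> D" by (rule Fil_least[OF D(1) _ D(2)])
  then show False using top D(3) submodule_in_carrier[OF D(1)] by blast
qed

theorem ratliff_rush_graded_cohen_macaulay:
  shows "fin_gen_module (assoc_graded_ring R I) (assoc_graded_module M RR)"
    and "module_dim (assoc_graded_ring R I) (assoc_graded_module M RR) = 1"
    and "cohen_macaulay_module (assoc_graded_ring R I) (assoc_graded_module M RR)"
proof -
  interpret A: cring "assoc_graded_ring R I" by (rule RR.GrR_cring)
  interpret G: module "assoc_graded_ring R I" "assoc_graded_module M RR" by (rule RR.Gr_module)
  show "fin_gen_module (assoc_graded_ring R I) (assoc_graded_module M RR)"
    by (rule G.fin_gen_of_noeth[OF graded_module_noetherian])
  have reg: "\<exists>p\<in>P. nonzerodivisor_on (assoc_graded_module M RR) p" if P: "maximalideal P (assoc_graded_ring R I)" for P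
    by (rule RR.Gr_regular_in_maximal[OF graded_ring_noetherian graded_module_noetherian _ P])
       (use RR_socle RR.F_carrier in blast)
  obtain C K where "\<And>n. rel_length R M (RR n) (carrier M) \<le> enat (C * (n + K))" using RR_length_bound by blast
  then have long: "\<not> prime_chain_over (assoc_graded_ring R I) (annihilator (assoc_graded_ring R I) (assoc_graded_module M RR)) 2"
    by (intro RR.Gr_no_long_prime_chain[OF graded_module_noetherian]) (simp add: ratliff_rush_def, blast)
  obtain Q where Q: "maximalideal Q (assoc_graded_ring R I)" "annihilator (assoc_graded_ring R I) (assoc_graded_module M RR) \<subseteq> Q"
    using A.exists_maximal_ideal[OF graded_ring_noetherian G.annihilator_ideal G.annihilator_proper[OF graded_module_nonzero]] by blast
  obtain p where p: "p \<in> Q" "nonzerodivisor_on (assoc_graded_module M RR) p" using reg[OF Q(1)] by blast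
  have "prime_chain_over (assoc_graded_ring R I) (annihilator (assoc_graded_ring R I) (assoc_graded_module M RR)) 1"
    by (rule G.prime_chain_of_regular[OF graded_ring_noetherian A.maximalideal_prime[OF Q(1)] p Q(2)])
  then show "module_dim (assoc_graded_ring R I) (assoc_graded_module M RR) = 1"
    unfolding G.module_dim_1_iff using long by blast
  show "cohen_macaulay_module (assoc_graded_ring R I) (assoc_graded_module M RR)"
    by (rule G.cohen_macaulay_dim_one[OF graded_ring_noetherian graded_module_noetherian reg long])
qed

end

theorem theorem10p5:
  fixes R :: "('a, 'c) ring_scheme" and M :: "('a, 'b, 'd) module_scheme"
    and \<mm> I :: "'a set"
  assumes "noetherian_local_ring R \<mm>"
    and "primary_to R \<mm> I"
    and "fin_gen_module R M"
    and "module_dim R M = 1"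
  shows "(module_length R (M\<lparr>carrier := local_cohomology_0 R \<mm> M\<rparr>) \<noteq> \<infinity> \<and>
      (\<forall>\<^sub>F n in sequentially.
        module_length R (quot_module M (ratliff_rush R I M (n + 1))) \<noteq> \<infinity> \<and>
        int (the_enat (module_length R (quot_module M (ratliff_rush R I M (n + 1))))) =
          hilbert_e0 R I M * (int n + 1) - hilbert_e1 R I M
          - int (the_enat (module_length R (M\<lparr>carrier := local_cohomology_0 R \<mm> M\<rparr>))))) \<and>
      fin_gen_module (assoc_graded_ring R I) (ratliff_rush_graded R I M) \<and>
      module_dim (assoc_graded_ring R I) (ratliff_rush_graded R I M) = 1 \<and>
      cohen_macaulay_module (assoc_graded_ring R I) (ratliff_rush_graded R I M)"
proof -
  interpret one_dim_module R M \<mm> I using assms by unfold_locales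
  show ?thesis unfolding ratliff_rush_graded_def
    using ratliff_rush_hilbert ratliff_rush_graded_cohen_macaulay by blast
qed

end
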